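(* Suppose $\Sigma_i^{n_i}\subset\mathbb{R}^{m_i}$, $i=1,2$, are smooth closed (immersed) self-shrinkers of dimension $n_i\ge1$, i.e. $H_i=-\frac{X_i^{\perp}}{2}$, where $X_i$ is the position vector and $H_i$ the mean curvature vector of $\Sigma_i$. Then $\Sigma_1\times\Sigma_2\subset\mathbb{R}^{m_1+m_2}$ is a self-shrinker and is $F$-unstable.
   Context: For an immersed submanifold $\Sigma^n\subset\mathbb{R}^m$ with position vector $X$, $v^\perp$ denotes the normal projection of $v$, and the mean curvature vector is $H=\sum_i(\overline\nabla_{e_i}e_i)^\perp$ for an orthonormal tangent frame $\{e_i\}$, $\overline\nabla$ being the flat connection of $\mathbb{R}^m$. $\Sigma$ is a self-shrinker if $H=-\frac12X^\perp$. Closed means compact without boundary. The functional $F$ is $F(\Sigma,x,t)=(4\pi t)^{-n/2}\int_\Sigma e^{-\frac{|X-x|^2}{4t}}d\mu$ for $x\in\mathbb{R}^m$, $t>0$. A self-shrinker $\Sigma$ (for which $(\Sigma,0,1)$ is a critical point of $F$) is $F$-stable if for every compactly supported smooth normal variation $\Sigma_s$ with $\Sigma_0=\Sigma$ there exist smooth variations $x_s$ of $x_0=0$ and $t_s$ of $t_0=1$ such that $\frac{\partial^2}{\partial s^2}\big|_{s=0}F(\Sigma_s,x_s,t_s)\ge 0$; it is $F$-unstable if it is not $F$-stable. *)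

theory Defs
  imports "HOL-Analysis.Analysis"
begin

section \<open>Smooth maps between open subsets of normed spaces\<close>

text \<open>Only used for open sets \<open>S\<close> and finite-dimensional domains, where it suffices to differentiate
  the directional derivatives again.\<close>

primrec Ck_on :: "nat \<Rightarrow> ('a::real_normed_vector \<Rightarrow> 'b::real_normed_vector) \<Rightarrow> 'a set \<Rightarrow> bool" where
  "Ck_on 0 f S \<longleftrightarrow> continuous_on S f"
| "Ck_on (Suc k) f S \<longleftrightarrow>
     (\<forall>x\<in>S. f differentiable (at x)) \<and> (\<forall>v. Ck_on k (\<lambda>x. frechet_derivative f (at x) v) S)"

definition smooth_on :: "('a::real_normed_vector \<Rightarrow> 'b::real_normed_vector) \<Rightarrow> 'a set \<Rightarrow> bool" where
  "smooth_on f S \<longleftrightarrow> (\<forall>k. Ck_on k f S)"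


section \<open>Immersed submanifolds\<close>

text \<open>An abstract manifold modelled on the Euclidean space \<open>'e\<close> (so its dimension is \<open>DIM('e) \<ge> 1\<close>),
  together with a position map into the Euclidean space \<open>'v\<close>. A chart is a pair of its domain and the
  coordinate map. The atlas need not be maximal.\<close>

record ('a, 'e, 'v) immersed =
  mtop :: "'a topology"
  atlas :: "('a set \<times> ('a \<Rightarrow> 'e)) set"
  pos :: "'a \<Rightarrow> 'v"

definition local_rep :: "'a set \<times> ('a \<Rightarrow> 'e) \<Rightarrow> ('a \<Rightarrow> 'b) \<Rightarrow> 'e \<Rightarrow> 'b" where
  "local_rep c f = f \<circ> inv_into (fst c) (snd c)"

definition smooth_manifold :: "('a, 'e::euclidean_space, 'v) immersed \<Rightarrow> bool" where
  "smooth_manifold S \<longleftrightarrow>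
     topspace (mtop S) \<noteq> {} \<and> Hausdorff_space (mtop S) \<and> second_countable (mtop S) \<and>
     (\<Union>(U, \<phi>)\<in>atlas S. U) = topspace (mtop S) \<and>
     (\<forall>(U, \<phi>)\<in>atlas S. openin (mtop S) U \<and> open (\<phi> ` U) \<and>
        homeomorphic_map (subtopology (mtop S) U) (top_of_set (\<phi> ` U)) \<phi>) \<and>
     (\<forall>(U, \<phi>)\<in>atlas S. \<forall>(V, \<psi>)\<in>atlas S. smooth_on (local_rep (U, \<phi>) \<psi>) (\<phi> ` (U \<inter> V)))"

definition smooth_map_on ::
  "('a, 'e::euclidean_space, 'v) immersed \<Rightarrow> 'a set \<Rightarrow> ('a \<Rightarrow> 'b::real_normed_vector) \<Rightarrow> bool" where
  "smooth_map_on S N f \<longleftrightarrow> (\<forall>(U, \<phi>)\<in>atlas S. smooth_on (local_rep (U, \<phi>) f) (\<phi> ` (U \<inter> N)))"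

text \<open>The tangent space of the abstract manifold at \<open>p\<close> is identified with \<open>'e\<close> through one arbitrarily
  chosen chart around \<open>p\<close>. The notions built on this below (injectivity of the differential,
  \<open>tangent_space\<close>, \<open>flat_deriv\<close>) do not depend on the choice.\<close>

definition chart_at :: "('a, 'e, 'v) immersed \<Rightarrow> 'a \<Rightarrow> 'a set \<times> ('a \<Rightarrow> 'e)" where
  "chart_at S p = (SOME c. c \<in> atlas S \<and> p \<in> fst c)"

definition differential ::
  "('a, 'e::euclidean_space, 'v) immersed \<Rightarrow> ('a \<Rightarrow> 'b::real_normed_vector) \<Rightarrow> 'a \<Rightarrow> 'e \<Rightarrow> 'b" where
  "differential S f p =
     frechet_derivative (local_rep (chart_at S p) f) (at (snd (chart_at S p) p))"

definition immersed_submanifold :: "('a, 'e::euclidean_space, 'v::euclidean_space) immersed \<Rightarrow> bool" where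
  "immersed_submanifold S \<longleftrightarrow>
     smooth_manifold S \<and> smooth_map_on S (topspace (mtop S)) (pos S) \<and>
     (\<forall>p\<in>topspace (mtop S). inj (differential S (pos S) p))"

text \<open>There is no boundary because charts are homeomorphisms onto open subsets of \<open>'e\<close>.\<close>

definition closed_submanifold :: "('a, 'e::euclidean_space, 'v::euclidean_space) immersed \<Rightarrow> bool" where
  "closed_submanifold S \<longleftrightarrow> immersed_submanifold S \<and> compact_space (mtop S)"

definition prod_immersed ::
  "('a, 'e1, 'v1) immersed \<Rightarrow> ('b, 'e2, 'v2) immersed \<Rightarrow> ('a \<times> 'b, 'e1 \<times> 'e2, 'v1 \<times> 'v2) immersed" where
  "prod_immersed S1 S2 =
     \<lparr> mtop = prod_topology (mtop S1) (mtop S2),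
       atlas = {(U \<times> V, map_prod \<phi> \<psi>) | U \<phi> V \<psi>. (U, \<phi>) \<in> atlas S1 \<and> (V, \<psi>) \<in> atlas S2},
       pos = map_prod (pos S1) (pos S2) \<rparr>"


section \<open>Mean curvature and self-shrinkers\<close>

definition tangent_space ::
  "('a, 'e::euclidean_space, 'v::euclidean_space) immersed \<Rightarrow> 'a \<Rightarrow> 'v set" where
  "tangent_space S p = range (differential S (pos S) p)"

definition normal_proj ::
  "('a, 'e::euclidean_space, 'v::euclidean_space) immersed \<Rightarrow> 'a \<Rightarrow> 'v \<Rightarrow> 'v" where
  "normal_proj S p v = (THE w. w \<in> (tangent_space S p)\<^sup>\<bottom> \<and> v - w \<in> tangent_space S p)"

text \<open>The derivative at \<open>p\<close>, with respect to the flat connection of \<open>'v\<close>, of a \<open>'v\<close>-valued field \<open>f\<close>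
  along the immersion in the direction of \<open>v \<in> tangent_space S p\<close>.\<close>

definition flat_deriv ::
  "('a, 'e::euclidean_space, 'v::euclidean_space) immersed \<Rightarrow> 'v \<Rightarrow> ('a \<Rightarrow> 'v) \<Rightarrow> 'a \<Rightarrow> 'v" where
  "flat_deriv S v f p = differential S f p (inv (differential S (pos S) p) v)"

text \<open>Orthonormal tangent frames are indexed by the \<open>DIM('e)\<close> elements of \<open>Basis :: 'e set\<close>.\<close>

definition orthonormal_frame ::
  "('a, 'e::euclidean_space, 'v::euclidean_space) immersed \<Rightarrow> 'a set \<Rightarrow> ('e \<Rightarrow> 'a \<Rightarrow> 'v) \<Rightarrow> bool" where
  "orthonormal_frame S N e \<longleftrightarrow>
     (\<forall>i\<in>Basis. smooth_map_on S N (e i)) \<and>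
     (\<forall>q\<in>N. (\<forall>i\<in>Basis. e i q \<in> tangent_space S q) \<and>
            (\<forall>i\<in>Basis. \<forall>j\<in>Basis. e i q \<bullet> e j q = (if i = j then 1 else 0)))"

text \<open>\<open>h\<close> is the mean curvature vector at \<open>p\<close>, computed in some orthonormal tangent frame near \<open>p\<close>.
  Such frames exist, and \<open>h\<close> does not depend on the frame.\<close>

definition has_mean_curvature ::
  "('a, 'e::euclidean_space, 'v::euclidean_space) immersed \<Rightarrow> 'a \<Rightarrow> 'v \<Rightarrow> bool" where
  "has_mean_curvature S p h \<longleftrightarrow>
     (\<exists>N e. openin (mtop S) N \<and> p \<in> N \<and> orthonormal_frame S N e \<and>
        h = (\<Sum>i\<in>Basis. normal_proj S p (flat_deriv S (e i p) (e i) p)))"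

definition self_shrinker :: "('a, 'e::euclidean_space, 'v::euclidean_space) immersed \<Rightarrow> bool" where
  "self_shrinker S \<longleftrightarrow>
     immersed_submanifold S \<and>
     (\<forall>p\<in>topspace (mtop S). has_mean_curvature S p (- (1 / 2) *\<^sub>R normal_proj S p (pos S p)))"


section \<open>The induced measure and the functional \<open>F\<close>\<close>

text \<open>\<open>sqrt (det g)\<close> at the coordinate point \<open>x\<close> of the chart \<open>c\<close>, where \<open>g\<close> is the induced metric. The
  determinant of the matrix indexed by \<open>Basis\<close> is expanded over permutations, since \<open>det\<close> is only
  available for matrices indexed by a type.\<close>

definition area_density ::
  "('a, 'e::euclidean_space, 'v::euclidean_space) immersed \<Rightarrow> 'a set \<times> ('a \<Rightarrow> 'e) \<Rightarrow> 'e \<Rightarrow> real" where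
  "area_density S c x =
     (let D = frechet_derivative (local_rep c (pos S)) (at x)
      in sqrt (\<Sum>\<pi> | \<pi> permutes (Basis :: 'e set). of_int (sign \<pi>) * (\<Prod>b\<in>Basis. D b \<bullet> D (\<pi> b))))"

text \<open>The induced measure \<open>d\<mu>\<close> is the unique Borel measure given by \<open>sqrt (det g) dx\<close> in every chart.
  It lives on the abstract manifold, so images covered several times are counted with multiplicity.\<close>

definition area_measure :: "('a, 'e::euclidean_space, 'v::euclidean_space) immersed \<Rightarrow> 'a measure" where
  "area_measure S = (THE \<mu>.
     space \<mu> = topspace (mtop S) \<and>
     sets \<mu> = sigma_sets (topspace (mtop S)) {U. openin (mtop S) U} \<and>
     (\<forall>(U, \<phi>)\<in>atlas S. \<forall>B\<in>sets \<mu>. B \<subseteq> U \<longrightarrow>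
        emeasure \<mu> B = (\<integral>\<^sup>+x\<in>\<phi> ` B. ennreal (area_density S (U, \<phi>) x) \<partial>lborel)))"

definition F_functional ::
  "('a, 'e::euclidean_space, 'v::euclidean_space) immersed \<Rightarrow> 'v \<Rightarrow> real \<Rightarrow> real" where
  "F_functional S x t =
     (4 * pi * t) powr (- real DIM('e) / 2) *
     (LINT p|area_measure S. exp (- (norm (pos S p - x))\<^sup>2 / (4 * t)))"


section \<open>\<open>F\<close>-stability\<close>

text \<open>\<open>Y s\<close> is the position map of the varied submanifold at parameter \<open>s\<close>. A variation is normal if its
  variation vector field, the derivative in \<open>s\<close> at \<open>s = 0\<close>, is normal.\<close>

definition normal_variation ::
  "('a, 'e::euclidean_space, 'v::euclidean_space) immersed \<Rightarrow> real \<Rightarrow> (real \<Rightarrow> 'a \<Rightarrow> 'v) \<Rightarrow> bool" where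
  "normal_variation S \<epsilon> Y \<longleftrightarrow>
     (\<forall>p\<in>topspace (mtop S). Y 0 p = pos S p) \<and>
     (\<forall>(U, \<phi>)\<in>atlas S. smooth_on (\<lambda>(s, x). local_rep (U, \<phi>) (Y s) x) ({-\<epsilon><..<\<epsilon>} \<times> \<phi> ` U)) \<and>
     (\<forall>s\<in>{-\<epsilon><..<\<epsilon>}. immersed_submanifold (S\<lparr>pos := Y s\<rparr>)) \<and>
     (\<exists>K. compactin (mtop S) K \<and> (\<forall>s\<in>{-\<epsilon><..<\<epsilon>}. \<forall>p\<in>topspace (mtop S) - K. Y s p = pos S p)) \<and>
     (\<forall>p\<in>topspace (mtop S). vector_derivative (\<lambda>s. Y s p) (at 0) \<in> (tangent_space S p)\<^sup>\<bottom>)"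

definition has_second_derivative_at :: "(real \<Rightarrow> real) \<Rightarrow> real \<Rightarrow> real \<Rightarrow> bool" where
  "has_second_derivative_at f D a \<longleftrightarrow>
     (\<exists>f'. (\<forall>\<^sub>F s in nhds a. (f has_real_derivative f' s) (at s)) \<and>
           (f' has_real_derivative D) (at a))"

definition F_stable :: "('a, 'e::euclidean_space, 'v::euclidean_space) immersed \<Rightarrow> bool" where
  "F_stable S \<longleftrightarrow>
     (\<forall>\<epsilon>>0. \<forall>Y. normal_variation S \<epsilon> Y \<longrightarrow>
        (\<exists>(x :: real \<Rightarrow> 'v) (t :: real \<Rightarrow> real) D.
           smooth_on x {-\<epsilon><..<\<epsilon>} \<and> x 0 = 0 \<and>
           smooth_on t {-\<epsilon><..<\<epsilon>} \<and> t 0 = 1 \<and> (\<forall>s\<in>{-\<epsilon><..<\<epsilon>}. t s > 0) \<and>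
           has_second_derivative_at (\<lambda>s. F_functional (S\<lparr>pos := Y s\<rparr>) (x s) (t s)) D 0 \<and>
           D \<ge> 0))"

definition F_unstable :: "('a, 'e::euclidean_space, 'v::euclidean_space) immersed \<Rightarrow> bool" where
  "F_unstable S \<longleftrightarrow> \<not> F_stable S"

end

theory Submission
  imports Defs
begin

text \<open>The destabilizing variation dilates the first factor, \<open>(X1, X2) \<mapsto> ((1 + s) X1, X2)\<close>, and is made normal by
  composition with diffeomorphisms \<open>\<phi> s\<close> of the product, which do not change \<open>F\<close>. The dilation multiplies the
  area measure by \<open>(1 + s)^n1\<close>, so along it \<open>F\<close> is an explicit integral over the fixed product. On a closed self-shrinker
  every smooth vector field \<open>W\<close> along the immersion satisfies \<open>\<integral> (div W - X \<bullet> W / 2) exp (-|X|^2 / 4) = 0\<close>. Applied to a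
  few linear and quadratic fields, this evaluates the second derivative: with \<open>b = t' / 2\<close>, \<open>a = b - 1\<close>, \<open>y = x'\<close> and
  averages weighted by \<open>exp (-|X|^2 / 4)\<close>, it is a positive multiple of
  \<open>- a^2 \<langle>|X1\<^sup>\<bottom>|^2\<rangle> - b^2 \<langle>|X2\<^sup>\<bottom>|^2\<rangle> - \<langle>|y\<^sup>\<bottom>|^2\<rangle> / 2\<close>. This is negative: \<open>a\<close> and \<open>b\<close> do not both vanish, and at the
  point of a closed factor farthest from the origin the position vector is normal and nonzero.\<close>

section \<open>Smooth maps\<close>

text \<open>\<open>F_stable\<close> answers each variation with arbitrary smooth \<open>x\<close>
  and \<open>t\<close>, so one variation has to beat all of them. Moving \<open>x\<close>
  compensates translations and moving \<open>t\<close> compensates a dilation of the whole product;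
  the relative size of the two factors is out of reach of both, which is why only one factor is
  dilated. The second derivatives of \<open>x\<close> and \<open>t\<close> at 0 enter linearly and
  cancel because \<open>(0, 1)\<close> is critical for \<open>F\<close>.

  The integral identity for all fields rests on \<open>div N = - N \<bullet> H\<close> for normal
  \<open>N\<close>: the self-shrinker equation turns this into \<open>X \<bullet> N / 2\<close>, so
  normal parts contribute nothing and the divergence theorem for tangential fields is enough. The
  test fields are a constant \<open>y\<close>, a block scaling \<open>L X\<close>, and multiples of
  these by polynomials in \<open>X\<close>.

  The obstacle is that the dilation has the velocity \<open>(X1, 0)\<close>, whose tangential part
  must be removed, while a normal velocity field alone would give no closed formula for the area.
  Since normality concerns only the velocity at \<open>s = 0\<close>, diffeomorphisms with the right
  velocity at 0 suffice, and the explicit dilation survives in the integrals.\<close>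

lemma frechet_derivative_cong_open:
  assumes "open S" "x \<in> S" "\<And>y. y \<in> S \<Longrightarrow> f y = g y"
  shows "frechet_derivative f (at x) = frechet_derivative g (at x)"
proof -
  have "(f has_derivative D) (at x) \<longleftrightarrow> (g has_derivative D) (at x)" for D
    using assms by (metis has_derivative_transform_within_open)
  then show ?thesis unfolding frechet_derivative_def by simp
qed

lemma differentiable_cong_open:
  assumes "open S" "x \<in> S" "\<And>y. y \<in> S \<Longrightarrow> f y = g y" "f differentiable (at x)"
  shows "g differentiable (at x)"
  using assms unfolding differentiable_def by (metis has_derivative_transform_within_open)

lemma has_frechet_derivative:
  "f differentiable (at x) \<Longrightarrow> (f has_derivative frechet_derivative f (at x)) (at x)"
  by (simp add: frechet_derivative_works)

lemma Ck_on_cong: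
  assumes "open S" "\<And>x. x \<in> S \<Longrightarrow> f x = g x" "Ck_on k f S"
  shows "Ck_on k g S"
  using assms(2,3)
proof (induction k arbitrary: f g)
  case 0
  then show ?case by (simp cong: continuous_on_cong)
next
  case (Suc k)
  have "frechet_derivative f (at x) = frechet_derivative g (at x)" if "x \<in> S" for x
    using frechet_derivative_cong_open[OF assms(1) that] Suc.prems(1) by blast
  moreover have "g differentiable (at x)" if "x \<in> S" for x
    using differentiable_cong_open[OF assms(1) that, of f g] Suc.prems that by auto
  ultimately show ?case
    using Suc.IH[of "\<lambda>x. frechet_derivative f (at x) v" "\<lambda>x. frechet_derivative g (at x) v" for v] Suc.prems(2)
    by auto
qed

text \<open>\<open>Ck_on\<close> is stated with \<open>frechet_derivative\<close>, which is awkward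
  to compute with. Derivatives at a point are unique, so any explicit formula \<open>f'\<close> may
  replace it; the closure properties below are inductions on \<open>k\<close> through this
  rule.\<close>

lemma Ck_on_SucI:
  assumes "open S" "\<And>x. x \<in> S \<Longrightarrow> (f has_derivative f' x) (at x)" "\<And>v. Ck_on k (\<lambda>x. f' x v) S"
  shows "Ck_on (Suc k) f S"
proof -
  have "Ck_on k (\<lambda>x. frechet_derivative f (at x) v) S" for v
    by (rule Ck_on_cong[OF assms(1) _ assms(3)[of v]]) (metis assms(2) frechet_derivative_at)
  then show ?thesis using assms(2) by (auto simp: differentiable_def)
qed

lemma Ck_on_SucD:
  assumes "Ck_on (Suc k) f S"
  shows "x \<in> S \<Longrightarrow> (f has_derivative frechet_derivative f (at x)) (at x)"
    "Ck_on k (\<lambda>x. frechet_derivative f (at x) v) S"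
  using assms has_frechet_derivative by auto

lemma Ck_on_Suc_imp: "Ck_on (Suc k) f S \<Longrightarrow> Ck_on k f S"
proof (induction k arbitrary: f)
  case 0
  then show ?case
    by (auto intro!: continuous_at_imp_continuous_on differentiable_imp_continuous_within)
next
  case (Suc k)
  then show ?case by auto
qed

lemma Ck_on_subset: "Ck_on k f S \<Longrightarrow> T \<subseteq> S \<Longrightarrow> Ck_on k f T"
  by (induction k arbitrary: f) (auto intro: continuous_on_subset)

text \<open>Continuity and differentiability are local. This serves functions glued from several
  formulas, such as extensions by zero and maps given in different charts.\<close>

lemma Ck_on_local:
  assumes "\<And>x. x \<in> S \<Longrightarrow> \<exists>T. open T \<and> x \<in> T \<and> Ck_on k f T"
  shows "Ck_on k f S"
  using assms
proof (induction k arbitrary: f)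
  case 0
  then show ?case
    by (auto intro!: continuous_at_imp_continuous_on) (metis continuous_on_eq_continuous_at)
next
  case (Suc k)
  show ?case
  proof (simp, safe)
    fix x assume "x \<in> S"
    then show "f differentiable (at x)" using Suc.prems[of x] by auto
  next
    fix v
    show "Ck_on k (\<lambda>x. frechet_derivative f (at x) v) S"
      by (rule Suc.IH) (use Suc.prems in \<open>simp; blast\<close>)
  qed
qed

lemma Ck_on_const: "Ck_on k (\<lambda>x. c) S"
proof (induction k arbitrary: c)
  case (Suc k)
  have "frechet_derivative (\<lambda>x. c) (at x) v = 0" for x v
    by (metis frechet_derivative_const)
  with Suc show ?case by simp
qed simp

lemma Ck_on_bounded_linear:
  assumes "open S" "bounded_linear L" "Ck_on k f S"
  shows "Ck_on k (\<lambda>x. L (f x)) S"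
  using assms(3)
proof (induction k arbitrary: f)
  case 0
  then show ?case using bounded_linear.continuous_on[OF assms(2)] by simp
next
  case (Suc k)
  show ?case
    by (rule Ck_on_SucI[OF assms(1) bounded_linear.has_derivative[OF assms(2) Ck_on_SucD(1)[OF Suc.prems]]
          Suc.IH[OF Ck_on_SucD(2)[OF Suc.prems]]])
qed

lemma Ck_on_add:
  assumes "open S" "Ck_on k f S" "Ck_on k g S"
  shows "Ck_on k (\<lambda>x. f x + g x) S"
  using assms(2,3)
proof (induction k arbitrary: f g)
  case 0
  then show ?case by (simp add: continuous_on_add)
next
  case (Suc k)
  show ?case
    by (rule Ck_on_SucI[OF assms(1) has_derivative_add[OF Ck_on_SucD(1)[OF Suc.prems(1)] Ck_on_SucD(1)[OF Suc.prems(2)]]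
          Suc.IH[OF Ck_on_SucD(2)[OF Suc.prems(1)] Ck_on_SucD(2)[OF Suc.prems(2)]]])
qed

lemma Ck_on_bilinear:
  assumes "open S" "bounded_bilinear B" "Ck_on k f S" "Ck_on k g S"
  shows "Ck_on k (\<lambda>x. B (f x) (g x)) S"
  using assms(3,4)
proof (induction k arbitrary: f g)
  case 0
  then show ?case using bounded_bilinear.continuous_on[OF assms(2)] by simp
next
  case (Suc k)
  show ?case
    by (rule Ck_on_SucI[OF assms(1) bounded_bilinear.FDERIV[OF assms(2) Ck_on_SucD(1)[OF Suc.prems(1)] Ck_on_SucD(1)[OF Suc.prems(2)]]])
      (assumption | intro Ck_on_add[OF assms(1)] Suc.IH Ck_on_SucD(2)[OF Suc.prems(1)] Ck_on_SucD(2)[OF Suc.prems(2)]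
        Ck_on_Suc_imp[OF Suc.prems(1)] Ck_on_Suc_imp[OF Suc.prems(2)])+
qed

lemma Ck_on_sum:
  assumes "open S" "\<And>i. i \<in> I \<Longrightarrow> Ck_on k (f i) S"
  shows "Ck_on k (\<lambda>x. \<Sum>i\<in>I. f i x) S"
proof (cases "finite I")
  case True
  from True assms(2) show ?thesis
    by (induction I rule: finite_induct) (auto intro!: Ck_on_const Ck_on_add[OF assms(1)])
next
  case False
  then show ?thesis by (simp add: Ck_on_const)
qed

lemma linear_basis_expansion:
  fixes L :: "'a::euclidean_space \<Rightarrow> 'b::real_vector"
  assumes "linear L"
  shows "L w = (\<Sum>b\<in>Basis. (w \<bullet> b) *\<^sub>R L b)"
proof -
  have "L w = L (\<Sum>b\<in>Basis. (w \<bullet> b) *\<^sub>R b)" by (simp add: euclidean_representation)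
  also have "\<dots> = (\<Sum>b\<in>Basis. (w \<bullet> b) *\<^sub>R L b)"
    by (simp add: linear_sum[OF assms] linear_scale[OF assms])
  finally show ?thesis .
qed

text \<open>The chain rule produces \<open>f' (g x) (g' x v)\<close>, whose direction varies with
  \<open>x\<close>, while \<open>Ck_on\<close> controls only fixed directions. Expanding
  \<open>g' x v\<close> in the basis of the middle space leaves products of
  \<open>f' (g x) b\<close> with real functions, to which the induction hypothesis and the product
  rule apply.\<close>

lemma Ck_on_compose:
  fixes g :: "'a::real_normed_vector \<Rightarrow> 'b::euclidean_space" and f :: "'b \<Rightarrow> 'c::real_normed_vector"
  assumes "open S" "open T" "g ` S \<subseteq> T" "Ck_on k g S" "Ck_on k f T"
  shows "Ck_on k (\<lambda>x. f (g x)) S"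
  using assms(4,5)
proof (induction k arbitrary: f)
  case 0
  then show ?case using continuous_on_compose2[of T f S g] assms(3) by simp
next
  case (Suc k)
  note Df = Ck_on_SucD[OF Suc.prems(2)] and Dg = Ck_on_SucD[OF Suc.prems(1)]
  show ?case
  proof (rule Ck_on_SucI[OF assms(1)])
    fix x assume x: "x \<in> S"
    then have gx: "g x \<in> T" using assms(3) by auto
    have lin: "linear (frechet_derivative f (at (g x)))"
      using Df(1)[OF gx] has_derivative_linear by blast
    have "(\<lambda>v. frechet_derivative f (at (g x)) (frechet_derivative g (at x) v)) =
      (\<lambda>v. \<Sum>b\<in>Basis. (frechet_derivative g (at x) v \<bullet> b) *\<^sub>R frechet_derivative f (at (g x)) b)"
      by (rule ext, rule linear_basis_expansion[OF lin])
    then show "((\<lambda>x. f (g x)) has_derivative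
      (\<lambda>v. \<Sum>b\<in>Basis. (frechet_derivative g (at x) v \<bullet> b) *\<^sub>R frechet_derivative f (at (g x)) b)) (at x)"
      using has_derivative_compose[OF Dg(1)[OF x] Df(1)[OF gx]] by simp
  next
    fix v
    have "Ck_on k (\<lambda>x. frechet_derivative f (at (g x)) b) S" for b
      by (rule Suc.IH[OF Ck_on_Suc_imp[OF Suc.prems(1)] Df(2)])
    then show "Ck_on k (\<lambda>x. \<Sum>b\<in>Basis. (frechet_derivative g (at x) v \<bullet> b) *\<^sub>R
        frechet_derivative f (at (g x)) b) S"
      by (intro Ck_on_sum[OF assms(1)] Ck_on_bilinear[OF assms(1) bounded_bilinear_scaleR]
          Ck_on_bounded_linear[OF assms(1) bounded_linear_inner_left] Dg(2))
  qed
qed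

text \<open>The derivative of \<open>inverse f\<close> is built from \<open>f'\<close> and two
  factors \<open>inverse f\<close>, so each order of smoothness of \<open>inverse f\<close> follows
  from the preceding one.\<close>

lemma Ck_on_inverse:
  fixes f :: "'a::real_normed_vector \<Rightarrow> real"
  assumes "open S" "Ck_on k f S" "\<And>x. x \<in> S \<Longrightarrow> f x \<noteq> 0"
  shows "Ck_on k (\<lambda>x. inverse (f x)) S"
  using assms(2)
proof (induction k)
  case 0
  then show ?case using assms(3) by (simp add: continuous_on_inverse)
next
  case (Suc k)
  note inv = Suc.IH[OF Ck_on_Suc_imp[OF Suc.prems]]
  show ?case
  proof (rule Ck_on_SucI[OF assms(1)])
    fix x assume x: "x \<in> S"
    show "((\<lambda>x. inverse (f x)) has_derivative
       (\<lambda>v. - 1 * ((inverse (f x) * frechet_derivative f (at x) v) * inverse (f x)))) (at x)"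
      using Deriv.has_derivative_inverse[OF assms(3)[OF x] Ck_on_SucD(1)[OF Suc.prems x]] by simp
  next
    fix v
    show "Ck_on k (\<lambda>x. - 1 * ((inverse (f x) * frechet_derivative f (at x) v) * inverse (f x))) S"
      by (intro Ck_on_bilinear[OF assms(1) bounded_bilinear_mult] Ck_on_const inv Ck_on_SucD(2)[OF Suc.prems])
  qed
qed

section \<open>Closure properties of smooth functions\<close>

named_theorems smooth_intros

lemma smooth_on_cong:
  assumes "open S" "\<And>x. x \<in> S \<Longrightarrow> f x = g x" "smooth_on f S"
  shows "smooth_on g S"
  using assms Ck_on_cong unfolding smooth_on_def by blast

lemma smooth_on_subset: "smooth_on f S \<Longrightarrow> T \<subseteq> S \<Longrightarrow> smooth_on f T"
  unfolding smooth_on_def using Ck_on_subset by blast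

lemma smooth_on_local:
  assumes "\<And>x. x \<in> S \<Longrightarrow> \<exists>T. open T \<and> x \<in> T \<and> smooth_on f T"
  shows "smooth_on f S"
  unfolding smooth_on_def by (intro allI Ck_on_local) (use assms in \<open>auto simp: smooth_on_def\<close>)

lemma smooth_on_const [smooth_intros]: "smooth_on (\<lambda>x. c) S"
  by (simp add: smooth_on_def Ck_on_const)

lemma smooth_on_bounded_linear:
  "open S \<Longrightarrow> bounded_linear L \<Longrightarrow> smooth_on f S \<Longrightarrow> smooth_on (\<lambda>x. L (f x)) S"
  by (simp add: smooth_on_def Ck_on_bounded_linear)

lemma smooth_on_ident [smooth_intros]: "open S \<Longrightarrow> smooth_on (\<lambda>x. x) S"
  unfolding smooth_on_def
proof
  fix k assume S: "open S"
  show "Ck_on k (\<lambda>x. x) S"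
    by (cases k) (use Ck_on_SucI[OF S has_derivative_ident] Ck_on_const in auto)
qed

lemma smooth_on_add [smooth_intros]:
  "open S \<Longrightarrow> smooth_on f S \<Longrightarrow> smooth_on g S \<Longrightarrow> smooth_on (\<lambda>x. f x + g x) S"
  by (simp add: smooth_on_def Ck_on_add)

lemma smooth_on_bilinear:
  "open S \<Longrightarrow> bounded_bilinear B \<Longrightarrow> smooth_on f S \<Longrightarrow> smooth_on g S \<Longrightarrow>
    smooth_on (\<lambda>x. B (f x) (g x)) S"
  by (simp add: smooth_on_def Ck_on_bilinear)

lemmas smooth_on_scaleR [smooth_intros] = smooth_on_bilinear[OF _ bounded_bilinear_scaleR]
lemmas smooth_on_inner [smooth_intros] = smooth_on_bilinear[OF _ bounded_bilinear_inner]
lemma smooth_on_mult [smooth_intros]: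
  fixes f g :: "'a::real_normed_vector \<Rightarrow> real"
  shows "open S \<Longrightarrow> smooth_on f S \<Longrightarrow> smooth_on g S \<Longrightarrow> smooth_on (\<lambda>x. f x * g x) S"
  by (rule smooth_on_bilinear[OF _ bounded_bilinear_mult])

lemma smooth_on_uminus [smooth_intros]:
  "open S \<Longrightarrow> smooth_on f S \<Longrightarrow> smooth_on (\<lambda>x. - f x) S"
  by (rule smooth_on_bounded_linear[OF _ bounded_linear_minus[OF bounded_linear_ident]])

lemma smooth_on_diff [smooth_intros]:
  "open S \<Longrightarrow> smooth_on f S \<Longrightarrow> smooth_on g S \<Longrightarrow> smooth_on (\<lambda>x. f x - g x) S"
  using smooth_on_add[of S f "\<lambda>x. - g x"] smooth_on_uminus[of S g] by simp

lemma smooth_on_sum [smooth_intros]: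
  "open S \<Longrightarrow> (\<And>i. i \<in> I \<Longrightarrow> smooth_on (f i) S) \<Longrightarrow> smooth_on (\<lambda>x. \<Sum>i\<in>I. f i x) S"
  by (simp add: smooth_on_def Ck_on_sum)

lemma smooth_on_prod [smooth_intros]:
  fixes f :: "'i \<Rightarrow> 'a::real_normed_vector \<Rightarrow> real"
  assumes "open S" "\<And>i. i \<in> I \<Longrightarrow> smooth_on (f i) S"
  shows "smooth_on (\<lambda>x. \<Prod>i\<in>I. f i x) S"
proof (cases "finite I")
  case True
  from True assms(2) show ?thesis
    by (induction I rule: finite_induct) (auto intro!: smooth_intros assms(1))
next
  case False
  then show ?thesis by (simp add: smooth_on_const)
qed

lemma smooth_on_fst [smooth_intros]: "open S \<Longrightarrow> smooth_on f S \<Longrightarrow> smooth_on (\<lambda>x. fst (f x)) S"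
  by (rule smooth_on_bounded_linear[OF _ bounded_linear_fst])

lemma smooth_on_snd [smooth_intros]: "open S \<Longrightarrow> smooth_on f S \<Longrightarrow> smooth_on (\<lambda>x. snd (f x)) S"
  by (rule smooth_on_bounded_linear[OF _ bounded_linear_snd])

lemma smooth_on_Pair [smooth_intros]:
  assumes "open S" "smooth_on f S" "smooth_on g S"
  shows "smooth_on (\<lambda>x. (f x, g x)) S"
proof -
  have "bounded_linear (\<lambda>x. (x, 0))" "bounded_linear (\<lambda>x. (0, x))"
    by (simp_all add: bounded_linear_Pair)
  from smooth_on_add[OF assms(1) smooth_on_bounded_linear[OF assms(1) this(1) assms(2)]
      smooth_on_bounded_linear[OF assms(1) this(2) assms(3)]]
  show ?thesis by simp
qed

lemma smooth_on_compose:
  fixes g :: "'a::real_normed_vector \<Rightarrow> 'b::euclidean_space"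
  shows "open S \<Longrightarrow> open T \<Longrightarrow> g ` S \<subseteq> T \<Longrightarrow> smooth_on g S \<Longrightarrow> smooth_on f T \<Longrightarrow>
    smooth_on (\<lambda>x. f (g x)) S"
  by (simp add: smooth_on_def Ck_on_compose)

lemma smooth_on_inverse [smooth_intros]:
  fixes f :: "'a::real_normed_vector \<Rightarrow> real"
  shows "open S \<Longrightarrow> smooth_on f S \<Longrightarrow> (\<And>x. x \<in> S \<Longrightarrow> f x \<noteq> 0) \<Longrightarrow> smooth_on (\<lambda>x. inverse (f x)) S"
  by (simp add: smooth_on_def Ck_on_inverse)

lemma smooth_on_divide [smooth_intros]:
  fixes f g :: "'a::real_normed_vector \<Rightarrow> real"
  shows "open S \<Longrightarrow> smooth_on f S \<Longrightarrow> smooth_on g S \<Longrightarrow> (\<And>x. x \<in> S \<Longrightarrow> g x \<noteq> 0) \<Longrightarrow>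
    smooth_on (\<lambda>x. f x / g x) S"
  unfolding divide_inverse by (intro smooth_intros)

lemma smooth_on_norm_sq [smooth_intros]:
  fixes f :: "'a::real_normed_vector \<Rightarrow> 'b::real_inner"
  shows "open S \<Longrightarrow> smooth_on f S \<Longrightarrow> smooth_on (\<lambda>x. (norm (f x))\<^sup>2) S"
  unfolding power2_norm_eq_inner by (intro smooth_intros)

lemma smooth_on_has_derivative:
  assumes "smooth_on f S" "x \<in> S"
  shows "(f has_derivative frechet_derivative f (at x)) (at x)"
  using assms Ck_on_SucD(1)[of 0 f S x] unfolding smooth_on_def by blast

lemma smooth_on_differentiable: "smooth_on f S \<Longrightarrow> x \<in> S \<Longrightarrow> f differentiable (at x)"
  using smooth_on_has_derivative differentiable_def by blast

lemma smooth_on_frechet_derivative [smooth_intros]: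
  assumes "smooth_on f S"
  shows "smooth_on (\<lambda>x. frechet_derivative f (at x) v) S"
  using assms Ck_on_SucD(2) unfolding smooth_on_def by blast

lemma smooth_on_imp_continuous_on: "smooth_on f S \<Longrightarrow> continuous_on S f"
  unfolding smooth_on_def using Ck_on.simps(1) by blast

lemma smooth_on_linear_frechet: "smooth_on f S \<Longrightarrow> x \<in> S \<Longrightarrow> linear (frechet_derivative f (at x))"
  using smooth_on_has_derivative has_derivative_linear by blast

lemma smooth_on_componentwise:
  fixes f :: "'a::real_normed_vector \<Rightarrow> 'b::euclidean_space"
  assumes "open S" "\<And>b. b \<in> Basis \<Longrightarrow> smooth_on (\<lambda>x. f x \<bullet> b) S"
  shows "smooth_on f S"
proof -
  have "smooth_on (\<lambda>x. \<Sum>b\<in>Basis. (f x \<bullet> b) *\<^sub>R b) S"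
    by (intro smooth_intros assms)
  then show ?thesis by (simp add: euclidean_representation)
qed

text \<open>The direction varies with the point; linearity reduces it to the finitely many fixed
  directions covered by \<open>smooth_on_frechet_derivative\<close>.\<close>

lemma smooth_on_frechet_derivative_field:
  fixes f :: "'a::euclidean_space \<Rightarrow> 'b::real_normed_vector"
  assumes "open S" "smooth_on f S" "smooth_on v S"
  shows "smooth_on (\<lambda>x. frechet_derivative f (at x) (v x)) S"
proof (rule smooth_on_cong[OF assms(1)])
  show "smooth_on (\<lambda>x. \<Sum>b\<in>Basis. (v x \<bullet> b) *\<^sub>R frechet_derivative f (at x) b) S"
    by (intro smooth_intros assms)
  fix x assume "x \<in> S"
  then show "(\<Sum>b\<in>Basis. (v x \<bullet> b) *\<^sub>R frechet_derivative f (at x) b) = frechet_derivative f (at x) (v x)"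
    using linear_basis_expansion[OF smooth_on_linear_frechet[OF assms(2)]] by simp
qed

text \<open>The mean value theorem, applied to
  \<open>\<phi> t = g (x + t u + h v) - g (x + t u)\<close>, turns the second difference into
  \<open>h\<close> times a difference of \<open>G (_) u\<close> at two points at distance
  \<open>O(h)\<close> from \<open>x\<close>. Differentiability of \<open>z \<mapsto> G z u\<close>
  at \<open>x\<close> replaces that difference by \<open>h * E v\<close> with an error
  \<open>o(h)\<close>.\<close>

lemma second_difference_estimate:
  fixes g :: "'a::real_normed_vector \<Rightarrow> real"
  assumes der: "\<And>z. norm (z - x) < d \<Longrightarrow> (g has_derivative G z) (at z)"
    and Gu: "((\<lambda>z. G z u) has_derivative E) (at x)"
    and e: "e > 0" and True: "d > 0"
  shows "\<exists>\<delta>>0. \<forall>h. 0 < h \<and> h < \<delta> \<longrightarrow>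
    \<bar>g (x + h *\<^sub>R u + h *\<^sub>R v) - g (x + h *\<^sub>R u) - g (x + h *\<^sub>R v) + g x - h\<^sup>2 * E v\<bar> \<le> e * h\<^sup>2"
proof -
  interpret E: bounded_linear E using Gu by (rule has_derivative_bounded_linear)
  \<comment> \<open>Each of the two points contributes an error of at most
    \<open>c * h * (norm u + norm v)\<close>; this \<open>c\<close> makes the two together at most
    \<open>e * h\<close>. The summand 1 keeps the denominator positive.\<close>
  define c where "c = e / (2 * (norm u + norm v + 1))"
  have n1: "norm u + norm v + 1 > 0" by (smt (verit) norm_ge_zero)
  have c: "c > 0" using e n1 by (simp add: c_def)
  from Gu have "\<exists>r>0. \<forall>y. norm (y - x) < r \<longrightarrow> norm (G y u - G x u - E (y - x)) \<le> c * norm (y - x)"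
    unfolding has_derivative_at_alt using c by blast
  then obtain r where r: "r > 0" and
    rb: "\<And>y. norm (y - x) < r \<Longrightarrow> \<bar>G y u - G x u - E (y - x)\<bar> \<le> c * norm (y - x)"
    by (auto simp: real_norm_def)
  define \<delta> where "\<delta> = min d r / (norm u + norm v + 1)"
  have \<delta>: "\<delta> > 0" using True r n1 by (simp add: \<delta>_def)
  show ?thesis
  proof (intro exI conjI allI impI)
    show "\<delta> > 0" by fact
    fix h :: real assume h: "0 < h \<and> h < \<delta>"
    have hb: "h * (norm u + norm v + 1) < min d r"
      using h n1 by (simp add: \<delta>_def pos_less_divide_eq)
    have nrm: "norm (t *\<^sub>R u + s *\<^sub>R v) \<le> h * (norm u + norm v)" if "0 \<le> t" "t \<le> h" "0 \<le> s" "s \<le> h" for t s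
    proof -
      have "norm (t *\<^sub>R u + s *\<^sub>R v) \<le> t * norm u + s * norm v"
        using norm_triangle_ineq[of "t *\<^sub>R u" "s *\<^sub>R v"] that by simp
      also have "\<dots> \<le> h * norm u + h * norm v" using that by (intro add_mono mult_right_mono) auto
      finally show ?thesis by (simp add: algebra_simps)
    qed
    have nr: "norm (t *\<^sub>R u + s *\<^sub>R v) < min d r" if "0 \<le> t" "t \<le> h" "0 \<le> s" "s \<le> h" for t s
      using nrm[OF that] hb h by (smt (verit) mult_less_cancel_left_pos)
    define \<phi> where "\<phi> t = g (x + t *\<^sub>R u + h *\<^sub>R v) - g (x + t *\<^sub>R u)" for t
    have "\<exists>z. 0 < z \<and> z < h \<and> \<phi> h - \<phi> 0 = (h - 0) * (G (x + z *\<^sub>R u + h *\<^sub>R v) u - G (x + z *\<^sub>R u) u)"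
    proof (rule MVT2)
      show "0 < h" using h by simp
      fix t :: real assume t: "0 \<le> t" "t \<le> h"
      have a: "(g has_derivative G (x + t *\<^sub>R u + h *\<^sub>R v)) (at (x + t *\<^sub>R u + h *\<^sub>R v))"
        using nr[of t h] t h by (intro der) (simp add: algebra_simps)
      have b: "(g has_derivative G (x + t *\<^sub>R u)) (at (x + t *\<^sub>R u))"
        using nr[of t 0] t h by (intro der) (simp add: algebra_simps)
      have aff1: "((\<lambda>t. x + t *\<^sub>R u + h *\<^sub>R v) has_derivative (\<lambda>s. s *\<^sub>R u)) (at t within UNIV)"
        and aff2: "((\<lambda>t. x + t *\<^sub>R u) has_derivative (\<lambda>s. s *\<^sub>R u)) (at t within UNIV)"
        by (auto intro!: derivative_eq_intros)
      have "((\<lambda>t. g (x + t *\<^sub>R u + h *\<^sub>R v)) has_derivative (\<lambda>s. G (x + t *\<^sub>R u + h *\<^sub>R v) (s *\<^sub>R u))) (at t)"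
        using has_derivative_compose[of "\<lambda>t. x + t *\<^sub>R u + h *\<^sub>R v" "\<lambda>s. s *\<^sub>R u" t UNIV, OF aff1 a]
        by simp
      moreover have "((\<lambda>t. g (x + t *\<^sub>R u)) has_derivative (\<lambda>s. G (x + t *\<^sub>R u) (s *\<^sub>R u))) (at t)"
        using has_derivative_compose[of "\<lambda>t. x + t *\<^sub>R u" "\<lambda>s. s *\<^sub>R u" t UNIV, OF aff2 b]
        by simp
      ultimately have "(\<phi> has_derivative (\<lambda>s. G (x + t *\<^sub>R u + h *\<^sub>R v) (s *\<^sub>R u) - G (x + t *\<^sub>R u) (s *\<^sub>R u))) (at t)"
        unfolding \<phi>_def by (rule has_derivative_diff)
      moreover have "G (x + t *\<^sub>R u + h *\<^sub>R v) (s *\<^sub>R u) = s * G (x + t *\<^sub>R u + h *\<^sub>R v) u"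
        "G (x + t *\<^sub>R u) (s *\<^sub>R u) = s * G (x + t *\<^sub>R u) u" for s
        using linear_scale[OF has_derivative_linear[OF a]] linear_scale[OF has_derivative_linear[OF b]] by simp_all
      ultimately show "DERIV \<phi> t :> G (x + t *\<^sub>R u + h *\<^sub>R v) u - G (x + t *\<^sub>R u) u"
        unfolding has_field_derivative_def
        by (simp add: right_diff_distrib[symmetric] mult.commute[of _ "_ - _"])
    qed
    then obtain z where z: "0 < z" "z < h"
      and eq: "\<phi> h - \<phi> 0 = h * (G (x + z *\<^sub>R u + h *\<^sub>R v) u - G (x + z *\<^sub>R u) u)" by auto
    have "\<bar>G (x + z *\<^sub>R u + h *\<^sub>R v) u - G x u - E (z *\<^sub>R u + h *\<^sub>R v)\<bar> \<le> c * (h * (norm u + norm v))"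
      using rb[of "x + z *\<^sub>R u + h *\<^sub>R v"] nr[of z h] nrm[of z h] z c
      by (smt (verit) add.assoc add_diff_cancel_left' mult_left_mono)
    moreover have "\<bar>G (x + z *\<^sub>R u) u - G x u - E (z *\<^sub>R u)\<bar> \<le> c * (h * (norm u + norm v))"
      using rb[of "x + z *\<^sub>R u"] nr[of z 0] nrm[of z 0] z c
      by (smt (verit) add.right_neutral scale_zero_left add_diff_cancel_left' mult_left_mono)
    ultimately have "\<bar>G (x + z *\<^sub>R u + h *\<^sub>R v) u - G (x + z *\<^sub>R u) u - h * E v\<bar> \<le> 2 * c * (h * (norm u + norm v))"
      by (simp add: E.add E.scaleR abs_le_iff)
    also have "\<dots> \<le> 2 * c * (h * (norm u + norm v + 1))" using c h by (intro mult_left_mono) auto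
    also have "\<dots> = (2 * c * (norm u + norm v + 1)) * h" by (simp add: mult_ac)
    also have "2 * c * (norm u + norm v + 1) = e" using n1 unfolding c_def by (metis
      nonzero_mult_div_cancel_left times_divide_eq_left times_divide_eq_right mult.assoc mult.commute
      less_numeral_extra(3) zero_neq_numeral mult_eq_0_iff)
    finally have "h * \<bar>G (x + z *\<^sub>R u + h *\<^sub>R v) u - G (x + z *\<^sub>R u) u - h * E v\<bar> \<le> h * (e * h)"
      using h by (intro mult_left_mono) auto
    also have "h * \<bar>G (x + z *\<^sub>R u + h *\<^sub>R v) u - G (x + z *\<^sub>R u) u - h * E v\<bar>
      = \<bar>\<phi> h - \<phi> 0 - h\<^sup>2 * E v\<bar>"
    proof -
      have "h * \<bar>r\<bar> = \<bar>h * r\<bar>" for r using h by (simp add: abs_mult)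
      then show ?thesis unfolding eq by (simp add: algebra_simps power2_eq_square)
    qed
    finally show "\<bar>g (x + h *\<^sub>R u + h *\<^sub>R v) - g (x + h *\<^sub>R u) - g (x + h *\<^sub>R v) + g x - h\<^sup>2 * E v\<bar> \<le> e * h\<^sup>2"
      by (simp add: \<phi>_def power2_eq_square algebra_simps)
  qed
qed

text \<open>The second difference is symmetric in \<open>u\<close> and \<open>v\<close>, and divided
  by \<open>h^2\<close> it tends to \<open>E u v\<close> as well as to \<open>E v u\<close>.\<close>

lemma frechet_derivative_commute_real:
  fixes g :: "'a::real_normed_vector \<Rightarrow> real"
  assumes "open S" "x \<in> S" "\<And>z. z \<in> S \<Longrightarrow> (g has_derivative G z) (at z)"
    and "\<And>u. ((\<lambda>z. G z u) has_derivative E u) (at x)"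
  shows "E u v = E v u"
proof (rule ccontr)
  assume ne: "E u v \<noteq> E v u"
  \<comment> \<open>Two estimates with error \<open>e * h^2\<close> each bound the gap by
    \<open>2 * e\<close>, which is half of the gap itself.\<close>
  define e where "e = \<bar>E u v - E v u\<bar> / 4"
  have e: "e > 0" using ne by (simp add: e_def)
  from assms(1,2) obtain d where d: "d > 0" "\<And>z. norm (z - x) < d \<Longrightarrow> z \<in> S"
    by (metis open_dist dist_norm)
  have der: "(g has_derivative G z) (at z)" if "norm (z - x) < d" for z using assms(3) d that by blast
  obtain d1 where d1: "d1 > 0" "\<And>h. 0 < h \<Longrightarrow> h < d1 \<Longrightarrow>
    \<bar>g (x + h *\<^sub>R u + h *\<^sub>R v) - g (x + h *\<^sub>R u) - g (x + h *\<^sub>R v) + g x - h\<^sup>2 * E u v\<bar> \<le> e * h\<^sup>2"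
    using second_difference_estimate[OF der assms(4) e d(1), of u v] by blast
  obtain d2 where d2: "d2 > 0" "\<And>h. 0 < h \<Longrightarrow> h < d2 \<Longrightarrow>
    \<bar>g (x + h *\<^sub>R v + h *\<^sub>R u) - g (x + h *\<^sub>R v) - g (x + h *\<^sub>R u) + g x - h\<^sup>2 * E v u\<bar> \<le> e * h\<^sup>2"
    using second_difference_estimate[OF der assms(4) e d(1), of v u] by blast
  define h where "h = min d1 d2 / 2"
  have h: "0 < h" "h < d1" "h < d2" using d1 d2 by (auto simp: h_def)
  have comm: "x + h *\<^sub>R v + h *\<^sub>R u = x + h *\<^sub>R u + h *\<^sub>R v" by (simp add: algebra_simps)
  have "\<bar>h\<^sup>2 * E u v - h\<^sup>2 * E v u\<bar> \<le> 2 * (e * h\<^sup>2)"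
    using d1(2)[OF h(1,2)] d2(2)[OF h(1,3)] unfolding comm by linarith
  moreover have "\<bar>h\<^sup>2 * E u v - h\<^sup>2 * E v u\<bar> = h\<^sup>2 * \<bar>E u v - E v u\<bar>"
    unfolding right_diff_distrib[symmetric] by (simp add: abs_mult)
  ultimately have "h\<^sup>2 * \<bar>E u v - E v u\<bar> \<le> h\<^sup>2 * (2 * e)" by (simp add: mult_ac)
  then have "\<bar>E u v - E v u\<bar> \<le> 2 * e" using h by simp
  then show False using ne by (simp add: e_def)
qed

lemma frechet_derivative_commute:
  fixes f :: "'a::real_normed_vector \<Rightarrow> 'b::euclidean_space"
  assumes "open S" "x \<in> S" "smooth_on f S"
  shows "frechet_derivative (\<lambda>y. frechet_derivative f (at y) u) (at x) v =
         frechet_derivative (\<lambda>y. frechet_derivative f (at y) v) (at x) u"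
proof (rule euclidean_eqI)
  fix b :: 'b assume "b \<in> Basis"
  show "frechet_derivative (\<lambda>y. frechet_derivative f (at y) u) (at x) v \<bullet> b =
         frechet_derivative (\<lambda>y. frechet_derivative f (at y) v) (at x) u \<bullet> b"
  proof (rule frechet_derivative_commute_real[OF assms(1,2)])
    show "((\<lambda>z. f z \<bullet> b) has_derivative (\<lambda>v. frechet_derivative f (at z) v \<bullet> b)) (at z)" if "z \<in> S" for z
      using has_derivative_inner_left[OF smooth_on_has_derivative[OF assms(3) that]] .
    show "((\<lambda>z. frechet_derivative f (at z) u \<bullet> b) has_derivative
       (\<lambda>v. frechet_derivative (\<lambda>y. frechet_derivative f (at y) u) (at x) v \<bullet> b)) (at x)" for u
      using has_derivative_inner_left[OF smooth_on_has_derivative[OF smooth_on_frechet_derivative[OF assms(3)] assms(2)]] .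
  qed
qed

section \<open>Bump functions and compactly supported vector fields\<close>

text \<open>Differentiating \<open>exp (-1/t)\<close> brings in powers of \<open>1/t\<close>, so the
  powers are made part of the family. It is then closed under differentiation, and smoothness for
  all \<open>n\<close> follows in one induction on the order.\<close>

definition flat_exp :: "nat \<Rightarrow> real \<Rightarrow> real" where
  "flat_exp n t = (if t > 0 then exp (- inverse t) * inverse t ^ n else 0)"

text \<open>On the right the substitution of \<open>1/t\<close> reduces this to the growth of
  \<open>exp\<close> against powers; on the left the function vanishes.\<close>

lemma flat_exp_tendsto_0: "(flat_exp n \<longlongrightarrow> 0) (at 0)"
proof -
  have "((\<lambda>x::real. x ^ n / exp x) \<longlongrightarrow> 0) at_top" by (rule tendsto_power_div_exp_0)
  then have "((\<lambda>t::real. inverse t ^ n / exp (inverse t)) \<longlongrightarrow> 0) (at_right 0)"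
    by (rule filterlim_compose) (rule filterlim_inverse_at_top_right)
  then have "(flat_exp n \<longlongrightarrow> 0) (at_right 0)"
    by (rule Lim_transform_eventually)
      (auto simp: flat_exp_def exp_minus divide_inverse eventually_at_right_less intro!: eventually_at_rightI[of 0 1])
  moreover have "(flat_exp n \<longlongrightarrow> 0) (at_left 0)"
    by (rule Lim_transform_eventually[OF tendsto_const])
      (auto simp: flat_exp_def intro!: eventually_at_leftI[of "-1" 0])
  ultimately show ?thesis by (simp add: filterlim_at_split)
qed

lemma flat_exp_DERIV:
  "(flat_exp n has_real_derivative (flat_exp (n + 2) t - n * flat_exp (n + 1) t)) (at t)"
proof (cases t "0::real" rule: linorder_cases)
  case less
  have "((\<lambda>_. 0) has_real_derivative (flat_exp (n + 2) t - n * flat_exp (n + 1) t)) (at t)"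
    using less by (simp add: flat_exp_def)
  then show ?thesis
    by (rule has_field_derivative_transform_within_open[of _ _ _ "{..<0}"]) (use less in \<open>auto simp: flat_exp_def\<close>)
next
  case greater
  have "((\<lambda>t. exp (- inverse t) * inverse t ^ n) has_real_derivative
      (flat_exp (n + 2) t - n * flat_exp (n + 1) t)) (at t)"
  proof -
    have inv: "(inverse has_real_derivative - (inverse t ^ 2)) (at t)"
      using DERIV_inverse[of t] greater by (simp add: numeral_2_eq_2)
    have "((\<lambda>t. inverse t ^ n) has_real_derivative - (n * inverse t ^ (n + 1))) (at t)"
    proof (cases n)
      case (Suc m)
      show ?thesis using DERIV_power_Suc[OF inv, of m] unfolding Suc
        by (simp add: power2_eq_square algebra_simps)
    qed simp
    moreover have "((\<lambda>t. exp (- inverse t)) has_real_derivative exp (- inverse t) * inverse t ^ 2) (at t)"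
      using DERIV_fun_exp[OF DERIV_minus[OF inv]] by simp
    ultimately have "((\<lambda>t. exp (- inverse t) * inverse t ^ n) has_real_derivative
      exp (- inverse t) * (inverse t)\<^sup>2 * inverse t ^ n + - (n * inverse t ^ (n + 1)) * exp (- inverse t)) (at t)"
      by (intro DERIV_mult)
    then show ?thesis using greater by (simp add: flat_exp_def power_add power2_eq_square mult_ac)
  qed
  then show ?thesis
    by (rule has_field_derivative_transform_within_open[of _ _ _ "{0<..}"]) (use greater in \<open>auto simp: flat_exp_def\<close>)
next
  case equal
  \<comment> \<open>The difference quotient at 0 is again a member of the family,
    \<open>flat_exp (Suc n)\<close>.\<close>
  have "((\<lambda>h. (flat_exp n (0 + h) - flat_exp n 0) / h) \<longlongrightarrow> 0) (at 0)"
    by (rule Lim_transform_eventually[OF flat_exp_tendsto_0[of "Suc n"]])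
      (auto simp: flat_exp_def divide_inverse intro!: always_eventually)
  then have "(flat_exp n has_real_derivative 0) (at 0)"
    by (simp add: DERIV_def)
  then show ?thesis using equal by (simp add: flat_exp_def)
qed

lemma smooth_on_flat_exp: "smooth_on (flat_exp n) UNIV"
proof -
  have "Ck_on k (flat_exp n) UNIV" for k
  proof (induction k arbitrary: n)
    case 0
    show ?case
      by (simp add: continuous_on_eq_continuous_at) (metis DERIV_isCont flat_exp_DERIV)
  next
    case (Suc k)
    show ?case
    proof (rule Ck_on_SucI[OF open_UNIV])
      show "(flat_exp n has_derivative (\<lambda>v. (flat_exp (n + 2) t + - n * flat_exp (n + 1) t) * v)) (at t)" for t
        using flat_exp_DERIV[of n t] by (simp add: has_field_derivative_def)
      show "Ck_on k (\<lambda>t. (flat_exp (n + 2) t + - n * flat_exp (n + 1) t) * v) UNIV" for v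
        by (intro Ck_on_bilinear[OF open_UNIV bounded_bilinear_mult] Ck_on_add[OF open_UNIV] Ck_on_const Suc.IH)
    qed
  qed
  then show ?thesis by (simp add: smooth_on_def)
qed

definition bump :: "'a::euclidean_space \<Rightarrow> real \<Rightarrow> 'a \<Rightarrow> real" where
  "bump a r x = flat_exp 0 (r\<^sup>2 - (norm (x - a))\<^sup>2)"

lemma smooth_on_bump: "smooth_on (bump a r) UNIV"
proof -
  have "smooth_on (\<lambda>x. flat_exp 0 (r\<^sup>2 - (norm (x - a))\<^sup>2)) UNIV"
    by (rule smooth_on_compose[OF open_UNIV open_UNIV _ _ smooth_on_flat_exp])
      (auto intro!: smooth_intros)
  then show ?thesis by (simp add: bump_def[abs_def])
qed

lemma bump_nonneg: "bump a r x \<ge> 0"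
  by (simp add: bump_def flat_exp_def)

lemma bump_pos_iff:
  assumes "r > 0"
  shows "bump a r x > 0 \<longleftrightarrow> x \<in> ball a r"
proof -
  have "(norm (x - a))\<^sup>2 < r\<^sup>2 \<longleftrightarrow> norm (x - a) < r"
    using assms power2_less_imp_less[of "norm (x - a)" r] power_strict_mono[of "norm (x - a)" r 2] by auto
  then show ?thesis by (simp add: bump_def flat_exp_def dist_norm norm_minus_commute)
qed

text \<open>The open sets \<open>\<Omega>\<close> and \<open>- K\<close> cover the space, and on
  each of them the extension agrees with a differentiable function.\<close>

lemma extend_by_zero_has_derivative:
  fixes f :: "'a::euclidean_space \<Rightarrow> 'b::real_normed_vector"
  assumes "open \<Omega>" "compact K" "K \<subseteq> \<Omega>" "\<And>x. x \<in> \<Omega> \<Longrightarrow> (f has_derivative f' x) (at x)"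
    "\<And>x. x \<in> \<Omega> - K \<Longrightarrow> f x = 0"
  shows "((\<lambda>x. if x \<in> \<Omega> then f x else 0) has_derivative (if x \<in> \<Omega> then f' x else (\<lambda>_. 0))) (at x)"
proof (cases "x \<in> \<Omega>")
  case True
  show ?thesis
    using has_derivative_transform_within_open[OF assms(4)[OF True] assms(1) True, of "\<lambda>x. if x \<in> \<Omega> then f x else 0"] True
    by simp
next
  case False
  have "open (- K)" "x \<in> - K" using False assms by (auto simp: compact_imp_closed open_Compl)
  then show ?thesis
    using has_derivative_transform_within_open[OF has_derivative_const[of 0], of "- K" x "\<lambda>x. if x \<in> \<Omega> then f x else 0"] False assms(5)
    by auto
qed

lemma extend_by_zero_smooth:
  fixes f :: "'a::euclidean_space \<Rightarrow> 'b::real_normed_vector"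
  assumes "open \<Omega>" "compact K" "K \<subseteq> \<Omega>" "smooth_on f \<Omega>" "\<And>x. x \<in> \<Omega> - K \<Longrightarrow> f x = 0"
  shows "smooth_on (\<lambda>x. if x \<in> \<Omega> then f x else 0) UNIV"
proof (rule smooth_on_local)
  fix x :: 'a
  have *: "open (- K)" using assms by (simp add: compact_imp_closed open_Compl)
  have "smooth_on (\<lambda>x. if x \<in> \<Omega> then f x else 0) \<Omega>"
    by (rule smooth_on_cong[OF assms(1) _ assms(4)]) simp
  moreover have "smooth_on (\<lambda>x. if x \<in> \<Omega> then f x else 0) (- K)"
    by (rule smooth_on_cong[OF * _ smooth_on_const[of 0]]) (use assms(5) in auto)
  ultimately show "\<exists>T. open T \<and> x \<in> T \<and> smooth_on (\<lambda>x. if x \<in> \<Omega> then f x else 0) T"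
    using assms(1,3) * by (cases "x \<in> \<Omega>") auto
qed

section \<open>The divergence theorem for compactly supported fields on a Euclidean space\<close>

lemma integral_translate_lborel:
  fixes f :: "'a::euclidean_space \<Rightarrow> real"
  assumes "f \<in> borel_measurable borel"
  shows "(LINT x|lborel. f (c + x)) = (LINT x|lborel. f x)"
proof -
  have "(LINT x|lborel. f x) = (LINT x|distr lborel borel ((+) c). f x)" by (simp add: lborel_distr_plus)
  also have "\<dots> = (LINT x|lborel. f (c + x))" using assms by (simp add: integral_distr)
  finally show ?thesis by simp
qed

lemma integrable_lborel_compact_support:
  fixes f :: "'a::euclidean_space \<Rightarrow> 'b::{banach, second_countable_topology}"
  assumes "compact K" "continuous_on K f" "\<And>x. x \<notin> K \<Longrightarrow> f x = 0"
  shows "integrable lborel f"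
proof -
  have "integrable lborel (\<lambda>x. indicator K x *\<^sub>R f x)"
    by (rule borel_integrable_compact[OF assms(1,2)])
  moreover have "(\<lambda>x. indicator K x *\<^sub>R f x) = f" using assms(3) by (auto simp: indicator_def)
  ultimately show ?thesis by simp
qed

text \<open>By translation invariance every difference quotient of \<open>f\<close> in the direction
  \<open>b\<close> has integral 0, and the quotients converge to the derivative under a common
  integrable bound.\<close>

lemma integral_partial_derivative_eq_0:
  fixes f :: "'a::euclidean_space \<Rightarrow> real"
  assumes "\<And>x. (f has_derivative f' x) (at x)" "compact K" "\<And>x. x \<notin> K \<Longrightarrow> f x = 0"
    "continuous_on UNIV (\<lambda>x. f' x b)"
  shows "(LINT x|lborel. f' x b) = 0"
proof -
  have contf: "continuous_on UNIV f"
    using assms(1) by (meson has_derivative_continuous continuous_at_imp_continuous_on)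
  have f'0: "f' x b = 0" if "x \<notin> K" for x
  proof -
    have "(f has_derivative (\<lambda>_. 0)) (at x)"
      using has_derivative_transform_within_open[OF has_derivative_const[of 0], of "- K" x f] that assms(2,3)
      by (auto simp: compact_imp_closed open_Compl)
    then show ?thesis using has_derivative_unique[OF assms(1)] by metis
  qed
  have lin: "(\<lambda>s. f' y (s *\<^sub>R b)) = (*) (f' y b)" for y
    by (rule ext) (simp add: linear_scale[OF has_derivative_linear[OF assms(1)]])
  obtain B where B: "\<And>x. \<bar>f' x b\<bar> \<le> B" "B \<ge> 0"
  proof -
    have "compact ((\<lambda>x. f' x b) ` K)"
      by (intro compact_continuous_image assms(2) continuous_on_subset[OF assms(4)]) auto
    then obtain B where "\<And>x. x \<in> K \<Longrightarrow> \<bar>f' x b\<bar> \<le> B"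
      using compact_imp_bounded[of "(\<lambda>x. f' x b) ` K"] by (auto simp: bounded_iff)
    then have "\<bar>f' x b\<bar> \<le> max B 0" for x using f'0[of x] by (cases "x \<in> K") (auto simp: le_max_iff_disj)
    then show thesis using that[of "max B 0"] by auto
  qed
  \<comment> \<open>All step lengths are at most 1, so every difference quotient vanishes outside
    this one compact set, \<open>K\<close> swept back along \<open>b\<close>.\<close>
  define K' where "K' = (\<lambda>(x, t). x - t *\<^sub>R b) ` (K \<times> {0..1})"
  have K': "compact K'" unfolding K'_def
    by (intro compact_continuous_image compact_Times assms(2)) (auto intro!: continuous_intros simp: case_prod_unfold)
  define q where "q n x = (f (inverse (Suc n) *\<^sub>R b + x) - f x) * Suc n" for n :: nat and x
  have qm: "continuous_on UNIV (q n)" for n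
    unfolding q_def by (intro continuous_intros continuous_on_compose2[OF contf]) auto
  have qbound: "\<bar>q n x\<bar> \<le> B * indicator K' x" for n x
  proof -
    have "\<exists>z. 0 < z \<and> z < inverse (Suc n) \<and> f (x + inverse (Suc n) *\<^sub>R b) - f (x + 0 *\<^sub>R b) = (inverse (Suc n) - 0) * f' (x + z *\<^sub>R b) b"
    proof (rule MVT2[where f="\<lambda>t. f (x + t *\<^sub>R b)"])
      fix t :: real
      have "((\<lambda>t. x + t *\<^sub>R b) has_derivative (\<lambda>s. s *\<^sub>R b)) (at t)" by (auto intro!: derivative_eq_intros)
      from has_derivative_compose[OF this assms(1)]
      have "((\<lambda>t. f (x + t *\<^sub>R b)) has_derivative (\<lambda>s. f' (x + t *\<^sub>R b) (s *\<^sub>R b))) (at t)" .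
      then show "((\<lambda>t. f (x + t *\<^sub>R b)) has_real_derivative f' (x + t *\<^sub>R b) b) (at t)"
        unfolding has_field_derivative_def lin .
    qed simp
    then obtain z where z: "0 < z" "z < inverse (Suc n)"
      and eq: "f (x + inverse (Suc n) *\<^sub>R b) - f x = inverse (Suc n) * f' (x + z *\<^sub>R b) b" by auto
    have q: "q n x = f' (x + z *\<^sub>R b) b" unfolding q_def using eq by (simp add: add.commute field_simps)
    show ?thesis
    proof (cases "x + z *\<^sub>R b \<in> K")
      case True
      have "inverse (real (Suc n)) \<le> 1" by (simp add: field_simps)
      with z have "z \<in> {0..1}" by auto
      with True have "x \<in> K'" unfolding K'_def by (intro image_eqI[of _ _ "(x + z *\<^sub>R b, z)"]) auto
      then show ?thesis using B(1) q by simp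
    next
      case False
      then show ?thesis using f'0 q B(2) by simp
    qed
  qed
  have lim: "(\<lambda>n. q n x) \<longlonglongrightarrow> f' x b" for x
  proof -
    have "((\<lambda>t. x + t *\<^sub>R b) has_derivative (\<lambda>s. s *\<^sub>R b)) (at 0)" by (auto intro!: derivative_eq_intros)
    from has_derivative_compose[OF this, of f "f' x"] assms(1)[of x]
    have "((\<lambda>t. f (x + t *\<^sub>R b)) has_derivative (\<lambda>s. f' x (s *\<^sub>R b))) (at 0)" by simp
    then have "((\<lambda>t. f (x + t *\<^sub>R b)) has_real_derivative f' x b) (at 0)"
      unfolding has_field_derivative_def lin .
    then have "((\<lambda>h. (f (x + h *\<^sub>R b) - f x) / h) \<longlongrightarrow> f' x b) (at 0)" by (simp add: DERIV_def)
    moreover have "filterlim (\<lambda>n. inverse (real (Suc n))) (at 0) sequentially"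
      using LIMSEQ_inverse_real_of_nat by (auto simp: filterlim_at)
    ultimately have "(\<lambda>n. (f (x + inverse (real (Suc n)) *\<^sub>R b) - f x) / inverse (real (Suc n))) \<longlonglongrightarrow> f' x b"
      by (rule filterlim_compose)
    then show ?thesis by (simp add: q_def add.commute divide_inverse)
  qed
  have int0: "(LINT x|lborel. q n x) = 0" for n
  proof -
    have fi: "integrable lborel f"
      by (rule integrable_lborel_compact_support[OF assms(2) continuous_on_subset[OF contf] assms(3)]) auto
    have "integrable lborel (\<lambda>x. f (inverse (Suc n) *\<^sub>R b + x))"
      using fi borel_measurable_continuous_onI[OF contf]
      by (subst (asm) lborel_distr_plus[of "inverse (Suc n) *\<^sub>R b", symmetric]) (simp add: integrable_distr_eq)
    then show ?thesis using fi integral_translate_lborel[of f "inverse (Suc n) *\<^sub>R b"] borel_measurable_continuous_onI[OF contf]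
      unfolding q_def by (simp del: of_nat_Suc)
  qed
  have "(\<lambda>n. LINT x|lborel. q n x) \<longlonglongrightarrow> (LINT x|lborel. f' x b)"
  proof (rule integral_dominated_convergence[where w="\<lambda>x. B * indicator K' x"])
    show "integrable lborel (\<lambda>x. B * indicator K' x)"
      using borel_integrable_compact[OF K', of "\<lambda>_. B"] by (simp add: mult.commute)
    show "(\<lambda>x. f' x b) \<in> borel_measurable lborel"
      using borel_measurable_continuous_onI[OF assms(4)] by simp
    show "q n \<in> borel_measurable lborel" for n using borel_measurable_continuous_onI[OF qm] by simp
    show "AE x in lborel. (\<lambda>n. q n x) \<longlonglongrightarrow> f' x b" using lim by simp
    show "AE x in lborel. norm (q n x) \<le> B * indicator K' x" for n using qbound by simp
  qed
  then show ?thesis using int0 by (simp add: LIMSEQ_const_iff)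
qed

text \<open>Each component is extended by zero to the whole space and differentiated in its own
  direction. The indicator is there because \<open>v\<close> and \<open>v'\<close> carry no
  information outside \<open>\<Omega>\<close>, which will be the image of a chart.\<close>

lemma integral_divergence_eq_0:
  fixes v :: "'a::euclidean_space \<Rightarrow> 'a"
  assumes "open \<Omega>" "compact K" "K \<subseteq> \<Omega>" "\<And>x. x \<in> \<Omega> \<Longrightarrow> (v has_derivative v' x) (at x)"
    "\<And>x. x \<in> \<Omega> - K \<Longrightarrow> v x = 0" "\<And>b. b \<in> Basis \<Longrightarrow> continuous_on \<Omega> (\<lambda>x. v' x b)"
  shows "(LINT x|lborel. indicator \<Omega> x * (\<Sum>b\<in>Basis. v' x b \<bullet> b)) = 0"
proof -
  define g where "g b x = (if x \<in> \<Omega> then v x \<bullet> b else 0)" for b x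
  define g' where "g' b x = (if x \<in> \<Omega> then (\<lambda>w. v' x w \<bullet> b) else (\<lambda>_. 0))" for b x
  have v'0: "v' x b = 0" if "x \<in> \<Omega> - K" for x b
  proof -
    have "(v has_derivative (\<lambda>_. 0)) (at x)"
      using has_derivative_transform_within_open[OF has_derivative_const[of 0], of "\<Omega> - K" x v] that assms
      by (auto simp: compact_imp_closed open_Diff)
    then show ?thesis using has_derivative_unique[OF assms(4)] that by (metis DiffD1)
  qed
  have der: "(g b has_derivative g' b x) (at x)" for b x
    unfolding g_def g'_def
    by (rule extend_by_zero_has_derivative[OF assms(1-3)]) (auto simp: assms(5) intro!: derivative_intros assms(4))
  have cont: "continuous_on UNIV (\<lambda>x. g' b x b)" if "b \<in> Basis" for b
  proof -
    have "continuous_on (- K \<union> \<Omega>) (\<lambda>x. g' b x b)"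
    proof (rule continuous_on_open_Un)
      show "open (- K)" using assms(2) by (simp add: compact_imp_closed open_Compl)
      show "open \<Omega>" by fact
      have "continuous_on (- K) (\<lambda>x. 0::real)" by simp
      then show "continuous_on (- K) (\<lambda>x. g' b x b)"
        by (rule continuous_on_eq) (use v'0 in \<open>auto simp: g'_def\<close>)
      have "continuous_on \<Omega> (\<lambda>x. v' x b \<bullet> b)" by (intro continuous_intros assms(6) that)
      then show "continuous_on \<Omega> (\<lambda>x. g' b x b)"
        by (rule continuous_on_eq) (auto simp: g'_def)
    qed
    moreover have "- K \<union> \<Omega> = UNIV" using assms(3) by auto
    ultimately show ?thesis by simp
  qed
  have z: "g' b x b = 0" if "x \<notin> K" for b x using v'0 that by (auto simp: g'_def)
  have int: "integrable lborel (\<lambda>x. g' b x b)" if "b \<in> Basis" for b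
    by (rule integrable_lborel_compact_support[OF assms(2) continuous_on_subset[OF cont[OF that]] z]) auto
  have "(\<lambda>x. indicator \<Omega> x * (\<Sum>b\<in>Basis. v' x b \<bullet> b)) = (\<lambda>x. \<Sum>b\<in>Basis. g' b x b)"
    by (auto simp: g'_def indicator_def)
  moreover have "(LINT x|lborel. g' b x b) = 0" if "b \<in> Basis" for b
    by (rule integral_partial_derivative_eq_0[OF der assms(2) _ cont[OF that]]) (use assms in \<open>auto simp: g_def\<close>)
  ultimately show ?thesis using int by simp
qed

section \<open>Gram determinants and change of variables\<close>

text \<open>The library develops determinants and the change of variables formula for vectors indexed by a
  type; \<open>'e bidx\<close> is such an index type for an arbitrary Euclidean space \<open>'e\<close>.\<close>

typedef (overloaded) 'e bidx = "Basis :: 'e::euclidean_space set"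
  morphisms bvec abs_bidx
  using nonempty_Basis by blast

instance bidx :: (euclidean_space) finite
proof
  have "(UNIV :: 'a bidx set) \<subseteq> abs_bidx ` Basis"
    by (metis UNIV_I bvec bvec_inverse image_iff subsetI)
  then show "finite (UNIV :: 'a bidx set)" by (rule finite_subset) simp
qed

lemma bvec_Basis [simp]: "bvec i \<in> Basis" by (rule bvec)
lemma bvec_eq_iff [simp]: "bvec i = bvec j \<longleftrightarrow> i = j" by (rule bvec_inject)
lemma bvec_inner: "bvec i \<bullet> bvec j = (if i = j then 1 else 0)" by (simp add: inner_Basis)
lemma range_bvec: "range bvec = Basis" using type_definition.Rep_range[OF type_definition_bidx] .
lemma bij_bvec: "bij_betw bvec UNIV Basis"
  by (simp add: bij_betw_def range_bvec inj_def)

text \<open>The change of variables theorem asks for a well-ordered index type, and any numbering of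
  a finite set provides such an order.\<close>

definition bidx_code :: "'e::euclidean_space bidx \<Rightarrow> nat" where
  "bidx_code = (SOME f. inj f)"

lemma inj_bidx_code: "inj (bidx_code :: 'e::euclidean_space bidx \<Rightarrow> nat)"
proof -
  have "\<exists>f :: 'e bidx \<Rightarrow> nat. inj f"
    using finite_imp_inj_to_nat_seg[OF finite_class.finite_UNIV] by auto
  then show ?thesis unfolding bidx_code_def by (rule someI_ex)
qed

instantiation bidx :: (euclidean_space) wellorder
begin

definition less_eq_bidx :: "'a bidx \<Rightarrow> 'a bidx \<Rightarrow> bool" where "less_eq_bidx i j \<longleftrightarrow> bidx_code i \<le> bidx_code j"
definition less_bidx :: "'a bidx \<Rightarrow> 'a bidx \<Rightarrow> bool" where "less_bidx i j \<longleftrightarrow> bidx_code i < bidx_code j"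

instance
proof
  fix i j k :: "'a bidx"
  show "i < j \<longleftrightarrow> i \<le> j \<and> \<not> j \<le> i" unfolding less_eq_bidx_def less_bidx_def by auto
  show "i \<le> i" unfolding less_eq_bidx_def by simp
  show "i \<le> j \<Longrightarrow> j \<le> k \<Longrightarrow> i \<le> k" unfolding less_eq_bidx_def by (rule order_trans)
  show "i \<le> j \<Longrightarrow> j \<le> i \<Longrightarrow> i = j"
    unfolding less_eq_bidx_def by (rule injD[OF inj_bidx_code]) (rule order_antisym)
  show "i \<le> j \<or> j \<le> i" unfolding less_eq_bidx_def by (rule linear)
next
  fix P :: "'a bidx \<Rightarrow> bool" and a
  assume step: "\<And>x. (\<And>y. y < x \<Longrightarrow> P y) \<Longrightarrow> P x"
  show "P a"
  proof (rule measure_induct_rule[of bidx_code P])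
    fix x :: "'a bidx" assume "\<And>y. bidx_code y < bidx_code x \<Longrightarrow> P y"
    then show "P x" using step[of x] unfolding less_bidx_def by blast
  qed
qed

end

definition tov :: "'e::euclidean_space \<Rightarrow> real ^ 'e bidx" where
  "tov x = (\<chi> i. x \<bullet> bvec i)"

definition fromv :: "real ^ 'e bidx \<Rightarrow> 'e::euclidean_space" where
  "fromv v = (\<Sum>i\<in>UNIV. (v $ i) *\<^sub>R bvec i)"

lemma sum_bidx: "(\<Sum>b\<in>Basis. f b) = (\<Sum>i\<in>UNIV. f (bvec i))"
  by (rule sum.reindex_bij_betw[symmetric, OF bij_bvec])

lemma fromv_tov [simp]: "fromv (tov x) = x"
  using euclidean_representation[of x] by (simp add: fromv_def tov_def sum_bidx)

lemma tov_fromv [simp]: "tov (fromv v) = v"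
  by (simp add: fromv_def tov_def vec_eq_iff inner_sum_left bvec_inner if_distrib cong: if_cong)

lemma fromv_inner: "fromv v \<bullet> bvec i = v $ i"
  using arg_cong[OF tov_fromv[of v], of "\<lambda>w. w $ i"] by (simp add: tov_def)

lemma linear_tov: "linear tov"
  by (auto simp: linear_iff tov_def vec_eq_iff inner_add_left)

lemma linear_fromv: "linear fromv"
  by (auto simp: linear_iff fromv_def scaleR_add_left sum.distrib scaleR_sum_right)

lemma fromv_axis [simp]: "fromv (axis i 1) = bvec i"
  by (simp add: fromv_def axis_def if_distrib[of "\<lambda>r. r *\<^sub>R _"] cong: if_cong)

lemma continuous_fromv: "continuous_on S fromv" and continuous_tov: "continuous_on S tov"
  by (simp_all add: linear_continuous_on linear_fromv linear_tov linear_conv_bounded_linear[symmetric])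

text \<open>Boxes determine Lebesgue measure, and the coordinates turn a box into a box with the
  same side lengths.\<close>

lemma lborel_distr_fromv: "distr lborel borel fromv = (lborel :: 'e::euclidean_space measure)"
proof (rule lborel_eqI[symmetric])
  have [measurable]: "fromv \<in> borel_measurable borel"
    by (rule borel_measurable_continuous_onI[OF continuous_fromv])
  fix l u :: 'e assume le: "\<And>b. b \<in> Basis \<Longrightarrow> l \<bullet> b \<le> u \<bullet> b"
  have "fromv -` box l u \<inter> space lborel = box (tov l) (tov u)"
  proof -
    have "fromv v \<in> box l u \<longleftrightarrow> v \<in> box (tov l) (tov u)" for v
    proof -
      have "fromv v \<in> box l u \<longleftrightarrow> (\<forall>i. l \<bullet> bvec i < fromv v \<bullet> bvec i \<and> fromv v \<bullet> bvec i < u \<bullet> bvec i)"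
        unfolding mem_box by (metis bvec_Basis rangeE range_bvec)
      then show ?thesis by (auto simp: mem_box Basis_vec_def inner_axis tov_def fromv_inner)
    qed
    then show ?thesis by auto
  qed
  then have "emeasure (distr lborel borel fromv) (box l u) = emeasure lborel (box (tov l) (tov u))"
    by (simp add: emeasure_distr)
  also have "\<dots> = (\<Prod>b\<in>Basis. (tov u - tov l) \<bullet> b)"
    using le by (subst emeasure_lborel_box) (auto simp: Basis_vec_def inner_axis tov_def)
  also have "(\<Prod>b\<in>Basis. (tov u - tov l) \<bullet> b) = (\<Prod>i\<in>UNIV. (u - l) \<bullet> bvec i)"
  proof -
    have B: "Basis = range (\<lambda>i. axis i (1::real) :: real ^ 'e bidx)" by (auto simp: Basis_vec_def)
    have inj: "inj (\<lambda>i. axis i (1::real) :: real ^ 'e bidx)" by (simp add: inj_def axis_eq_axis)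
    show ?thesis
      by (subst B, subst prod.reindex[OF inj]) (simp add: inner_axis tov_def inner_diff_left)
  qed
  also have "\<dots> = (\<Prod>b\<in>Basis. (u - l) \<bullet> b)"
    by (rule prod.reindex_bij_betw[OF bij_bvec])
  finally show "emeasure (distr lborel borel fromv) (box l u) = (\<Prod>b\<in>Basis. (u - l) \<bullet> b)" .
qed simp

section \<open>Matrices of linear maps and Gram matrices\<close>

definition mat_of :: "('e::euclidean_space \<Rightarrow> 'e) \<Rightarrow> real ^ 'e bidx ^ 'e bidx" where
  "mat_of L = (\<chi> i j. L (bvec j) \<bullet> bvec i)"

definition gram :: "('e::euclidean_space \<Rightarrow> 'v::real_inner) \<Rightarrow> real ^ 'e bidx ^ 'e bidx" where
  "gram A = (\<chi> i j. A (bvec i) \<bullet> A (bvec j))"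

lemma matrix_eq_mat_of: "matrix (\<lambda>v. tov (L (fromv v))) = mat_of L"
  by (simp add: matrix_def mat_of_def tov_def vec_eq_iff)

text \<open>Conjugation with \<open>bvec\<close> carries permutations of the index type to
  permutations of \<open>Basis\<close>; it preserves the sign, by induction over transpositions.
  This connects the expansion in \<open>area_density\<close> with \<open>det\<close> and its
  algebra.\<close>

lemma permutes_Basis_sum:
  fixes g :: "'e::euclidean_space \<Rightarrow> 'e \<Rightarrow> real"
  shows "(\<Sum>\<pi> | \<pi> permutes (Basis :: 'e set). of_int (sign \<pi>) * (\<Prod>b\<in>Basis. g b (\<pi> b)))
    = det (\<chi> i j. g (bvec i) (bvec j))"
proof -
  define T :: "('e bidx \<Rightarrow> 'e bidx) \<Rightarrow> 'e \<Rightarrow> 'e" where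
    "T \<pi> = (\<lambda>x. if x \<in> Basis then bvec (\<pi> (inv_into UNIV bvec x)) else x)" for \<pi>
  have T: "bij_betw T {\<pi>. \<pi> permutes UNIV} {\<pi>. \<pi> permutes Basis}"
    using bij_betw_permutations[OF bij_bvec] unfolding T_def .
  have inv: "inv_into UNIV bvec (bvec i) = i" for i :: "'e bidx"
    by (meson UNIV_I bij_betw_imp_inj_on bij_bvec inv_into_f_f)
  have Tb: "T \<pi> (bvec i) = bvec (\<pi> i)" for \<pi> i by (simp add: T_def inv)
  have To: "T (p \<circ> q) = T p \<circ> T q" for p q by (auto simp: T_def inv fun_eq_iff)
  have fB: "finite (Basis :: 'e set)" by simp
  have Tp: "permutation (T p)" if "p permutes UNIV" for p
    using T that fB by (metis bij_betw_apply mem_Collect_eq permutation_permutes)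
  have sgn: "sign (T p) = sign p" if "p permutes UNIV" for p
    using that finite_class.finite_UNIV
  proof (induction rule: permutes_induct)
    case id
    have "T id = id" by (auto simp: T_def fun_eq_iff) (metis f_inv_into_f range_bvec)
    then show ?case by (metis sign_id)
  next
    case (swap a b p)
    have Tt: "T (Transposition.transpose a b) = Transposition.transpose (bvec a) (bvec b)"
      by (auto simp: T_def fun_eq_iff Transposition.transpose_def inv) (metis f_inv_into_f range_bvec)+
    have "permutation p" using swap by (meson finite_class.finite_UNIV permutation_permutes)
    then have "sign (Transposition.transpose a b \<circ> p) = - sign p"
      using swap by (simp add: sign_compose sign_swap_id permutation_swap_id)
    moreover have "sign (T (Transposition.transpose a b \<circ> p)) = - sign (T p)"
      using swap unfolding To Tt by (subst sign_compose) (auto simp: Tp sign_swap_id permutation_swap_id)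
    ultimately show ?case using swap by (simp only:)
  qed
  have "(\<Sum>\<pi> | \<pi> permutes (Basis :: 'e set). of_int (sign \<pi>) * (\<Prod>b\<in>Basis. g b (\<pi> b)))
    = (\<Sum>\<pi> | \<pi> permutes UNIV. of_int (sign (T \<pi>)) * (\<Prod>b\<in>Basis. g b (T \<pi> b)))"
    by (rule sum.reindex_bij_betw[symmetric, OF T])
  also have "\<dots> = (\<Sum>\<pi> | \<pi> permutes UNIV. of_int (sign \<pi>) * (\<Prod>i\<in>UNIV. g (bvec i) (bvec (\<pi> i))))"
    by (intro sum.cong refl) (simp add: sgn prod.reindex_bij_betw[symmetric, OF bij_bvec] Tb)
  finally show ?thesis by (simp add: det_def)
qed

lemma gram_mult_inner: "linear A \<Longrightarrow> u \<bullet> (gram A *v w) = A (fromv u) \<bullet> A (fromv w)"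
  by (simp add: fromv_def linear_sum linear_scale inner_sum_left inner_sum_right gram_def
      matrix_vector_mult_def inner_vec_def sum_distrib_left mult_ac) (subst sum.swap, rule refl)

lemma gram_mult_nth: "linear A \<Longrightarrow> (gram A *v w) $ i = A (bvec i) \<bullet> A (fromv w)"
  by (simp add: fromv_def linear_sum linear_scale inner_sum_right gram_def matrix_vector_mult_def mult_ac)

lemma gram_compose:
  assumes "linear A" "linear J"
  shows "gram (A \<circ> J) = transpose (mat_of J) ** gram A ** mat_of J"
proof -
  have J: "J (bvec i) = (\<Sum>k\<in>UNIV. (mat_of J $ k $ i) *\<^sub>R bvec k)" for i
    using euclidean_representation[of "J (bvec i)"] by (simp add: mat_of_def sum_bidx)
  have "A (J (bvec i)) = (\<Sum>k\<in>UNIV. (mat_of J $ k $ i) *\<^sub>R A (bvec k))" for i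
    by (subst J) (simp add: linear_sum[OF assms(1)] linear_scale[OF assms(1)])
  then show ?thesis
    by (simp add: gram_def matrix_matrix_mult_def transpose_def vec_eq_iff inner_sum_left inner_sum_right
        sum_distrib_left sum_distrib_right mult_ac)
      (simp add: sum.swap)?
qed

text \<open>The Gram matrix transforms as a quadratic form, so the square root of its determinant
  scales by \<open>|det J|\<close>, the very factor in the change of variables formula. Area is
  therefore independent of charts and of reparametrizations.\<close>

lemma det_gram_compose:
  "linear A \<Longrightarrow> linear J \<Longrightarrow> det (gram (A \<circ> J)) = (det (mat_of J))\<^sup>2 * det (gram A)"
  by (simp add: gram_compose det_mul det_transpose power2_eq_square)

lemma pos_def_det_nonzero:
  fixes M :: "real ^ 'n ^ 'n"
  assumes "\<And>u. u \<noteq> 0 \<Longrightarrow> u \<bullet> (M *v u) > 0"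
  shows "det M \<noteq> 0"
proof -
  have "\<forall>x. M *v x = 0 \<longrightarrow> x = 0" using assms by (metis inner_zero_right less_irrefl)
  then show ?thesis
    using matrix_left_invertible_ker[of M] invertible_left_inverse invertible_det_nz by blast
qed

text \<open>The segment from the identity matrix to \<open>M\<close> consists of positive definite,
  hence invertible, matrices, so \<open>det\<close> cannot change sign along it from its value 1 at
  the identity.\<close>

lemma pos_def_det_pos:
  fixes M :: "real ^ 'n ^ 'n"
  assumes "\<And>u. u \<noteq> 0 \<Longrightarrow> u \<bullet> (M *v u) > 0"
  shows "det M > 0"
proof (rule ccontr)
  assume "\<not> det M > 0"
  define f where "f t = det ((1 - t) *\<^sub>R mat 1 + t *\<^sub>R M)" for t :: real
  have f0: "f 0 = 1" and f1: "f 1 = det M" by (simp_all add: f_def)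
  have cont: "continuous_on {0..1} f"
    unfolding f_def det_def by (intro continuous_intros)
  obtain t where t: "0 \<le> t" "t \<le> 1" "f t = 0"
    using IVT2'[of f 1 0 0] cont f0 f1 \<open>\<not> det M > 0\<close> by auto
  have "u \<bullet> (((1 - t) *\<^sub>R mat 1 + t *\<^sub>R M) *v u) > 0" if "u \<noteq> 0" for u
  proof -
    have "u \<bullet> (((1 - t) *\<^sub>R mat 1 + t *\<^sub>R M) *v u) = (1 - t) * (u \<bullet> u) + t * (u \<bullet> (M *v u))"
      by (simp add: matrix_vector_mult_add_rdistrib scaleR_matrix_vector_assoc[symmetric] inner_add_right)
    also have "\<dots> > 0"
    proof (cases "t = 0")
      case True
      then show ?thesis using that by simp
    next
      case False
      have "(1 - t) * (u \<bullet> u) \<ge> 0" using t by simp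
      moreover have "t * (u \<bullet> (M *v u)) > 0" using t False assms[OF that] by simp
      ultimately show ?thesis by simp
    qed
    finally show ?thesis .
  qed
  then show False using pos_def_det_nonzero t(3) unfolding f_def by blast
qed

lemma gram_pos_def:
  assumes "linear A" "inj A" "u \<noteq> 0"
  shows "u \<bullet> (gram A *v u) > 0"
proof -
  have "fromv u \<noteq> 0" using assms(3) by (metis linear_0 linear_tov tov_fromv)
  then have "A (fromv u) \<noteq> 0" using assms(1,2) linear_injective_0 by blast
  then show ?thesis by (simp add: gram_mult_inner[OF assms(1)])
qed

lemma det_gram_pos: "linear A \<Longrightarrow> inj A \<Longrightarrow> det (gram A) > 0"
  by (rule pos_def_det_pos, rule gram_pos_def)

section \<open>Traces and pseudo-inverses\<close>

definition tr :: "('e::euclidean_space \<Rightarrow> 'e) \<Rightarrow> real" where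
  "tr L = (\<Sum>b\<in>Basis. L b \<bullet> b)"

text \<open>The maps go between different spaces. A trace over the ambient space thus becomes one
  over the coordinate space, which is how the divergence is computed in a chart.\<close>

lemma tr_commute:
  fixes K :: "'e::euclidean_space \<Rightarrow> 'f::euclidean_space" and L :: "'f \<Rightarrow> 'e"
  assumes "linear K" "linear L"
  shows "tr (\<lambda>x. L (K x)) = tr (\<lambda>y. K (L y))"
proof -
  have "tr (\<lambda>x. L (K x)) = (\<Sum>b\<in>Basis. \<Sum>c\<in>Basis. (K b \<bullet> c) * (L c \<bullet> b))"
    unfolding tr_def
    by (intro sum.cong refl) (subst linear_basis_expansion[OF assms(2)], simp add: inner_sum_left)
  also have "\<dots> = (\<Sum>c\<in>Basis. \<Sum>b\<in>Basis. (L c \<bullet> b) * (K b \<bullet> c))"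
    by (subst sum.swap) (simp add: mult.commute)
  also have "\<dots> = tr (\<lambda>y. K (L y))"
    unfolding tr_def
    by (intro sum.cong refl) (subst (2) linear_basis_expansion[OF assms(1)], simp add: inner_sum_left)
  finally show ?thesis .
qed

text \<open>The pseudo-inverse of an injective linear map, written through the Gram matrix because it has to
  depend smoothly on the map.\<close>

definition pinv :: "('e::euclidean_space \<Rightarrow> 'v::real_inner) \<Rightarrow> 'v \<Rightarrow> 'e" where
  "pinv A y = fromv (matrix_inv (gram A) *v (\<chi> i. y \<bullet> A (bvec i)))"

lemma gram_matrix_inv:
  assumes "linear A" "inj A"
  shows "matrix_inv (gram A) ** gram A = mat 1" "gram A ** matrix_inv (gram A) = mat 1"
proof -
  have "invertible (gram A)" using det_gram_pos[OF assms] by (simp add: invertible_det_nz)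
  then show "matrix_inv (gram A) ** gram A = mat 1" "gram A ** matrix_inv (gram A) = mat 1"
    unfolding invertible_def matrix_inv_def by (metis (mono_tags, lifting) someI_ex)+
qed

lemma linear_pinv: "linear (pinv A)"
proof -
  have "linear (\<lambda>y. matrix_inv (gram A) *v (\<chi> i. y \<bullet> A (bvec i)))"
    by (auto simp: linear_iff matrix_vector_mult_def vec_eq_iff inner_add_left algebra_simps sum.distrib sum_distrib_left)
  then show ?thesis unfolding pinv_def using linear_compose[OF _ linear_fromv] by (simp add: o_def)
qed

lemma pinv_left [simp]:
  assumes "linear A" "inj A"
  shows "pinv A (A u) = u"
proof -
  have "(\<chi> i. A u \<bullet> A (bvec i)) = gram A *v tov u"
    using gram_mult_nth[OF assms(1), of "tov u"] by (simp add: vec_eq_iff inner_commute)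
  then show ?thesis
    by (simp add: pinv_def matrix_vector_mul_assoc gram_matrix_inv[OF assms])
qed

text \<open>These are the normal equations: \<open>A (pinv A y)\<close> is the orthogonal projection
  of \<open>y\<close> onto the range of \<open>A\<close>.\<close>

lemma pinv_orth:
  assumes "linear A" "inj A"
  shows "(y - A (pinv A y)) \<bullet> A w = 0"
proof -
  have "(y - A (pinv A y)) \<bullet> A (bvec i) = 0" for i
  proof -
    have "A (bvec i) \<bullet> A (pinv A y) = (gram A *v (matrix_inv (gram A) *v (\<chi> i. y \<bullet> A (bvec i)))) $ i"
      by (simp add: gram_mult_nth[OF assms(1)] pinv_def)
    also have "\<dots> = y \<bullet> A (bvec i)" by (simp add: matrix_vector_mul_assoc gram_matrix_inv[OF assms])
    finally show ?thesis by (simp add: inner_commute[of _ "A (bvec i)"] inner_diff_right)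
  qed
  moreover have "A w = (\<Sum>i\<in>UNIV. (w \<bullet> bvec i) *\<^sub>R A (bvec i))"
    using linear_basis_expansion[OF assms(1), of w] by (simp add: sum_bidx)
  ultimately show ?thesis by (simp add: inner_sum_right)
qed

lemma pinv_uniqueI:
  assumes "linear A" "inj A" "\<And>w. (y - A u) \<bullet> A w = 0"
  shows "pinv A y = u"
proof -
  have "(A (pinv A y) - A u) \<bullet> A w = 0" for w
    using assms(3)[of w] pinv_orth[OF assms(1,2), of y w] by (simp add: inner_diff_left)
  from this[of "pinv A y - u"] have "A (pinv A y) = A u"
    by (simp add: linear_diff[OF assms(1)])
  then show ?thesis using assms(2) by (simp add: inj_eq)
qed

text \<open>In the Leibniz expansion at the identity matrix a permutation other than
  \<open>id\<close> moves at least two indices, so after one factor has been differentiated another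
  is still an off-diagonal 0. Only the diagonal product contributes.\<close>

lemma has_derivative_det_at_identity:
  fixes N :: "'p::real_normed_vector \<Rightarrow> real ^ 'n ^ 'n"
  assumes "\<And>i j. ((\<lambda>x. N x $ i $ j) has_derivative (\<lambda>v. N' v i j)) (at x)" "N x = mat 1"
  shows "((\<lambda>x. det (N x)) has_derivative (\<lambda>v. \<Sum>i\<in>UNIV. N' v i i)) (at x)"
proof -
  have "((\<lambda>x. det (N x)) has_derivative (\<lambda>v. \<Sum>p | p permutes (UNIV::'n set). of_int (sign p) *
     (\<Sum>i\<in>UNIV. N' v i (p i) * (\<Prod>j\<in>UNIV - {i}. N x $ j $ p j)))) (at x)"
    unfolding det_def
    by (intro has_derivative_sum has_derivative_mult_right has_derivative_prod assms(1))
  moreover have "(\<Sum>p | p permutes (UNIV::'n set). of_int (sign p) *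
     (\<Sum>i\<in>UNIV. N' v i (p i) * (\<Prod>j\<in>UNIV - {i}. N x $ j $ p j))) = (\<Sum>i\<in>UNIV. N' v i i)" for v
  proof -
    have "(\<Sum>p | p permutes (UNIV::'n set). of_int (sign p) *
       (\<Sum>i\<in>UNIV. N' v i (p i) * (\<Prod>j\<in>UNIV - {i}. N x $ j $ p j))) =
      (\<Sum>p | p permutes (UNIV::'n set). if p = id then (\<Sum>i\<in>UNIV. N' v i i) else 0)"
    proof (intro sum.cong refl)
      fix p :: "'n \<Rightarrow> 'n" assume p: "p \<in> {p. p permutes UNIV}"
      show "of_int (sign p) * (\<Sum>i\<in>UNIV. N' v i (p i) * (\<Prod>j\<in>UNIV - {i}. N x $ j $ p j))
        = (if p = id then (\<Sum>i\<in>UNIV. N' v i i) else 0)"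
      proof (cases "p = id")
        case True
        then show ?thesis by (simp add: assms(2) mat_def)
      next
        case False
        have z: "(\<Prod>j\<in>UNIV - {i}. N x $ j $ p j) = 0" for i
        proof -
          have "\<exists>j. j \<noteq> i \<and> p j \<noteq> j"
          proof (rule ccontr)
            assume "\<not> ?thesis"
            then have *: "\<And>j. j \<noteq> i \<Longrightarrow> p j = j" by auto
            have "inj p" using p by (simp add: permutes_inj)
            then have "p i = i" using * by (metis injD)
            then show False using * False by (metis eq_id_iff)
          qed
          then obtain j where j: "j \<noteq> i" "p j \<noteq> j" by blast
          then show ?thesis by (intro prod_zero bexI[of _ j]) (auto simp: assms(2) mat_def)
        qed
        show ?thesis using False by (simp only: z) simp
      qed
    qed
    then show ?thesis by (simp add: finite_permutations)
  qed
  ultimately show ?thesis by simp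
qed

text \<open>Jacobi's formula. Multiplying by the inverse \<open>P\<close> of the Gram matrix at
  \<open>x\<close> moves the base point to the identity matrix. The derivative of the Gram matrix
  has two mirror-image summands which, \<open>P\<close> being symmetric, have equal traces; hence
  the factor 2.\<close>

lemma has_derivative_det_gram:
  fixes A :: "'p::real_normed_vector \<Rightarrow> 'e::euclidean_space \<Rightarrow> 'v::euclidean_space"
  assumes A: "linear (A x)" "inj (A x)"
    and A': "\<And>b. b \<in> Basis \<Longrightarrow> ((\<lambda>x. A x b) has_derivative (\<lambda>v. A' v b)) (at x)"
  shows "((\<lambda>x. det (gram (A x))) has_derivative
    (\<lambda>v. 2 * det (gram (A x)) * tr (\<lambda>w. pinv (A x) (A' v w)))) (at x)"
proof -
  define P where "P = matrix_inv (gram (A x))"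
  have P: "P ** gram (A x) = mat 1" "gram (A x) ** P = mat 1"
    using gram_matrix_inv[OF A] by (simp_all add: P_def)
  have Psym: "P $ i $ j = P $ j $ i" for i j
  proof -
    have "transpose (gram (A x)) = gram (A x)"
      by (simp add: transpose_def gram_def vec_eq_iff inner_commute)
    then have "transpose P ** gram (A x) = mat 1"
      by (metis P(2) matrix_transpose_mul transpose_mat)
    then have "transpose P = P" by (metis P(2) matrix_mul_assoc matrix_mul_lid matrix_mul_rid)
    moreover have "P $ i $ j = transpose P $ j $ i" by (simp add: transpose_def)
    ultimately show ?thesis by simp
  qed
  define G' where "G' v i j = A x (bvec i) \<bullet> A' v (bvec j) + A' v (bvec i) \<bullet> A x (bvec j)" for v and i j :: "'e bidx"
  have detP: "det (gram (A x)) * det P = 1" using arg_cong[OF P(2), of det] by (simp add: det_mul)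
  have "((\<lambda>y. det (P ** gram (A y))) has_derivative (\<lambda>v. \<Sum>i\<in>UNIV. (\<Sum>k\<in>UNIV. P $ i $ k * G' v k i))) (at x)"
  proof (rule has_derivative_det_at_identity[where N'="\<lambda>v i j. \<Sum>k\<in>UNIV. P $ i $ k * G' v k j"])
    show "((\<lambda>y. (P ** gram (A y)) $ i $ j) has_derivative (\<lambda>v. \<Sum>k\<in>UNIV. P $ i $ k * G' v k j)) (at x)" for i j
      unfolding matrix_matrix_mult_def gram_def G'_def
      by (simp, intro has_derivative_sum has_derivative_mult_right has_derivative_inner A') auto
  qed (rule P)
  then have "((\<lambda>y. det (gram (A x)) * det (P ** gram (A y))) has_derivative
      (\<lambda>v. det (gram (A x)) * (\<Sum>i\<in>UNIV. (\<Sum>k\<in>UNIV. P $ i $ k * G' v k i)))) (at x)"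
    by (rule has_derivative_mult_right)
  moreover have "det (gram (A x)) * det (P ** gram (A y)) = det (gram (A y))" for y
    using detP by (simp add: det_mul)
  moreover have "(\<Sum>i\<in>UNIV. (\<Sum>k\<in>UNIV. P $ i $ k * G' v k i)) = 2 * tr (\<lambda>w. pinv (A x) (A' v w))" for v
  proof -
    have t: "tr (\<lambda>w. pinv (A x) (A' v w)) = (\<Sum>i\<in>UNIV. \<Sum>k\<in>UNIV. P $ i $ k * (A' v (bvec i) \<bullet> A x (bvec k)))"
      by (simp add: tr_def sum_bidx pinv_def matrix_vector_mult_def P_def fromv_inner)
    have "(\<Sum>i\<in>UNIV. \<Sum>k\<in>UNIV. P $ i $ k * (A' v (bvec k) \<bullet> A x (bvec i))) = tr (\<lambda>w. pinv (A x) (A' v w))"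
      unfolding t by (subst sum.swap) (simp add: Psym)
    then show ?thesis using t
      by (simp add: G'_def distrib_left sum.distrib inner_commute)
  qed
  ultimately show ?thesis by (simp add: mult_ac)
qed

lemma has_derivative_sqrt_det_gram:
  fixes A :: "'p::real_normed_vector \<Rightarrow> 'e::euclidean_space \<Rightarrow> 'v::euclidean_space"
  assumes A: "linear (A x)" "inj (A x)"
    and A': "\<And>b. b \<in> Basis \<Longrightarrow> ((\<lambda>x. A x b) has_derivative (\<lambda>v. A' v b)) (at x)"
  shows "((\<lambda>x. sqrt (det (gram (A x)))) has_derivative
    (\<lambda>v. sqrt (det (gram (A x))) * tr (\<lambda>w. pinv (A x) (A' v w)))) (at x)"
proof -
  have pos: "det (gram (A x)) > 0" by (rule det_gram_pos[OF A])
  have "((\<lambda>x. sqrt (det (gram (A x)))) has_derivative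
    (\<lambda>v. (2 * det (gram (A x)) * tr (\<lambda>w. pinv (A x) (A' v w))) * (inverse (sqrt (det (gram (A x)))) / 2))) (at x)"
    using DERIV_compose_FDERIV[OF DERIV_real_sqrt[OF pos] has_derivative_det_gram[OF assms]] by simp
  moreover have "(2 * det (gram (A x)) * t) * (inverse (sqrt (det (gram (A x)))) / 2) = sqrt (det (gram (A x))) * t" for t
    using pos real_sqrt_mult_self[of "det (gram (A x))"] by (simp add: field_simps)
  ultimately show ?thesis by (simp only:)
qed

section \<open>Change of variables for non-negative integrals\<close>

lemma nn_integral_eq_of_integral_iff:
  fixes f :: "'a \<Rightarrow> real" and g :: "'b \<Rightarrow> real"
  assumes "f \<in> borel_measurable M" "g \<in> borel_measurable N" "\<And>x. f x \<ge> 0" "\<And>x. g x \<ge> 0"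
    and "integrable M f \<longleftrightarrow> integrable N g" "integrable M f \<Longrightarrow> integral\<^sup>L M f = integral\<^sup>L N g"
  shows "(\<integral>\<^sup>+x. ennreal (f x) \<partial>M) = (\<integral>\<^sup>+x. ennreal (g x) \<partial>N)"
proof (cases "integrable M f")
  case True
  then show ?thesis using assms by (simp add: nn_integral_eq_integral)
next
  case False
  have "(\<integral>\<^sup>+x. ennreal (f x) \<partial>M) = \<infinity>"
    using False assms(1,3) by (simp add: integrable_iff_bounded not_less top_unique)
  moreover have "(\<integral>\<^sup>+x. ennreal (g x) \<partial>N) = \<infinity>"
    using False[unfolded assms(5)] assms(2,4) by (simp add: integrable_iff_bounded not_less top_unique)
  ultimately show ?thesis by simp
qed

text \<open>The classical theorem gives the values when one side is absolutely integrable, and also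
  that one side is so exactly when the other is; this covers the infinite case. As an identity of
  non-negative integrals it can be used for measures of arbitrary Borel sets.\<close>

lemma change_of_variables_vec:
  fixes g :: "real^'m::{finite,wellorder} \<Rightarrow> real^'m::_" and f :: "real^'m::_ \<Rightarrow> real"
  assumes S: "S \<in> sets borel" and gS: "g ` S \<in> sets borel"
    and der: "\<And>x. x \<in> S \<Longrightarrow> (g has_derivative g' x) (at x)" and inj: "inj_on g S"
    and f0: "\<And>y. y \<in> g ` S \<Longrightarrow> f y \<ge> 0"
    and m1: "(\<lambda>y. indicator (g ` S) y * f y) \<in> borel_measurable borel"
    and m2: "(\<lambda>x. indicator S x * (\<bar>det (matrix (g' x))\<bar> * f (g x))) \<in> borel_measurable borel"
  shows "(\<integral>\<^sup>+y. ennreal (indicator (g ` S) y * f y) \<partial>lborel)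
    = (\<integral>\<^sup>+x. ennreal (indicator S x * (\<bar>det (matrix (g' x))\<bar> * f (g x))) \<partial>lborel)"
proof -
  \<comment> \<open>The theorem takes vector-valued integrands, so the real integrand is passed
    through the one-dimensional space \<open>real^1\<close>.\<close>
  define F :: "real^'m::_ \<Rightarrow> real^1" where "F y = vec (f y)" for y
  have ai: "h absolutely_integrable_on T \<longleftrightarrow> integrable lborel (\<lambda>x. indicator T x * h x)"
    if "(\<lambda>x. indicator T x * h x) \<in> borel_measurable borel" for h :: "real^'m::_ \<Rightarrow> real" and T
    using that unfolding set_integrable_def by (simp add: integrable_completion)
  have li: "integral T h = (LINT x|lborel. indicator T x * h x)"
    if "(\<lambda>x. indicator T x * h x) \<in> borel_measurable borel" "h absolutely_integrable_on T"
    for h :: "real^'m::_ \<Rightarrow> real" and T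
    using set_lebesgue_integral_eq_integral(2)[OF that(2)] that(1)
    unfolding set_lebesgue_integral_def by (simp add: integral_completion)
  have S': "S \<in> sets lebesgue" using S by auto
  have der': "(g has_derivative g' x) (at x within S)" if "x \<in> S" for x
    using der[OF that] has_derivative_at_withinI by blast
  have eq: "(\<lambda>x. \<bar>det (matrix (g' x))\<bar> *\<^sub>R F (g x)) = (\<lambda>x. vec (\<bar>det (matrix (g' x))\<bar> * f (g x)))"
    by (simp add: F_def vec_eq_iff fun_eq_iff)
  have v1: "(\<lambda>x. vec (k x) :: real^1) absolutely_integrable_on T \<longleftrightarrow> k absolutely_integrable_on T"
    and v2: "integral T (\<lambda>x. vec (k x) :: real^1) = vec (integral T k)"
    for k :: "real^'m::_ \<Rightarrow> real" and T
    by (subst absolutely_integrable_on_1_iff, simp, subst integral_on_1_eq, simp)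
  have v3: "(vec a :: real^1) = vec b \<longleftrightarrow> a = b" for a b :: real by (simp add: vec_eq_iff)
  have F1: "F = (\<lambda>x. vec (f x))" by (simp add: F_def fun_eq_iff)
  have *: "(\<lambda>x. \<bar>det (matrix (g' x))\<bar> * f (g x)) absolutely_integrable_on S \<and>
      integral S (\<lambda>x. \<bar>det (matrix (g' x))\<bar> * f (g x)) = b \<longleftrightarrow>
      f absolutely_integrable_on (g ` S) \<and> integral (g ` S) f = b" for b
    using has_absolute_integral_change_of_variables[OF S' der' inj, of F "vec b"]
    unfolding eq unfolding F1 unfolding v1 v2 v3 by blast
  have iff: "(\<lambda>x. \<bar>det (matrix (g' x))\<bar> * f (g x)) absolutely_integrable_on S \<longleftrightarrow> f absolutely_integrable_on (g ` S)"
    and val: "f absolutely_integrable_on (g ` S) \<Longrightarrow> integral S (\<lambda>x. \<bar>det (matrix (g' x))\<bar> * f (g x)) = integral (g ` S) f"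
    using *[of "integral S (\<lambda>x. \<bar>det (matrix (g' x))\<bar> * f (g x))"] *[of "integral (g ` S) f"] by blast+
  show ?thesis
  proof (rule nn_integral_eq_of_integral_iff)
    show "integrable lborel (\<lambda>y. indicator (g ` S) y * f y) \<longleftrightarrow>
       integrable lborel (\<lambda>x. indicator S x * (\<bar>det (matrix (g' x))\<bar> * f (g x)))"
      using iff ai[OF m1] ai[OF m2] by simp
    assume "integrable lborel (\<lambda>y. indicator (g ` S) y * f y)"
    then have "f absolutely_integrable_on (g ` S)" using ai[OF m1] by simp
    then show "(LINT y|lborel. indicator (g ` S) y * f y) =
       (LINT x|lborel. indicator S x * (\<bar>det (matrix (g' x))\<bar> * f (g x)))"
      using val iff li[OF m1] li[OF m2] by simp
  qed (use f0 m1 m2 in \<open>auto simp: indicator_def\<close>)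
qed

text \<open>Conjugation with the measure-preserving coordinates \<open>fromv\<close> transports the
  formula from vectors to \<open>'e\<close>.\<close>

lemma change_of_variables_euclidean:
  fixes g :: "'e::euclidean_space \<Rightarrow> 'e" and f :: "'e \<Rightarrow> real"
  assumes S: "S \<in> sets borel" and gS: "g ` S \<in> sets borel"
    and der: "\<And>x. x \<in> S \<Longrightarrow> (g has_derivative g' x) (at x)" and inj: "inj_on g S"
    and f0: "\<And>y. y \<in> g ` S \<Longrightarrow> f y \<ge> 0"
    and m1: "(\<lambda>y. indicator (g ` S) y * f y) \<in> borel_measurable borel"
    and m2: "(\<lambda>x. indicator S x * (\<bar>det (mat_of (g' x))\<bar> * f (g x))) \<in> borel_measurable borel"
  shows "(\<integral>\<^sup>+y. ennreal (indicator (g ` S) y * f y) \<partial>lborel)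
    = (\<integral>\<^sup>+x. ennreal (indicator S x * (\<bar>det (mat_of (g' x))\<bar> * f (g x))) \<partial>lborel)"
proof -
  define h where "h v = tov (g (fromv v))" for v
  define h' where "h' v = (\<lambda>w. tov (g' (fromv v) (fromv w)))" for v
  define T where "T = fromv -` S"
  have [measurable]: "fromv \<in> borel_measurable borel"
    by (rule borel_measurable_continuous_onI[OF continuous_fromv])
  have fS: "fromv -` X \<in> sets borel" if "X \<in> sets borel" for X :: "'e set"
    using measurable_sets_borel[OF \<open>fromv \<in> borel_measurable borel\<close> that] .
  have trans: "(\<integral>\<^sup>+y. k y \<partial>lborel) = (\<integral>\<^sup>+v. k (fromv v) \<partial>lborel)" if "k \<in> borel_measurable borel"
    for k :: "'e \<Rightarrow> ennreal"
    by (subst lborel_distr_fromv[symmetric]) (simp add: nn_integral_distr that)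
  have hT: "h ` T = fromv -` (g ` S)"
    unfolding h_def T_def image_def vimage_def by auto (metis fromv_tov tov_fromv)
  have i1: "indicator (h ` T) v = indicator (g ` S) (fromv v)" for v
    unfolding hT by (simp add: indicator_def)
  have i2: "indicator T v = indicator S (fromv v)" for v unfolding T_def by (simp add: indicator_def)
  have dm: "det (matrix (h' v)) = det (mat_of (g' (fromv v)))" for v
    unfolding h'_def matrix_eq_mat_of ..
  have fh: "f (fromv (h v)) = f (g (fromv v))" for v by (simp add: h_def)
  have main: "(\<integral>\<^sup>+y. ennreal (indicator (h ` T) y * f (fromv y)) \<partial>lborel)
    = (\<integral>\<^sup>+x. ennreal (indicator T x * (\<bar>det (matrix (h' x))\<bar> * f (fromv (h x)))) \<partial>lborel)"
  proof (rule change_of_variables_vec)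
    show "T \<in> sets borel" unfolding T_def by (rule fS[OF S])
    show "h ` T \<in> sets borel" unfolding hT by (rule fS[OF gS])
    show "(h has_derivative h' v) (at v)" if "v \<in> T" for v
    proof -
      have bl: "bounded_linear tov" "bounded_linear (fromv :: _ \<Rightarrow> 'e)"
        using linear_tov linear_fromv linear_conv_bounded_linear by blast+
      have "(g has_derivative g' (fromv v)) (at (fromv v))" using der that by (simp add: T_def)
      from has_derivative_compose[OF bounded_linear_imp_has_derivative[OF bl(2)] this]
      show ?thesis unfolding h_def h'_def by (rule bounded_linear.has_derivative[OF bl(1)])
    qed
    show "inj_on h T"
      using inj unfolding h_def T_def inj_on_def by (metis fromv_tov tov_fromv vimageD)
    show "f (fromv y) \<ge> 0" if "y \<in> h ` T" for y using f0 that unfolding hT by simp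
    show "(\<lambda>y. indicator (h ` T) y * f (fromv y)) \<in> borel_measurable borel"
      unfolding i1 by (rule measurable_compose[OF _ m1, of fromv]) simp
    show "(\<lambda>x. indicator T x * (\<bar>det (matrix (h' x))\<bar> * f (fromv (h x)))) \<in> borel_measurable borel"
      unfolding i2 dm fh by (rule measurable_compose[OF _ m2, of fromv]) simp
  qed
  have "(\<integral>\<^sup>+y. ennreal (indicator (g ` S) y * f y) \<partial>lborel)
      = (\<integral>\<^sup>+v. ennreal (indicator (g ` S) (fromv v) * f (fromv v)) \<partial>lborel)"
    by (rule trans) (intro measurable_compose[OF m1] measurable_ennreal)
  also have "\<dots> = (\<integral>\<^sup>+v. ennreal (indicator S (fromv v) * (\<bar>det (mat_of (g' (fromv v)))\<bar> * f (g (fromv v)))) \<partial>lborel)"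
    using main unfolding i1 i2 dm fh .
  also have "\<dots> = (\<integral>\<^sup>+x. ennreal (indicator S x * (\<bar>det (mat_of (g' x))\<bar> * f (g x))) \<partial>lborel)"
    by (rule trans[symmetric]) (intro measurable_compose[OF m2] measurable_ennreal)
  finally show ?thesis .
qed

section \<open>Calculus on immersed manifolds\<close>

abbreviation cinv :: "'a set \<times> ('a \<Rightarrow> 'e) \<Rightarrow> 'e \<Rightarrow> 'a" where
  "cinv c \<equiv> inv_into (fst c) (snd c)"

abbreviation cdom :: "'a set \<times> ('a \<Rightarrow> 'e) \<Rightarrow> 'e set" where
  "cdom c \<equiv> snd c ` fst c"

text \<open>The derivative in a freely chosen chart, as a function of the coordinate point.
  \<open>differential\<close> picks an arbitrary chart at every point, which is unsuitable for
  differentiating again and for integrating over a chart.\<close>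

definition dloc :: "'a set \<times> ('a \<Rightarrow> 'e::real_normed_vector) \<Rightarrow> ('a \<Rightarrow> 'b::real_normed_vector) \<Rightarrow> 'e \<Rightarrow> 'e \<Rightarrow> 'b" where
  "dloc c f x = frechet_derivative (local_rep c f) (at x)"

lemma local_rep_apply: "local_rep c f x = f (cinv c x)"
  by (simp add: local_rep_def)

section \<open>Charts and topology of a smooth manifold\<close>

locale mfd =
  fixes S :: "('a, 'e::euclidean_space, 'v) immersed"
  assumes smooth_mfd: "smooth_manifold S"
begin

abbreviation "M \<equiv> topspace (mtop S)"

lemma M_nonempty: "M \<noteq> {}" and Hausdorff: "Hausdorff_space (mtop S)"
  and second_countable_mtop: "second_countable (mtop S)"
  using smooth_mfd by (simp_all add: smooth_manifold_def)

lemma chart_openin: "c \<in> atlas S \<Longrightarrow> openin (mtop S) (fst c)"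
  and open_cdom: "c \<in> atlas S \<Longrightarrow> open (cdom c)"
  and chart_homeo: "c \<in> atlas S \<Longrightarrow> homeomorphic_map (subtopology (mtop S) (fst c)) (top_of_set (cdom c)) (snd c)"
  using smooth_mfd by (auto simp: smooth_manifold_def)

lemma chart_subset: "c \<in> atlas S \<Longrightarrow> fst c \<subseteq> M"
  using chart_openin openin_subset by blast

lemma chart_inj: "c \<in> atlas S \<Longrightarrow> inj_on (snd c) (fst c)"
  using homeomorphic_imp_injective_map[OF chart_homeo, of c] chart_subset[of c]
  by (simp add: Int_absorb1)

lemma cinv_chart [simp]: "c \<in> atlas S \<Longrightarrow> p \<in> fst c \<Longrightarrow> cinv c (snd c p) = p"
  by (simp add: chart_inj)

lemma chart_cinv [simp]: "x \<in> cdom c \<Longrightarrow> snd c (cinv c x) = x"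
  by (rule f_inv_into_f)

lemma cinv_in [simp]: "x \<in> cdom c \<Longrightarrow> cinv c x \<in> fst c"
  by (rule inv_into_into)

lemma atlas_covers: "p \<in> M \<Longrightarrow> \<exists>c\<in>atlas S. p \<in> fst c"
  using smooth_mfd by (force simp: smooth_manifold_def)

lemma chart_at: "p \<in> M \<Longrightarrow> chart_at S p \<in> atlas S" "p \<in> M \<Longrightarrow> p \<in> fst (chart_at S p)"
  unfolding chart_at_def using someI_ex[of "\<lambda>c. c \<in> atlas S \<and> p \<in> fst c"] atlas_covers by blast+

lemma continuous_chart:
  "c \<in> atlas S \<Longrightarrow> continuous_map (subtopology (mtop S) (fst c)) (top_of_set (cdom c)) (snd c)"
  by (rule homeomorphic_imp_continuous_map[OF chart_homeo])

lemma continuous_cinv: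
  assumes "c \<in> atlas S"
  shows "continuous_map (top_of_set (cdom c)) (mtop S) (cinv c)"
proof -
  obtain g where g: "homeomorphic_maps (subtopology (mtop S) (fst c)) (top_of_set (cdom c)) (snd c) g"
    using chart_homeo[OF assms] homeomorphic_map_maps by blast
  then have cg: "continuous_map (top_of_set (cdom c)) (subtopology (mtop S) (fst c)) g"
    and gl: "\<And>p. p \<in> fst c \<Longrightarrow> g (snd c p) = p"
    using chart_subset[OF assms] by (auto simp: homeomorphic_maps_def)
  have "continuous_map (top_of_set (cdom c)) (mtop S) g"
    using cg continuous_map_in_subtopology by blast
  then show ?thesis
    by (rule continuous_map_eq) (use gl assms in auto)
qed

lemma open_chart_image:
  assumes "c \<in> atlas S" "openin (mtop S) N" "N \<subseteq> fst c"
  shows "open (snd c ` N)"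
proof -
  have "openin (subtopology (mtop S) (fst c)) N"
    using assms by (simp add: openin_open_subtopology[OF chart_openin])
  then have "openin (top_of_set (cdom c)) (snd c ` N)"
    using homeomorphic_imp_open_map[OF chart_homeo[OF assms(1)]] by (simp add: open_map_def)
  then show ?thesis using open_cdom[OF assms(1)] openin_open_trans open_openin by blast
qed

lemma openin_chart_preimage:
  assumes "c \<in> atlas S" "open T"
  shows "openin (mtop S) {p \<in> fst c. snd c p \<in> T}"
proof -
  have "openin (top_of_set (cdom c)) (cdom c \<inter> T)" using assms(2) by blast
  from openin_continuous_map_preimage[OF continuous_chart[OF assms(1)] this]
  have "openin (subtopology (mtop S) (fst c)) {p \<in> topspace (subtopology (mtop S) (fst c)). snd c p \<in> cdom c \<inter> T}" .
  also have "{p \<in> topspace (subtopology (mtop S) (fst c)). snd c p \<in> cdom c \<inter> T} = {p \<in> fst c. snd c p \<in> T}"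
    using chart_subset[OF assms(1)] by auto
  finally show ?thesis using chart_openin[OF assms(1)] openin_trans_full by blast
qed

lemma compactin_cinv_image:
  assumes "c \<in> atlas S" "compact K" "K \<subseteq> cdom c"
  shows "compactin (mtop S) (cinv c ` K)"
  by (rule image_compactin[OF _ continuous_cinv[OF assms(1)]])
    (use assms in \<open>simp add: compactin_subtopology\<close>)

lemma compact_chart_image:
  assumes "c \<in> atlas S" "compactin (mtop S) K" "K \<subseteq> fst c"
  shows "compact (snd c ` K)"
proof -
  have "compactin (top_of_set (cdom c)) (snd c ` K)"
    by (rule image_compactin[OF _ continuous_chart[OF assms(1)]])
      (use assms in \<open>simp add: compactin_subtopology\<close>)
  then show ?thesis by (simp add: compactin_subtopology)
qed

lemma compactin_closedin: "compactin (mtop S) K \<Longrightarrow> closedin (mtop S) K"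
  using Hausdorff compactin_imp_closedin by blast

lemma transition_smooth:
  assumes "c \<in> atlas S" "d \<in> atlas S"
  shows "smooth_on (\<lambda>x. snd d (cinv c x)) (snd c ` (fst c \<inter> fst d))"
proof -
  have *: "\<forall>(U, \<phi>)\<in>atlas S. \<forall>(V, \<psi>)\<in>atlas S. smooth_on (local_rep (U, \<phi>) \<psi>) (\<phi> ` (U \<inter> V))"
    using smooth_mfd by (simp add: smooth_manifold_def)
  from bspec[OF bspec[OF *[unfolded case_prod_beta] assms(1)] assms(2)]
  show ?thesis by (simp add: local_rep_def o_def)
qed

lemma open_chart_Int: "c \<in> atlas S \<Longrightarrow> openin (mtop S) N \<Longrightarrow> open (snd c ` (fst c \<inter> N))"
  by (rule open_chart_image) (simp_all add: openin_Int chart_openin)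

section \<open>Smooth maps on a manifold\<close>

lemma smooth_map_onD:
  assumes "smooth_map_on S N f" "c \<in> atlas S"
  shows "smooth_on (local_rep c f) (snd c ` (fst c \<inter> N))"
  using bspec[OF assms(1)[unfolded smooth_map_on_def case_prod_beta] assms(2)] by simp

lemma smooth_map_onD2:
  assumes "smooth_map_on S N f" "c \<in> atlas S"
  shows "smooth_on (\<lambda>x. f (cinv c x)) (snd c ` (fst c \<inter> N))"
  using smooth_map_onD[OF assms] by (simp add: local_rep_def o_def)

lemma smooth_map_onD':
  assumes "smooth_map_on S M f" "c \<in> atlas S"
  shows "smooth_on (local_rep c f) (cdom c)"
  using smooth_map_onD[OF assms] chart_subset[OF assms(2)] by (simp add: Int_absorb2)

lemma smooth_map_onI_global:
  assumes "\<And>c. c \<in> atlas S \<Longrightarrow> smooth_on (\<lambda>x. f (cinv c x)) (snd c ` (fst c \<inter> N))"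
  shows "smooth_map_on S N f"
  using assms by (simp add: smooth_map_on_def case_prod_beta local_rep_def o_def)

lemma smooth_map_on_subset: "smooth_map_on S N f \<Longrightarrow> N' \<subseteq> N \<Longrightarrow> smooth_map_on S N' f"
  by (rule smooth_map_onI_global) (rule smooth_on_subset[OF smooth_map_onD2], auto)

text \<open>The transition map acts on the coordinate while the parameter \<open>s\<close> is
  carried along.\<close>

lemma smooth_family_transfer:
  fixes g :: "real \<Rightarrow> 'a \<Rightarrow> 'b::real_normed_vector"
  assumes "c \<in> atlas S" "d \<in> atlas S" "openin (mtop S) N" "N \<subseteq> fst c" "open I"
    "smooth_on (\<lambda>(s, x). g s (cinv c x)) (I \<times> snd c ` N)"
  shows "smooth_on (\<lambda>(s, x). g s (cinv d x)) (I \<times> snd d ` (fst d \<inter> N))"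
proof -
  let ?D = "snd d ` (fst d \<inter> N)"
  have oD: "open ?D" by (rule open_chart_Int[OF assms(2,3)])
  have oN: "open (snd c ` N)" using assms open_chart_image by blast
  have tr: "smooth_on (\<lambda>x. snd c (cinv d x)) ?D"
    by (rule smooth_on_subset[OF transition_smooth[OF assms(2,1)]]) (use assms(4) in auto)
  have "smooth_on (\<lambda>sx. (fst sx, snd c (cinv d (snd sx)))) (I \<times> ?D)"
  proof (rule smooth_on_Pair)
    show "open (I \<times> ?D)" using oD assms(5) by (simp add: open_Times)
    then show "smooth_on fst (I \<times> ?D)" by (intro smooth_on_fst smooth_on_ident)
    show "smooth_on (\<lambda>sx. snd c (cinv d (snd sx))) (I \<times> ?D)"
      by (rule smooth_on_compose[OF \<open>open (I \<times> ?D)\<close> oD _ _ tr])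
        (auto intro!: smooth_intros \<open>open (I \<times> ?D)\<close>)
  qed
  then have sm: "smooth_on (\<lambda>sx. (fst sx, snd c (cinv d (snd sx)))) (I \<times> ?D)" .
  have img: "(\<lambda>sx. (fst sx, snd c (cinv d (snd sx)))) ` (I \<times> ?D) \<subseteq> I \<times> snd c ` N"
    using assms(2) by auto
  have "smooth_on (\<lambda>sx. (\<lambda>(s, x). g s (cinv c x)) (fst sx, snd c (cinv d (snd sx)))) (I \<times> ?D)"
    by (rule smooth_on_compose[OF _ _ img sm assms(6)]) (simp_all add: open_Times oD oN assms(5))
  then show ?thesis
  proof (rule smooth_on_cong[rotated 2])
    show "open (I \<times> ?D)" using oD assms(5) by (simp add: open_Times)
    fix sx assume "sx \<in> I \<times> ?D"
    then show "(\<lambda>(s, x). g s (cinv c x)) (fst sx, snd c (cinv d (snd sx))) = (\<lambda>(s, x). g s (cinv d x)) sx"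
      using assms(1,2,4) by auto
  qed
qed

lemma smooth_transfer:
  assumes "c \<in> atlas S" "d \<in> atlas S" "openin (mtop S) N" "N \<subseteq> fst c"
    "smooth_on (\<lambda>x. f (cinv c x)) (snd c ` N)"
  shows "smooth_on (\<lambda>x. f (cinv d x)) (snd d ` (fst d \<inter> N))"
proof -
  let ?D = "snd d ` (fst d \<inter> N)"
  have oD: "open ?D" by (rule open_chart_Int[OF assms(2,3)])
  have oN: "open (snd c ` N)" using assms open_chart_image by blast
  have tr: "smooth_on (\<lambda>x. snd c (cinv d x)) ?D"
    by (rule smooth_on_subset[OF transition_smooth[OF assms(2,1)]]) (use assms(4) in auto)
  have "smooth_on (\<lambda>x. f (cinv c (snd c (cinv d x)))) ?D"
    by (rule smooth_on_compose[OF oD oN _ tr assms(5)]) (use assms(2) in auto)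
  then show ?thesis
    by (rule smooth_on_cong[OF oD, rotated]) (use assms(1,2,4) in auto)
qed

text \<open>Transition maps are smooth, so although \<open>smooth_map_on\<close> quantifies over all
  charts, one suitable chart near each point is enough.\<close>

lemma smooth_map_onI:
  assumes "\<And>p. p \<in> N \<Longrightarrow> \<exists>c\<in>atlas S. \<exists>N'. openin (mtop S) N' \<and> p \<in> N' \<and> N' \<subseteq> fst c \<and>
     smooth_on (\<lambda>x. f (cinv c x)) (snd c ` N')"
  shows "smooth_map_on S N f"
proof (rule smooth_map_onI_global, rule smooth_on_local)
  fix d x assume d: "d \<in> atlas S" and "x \<in> snd d ` (fst d \<inter> N)"
  then obtain p where p: "p \<in> fst d" "p \<in> N" "x = snd d p" by auto
  obtain c N' where c: "c \<in> atlas S" and N': "openin (mtop S) N'" "p \<in> N'" "N' \<subseteq> fst c"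
    "smooth_on (\<lambda>x. f (cinv c x)) (snd c ` N')" using assms[OF p(2)] by blast
  have "open (snd d ` (fst d \<inter> N'))" by (rule open_chart_Int[OF d N'(1)])
  then show "\<exists>T. open T \<and> x \<in> T \<and> smooth_on (\<lambda>x. f (cinv d x)) T"
    using smooth_transfer[OF c d N'(1,3,4)] p N'(2) by auto
qed

lemma smooth_map_on_const: "openin (mtop S) N \<Longrightarrow> smooth_map_on S N (\<lambda>p. k)"
  by (rule smooth_map_onI_global) (intro smooth_intros open_chart_Int)

lemma smooth_map_on_bounded_linear:
  "openin (mtop S) N \<Longrightarrow> bounded_linear L \<Longrightarrow> smooth_map_on S N f \<Longrightarrow> smooth_map_on S N (\<lambda>p. L (f p))"
  by (rule smooth_map_onI_global, rule smooth_on_bounded_linear) (simp_all add: open_chart_Int smooth_map_onD2)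

lemma smooth_map_on_bilinear:
  "openin (mtop S) N \<Longrightarrow> bounded_bilinear B \<Longrightarrow> smooth_map_on S N f \<Longrightarrow> smooth_map_on S N g \<Longrightarrow>
    smooth_map_on S N (\<lambda>p. B (f p) (g p))"
  by (rule smooth_map_onI_global, rule smooth_on_bilinear) (simp_all add: open_chart_Int smooth_map_onD2)

lemma smooth_map_on_add:
  "openin (mtop S) N \<Longrightarrow> smooth_map_on S N f \<Longrightarrow> smooth_map_on S N g \<Longrightarrow> smooth_map_on S N (\<lambda>p. f p + g p)"
  by (rule smooth_map_onI_global, rule smooth_on_add) (simp_all add: open_chart_Int smooth_map_onD2)

lemma smooth_map_on_diff:
  "openin (mtop S) N \<Longrightarrow> smooth_map_on S N f \<Longrightarrow> smooth_map_on S N g \<Longrightarrow> smooth_map_on S N (\<lambda>p. f p - g p)"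
  by (rule smooth_map_onI_global, rule smooth_on_diff) (simp_all add: open_chart_Int smooth_map_onD2)

lemma smooth_map_on_sum:
  "openin (mtop S) N \<Longrightarrow> (\<And>i. i \<in> I \<Longrightarrow> smooth_map_on S N (f i)) \<Longrightarrow> smooth_map_on S N (\<lambda>p. \<Sum>i\<in>I. f i p)"
  by (rule smooth_map_onI_global, rule smooth_on_sum) (simp_all add: open_chart_Int smooth_map_onD2)

lemma smooth_map_on_inverse:
  fixes f :: "'a \<Rightarrow> real"
  shows "openin (mtop S) N \<Longrightarrow> smooth_map_on S N f \<Longrightarrow> (\<And>p. p \<in> N \<Longrightarrow> f p \<noteq> 0) \<Longrightarrow>
    smooth_map_on S N (\<lambda>p. inverse (f p))"
  by (rule smooth_map_onI_global, rule smooth_on_inverse)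
    (simp_all add: open_chart_Int smooth_map_onD2 image_iff, metis IntE cinv_chart)

lemma openin_M: "openin (mtop S) M" by simp

section \<open>Derivatives in charts and their change of chart\<close>

lemma dloc_has_derivative:
  assumes "smooth_map_on S N f" "c \<in> atlas S" "p \<in> fst c" "p \<in> N"
  shows "(local_rep c f has_derivative dloc c f (snd c p)) (at (snd c p))"
  unfolding dloc_def by (rule smooth_on_has_derivative[OF smooth_map_onD[OF assms(1,2)]]) (use assms in auto)

lemma dloc_linear:
  assumes "smooth_map_on S N f" "c \<in> atlas S" "p \<in> fst c" "p \<in> N"
  shows "linear (dloc c f (snd c p))"
  using dloc_has_derivative[OF assms] has_derivative_linear by blast

lemma dloc_eqI:
  "(local_rep c f has_derivative D) (at x) \<Longrightarrow> dloc c f x = D"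
  unfolding dloc_def by (metis frechet_derivative_at)

lemma dloc_change:
  assumes "c \<in> atlas S" "d \<in> atlas S" "p \<in> fst c" "p \<in> fst d" "openin (mtop S) N" "p \<in> N" "smooth_map_on S N f"
  shows "dloc c f (snd c p) = (\<lambda>v. dloc d f (snd d p) (dloc c (snd d) (snd c p) v))"
proof (rule dloc_eqI)
  have s: "smooth_on (\<lambda>x. snd d (cinv c x)) (snd c ` (fst c \<inter> fst d))" by (rule transition_smooth[OF assms(1,2)])
  have tr: "(local_rep c (snd d) has_derivative dloc c (snd d) (snd c p)) (at (snd c p))"
    unfolding dloc_def by (rule smooth_on_has_derivative) (use s assms in \<open>auto simp: local_rep_def o_def\<close>)
  have lp: "local_rep c (snd d) (snd c p) = snd d p" using assms by (simp add: local_rep_def)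
  have "((\<lambda>x. local_rep d f (local_rep c (snd d) x)) has_derivative
     (\<lambda>v. dloc d f (snd d p) (dloc c (snd d) (snd c p) v))) (at (snd c p))"
    by (rule has_derivative_compose[OF tr]) (use dloc_has_derivative[OF assms(7,2,4,6)] lp in simp)
  then show "(local_rep c f has_derivative (\<lambda>v. dloc d f (snd d p) (dloc c (snd d) (snd c p) v))) (at (snd c p))"
  proof (rule has_derivative_transform_within_open)
    show "open (snd c ` (fst c \<inter> fst d))" using assms by (intro open_chart_Int chart_openin)
    show "snd c p \<in> snd c ` (fst c \<inter> fst d)" using assms by auto
    fix x assume "x \<in> snd c ` (fst c \<inter> fst d)"
    then show "local_rep d f (local_rep c (snd d) x) = local_rep c f x" using assms by (auto simp: local_rep_def)
  qed
qed

lemma smooth_map_chart: "c \<in> atlas S \<Longrightarrow> smooth_map_on S (fst c) (snd c)"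
  by (rule smooth_map_onI_global) (metis transition_smooth)

lemma dloc_self:
  assumes "c \<in> atlas S" "p \<in> fst c"
  shows "dloc c (snd c) (snd c p) = (\<lambda>v. v)"
proof (rule dloc_eqI, rule has_derivative_transform_within_open[OF has_derivative_ident open_cdom[OF assms(1)]])
  show "snd c p \<in> cdom c" using assms by auto
qed (simp add: local_rep_def)

text \<open>The chain rule applied to the chart map itself, whose derivative in its own coordinates
  is the identity.\<close>

lemma dloc_transition_inverse:
  assumes "c \<in> atlas S" "d \<in> atlas S" "p \<in> fst c" "p \<in> fst d"
  shows "dloc d (snd c) (snd d p) (dloc c (snd d) (snd c p) v) = v"
  using dloc_change[OF assms chart_openin[OF assms(1)] assms(3) smooth_map_chart[OF assms(1)]]
    dloc_self[OF assms(1,3)] by (metis)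

lemma dloc_transition_linear:
  assumes "c \<in> atlas S" "d \<in> atlas S" "p \<in> fst c" "p \<in> fst d"
  shows "linear (dloc c (snd d) (snd c p))"
  by (rule dloc_linear[OF smooth_map_chart[OF assms(2)]]) (use assms in auto)

lemma differential_dloc: "differential S f p = dloc (chart_at S p) f (snd (chart_at S p) p)"
  by (simp add: differential_def dloc_def)

text \<open>The derivative of a transition map is onto, so \<open>tangent_space\<close>, defined
  through an arbitrary chart, can be computed in any chart.\<close>

lemma range_dloc_change:
  assumes "c \<in> atlas S" "d \<in> atlas S" "p \<in> fst c" "p \<in> fst d" "openin (mtop S) N" "p \<in> N" "smooth_map_on S N f"
  shows "range (dloc c f (snd c p)) = range (dloc d f (snd d p))"
  using dloc_change[OF assms] dloc_transition_inverse[OF assms(2,1,4,3)]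
  by (auto simp: image_iff) metis

lemma inj_dloc_change:
  assumes "c \<in> atlas S" "d \<in> atlas S" "p \<in> fst c" "p \<in> fst d" "openin (mtop S) N" "p \<in> N" "smooth_map_on S N f"
    and "inj (dloc d f (snd d p))"
  shows "inj (dloc c f (snd c p))"
  unfolding dloc_change[OF assms(1-7)]
proof (rule injI)
  fix u v assume "dloc d f (snd d p) (dloc c (snd d) (snd c p) u) = dloc d f (snd d p) (dloc c (snd d) (snd c p) v)"
  then have "dloc c (snd d) (snd c p) u = dloc c (snd d) (snd c p) v" using assms(8) by (simp add: inj_eq)
  then show "u = v" using dloc_transition_inverse[OF assms(1-4)] by metis
qed

text \<open>Two open sets suffice, the chart domain and the complement of \<open>K\<close>; the
  latter is open because compact sets in a Hausdorff space are closed.\<close>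

lemma extend_by_zero_smooth_map:
  assumes "c \<in> atlas S" "compactin (mtop S) K" "K \<subseteq> fst c" "smooth_on g (cdom c)"
    "\<And>p. p \<in> fst c - K \<Longrightarrow> g (snd c p) = 0"
  shows "smooth_map_on S M (\<lambda>p. if p \<in> fst c then g (snd c p) else 0)"
proof (rule smooth_map_onI)
  fix p assume p: "p \<in> M"
  show "\<exists>d\<in>atlas S. \<exists>N'. openin (mtop S) N' \<and> p \<in> N' \<and> N' \<subseteq> fst d \<and>
     smooth_on (\<lambda>x. if cinv d x \<in> fst c then g (snd c (cinv d x)) else 0) (snd d ` N')"
  proof (cases "p \<in> fst c")
    case True
    have "smooth_on (\<lambda>x. if cinv c x \<in> fst c then g (snd c (cinv c x)) else 0) (cdom c)"
      by (rule smooth_on_cong[OF open_cdom[OF assms(1)] _ assms(4)]) (use assms(1) in auto)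
    then show ?thesis using True assms(1) chart_openin by blast
  next
    case False
    obtain d where d: "d \<in> atlas S" "p \<in> fst d" using atlas_covers[OF p] by blast
    have o: "openin (mtop S) (fst d - K)"
      using chart_openin[OF d(1)] compactin_closedin[OF assms(2)] by (rule openin_diff)
    have o': "open (snd d ` (fst d - K))" by (rule open_chart_image[OF d(1) o]) auto
    have "smooth_on (\<lambda>x. if cinv d x \<in> fst c then g (snd c (cinv d x)) else 0) (snd d ` (fst d - K))"
      by (rule smooth_on_cong[OF o' _ smooth_on_const[of 0]]) (use d assms in auto)
    then show ?thesis using d o False assms(3) by blast
  qed
qed

text \<open>A Euclidean bump in the coordinates of a chart, extended by zero. Its positivity set is
  recorded as open so that compactness can select finitely many bumps.\<close>

lemma bump_exists:
  assumes "p \<in> M"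
  shows "\<exists>c\<in>atlas S. \<exists>\<beta> :: 'a \<Rightarrow> real. \<exists>K. smooth_map_on S M \<beta> \<and> (\<forall>q. \<beta> q \<ge> 0) \<and> \<beta> p > 0 \<and>
    compactin (mtop S) K \<and> K \<subseteq> fst c \<and> (\<forall>q. q \<notin> K \<longrightarrow> \<beta> q = 0) \<and> openin (mtop S) {q \<in> M. \<beta> q > 0}"
proof -
  obtain c where c: "c \<in> atlas S" "p \<in> fst c" using atlas_covers[OF assms] by blast
  have "snd c p \<in> cdom c" using c by auto
  then obtain r where r: "r > 0" "cball (snd c p) r \<subseteq> cdom c"
    using open_cdom[OF c(1)] open_contains_cball by blast
  define K where "K = cinv c ` cball (snd c p) r"
  define \<beta> where "\<beta> q = (if q \<in> fst c then bump (snd c p) r (snd c q) else 0)" for q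
  have K: "compactin (mtop S) K" unfolding K_def by (rule compactin_cinv_image[OF c(1) _ r(2)]) simp
  have Ksub: "K \<subseteq> fst c" using r(2) by (auto simp: K_def)
  have pos: "\<beta> q > 0 \<longleftrightarrow> q \<in> fst c \<and> snd c q \<in> ball (snd c p) r" for q
    using bump_pos_iff[OF r(1), of "snd c p" "snd c q"] by (simp add: \<beta>_def)
  have nn: "\<beta> q \<ge> 0" for q by (simp add: \<beta>_def bump_nonneg)
  have z: "\<beta> q = 0" if "q \<notin> K" for q
  proof (rule ccontr)
    assume "\<beta> q \<noteq> 0"
    then have "q \<in> fst c" "snd c q \<in> cball (snd c p) r" using nn[of q] pos[of q] by auto
    then have "q \<in> K" unfolding K_def by (metis c(1) cinv_chart image_eqI)
    with that show False by simp
  qed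
  have "smooth_map_on S M \<beta>" unfolding \<beta>_def
  proof (rule extend_by_zero_smooth_map[OF c(1) K Ksub smooth_on_subset[OF smooth_on_bump]])
    show "bump (snd c p) r (snd c q) = 0" if "q \<in> fst c - K" for q
      using z[of q] that by (simp add: \<beta>_def)
  qed simp
  moreover have "{q \<in> M. \<beta> q > 0} = {q \<in> fst c. snd c q \<in> ball (snd c p) r}"
    using pos chart_subset[OF c(1)] by auto
  ultimately have "smooth_map_on S M \<beta>" "openin (mtop S) {q \<in> M. \<beta> q > 0}" "\<beta> p > 0"
    using openin_chart_preimage[OF c(1) open_ball, of "snd c p" r] pos[of p] r(1) c(2) by auto
  then show ?thesis using c K Ksub nn z by blast
qed

text \<open>Finitely many positivity sets of bumps cover the manifold, and the bumps are divided by
  their sum. The index of a function is the point for which its bump was chosen. The supports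
  \<open>K i\<close> are recorded because the local divergence theorem and the local diffeomorphisms
  work with compact support inside one chart.\<close>

lemma partition_of_unity:
  assumes "compact_space (mtop S)"
  obtains I :: "'a set" and c :: "'a \<Rightarrow> 'a set \<times> ('a \<Rightarrow> 'e)" and \<rho> :: "'a \<Rightarrow> 'a \<Rightarrow> real" and K
  where "finite I" "\<And>i. i \<in> I \<Longrightarrow> c i \<in> atlas S" "\<And>i. i \<in> I \<Longrightarrow> smooth_map_on S M (\<rho> i)"
    "\<And>i. i \<in> I \<Longrightarrow> compactin (mtop S) (K i)" "\<And>i. i \<in> I \<Longrightarrow> K i \<subseteq> fst (c i)"
    "\<And>i q. i \<in> I \<Longrightarrow> q \<notin> K i \<Longrightarrow> \<rho> i q = 0" "\<And>q. q \<in> M \<Longrightarrow> (\<Sum>i\<in>I. \<rho> i q) = 1"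
proof -
  \<comment> \<open>Bundled into one predicate so that chart, bump and support are chosen together
    for each point.\<close>
  define Q where "Q p c \<beta> K \<longleftrightarrow> c \<in> atlas S \<and> smooth_map_on S M \<beta> \<and> (\<forall>q. \<beta> q \<ge> (0::real)) \<and> \<beta> p > 0 \<and>
    compactin (mtop S) K \<and> K \<subseteq> fst c \<and> (\<forall>q. q \<notin> K \<longrightarrow> \<beta> q = 0) \<and> openin (mtop S) {q \<in> M. \<beta> q > 0}"
    for p c \<beta> K
  have "\<forall>p\<in>M. \<exists>c \<beta> K. Q p c \<beta> K"
    using bump_exists unfolding Q_def by blast
  then obtain c \<beta> K where "\<And>p. p \<in> M \<Longrightarrow> Q p (c p) (\<beta> p) (K p)"
    by metis
  then have *: "p \<in> M \<Longrightarrow> c p \<in> atlas S \<and> smooth_map_on S M (\<beta> p) \<and> (\<forall>q. \<beta> p q \<ge> (0::real)) \<and> \<beta> p p > 0 \<and>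
    compactin (mtop S) (K p) \<and> K p \<subseteq> fst (c p) \<and> (\<forall>q. q \<notin> K p \<longrightarrow> \<beta> p q = 0) \<and> openin (mtop S) {q \<in> M. \<beta> p q > 0}"
    for p unfolding Q_def by blast
  define \<U> where "\<U> = (\<lambda>p. {q \<in> M. \<beta> p q > 0}) ` M"
  have "\<forall>U\<in>\<U>. openin (mtop S) U" using * by (simp add: \<U>_def)
  moreover have "M \<subseteq> \<Union>\<U>"
  proof
    fix p assume "p \<in> M"
    with *[OF this] show "p \<in> \<Union>\<U>" by (auto simp: \<U>_def)
  qed
  ultimately obtain \<F> where \<F>: "finite \<F>" "\<F> \<subseteq> (\<lambda>p. {q \<in> M. \<beta> p q > 0}) ` M" "M \<subseteq> \<Union>\<F>"
    using assms unfolding compact_space_alt \<U>_def by meson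
  then obtain I where I: "finite I" "I \<subseteq> M" "\<F> = (\<lambda>p. {q \<in> M. \<beta> p q > 0}) ` I"
    by (meson finite_subset_image)
  define \<sigma> where "\<sigma> q = (\<Sum>i\<in>I. \<beta> i q)" for q
  have \<sigma>pos: "\<sigma> q > 0" if q: "q \<in> M" for q
  proof -
    obtain i where i: "i \<in> I" "\<beta> i q > 0" using \<F>(3) I(3) q by blast
    then show ?thesis unfolding \<sigma>_def using I *
      by (intro sum_pos2[where f="\<lambda>i. \<beta> i q" and i=i]) (use i in blast)+
  qed
  show thesis
  proof (rule that[of I c "\<lambda>i q. inverse (\<sigma> q) * \<beta> i q" K])
    show "smooth_map_on S M (\<lambda>q. inverse (\<sigma> q) * \<beta> i q)" if "i \<in> I" for i
    proof (intro smooth_map_on_bilinear[OF openin_M bounded_bilinear_mult] smooth_map_on_inverse openin_M)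
      show "smooth_map_on S M \<sigma>" unfolding \<sigma>_def using I * by (intro smooth_map_on_sum openin_M) blast
      show "smooth_map_on S M (\<beta> i)" using I * that by blast
    qed (use \<sigma>pos in force)
    show "(\<Sum>i\<in>I. inverse (\<sigma> q) * \<beta> i q) = 1" if "q \<in> M" for q
      using \<sigma>pos[OF that] by (simp add: sum_distrib_left[symmetric] \<sigma>_def)
    fix i assume i: "i \<in> I"
    then have "i \<in> M" using I(2) by blast
    from *[OF this] show "c i \<in> atlas S" "compactin (mtop S) (K i)" "K i \<subseteq> fst (c i)"
      "q \<notin> K i \<Longrightarrow> inverse (\<sigma> q) * \<beta> i q = 0" for q by simp_all
  qed (rule I(1))
qed

end

section \<open>Tangential derivative, projection and divergence along an immersion\<close>

locale imm = mfd S for S :: "('a, 'e::euclidean_space, 'v::euclidean_space) immersed" +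
  assumes immersed: "immersed_submanifold S"
begin

abbreviation "X \<equiv> pos S"

lemma smooth_pos: "smooth_map_on S M X"
  and inj_differential: "p \<in> M \<Longrightarrow> inj (differential S X p)"
  using immersed by (simp_all add: immersed_submanifold_def)

lemma smooth_pos_chart: "c \<in> atlas S \<Longrightarrow> smooth_on (local_rep c X) (cdom c)"
  by (rule smooth_map_onD'[OF smooth_pos])

lemma dloc_pos_linear: "c \<in> atlas S \<Longrightarrow> p \<in> fst c \<Longrightarrow> linear (dloc c X (snd c p))"
  by (rule dloc_linear[OF smooth_pos]) (simp_all add: subsetD[OF chart_subset])

lemma dloc_pos_inj:
  assumes "c \<in> atlas S" "p \<in> fst c"
  shows "inj (dloc c X (snd c p))"
proof -
  have p: "p \<in> M" using assms chart_subset by blast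
  show ?thesis
    by (rule inj_dloc_change[OF assms(1) chart_at(1)[OF p] assms(2) chart_at(2)[OF p] openin_M p smooth_pos])
      (use inj_differential[OF p] in \<open>simp add: differential_dloc\<close>)
qed

lemma dloc_pos_linear': "c \<in> atlas S \<Longrightarrow> x \<in> cdom c \<Longrightarrow> linear (dloc c X x)"
  and dloc_pos_inj': "c \<in> atlas S \<Longrightarrow> x \<in> cdom c \<Longrightarrow> inj (dloc c X x)"
  using dloc_pos_linear[of c "cinv c x"] dloc_pos_inj[of c "cinv c x"] by simp_all

text \<open>The derivative of \<open>f\<close> at \<open>p\<close> in the direction of the tangential part of \<open>y\<close>.\<close>

definition tderiv :: "('a \<Rightarrow> 'b::real_normed_vector) \<Rightarrow> 'a \<Rightarrow> 'v \<Rightarrow> 'b" where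
  "tderiv f p y = differential S f p (pinv (differential S X p) y)"

text \<open>The derivative of the position in the direction of the tangential part of
  \<open>y\<close> is that tangential part itself, so this is the orthogonal projection onto the
  tangent space.\<close>

abbreviation tproj :: "'a \<Rightarrow> 'v \<Rightarrow> 'v" where
  "tproj \<equiv> tderiv X"

text \<open>Both sides are the coordinates of one vector, the orthogonal projection of
  \<open>y\<close> onto the tangent space; uniqueness in the normal equations identifies
  them.\<close>

lemma pinv_dloc_change:
  assumes "c \<in> atlas S" "d \<in> atlas S" "p \<in> fst c" "p \<in> fst d"
  shows "pinv (dloc c X (snd c p)) y = dloc d (snd c) (snd d p) (pinv (dloc d X (snd d p)) y)"
proof (rule pinv_uniqueI[OF dloc_pos_linear dloc_pos_inj])
  have p: "p \<in> M" using assms chart_subset by blast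
  fix w
  have "dloc c X (snd c p) (dloc d (snd c) (snd d p) u) = dloc d X (snd d p) u" for u
    using dloc_change[OF assms(2,1,4,3) openin_M p smooth_pos] by simp
  moreover have "dloc c X (snd c p) w = dloc d X (snd d p) (dloc c (snd d) (snd c p) w)"
    using dloc_change[OF assms(1-4) openin_M p smooth_pos] by simp
  ultimately show "(y - dloc c X (snd c p) (dloc d (snd c) (snd d p) (pinv (dloc d X (snd d p)) y))) \<bullet> dloc c X (snd c p) w = 0"
    using pinv_orth[OF dloc_pos_linear dloc_pos_inj] assms by simp
qed (use assms in auto)

lemma tderiv_chart:
  assumes "c \<in> atlas S" "p \<in> fst c" "openin (mtop S) N" "p \<in> N" "smooth_map_on S N f"
  shows "tderiv f p y = dloc c f (snd c p) (pinv (dloc c X (snd c p)) y)"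
proof -
  have p: "p \<in> M" using assms chart_subset by blast
  show ?thesis
    unfolding tderiv_def differential_dloc
    using dloc_change[OF assms(1) chart_at(1)[OF p] assms(2) chart_at(2)[OF p] assms(3-5)]
      pinv_dloc_change[OF chart_at(1)[OF p] assms(1) chart_at(2)[OF p] assms(2)] by simp
qed

lemma tderiv_chart':
  assumes "c \<in> atlas S" "x \<in> cdom c" "smooth_map_on S M f"
  shows "tderiv f (cinv c x) y = dloc c f x (pinv (dloc c X x) y)"
  using tderiv_chart[OF assms(1) cinv_in[OF assms(2)] openin_M _ assms(3), of y]
    subsetD[OF chart_subset[OF assms(1)] cinv_in[OF assms(2)]] assms(2) by simp

lemma tderiv_dloc:
  assumes "c \<in> atlas S" "p \<in> fst c" "openin (mtop S) N" "p \<in> N" "smooth_map_on S N f"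
  shows "tderiv f p (dloc c X (snd c p) u) = dloc c f (snd c p) u"
  by (simp add: tderiv_chart[OF assms] dloc_pos_linear dloc_pos_inj assms)

lemma tderiv_cong:
  assumes "openin (mtop S) N" "p \<in> N" "\<And>q. q \<in> N \<Longrightarrow> f q = g q"
  shows "tderiv f p y = tderiv g p y"
proof -
  have p: "p \<in> M" using assms openin_subset by blast
  let ?c = "chart_at S p"
  have "frechet_derivative (local_rep ?c f) (at (snd ?c p)) = frechet_derivative (local_rep ?c g) (at (snd ?c p))"
    by (rule frechet_derivative_cong_open[OF open_chart_Int[OF chart_at(1)[OF p] assms(1)]])
      (use chart_at[OF p] assms in \<open>auto simp: local_rep_def\<close>)
  then show ?thesis by (simp add: tderiv_def differential_def)
qed

lemma tderiv_has_derivative: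
  assumes "p \<in> N" "p \<in> M" "smooth_map_on S N f"
  shows "(local_rep (chart_at S p) f has_derivative differential S f p) (at (snd (chart_at S p) p))"
  unfolding differential_dloc by (rule dloc_has_derivative[OF assms(3) chart_at(1)[OF assms(2)] chart_at(2)[OF assms(2)] assms(1)])

lemma tderiv_eqI:
  "(local_rep (chart_at S p) f has_derivative D) (at (snd (chart_at S p) p)) \<Longrightarrow> tderiv f p y = D (pinv (differential S X p) y)"
  unfolding tderiv_def differential_dloc by (simp add: dloc_eqI)

lemma local_rep_chart_at: "p \<in> M \<Longrightarrow> local_rep (chart_at S p) f (snd (chart_at S p) p) = f p"
  by (simp add: local_rep_def chart_at)

lemma tderiv_const: "tderiv (\<lambda>p. k) p y = 0"
  using tderiv_eqI[of p "\<lambda>p. k" "\<lambda>_. 0"] by (simp add: local_rep_def o_def)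

lemma tderiv_bilinear:
  assumes "bounded_bilinear B" "p \<in> N" "p \<in> M" "smooth_map_on S N f" "smooth_map_on S N g"
  shows "tderiv (\<lambda>q. B (f q) (g q)) p y = B (f p) (tderiv g p y) + B (tderiv f p y) (g p)"
  using tderiv_eqI[of p "\<lambda>q. B (f q) (g q)" "\<lambda>v. B (f p) (differential S g p v) + B (differential S f p v) (g p)" y]
    bounded_bilinear.FDERIV[OF assms(1) tderiv_has_derivative[OF assms(2-4)] tderiv_has_derivative[OF assms(2,3,5)]]
  unfolding local_rep_chart_at[OF assms(3)] by (simp add: tderiv_def local_rep_def o_def)

lemma tderiv_bounded_linear:
  assumes "bounded_linear L" "p \<in> N" "p \<in> M" "smooth_map_on S N f"
  shows "tderiv (\<lambda>q. L (f q)) p y = L (tderiv f p y)"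
  using tderiv_eqI[of p "\<lambda>q. L (f q)" "\<lambda>v. L (differential S f p v)" y]
    bounded_linear.has_derivative[OF assms(1) tderiv_has_derivative[OF assms(2-4)]]
  by (simp add: tderiv_def local_rep_def o_def)

lemma tderiv_sum:
  assumes "p \<in> N" "p \<in> M" "\<And>i. i \<in> I \<Longrightarrow> smooth_map_on S N (f i)"
  shows "tderiv (\<lambda>q. \<Sum>i\<in>I. f i q) p y = (\<Sum>i\<in>I. tderiv (f i) p y)"
  using tderiv_eqI[of p "\<lambda>q. \<Sum>i\<in>I. f i q" "\<lambda>v. \<Sum>i\<in>I. differential S (f i) p v" y]
    has_derivative_sum[of I "\<lambda>i. local_rep (chart_at S p) (f i)" "\<lambda>i. differential S (f i) p", OF tderiv_has_derivative[OF assms]]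
  by (simp add: tderiv_def local_rep_def o_def)

lemma tderiv_diff:
  assumes "p \<in> N" "p \<in> M" "smooth_map_on S N f" "smooth_map_on S N g"
  shows "tderiv (\<lambda>q. f q - g q) p y = tderiv f p y - tderiv g p y"
  using tderiv_eqI[of p "\<lambda>q. f q - g q" "\<lambda>v. differential S f p v - differential S g p v" y]
    has_derivative_diff[OF tderiv_has_derivative[OF assms(1-3)] tderiv_has_derivative[OF assms(1,2,4)]]
  by (simp add: tderiv_def local_rep_def o_def)

lemma tderiv_linear:
  assumes "p \<in> N" "p \<in> M" "smooth_map_on S N f"
  shows "linear (tderiv f p)"
proof -
  have "linear (differential S f p)" using tderiv_has_derivative[OF assms] has_derivative_linear by blast
  then have "linear (differential S f p \<circ> pinv (differential S X p))" by (rule linear_compose[OF linear_pinv])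
  moreover have "tderiv f p = differential S f p \<circ> pinv (differential S X p)" by (auto simp: tderiv_def)
  ultimately show ?thesis by simp
qed

lemma tproj_linear: "p \<in> M \<Longrightarrow> linear (tproj p)"
  by (rule tderiv_linear[OF _ _ smooth_pos])

lemma differential_pos_linear: "p \<in> M \<Longrightarrow> linear (differential S X p)"
  using tderiv_has_derivative[OF _ _ smooth_pos] has_derivative_linear by blast

lemma tproj_in: "tproj p y \<in> tangent_space S p"
  by (simp add: tderiv_def tangent_space_def)

lemma tproj_orth: "p \<in> M \<Longrightarrow> t \<in> tangent_space S p \<Longrightarrow> (y - tproj p y) \<bullet> t = 0"
  using pinv_orth[OF differential_pos_linear inj_differential] by (auto simp: tderiv_def tangent_space_def)

lemma tproj_tangent: "p \<in> M \<Longrightarrow> t \<in> tangent_space S p \<Longrightarrow> tproj p t = t"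
  by (auto simp: tderiv_def tangent_space_def differential_pos_linear inj_differential)

lemma tderiv_tproj: "p \<in> M \<Longrightarrow> tderiv f p (tproj p y) = tderiv f p y"
  by (simp add: tderiv_def differential_pos_linear inj_differential)

lemma tproj_inner: "p \<in> M \<Longrightarrow> tproj p y \<bullet> z = tproj p y \<bullet> tproj p z"
  using tproj_orth[OF _ tproj_in, of p z y] by (simp add: inner_diff_left inner_commute[of "tproj p y"])

lemma tproj_selfadjoint: "p \<in> M \<Longrightarrow> tproj p y \<bullet> z = y \<bullet> tproj p z"
  using tproj_inner[of p y z] tproj_inner[of p z y] by (simp add: inner_commute)

lemma subspace_tangent: "p \<in> M \<Longrightarrow> subspace (tangent_space S p)"
  unfolding tangent_space_def by (intro linear_subspace_image differential_pos_linear subspace_UNIV)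

lemma normal_proj_eq:
  assumes "p \<in> M"
  shows "normal_proj S p y = y - tproj p y"
  unfolding normal_proj_def
proof (rule the_equality)
  show "y - tproj p y \<in> (tangent_space S p)\<^sup>\<bottom> \<and> y - (y - tproj p y) \<in> tangent_space S p"
    using tproj_orth[OF assms] tproj_in by (auto simp: orthogonal_comp_def orthogonal_def inner_commute)
  fix w assume w: "w \<in> (tangent_space S p)\<^sup>\<bottom> \<and> y - w \<in> tangent_space S p"
  define t where "t = tproj p y - (y - w)"
  have t: "t \<in> tangent_space S p" unfolding t_def using subspace_tangent[OF assms] tproj_in w subspace_diff by blast
  have "w \<bullet> t = 0" using w t by (auto simp: orthogonal_comp_def orthogonal_def inner_commute)
  moreover have "(y - tproj p y) \<bullet> t = 0" by (rule tproj_orth[OF assms t])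
  ultimately have "t \<bullet> t = 0" by (simp add: t_def inner_diff_left)
  then show "w = y - tproj p y" by (simp add: t_def)
qed

lemma flat_deriv_eq:
  assumes "p \<in> M" "v \<in> tangent_space S p"
  shows "flat_deriv S v f p = tderiv f p v"
proof -
  obtain u where u: "v = differential S X p u" using assms(2) by (auto simp: tangent_space_def)
  show ?thesis unfolding flat_deriv_def tderiv_def u
    by (simp add: inv_f_f inj_differential differential_pos_linear assms(1))
qed

text \<open>A trace over the ambient space of the derivative along tangential parts. It equals the
  sum of \<open>D_e W \<bullet> e\<close> over an orthonormal tangent frame and makes sense for
  every field along the immersion, tangential or not.\<close>

definition divg :: "('a \<Rightarrow> 'v) \<Rightarrow> 'a \<Rightarrow> real" where
  "divg W p = tr (tderiv W p)"

text \<open>Cyclicity of the trace moves the computation to the coordinate space, the form in which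
  the derivative of the area density appears.\<close>

lemma divg_chart:
  assumes "c \<in> atlas S" "p \<in> fst c" "openin (mtop S) N" "p \<in> N" "smooth_map_on S N W"
  shows "divg W p = tr (\<lambda>w. pinv (dloc c X (snd c p)) (dloc c W (snd c p) w))"
proof -
  have "divg W p = tr (\<lambda>y. dloc c W (snd c p) (pinv (dloc c X (snd c p)) y))"
    unfolding divg_def by (rule arg_cong[where f=tr]) (rule ext, rule tderiv_chart[OF assms])
  also have "\<dots> = tr (\<lambda>w. pinv (dloc c X (snd c p)) (dloc c W (snd c p) w))"
    by (rule tr_commute[OF linear_pinv dloc_linear[OF assms(5,1,2,4)]])
  finally show ?thesis .
qed

end

section \<open>The area measure\<close>

context mfd
begin

section \<open>Borel sets of the manifold\<close>

definition BorM :: "'a set set" where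
  "BorM = sigma_sets M {U. openin (mtop S) U}"

lemma opens_Pow: "{U. openin (mtop S) U} \<subseteq> Pow M"
  using openin_subset by blast

lemma sigma_algebra_BorM: "sigma_algebra M BorM"
  unfolding BorM_def by (rule sigma_algebra_sigma_sets[OF opens_Pow])

lemma open_BorM: "openin (mtop S) U \<Longrightarrow> U \<in> BorM"
  unfolding BorM_def by (rule sigma_sets.Basic) simp

lemma BorM_subset: "B \<in> BorM \<Longrightarrow> B \<subseteq> M"
  unfolding BorM_def using sigma_sets_into_sp[OF opens_Pow] by blast

lemma BorM_Int: "A \<in> BorM \<Longrightarrow> B \<in> BorM \<Longrightarrow> A \<inter> B \<in> BorM"
  and BorM_Diff: "A \<in> BorM \<Longrightarrow> B \<in> BorM \<Longrightarrow> A - B \<in> BorM"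
  and BorM_Un: "A \<in> BorM \<Longrightarrow> B \<in> BorM \<Longrightarrow> A \<union> B \<in> BorM"
proof -
  interpret sigma_algebra M BorM by (rule sigma_algebra_BorM)
  show "A \<in> BorM \<Longrightarrow> B \<in> BorM \<Longrightarrow> A \<inter> B \<in> BorM" "A \<in> BorM \<Longrightarrow> B \<in> BorM \<Longrightarrow> A - B \<in> BorM"
    "A \<in> BorM \<Longrightarrow> B \<in> BorM \<Longrightarrow> A \<union> B \<in> BorM" by auto
qed

lemma BorM_UN: "(\<And>i::nat. A i \<in> BorM) \<Longrightarrow> (\<Union>i. A i) \<in> BorM"
  unfolding BorM_def by (rule sigma_sets.Union) 

lemma chart_BorM: "c \<in> atlas S \<Longrightarrow> fst c \<in> BorM"
  using open_BorM chart_openin by blast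

lemma M_BorM: "M \<in> BorM"
  by (rule open_BorM) simp

text \<open>Induction over the generated sigma-algebra; injectivity of the chart lets images commute
  with complements inside its domain.\<close>

lemma chart_image_borel:
  assumes c: "c \<in> atlas S" and B: "B \<in> BorM"
  shows "snd c ` (B \<inter> fst c) \<in> sets borel"
  using B unfolding BorM_def
proof (induction rule: sigma_sets.induct)
  case (Basic a)
  then show ?case using open_chart_Int[OF c, of a] by (simp add: Int_commute)
next
  case Empty
  then show ?case by simp
next
  case (Compl a)
  have "snd c ` ((M - a) \<inter> fst c) = cdom c - snd c ` (a \<inter> fst c)"
    using chart_inj[OF c] chart_subset[OF c] by (auto simp: inj_on_def)
  then show ?case using Compl open_cdom[OF c] by simp
next
  case (Union a)
  have "snd c ` (\<Union> (range a) \<inter> fst c) = (\<Union>i. snd c ` (a i \<inter> fst c))" by auto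
  then show ?case using Union by simp
qed

lemma chart_image_borel':
  assumes "c \<in> atlas S" "B \<in> BorM" "B \<subseteq> fst c"
  shows "snd c ` B \<in> sets borel"
  using chart_image_borel[OF assms(1,2)] assms(3) by (simp add: Int_absorb2)

lemma chart_preimage_BorM:
  assumes c: "c \<in> atlas S" and T: "T \<in> sets borel"
  shows "{p \<in> fst c. snd c p \<in> T} \<in> BorM"
proof -
  have "T \<in> sigma_sets UNIV {S. open S}" using T by (simp add: borel_def)
  then show ?thesis
  proof (induction rule: sigma_sets.induct)
    case (Basic a)
    then show ?case using openin_chart_preimage[OF c] open_BorM by blast
  next
    case Empty
    show ?case using open_BorM[of "{}"] by simp
  next
    case (Compl a)
    have "{p \<in> fst c. snd c p \<in> UNIV - a} = fst c - {p \<in> fst c. snd c p \<in> a}" by auto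
    then show ?case using BorM_Diff[OF chart_BorM[OF c] Compl.IH] by simp
  next
    case (Union a)
    have "{p \<in> fst c. snd c p \<in> \<Union> (range a)} = (\<Union>i. {p \<in> fst c. snd c p \<in> a i})" by auto
    then show ?case using BorM_UN[OF Union.IH] by simp
  qed
qed

lemma finite_chart_cover:
  assumes "compact_space (mtop S)"
  obtains n :: nat and c where "\<And>i. i < n \<Longrightarrow> c i \<in> atlas S" "M = (\<Union>i<n. fst (c i))"
proof -
  have "\<forall>U\<in>fst ` atlas S. openin (mtop S) U" using chart_openin by auto
  moreover have "M \<subseteq> \<Union>(fst ` atlas S)" using atlas_covers by blast
  ultimately obtain \<F> where "finite \<F>" "\<F> \<subseteq> fst ` atlas S" "M \<subseteq> \<Union>\<F>"
    using assms unfolding compact_space_alt by meson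
  then obtain C where C: "finite C" "C \<subseteq> atlas S" "\<F> = fst ` C" by (meson finite_subset_image)
  obtain cs where cs: "set cs = C" using finite_list[OF C(1)] by blast
  show thesis
  proof (rule that[of "length cs" "\<lambda>i. cs ! i"])
    show "cs ! i \<in> atlas S" if "i < length cs" for i using that cs C nth_mem by blast
    have "set cs = (!) cs ` {..<length cs}" by (auto simp: set_conv_nth)
    then have "(\<Union>i<length cs. fst (cs ! i)) = \<Union>(fst ` C)" by (simp add: cs[symmetric] image_image)
    moreover have "\<Union>(fst ` C) \<subseteq> M" using C(2) chart_subset by blast
    ultimately show "M = (\<Union>i<length cs. fst (cs ! i))"
      using \<open>M \<subseteq> \<Union>\<F>\<close> C(3) by auto
  qed
qed

text \<open>\<open>area_measure\<close> is prescribed only on sets inside a single chart. A finite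
  cover by charts, made disjoint, splits every Borel set into such pieces, so the prescription
  determines the measure.\<close>

lemma emeasure_eq_on_charts:
  assumes "compact_space (mtop S)" "sets \<mu> = BorM" "sets \<nu> = BorM"
    and "\<And>c B. c \<in> atlas S \<Longrightarrow> B \<in> BorM \<Longrightarrow> B \<subseteq> fst c \<Longrightarrow> emeasure \<mu> B = emeasure \<nu> B"
  shows "\<mu> = \<nu>"
proof (rule measure_eqI)
  obtain n :: nat and c where c: "\<And>i. i < n \<Longrightarrow> c i \<in> atlas S" "M = (\<Union>i<n. fst (c i))"
    using finite_chart_cover[OF assms(1)] by metis
  \<comment> \<open>Removing the earlier charts makes the cover disjoint while each piece stays
    inside one chart.\<close>
  define A where "A i = fst (c i) - (\<Union>j<i. fst (c j))" for i
  have A: "A i \<in> BorM" if "i < n" for i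
  proof -
    have "(\<Union>j<i. fst (c j)) \<in> BorM"
    proof -
      have "openin (mtop S) (fst (c j))" if "j < i" for j
        by (rule chart_openin, rule c(1)) (use that \<open>i < n\<close> in simp)
      then have "openin (mtop S) (\<Union>j<i. fst (c j))" by (auto intro!: openin_Union)
      then show ?thesis by (rule open_BorM)
    qed
    then show ?thesis unfolding A_def using chart_BorM[OF c(1)[OF that]] by (intro BorM_Diff)
  qed
  have disj: "disjoint_family_on (\<lambda>i. B \<inter> A i) {..<n}" for B
    unfolding disjoint_family_on_def A_def by (auto) (metis linorder_neqE_nat lessThan_iff)
  have un: "B = (\<Union>i<n. B \<inter> A i)" if "B \<subseteq> M" for B
  proof (intro equalityI subsetI)
    fix p assume p: "p \<in> B"
    define i where "i = (LEAST i. i < n \<and> p \<in> fst (c i))"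
    have ex: "\<exists>i. i < n \<and> p \<in> fst (c i)" using p that c(2) by auto
    have i: "i < n \<and> p \<in> fst (c i)" unfolding i_def by (rule LeastI_ex[OF ex])
    have "p \<notin> fst (c j)" if "j < i" for j using not_less_Least[of j] that i unfolding i_def by fastforce
    then show "p \<in> (\<Union>i<n. B \<inter> A i)" using i p unfolding A_def by blast
  qed auto
  fix B assume "B \<in> sets \<mu>"
  then have B: "B \<in> BorM" using assms by simp
  have sub: "B \<inter> A i \<in> BorM" "B \<inter> A i \<subseteq> fst (c i)" if "i < n" for i
    using BorM_Int[OF B A[OF that]] by (auto simp: A_def)
  have "emeasure \<mu> B = (\<Sum>i<n. emeasure \<mu> (B \<inter> A i))"
    by (subst un[OF BorM_subset[OF B]], rule sum_emeasure[symmetric]) (use disj sub assms in auto)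
  also have "\<dots> = (\<Sum>i<n. emeasure \<nu> (B \<inter> A i))"
    by (intro sum.cong refl assms(4)[OF c(1)]) (use sub in auto)
  also have "\<dots> = emeasure \<nu> B"
    by (subst (2) un[OF BorM_subset[OF B]], rule sum_emeasure) (use disj sub assms in auto)
  finally show "emeasure \<mu> B = emeasure \<nu> B" .
qed (simp add: assms)

lemma smooth_imp_continuous_map:
  assumes "smooth_map_on S M f"
  shows "continuous_map (mtop S) euclidean f"
  unfolding continuous_map
proof (intro conjI allI impI)
  fix T :: "'b set" assume "openin euclidean T"
  then have T: "open T" by simp
  have "{p \<in> M. f p \<in> T} = \<Union>((\<lambda>c. {p \<in> fst c. snd c p \<in> local_rep c f -` T \<inter> cdom c}) ` atlas S)"
  proof (intro equalityI subsetI)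
    fix p assume p: "p \<in> {p \<in> M. f p \<in> T}"
    then obtain c where c: "c \<in> atlas S" "p \<in> fst c" using atlas_covers by blast
    then have "p \<in> {p \<in> fst c. snd c p \<in> local_rep c f -` T \<inter> cdom c}" using p by (simp add: local_rep_def)
    then show "p \<in> \<Union>((\<lambda>c. {p \<in> fst c. snd c p \<in> local_rep c f -` T \<inter> cdom c}) ` atlas S)"
      using c by blast
  next
    fix p assume "p \<in> \<Union>((\<lambda>c. {p \<in> fst c. snd c p \<in> local_rep c f -` T \<inter> cdom c}) ` atlas S)"
    then obtain c where c: "c \<in> atlas S" "p \<in> fst c" "snd c p \<in> local_rep c f -` T" by blast
    then show "p \<in> {p \<in> M. f p \<in> T}" using subsetD[OF chart_subset[OF c(1)]] by (simp add: local_rep_def)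
  qed
  moreover have "openin (mtop S) {p \<in> fst c. snd c p \<in> local_rep c f -` T \<inter> cdom c}" if "c \<in> atlas S" for c
  proof (rule openin_chart_preimage[OF that])
    have "continuous_on (cdom c) (local_rep c f)"
      by (rule smooth_on_imp_continuous_on[OF smooth_map_onD'[OF assms that]])
    then show "open (local_rep c f -` T \<inter> cdom c)"
      using T open_cdom[OF that] by (simp add: continuous_on_open_vimage)
  qed
  ultimately show "openin (mtop S) {p \<in> M. f p \<in> T}" by (auto intro!: openin_Union)
qed simp

end

context imm
begin

section \<open>The area density in a chart and its transformation\<close>

definition adens :: "'a set \<times> ('a \<Rightarrow> 'e) \<Rightarrow> 'e \<Rightarrow> real" where
  "adens c x = sqrt (det (gram (dloc c X x)))"

lemma area_density_eq: "area_density S c x = adens c x"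
  unfolding area_density_def adens_def Let_def
  by (subst permutes_Basis_sum) (simp add: gram_def dloc_def)

lemma adens_pos: "c \<in> atlas S \<Longrightarrow> x \<in> cdom c \<Longrightarrow> adens c x > 0"
  unfolding adens_def by (simp add: det_gram_pos[OF dloc_pos_linear' dloc_pos_inj'])

lemma continuous_on_dloc: "c \<in> atlas S \<Longrightarrow> continuous_on (cdom c) (\<lambda>x. dloc c X x b)"
  unfolding dloc_def by (intro smooth_on_imp_continuous_on smooth_on_frechet_derivative smooth_pos_chart)

lemma continuous_on_adens: "c \<in> atlas S \<Longrightarrow> continuous_on (cdom c) (adens c)"
  unfolding adens_def det_def gram_def
  by (simp, intro continuous_intros continuous_on_dloc)

lemma adens_transition:
  assumes "c \<in> atlas S" "d \<in> atlas S" "p \<in> fst c" "p \<in> fst d"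
  shows "adens c (snd c p) = \<bar>det (mat_of (dloc c (snd d) (snd c p)))\<bar> * adens d (snd d p)"
proof -
  have p: "p \<in> M" using assms chart_subset by blast
  have "dloc c X (snd c p) = dloc d X (snd d p) \<circ> dloc c (snd d) (snd c p)"
    using dloc_change[OF assms openin_M p smooth_pos] by (simp add: o_def)
  then show ?thesis
    unfolding adens_def using dloc_transition_linear[OF assms] dloc_pos_linear[OF assms(2,4)]
    by (simp add: det_gram_compose real_sqrt_mult)
qed

lemma borel_adens:
  assumes "c \<in> atlas S" "A \<in> sets borel" "A \<subseteq> cdom c"
  shows "(\<lambda>x. indicator A x * adens c x) \<in> borel_measurable borel"
proof -
  have "(\<lambda>x. if x \<in> cdom c then adens c x else 0) \<in> borel_measurable borel"
    by (rule borel_measurable_continuous_on_if) (use assms continuous_on_adens open_cdom in auto)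
  then have "(\<lambda>x. indicator A x * (if x \<in> cdom c then adens c x else 0)) \<in> borel_measurable borel"
    using assms(2) by (intro borel_measurable_times) simp_all
  moreover have "(\<lambda>x. indicator A x * (if x \<in> cdom c then adens c x else 0)) = (\<lambda>x. indicator A x * adens c x)"
    using assms(3) by (auto simp: indicator_def fun_eq_iff)
  ultimately show ?thesis by simp
qed

lemma set_nn_integral_adens:
  "(\<integral>\<^sup>+x\<in>A. ennreal (adens c x) \<partial>lborel) = (\<integral>\<^sup>+x. ennreal (indicator A x * adens c x) \<partial>lborel)"
  by (rule nn_integral_cong) (simp add: indicator_def)

text \<open>Change of variables along the transition map, whose Jacobian is exactly the ratio of the
  two densities. Without this consistency no measure could have the prescribed values in all
  charts.\<close>

lemma chart_area_change:
  assumes "c \<in> atlas S" "d \<in> atlas S" "B \<in> BorM" "B \<subseteq> fst c" "B \<subseteq> fst d"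
  shows "(\<integral>\<^sup>+x\<in>snd c ` B. ennreal (adens c x) \<partial>lborel) = (\<integral>\<^sup>+x\<in>snd d ` B. ennreal (adens d x) \<partial>lborel)"
proof -
  let ?g = "\<lambda>x. snd d (cinv c x)" and ?g' = "dloc c (snd d)"
  have im: "?g ` snd c ` B = snd d ` B"
    unfolding image_image by (rule image_cong) (use assms(1,4) in auto)
  have eq: "indicator (snd c ` B) x * (\<bar>det (mat_of (?g' x))\<bar> * adens d (?g x)) = indicator (snd c ` B) x * adens c x" for x
    using adens_transition[OF assms(1,2), of "cinv c x"] assms by (auto simp: indicator_def subset_iff)
  have "(\<integral>\<^sup>+y. ennreal (indicator (?g ` snd c ` B) y * adens d y) \<partial>lborel)
    = (\<integral>\<^sup>+x. ennreal (indicator (snd c ` B) x * (\<bar>det (mat_of (?g' x))\<bar> * adens d (?g x))) \<partial>lborel)"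
  proof (rule change_of_variables_euclidean)
    show "snd c ` B \<in> sets borel" using assms by (intro chart_image_borel')
    show "?g ` snd c ` B \<in> sets borel" unfolding im using assms by (intro chart_image_borel')
    show "(?g has_derivative ?g' x) (at x)" if "x \<in> snd c ` B" for x
    proof -
      obtain p where p: "p \<in> B" "x = snd c p" using \<open>x \<in> snd c ` B\<close> by auto
      show ?thesis
        using dloc_has_derivative[OF smooth_map_chart[OF assms(2)] assms(1), of p] p assms(4,5)
        by (auto simp: local_rep_def o_def)
    qed
    show "inj_on ?g (snd c ` B)"
    proof (rule inj_onI)
      fix x y assume "x \<in> snd c ` B" "y \<in> snd c ` B" and e: "?g x = ?g y"
      then obtain p q where pq: "p \<in> B" "q \<in> B" "x = snd c p" "y = snd c q" by auto
      then have "cinv c x = p" "cinv c y = q" using assms(1,4) by auto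
      then have "snd d p = snd d q" using e by simp
      then have "p = q" using inj_onD[OF chart_inj[OF assms(2)]] pq assms(5) by blast
      then show "x = y" using pq by simp
    qed
    show "adens d y \<ge> 0" if "y \<in> ?g ` snd c ` B" for y
      using that adens_pos[OF assms(2), of y] assms(5) unfolding im by force
    show "(\<lambda>y. indicator (?g ` snd c ` B) y * adens d y) \<in> borel_measurable borel"
      unfolding im using assms by (intro borel_adens chart_image_borel') auto
    show "(\<lambda>x. indicator (snd c ` B) x * (\<bar>det (mat_of (?g' x))\<bar> * adens d (?g x))) \<in> borel_measurable borel"
      unfolding eq using assms by (intro borel_adens chart_image_borel') auto
  qed
  then show ?thesis unfolding im eq set_nn_integral_adens by simp
qed

definition is_area :: "'a measure \<Rightarrow> bool" where
  "is_area \<mu> \<longleftrightarrow> space \<mu> = M \<and> sets \<mu> = BorM \<and>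
     (\<forall>c\<in>atlas S. \<forall>B\<in>BorM. B \<subseteq> fst c \<longrightarrow>
        emeasure \<mu> B = (\<integral>\<^sup>+x\<in>snd c ` B. ennreal (adens c x) \<partial>lborel))"

lemma area_measure_The: "area_measure S = (THE \<mu>. is_area \<mu>)"
proof -
  have "(space \<mu> = M \<and> sets \<mu> = sigma_sets M {U. openin (mtop S) U} \<and>
     (\<forall>(U, \<phi>)\<in>atlas S. \<forall>B\<in>sets \<mu>. B \<subseteq> U \<longrightarrow>
        emeasure \<mu> B = (\<integral>\<^sup>+x\<in>\<phi> ` B. ennreal (area_density S (U, \<phi>) x) \<partial>lborel))) \<longleftrightarrow> is_area \<mu>" for \<mu>
    unfolding is_area_def area_density_eq BorM_def case_prod_beta by auto
  then show ?thesis unfolding area_measure_def by simp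
qed

end

section \<open>Existence, uniqueness and finiteness of the area measure on a closed manifold\<close>

locale cimm = imm S for S :: "('a, 'e::euclidean_space, 'v::euclidean_space) immersed" +
  assumes compact: "compact_space (mtop S)"
begin

lemma is_area_unique: "is_area \<mu> \<Longrightarrow> is_area \<nu> \<Longrightarrow> \<mu> = \<nu>"
  by (rule emeasure_eq_on_charts[OF compact]) (simp_all add: is_area_def)

text \<open>The measure is assembled from the pieces of a disjoint chart cover, each measured in its
  own chart. For a set inside another chart \<open>d\<close> every piece is re-expressed in
  \<open>d\<close> by \<open>chart_area_change\<close>, and there the pieces add up again.\<close>

lemma is_area_exists: "\<exists>\<mu>. is_area \<mu>"
proof -
  obtain n :: nat and c where c: "\<And>i. i < n \<Longrightarrow> c i \<in> atlas S" "M = (\<Union>i<n. fst (c i))"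
    using finite_chart_cover[OF compact] by metis
  define A where "A i = fst (c i) - (\<Union>j<i. fst (c j))" for i
  have A: "A i \<in> BorM" if "i < n" for i
  proof -
    have "openin (mtop S) (fst (c j))" if "j < i" for j
      by (rule chart_openin, rule c(1)) (use that \<open>i < n\<close> in simp)
    then have "openin (mtop S) (\<Union>j<i. fst (c j))" by (auto intro!: openin_Union)
    then show ?thesis unfolding A_def by (rule BorM_Diff[OF chart_BorM[OF c(1)[OF that]] open_BorM])
  qed
  have Ac: "A i \<subseteq> fst (c i)" for i by (auto simp: A_def)
  define m where "m B = (\<Sum>i<n. \<integral>\<^sup>+x\<in>snd (c i) ` (B \<inter> A i). ennreal (adens (c i) x) \<partial>lborel)" for B
  define \<mu> where "\<mu> = measure_of M BorM m"
  have BP: "BorM \<subseteq> Pow M" using BorM_subset by blast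
  have sets: "sets \<mu> = BorM" and space: "space \<mu> = M"
    unfolding \<mu>_def using sigma_algebra.sigma_sets_eq[OF sigma_algebra_BorM] BP by simp_all
  have meas: "(\<lambda>x. ennreal (indicator (snd (c i) ` (B \<inter> A i)) x * adens (c i) x)) \<in> borel_measurable lborel"
    if "i < n" "B \<in> BorM" for i B
  proof -
    have "(\<lambda>x. indicator (snd (c i) ` (B \<inter> A i)) x * adens (c i) x) \<in> borel_measurable borel"
      using that Ac by (intro borel_adens chart_image_borel' BorM_Int A c(1)) auto
    then show ?thesis by simp
  qed
  have em: "emeasure \<mu> B = m B" if "B \<in> BorM" for B
  proof (rule emeasure_measure_of[OF \<mu>_def BP])
    show "B \<in> sets \<mu>" using that sets by simp
    show "positive (sets \<mu>) m" by (simp add: positive_def m_def)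
    show "countably_additive (sets \<mu>) m"
      unfolding countably_additive_def
    proof (intro allI impI)
      fix B :: "nat \<Rightarrow> 'a set"
      assume B: "range B \<subseteq> sets \<mu>" and dis: "disjoint_family B" and "\<Union> (range B) \<in> sets \<mu>"
      have Bk: "B k \<in> BorM" for k using B sets by auto
      have "(\<integral>\<^sup>+x\<in>snd (c i) ` (\<Union> (range B) \<inter> A i). ennreal (adens (c i) x) \<partial>lborel) =
         (\<Sum>k. \<integral>\<^sup>+x\<in>snd (c i) ` (B k \<inter> A i). ennreal (adens (c i) x) \<partial>lborel)" if i: "i < n" for i
      proof -
        have inj: "inj_on (snd (c i)) (fst (c i))" by (rule chart_inj[OF c(1)[OF i]])
        have dis': "disjoint_family (\<lambda>k. snd (c i) ` (B k \<inter> A i))"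
          unfolding disjoint_family_on_def
        proof (intro ballI impI)
          fix k l :: nat assume "k \<noteq> l"
          then have "(B k \<inter> A i) \<inter> (B l \<inter> A i) = {}" using dis unfolding disjoint_family_on_def by blast
          then show "snd (c i) ` (B k \<inter> A i) \<inter> snd (c i) ` (B l \<inter> A i) = {}"
            using inj_on_image_Int[OF inj, of "B k \<inter> A i" "B l \<inter> A i"] Ac[of i] by auto
        qed
        have un: "snd (c i) ` (\<Union> (range B) \<inter> A i) = (\<Union>k. snd (c i) ` (B k \<inter> A i))" by auto
        have ind: "ennreal (adens (c i) x) * indicator (\<Union>k. snd (c i) ` (B k \<inter> A i)) x =
          (\<Sum>k. ennreal (adens (c i) x) * indicator (snd (c i) ` (B k \<inter> A i)) x)" for x
          using suminf_indicator[OF dis', of x] by (simp add: ennreal_suminf_cmult)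
        show ?thesis unfolding un ind
        proof (rule nn_integral_suminf)
          fix k
          show "(\<lambda>x. ennreal (adens (c i) x) * indicator (snd (c i) ` (B k \<inter> A i)) x) \<in> borel_measurable lborel"
            using meas[OF i Bk[of k]] by (rule measurable_cong[THEN iffD1, rotated]) (simp add: indicator_def)
        qed
      qed
      then have "m (\<Union> (range B)) = (\<Sum>i<n. \<Sum>k. \<integral>\<^sup>+x\<in>snd (c i) ` (B k \<inter> A i). ennreal (adens (c i) x) \<partial>lborel)"
        unfolding m_def by simp
      also have "\<dots> = (\<Sum>k. m (B k))" unfolding m_def by (rule suminf_sum[symmetric]) simp
      finally show "(\<Sum>k. m (B k)) = m (\<Union> (range B))" by simp
    qed
  qed
  have "emeasure \<mu> B = (\<integral>\<^sup>+x\<in>snd d ` B. ennreal (adens d x) \<partial>lborel)"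
    if d: "d \<in> atlas S" and B: "B \<in> BorM" "B \<subseteq> fst d" for d B
  proof -
    have BA: "B \<inter> A i \<in> BorM" if "i < n" for i by (rule BorM_Int[OF B(1) A[OF that]])
    have "m B = (\<Sum>i<n. \<integral>\<^sup>+x\<in>snd d ` (B \<inter> A i). ennreal (adens d x) \<partial>lborel)"
      unfolding m_def using Ac B by (intro sum.cong refl chart_area_change c(1) d BA) auto
    also have "\<dots> = (\<integral>\<^sup>+x. (\<Sum>i<n. ennreal (adens d x) * indicator (snd d ` (B \<inter> A i)) x) \<partial>lborel)"
    proof (rule nn_integral_sum[symmetric])
      fix i assume "i \<in> {..<n}"
      then have "(\<lambda>x. indicator (snd d ` (B \<inter> A i)) x * adens d x) \<in> borel_measurable borel"
        using B by (intro borel_adens chart_image_borel' BA d) auto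
      then have "(\<lambda>x. ennreal (indicator (snd d ` (B \<inter> A i)) x * adens d x)) \<in> borel_measurable lborel" by simp
      then show "(\<lambda>x. ennreal (adens d x) * indicator (snd d ` (B \<inter> A i)) x) \<in> borel_measurable lborel"
        by (rule measurable_cong[THEN iffD1, rotated]) (simp add: indicator_def)
    qed
    also have "\<dots> = (\<integral>\<^sup>+x\<in>snd d ` B. ennreal (adens d x) \<partial>lborel)"
    proof (rule nn_integral_cong)
      fix x
      \<comment> \<open>A point of \<open>B\<close> lies in exactly one piece, that of the first
        chart containing it.\<close>
      have "(\<Sum>i<n. indicator (snd d ` (B \<inter> A i)) x) = (indicator (snd d ` B) x :: ennreal)"
      proof (cases "x \<in> snd d ` B")
        case True
        then obtain p where p: "p \<in> B" "x = snd d p" by auto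
        define i where "i = (LEAST i. i < n \<and> p \<in> fst (c i))"
        have ex: "\<exists>i. i < n \<and> p \<in> fst (c i)" using p BorM_subset[OF B(1)] c(2) by auto
        have i: "i < n \<and> p \<in> fst (c i)" unfolding i_def by (rule LeastI_ex[OF ex])
        have ni: "p \<notin> fst (c j)" if "j < i" for j using not_less_Least[of j] that i unfolding i_def by fastforce
        have iff: "x \<in> snd d ` (B \<inter> A j) \<longleftrightarrow> p \<in> A j" for j
          using p B(2) chart_inj[OF d] by (auto simp: inj_on_def subset_iff)
        have "p \<in> A j \<longleftrightarrow> j = i" if "j < n" for j
          using i ni unfolding A_def by (auto) (metis linorder_neqE_nat lessThan_iff)
        then have "(\<Sum>j<n. indicator (snd d ` (B \<inter> A j)) x) = (\<Sum>j<n. if j = i then 1 else 0 :: ennreal)"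
          by (intro sum.cong refl) (simp add: indicator_def iff)
        also have "\<dots> = 1" using i by simp
        finally show ?thesis using True by simp
      next
        case False
        then have "x \<notin> snd d ` (B \<inter> A i)" for i by blast
        then show ?thesis using False by simp
      qed
      then show "(\<Sum>i<n. ennreal (adens d x) * indicator (snd d ` (B \<inter> A i)) x) = ennreal (adens d x) * indicator (snd d ` B) x"
        by (simp add: sum_distrib_left[symmetric])
    qed
    finally show ?thesis using em[OF B(1)] by simp
  qed
  then have "is_area \<mu>" using sets space by (simp add: is_area_def)
  then show ?thesis ..
qed

abbreviation "\<mu>S \<equiv> area_measure S"

lemma is_area_area_measure: "is_area \<mu>S"
  unfolding area_measure_The using is_area_exists is_area_unique by (metis (mono_tags, lifting) theI)

lemma space_area [simp]: "space \<mu>S = M" and sets_area [simp]: "sets \<mu>S = BorM"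
  and emeasure_area: "c \<in> atlas S \<Longrightarrow> B \<in> BorM \<Longrightarrow> B \<subseteq> fst c \<Longrightarrow>
    emeasure \<mu>S B = (\<integral>\<^sup>+x. ennreal (indicator (snd c ` B) x * adens c x) \<partial>lborel)"
  using is_area_area_measure by (auto simp: is_area_def set_nn_integral_adens[symmetric])

lemma chart_distr:
  assumes c: "c \<in> atlas S"
  shows "distr (restrict_space \<mu>S (fst c)) borel (snd c) = density lborel (\<lambda>x. ennreal (indicator (cdom c) x * adens c x))"
proof (rule measure_eqI)
  have sc: "snd c \<in> measurable (restrict_space \<mu>S (fst c)) borel"
  proof (rule measurableI)
    fix T :: "'e set" assume T: "T \<in> sets borel"
    have "snd c -` T \<inter> space (restrict_space \<mu>S (fst c)) = {p \<in> fst c. snd c p \<in> T}"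
      using chart_subset[OF c] by (auto simp: space_restrict_space)
    moreover have "{p \<in> fst c. snd c p \<in> T} \<in> sets (restrict_space \<mu>S (fst c))"
      using chart_preimage_BorM[OF c T] chart_BorM[OF c]
      by (subst sets_restrict_space_iff) (auto simp: Int_absorb2 chart_subset[OF c])
    ultimately show "snd c -` T \<inter> space (restrict_space \<mu>S (fst c)) \<in> sets (restrict_space \<mu>S (fst c))" by simp
  qed simp
  have dm: "(\<lambda>x. ennreal (indicator (cdom c) x * adens c x)) \<in> borel_measurable lborel"
    using borel_adens[OF c, of "cdom c"] open_cdom[OF c] by simp
  fix T assume "T \<in> sets (distr (restrict_space \<mu>S (fst c)) borel (snd c))"
  then have T: "T \<in> sets borel" by simp
  have im: "snd c ` {p \<in> fst c. snd c p \<in> T} = cdom c \<inter> T" by auto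
  have "emeasure (distr (restrict_space \<mu>S (fst c)) borel (snd c)) T = emeasure \<mu>S {p \<in> fst c. snd c p \<in> T}"
  proof -
    have "snd c -` T \<inter> space (restrict_space \<mu>S (fst c)) = {p \<in> fst c. snd c p \<in> T}"
      using chart_subset[OF c] by (auto simp: space_restrict_space)
    then show ?thesis using T sc chart_BorM[OF c] chart_subset[OF c]
      by (subst emeasure_distr, simp, simp, subst emeasure_restrict_space) (auto simp: Int_absorb2)
  qed
  also have "\<dots> = (\<integral>\<^sup>+x. ennreal (indicator (cdom c \<inter> T) x * adens c x) \<partial>lborel)"
    by (subst emeasure_area[OF c chart_preimage_BorM[OF c T]]) (auto simp: im)
  also have "\<dots> = emeasure (density lborel (\<lambda>x. ennreal (indicator (cdom c) x * adens c x))) T"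
    using T dm by (subst emeasure_density) (auto intro!: nn_integral_cong simp: indicator_def)
  finally show "emeasure (distr (restrict_space \<mu>S (fst c)) borel (snd c)) T =
    emeasure (density lborel (\<lambda>x. ennreal (indicator (cdom c) x * adens c x))) T" .
qed simp

lemma borel_chart_pullback:
  fixes f :: "'a \<Rightarrow> real"
  assumes c: "c \<in> atlas S" and f: "f \<in> borel_measurable \<mu>S"
  shows "(\<lambda>x. if x \<in> cdom c then f (cinv c x) else 0) \<in> borel_measurable borel"
proof (rule measurableI)
  fix T :: "real set" assume T: "T \<in> sets borel"
  have "{p \<in> M. f p \<in> T} \<in> BorM"
    using measurable_sets[OF f T] by (simp add: vimage_def Int_def conj_commute)
  from chart_image_borel[OF c this] have 1: "snd c ` ({p \<in> M. f p \<in> T} \<inter> fst c) \<in> sets borel" .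
  have "(\<lambda>x. if x \<in> cdom c then f (cinv c x) else 0) -` T =
    snd c ` ({p \<in> M. f p \<in> T} \<inter> fst c) \<union> (if 0 \<in> T then - cdom c else {})"
  proof (rule set_eqI)
    fix x
    show "x \<in> (\<lambda>x. if x \<in> cdom c then f (cinv c x) else 0) -` T \<longleftrightarrow>
      x \<in> snd c ` ({p \<in> M. f p \<in> T} \<inter> fst c) \<union> (if 0 \<in> T then - cdom c else {})"
    proof (cases "x \<in> cdom c")
      case True
      then obtain p where p: "p \<in> fst c" "x = snd c p" by auto
      have "x \<in> snd c ` ({p \<in> M. f p \<in> T} \<inter> fst c) \<longleftrightarrow> f p \<in> T"
        using p chart_subset[OF c] chart_inj[OF c] by (auto simp: inj_on_def)
      then show ?thesis using p c True by simp
    next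
      case False
      then show ?thesis by auto
    qed
  qed
  moreover have "- cdom c \<in> sets borel" using open_cdom[OF c] by (simp add: borel_closed closed_Compl)
  ultimately show "(\<lambda>x. if x \<in> cdom c then f (cinv c x) else 0) -` T \<inter> space borel \<in> sets borel"
    using 1 by auto
qed simp

text \<open>The bridge from the abstract measure to Lebesgue integration in coordinates, where the
  Euclidean divergence theorem is available.\<close>

lemma integral_chart:
  fixes f :: "'a \<Rightarrow> real"
  assumes c: "c \<in> atlas S" and f: "f \<in> borel_measurable \<mu>S" and z: "\<And>p. p \<in> M - fst c \<Longrightarrow> f p = 0"
  shows "(LINT p|\<mu>S. f p) = (LINT x|lborel. indicator (cdom c) x * (f (cinv c x) * adens c x))"
proof -
  define h where "h x = (if x \<in> cdom c then f (cinv c x) else 0)" for x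
  have h: "h \<in> borel_measurable borel" unfolding h_def by (rule borel_chart_pullback[OF c f])
  have sc: "snd c \<in> measurable (restrict_space \<mu>S (fst c)) borel"
  proof (rule measurableI)
    fix T :: "'e set" assume T: "T \<in> sets borel"
    have "snd c -` T \<inter> space (restrict_space \<mu>S (fst c)) = {p \<in> fst c. snd c p \<in> T}"
      using chart_subset[OF c] by (auto simp: space_restrict_space)
    moreover have "{p \<in> fst c. snd c p \<in> T} \<in> sets (restrict_space \<mu>S (fst c))"
      using chart_preimage_BorM[OF c T] chart_BorM[OF c]
      by (subst sets_restrict_space_iff) (auto simp: Int_absorb2 chart_subset[OF c])
    ultimately show "snd c -` T \<inter> space (restrict_space \<mu>S (fst c)) \<in> sets (restrict_space \<mu>S (fst c))" by simp
  qed simp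
  have "(LINT p|\<mu>S. f p) = (LINT p|\<mu>S. indicator (fst c) p *\<^sub>R f p)"
    by (rule Bochner_Integration.integral_cong) (use z in \<open>auto simp: indicator_def\<close>)
  also have "\<dots> = (LINT p|restrict_space \<mu>S (fst c). f p)"
    using chart_BorM[OF c] chart_subset[OF c] by (subst integral_restrict_space) (auto simp: Int_absorb2)
  also have "\<dots> = (LINT p|restrict_space \<mu>S (fst c). h (snd c p))"
    by (rule Bochner_Integration.integral_cong) (use c in \<open>auto simp: h_def space_restrict_space\<close>)
  also have "\<dots> = (LINT x|distr (restrict_space \<mu>S (fst c)) borel (snd c). h x)"
    by (rule integral_distr[symmetric, OF sc h])
  also have "\<dots> = (LINT x|lborel. (indicator (cdom c) x * adens c x) *\<^sub>R h x)"
    unfolding chart_distr[OF c]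
    by (rule integral_density)
      (use h borel_adens[OF c, of "cdom c"] open_cdom[OF c] adens_pos[OF c] in \<open>auto simp: indicator_def intro!: AE_I2 less_imp_le\<close>)
  also have "\<dots> = (LINT x|lborel. indicator (cdom c) x * (f (cinv c x) * adens c x))"
    by (rule Bochner_Integration.integral_cong) (auto simp: h_def indicator_def)
  finally show ?thesis .
qed

lemma emeasure_area_compact:
  assumes c: "c \<in> atlas S" and K: "compactin (mtop S) K" "K \<subseteq> fst c"
  shows "emeasure \<mu>S K < \<infinity>"
proof -
  have KB: "K \<in> BorM"
  proof -
    have "K = M - (M - K)" using compactin_subset_topspace[OF K(1)] by auto
    moreover have "M - K \<in> BorM" using compactin_closedin[OF K(1)] open_BorM by (simp add: closedin_def)
    ultimately show ?thesis using BorM_Diff[OF M_BorM] by metis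
  qed
  have cK: "compact (snd c ` K)" by (rule compact_chart_image[OF c K])
  have "integrable lborel (\<lambda>x. indicator (snd c ` K) x *\<^sub>R adens c x)"
    by (rule borel_integrable_compact[OF cK continuous_on_subset[OF continuous_on_adens[OF c]]]) (use K in auto)
  then have "(\<integral>\<^sup>+x. ennreal (norm (indicator (snd c ` K) x *\<^sub>R adens c x)) \<partial>lborel) < \<infinity>"
    by (simp add: integrable_iff_bounded)
  also have "(\<integral>\<^sup>+x. ennreal (norm (indicator (snd c ` K) x *\<^sub>R adens c x)) \<partial>lborel) = emeasure \<mu>S K"
    unfolding emeasure_area[OF c KB K(2)]
  proof (rule nn_integral_cong)
    fix x
    have "adens c x > 0" if "x \<in> snd c ` K" using adens_pos[OF c] that K(2) by blast
    then show "ennreal (norm (indicator (snd c ` K) x *\<^sub>R adens c x)) = ennreal (indicator (snd c ` K) x * adens c x)"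
      by (auto simp: indicator_def)
  qed
  finally show ?thesis .
qed

definition is_partition ::
  "'a set \<Rightarrow> ('a \<Rightarrow> 'a set \<times> ('a \<Rightarrow> 'e)) \<Rightarrow> ('a \<Rightarrow> 'a \<Rightarrow> real) \<Rightarrow> ('a \<Rightarrow> 'a set) \<Rightarrow> bool" where
  "is_partition I c \<rho> K \<longleftrightarrow> finite I \<and> (\<forall>i\<in>I. c i \<in> atlas S \<and> smooth_map_on S M (\<rho> i) \<and>
     compactin (mtop S) (K i) \<and> K i \<subseteq> fst (c i) \<and> (\<forall>q. q \<notin> K i \<longrightarrow> \<rho> i q = 0)) \<and>
     (\<forall>q\<in>M. (\<Sum>i\<in>I. \<rho> i q) = 1)"

lemma is_partition_exists: "\<exists>I c \<rho> K. is_partition I c \<rho> K"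
proof (rule partition_of_unity[OF compact])
  fix I :: "'a set" and c :: "'a \<Rightarrow> 'a set \<times> ('a \<Rightarrow> 'e)" and \<rho> :: "'a \<Rightarrow> 'a \<Rightarrow> real" and K
  assume "finite I" "\<And>i. i \<in> I \<Longrightarrow> c i \<in> atlas S" "\<And>i. i \<in> I \<Longrightarrow> smooth_map_on S M (\<rho> i)"
    "\<And>i. i \<in> I \<Longrightarrow> compactin (mtop S) (K i)" "\<And>i. i \<in> I \<Longrightarrow> K i \<subseteq> fst (c i)"
    "\<And>i q. i \<in> I \<Longrightarrow> q \<notin> K i \<Longrightarrow> \<rho> i q = 0" "\<And>q. q \<in> M \<Longrightarrow> (\<Sum>i\<in>I. \<rho> i q) = 1"
  then have "is_partition I c \<rho> K" unfolding is_partition_def by simp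
  then show ?thesis by (intro exI)
qed

lemma is_partitionD:
  assumes "is_partition I c \<rho> K"
  shows "finite I" "\<And>i. i \<in> I \<Longrightarrow> c i \<in> atlas S" "\<And>i. i \<in> I \<Longrightarrow> smooth_map_on S M (\<rho> i)"
    "\<And>i. i \<in> I \<Longrightarrow> compactin (mtop S) (K i)" "\<And>i. i \<in> I \<Longrightarrow> K i \<subseteq> fst (c i)"
    "\<And>i q. i \<in> I \<Longrightarrow> q \<notin> K i \<Longrightarrow> \<rho> i q = 0" "\<And>q. q \<in> M \<Longrightarrow> (\<Sum>i\<in>I. \<rho> i q) = 1"
  using assms unfolding is_partition_def by blast+

text \<open>The density may be unbounded near the edge of a chart, so finiteness comes from the
  compact supports \<open>K i\<close> of a partition of unity. They cover the manifold because the
  functions sum to 1.\<close>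

lemma finite_measure_area: "finite_measure \<mu>S"
proof
  obtain I c \<rho> K where pou: "is_partition I c \<rho> K" using is_partition_exists by blast
  note I = is_partitionD[OF pou]
  have "M \<subseteq> (\<Union>i\<in>I. K i)"
  proof
    fix q assume "q \<in> M"
    then show "q \<in> (\<Union>i\<in>I. K i)" using I(6)[of _ q] I(7)[of q] by (metis UN_I sum.neutral zero_neq_one)
  qed
  moreover have KB: "K i \<in> BorM" if "i \<in> I" for i
  proof -
    have "K i = M - (M - K i)" using compactin_subset_topspace[OF I(4)[OF that]] by auto
    moreover have "M - K i \<in> BorM" using compactin_closedin[OF I(4)[OF that]] open_BorM by (simp add: closedin_def)
    ultimately show ?thesis using BorM_Diff[OF M_BorM] by metis
  qed
  ultimately have "emeasure \<mu>S M \<le> emeasure \<mu>S (\<Union>i\<in>I. K i)"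
    using sets.finite_UN[OF I(1), of K \<mu>S] by (intro emeasure_mono) simp_all
  also have "\<dots> \<le> (\<Sum>i\<in>I. emeasure \<mu>S (K i))"
    by (rule emeasure_subadditive_finite[OF I(1)]) (use KB in auto)
  also have "\<dots> < \<infinity>" using emeasure_area_compact[OF I(2,4,5)] I(1) by (simp add: less_top[symmetric])
  finally show "emeasure \<mu>S (space \<mu>S) \<noteq> \<infinity>" by simp
qed

lemma borel_continuous:
  fixes f :: "'a \<Rightarrow> 'b::topological_space"
  assumes "continuous_map (mtop S) euclidean f"
  shows "f \<in> borel_measurable \<mu>S"
proof (rule borel_measurableI)
  fix T :: "'b set" assume "open T"
  then have "openin (mtop S) {p \<in> M. f p \<in> T}" using assms by (simp add: continuous_map)
  then show "f -` T \<inter> space \<mu>S \<in> sets \<mu>S"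
    using open_BorM by (simp add: vimage_def Int_def conj_commute)
qed

lemma continuous_bounded:
  fixes f :: "'a \<Rightarrow> 'b::real_normed_vector"
  assumes "continuous_map (mtop S) euclidean f"
  obtains B where "\<And>p. p \<in> M \<Longrightarrow> norm (f p) \<le> B"
proof -
  have "compactin euclidean (f ` M)"
    using image_compactin[OF compact[unfolded compact_space_def] assms] .
  then have "bounded (f ` M)" by (simp add: compact_imp_bounded)
  then show thesis using that unfolding bounded_iff by auto
qed

lemma integrable_continuous:
  fixes f :: "'a \<Rightarrow> real"
  assumes "continuous_map (mtop S) euclidean f"
  shows "integrable \<mu>S f"
proof -
  obtain B where B: "\<And>p. p \<in> M \<Longrightarrow> norm (f p) \<le> B" using continuous_bounded[OF assms] by blast
  interpret finite_measure \<mu>S by (rule finite_measure_area)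
  show ?thesis by (rule integrable_const_bound[of _ B]) (use B borel_continuous[OF assms] in auto)
qed

text \<open>In a chart the density is positive and a nonempty open set is not negligible. The
  strictness of the final inequality is drawn from here, through
  \<open>integral_pos\<close>.\<close>

lemma emeasure_area_open_pos:
  assumes "openin (mtop S) N" "p \<in> N"
  shows "emeasure \<mu>S N > 0"
proof -
  have "p \<in> M" using assms openin_subset by blast
  then obtain c where c: "c \<in> atlas S" "p \<in> fst c" using atlas_covers by blast
  have o: "open (snd c ` (fst c \<inter> N))" by (rule open_chart_Int[OF c(1) assms(1)])
  have B: "fst c \<inter> N \<in> BorM" by (intro open_BorM openin_Int chart_openin c assms(1))
  have m: "(\<lambda>x. indicator (snd c ` (fst c \<inter> N)) x * adens c x) \<in> borel_measurable borel"
    using o by (intro borel_adens[OF c(1)]) auto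
  have "emeasure \<mu>S (fst c \<inter> N) \<noteq> 0"
  proof
    assume "emeasure \<mu>S (fst c \<inter> N) = 0"
    then have "(\<integral>\<^sup>+x. ennreal (indicator (snd c ` (fst c \<inter> N)) x * adens c x) \<partial>lborel) = 0"
      using emeasure_area[OF c(1) B] by simp
    then have "AE x in lborel. ennreal (indicator (snd c ` (fst c \<inter> N)) x * adens c x) = 0"
      using m by (subst (asm) nn_integral_0_iff_AE) simp_all
    then have "AE x in lborel. x \<notin> snd c ` (fst c \<inter> N)"
    proof eventually_elim
      case (elim x)
      show ?case
      proof
        assume x: "x \<in> snd c ` (fst c \<inter> N)"
        then have "x \<in> cdom c" by auto
        then show False using elim x adens_pos[OF c(1), of x] by simp
      qed
    qed
    then have "emeasure lborel (snd c ` (fst c \<inter> N)) = 0"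
      using o by (subst (asm) AE_iff_measurable[OF _ refl]) auto
    then have "snd c ` (fst c \<inter> N) \<in> null_sets lborel" using o by (auto simp: null_sets_def)
    then have "negligible (snd c ` (fst c \<inter> N))"
      using null_sets_completionI negligible_iff_null_sets by blast
    then show False using open_not_negligible[OF o] c assms by blast
  qed
  moreover have "emeasure \<mu>S (fst c \<inter> N) \<le> emeasure \<mu>S N"
    using open_BorM[OF assms(1)] by (intro emeasure_mono) auto
  ultimately show ?thesis by (metis le_zero_eq not_gr_zero)
qed

lemma integral_pos:
  fixes f :: "'a \<Rightarrow> real"
  assumes f: "continuous_map (mtop S) euclidean f" and nn: "\<And>q. q \<in> M \<Longrightarrow> f q \<ge> 0" and p: "p \<in> M" "f p > 0"
  shows "(LINT q|\<mu>S. f q) > 0"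
proof -
  have "(LINT q|\<mu>S. f q) \<noteq> 0"
  proof
    assume "(LINT q|\<mu>S. f q) = 0"
    then have AE: "AE q in \<mu>S. f q = 0"
      using integral_nonneg_eq_0_iff_AE[OF integrable_continuous[OF f] AE_I2] nn by simp
    have o: "openin (mtop S) {q \<in> M. f q \<in> {0<..}}"
      by (rule openin_continuous_map_preimage[OF f]) simp
    have "emeasure \<mu>S {q \<in> M. f q \<in> {0<..}} = 0"
    proof -
      have "AE q in \<mu>S. q \<notin> {q \<in> M. f q \<in> {0<..}}" using AE by eventually_elim simp
      then show ?thesis using open_BorM[OF o] by (subst (asm) AE_iff_measurable[OF _ refl]) (auto cong: conj_cong)
    qed
    moreover have "emeasure \<mu>S {q \<in> M. f q \<in> {0<..}} > 0"
      by (rule emeasure_area_open_pos[OF o, of p]) (use p in simp)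
    ultimately show False by (simp only: less_irrefl)
  qed
  moreover have "(LINT q|\<mu>S. f q) \<ge> 0" by (rule Bochner_Integration.integral_nonneg_AE) (use nn in auto)
  ultimately show ?thesis by simp
qed

end

section \<open>Integration by parts on a closed self-shrinker\<close>

lemma smooth_on_det:
  fixes G :: "'p::real_normed_vector \<Rightarrow> 'n::finite \<Rightarrow> 'n \<Rightarrow> real"
  assumes "open \<Omega>" "\<And>i j. smooth_on (\<lambda>x. G x i j) \<Omega>"
  shows "smooth_on (\<lambda>x. det (\<chi> i j. G x i j)) \<Omega>"
  unfolding det_def by (simp, intro smooth_intros assms)

text \<open>Cramer's rule writes the components of the solution of the normal equations as quotients
  of determinants, and these are polynomials in smooth functions, with a positive
  denominator.\<close>

lemma smooth_on_pinv:
  fixes A :: "'p::real_normed_vector \<Rightarrow> 'e::euclidean_space \<Rightarrow> 'v::euclidean_space"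
  assumes \<Omega>: "open \<Omega>" and lin: "\<And>x. x \<in> \<Omega> \<Longrightarrow> linear (A x)" "\<And>x. x \<in> \<Omega> \<Longrightarrow> inj (A x)"
    and A: "\<And>b. smooth_on (\<lambda>x. A x b) \<Omega>" and y: "smooth_on y \<Omega>"
  shows "smooth_on (\<lambda>x. pinv (A x) (y x)) \<Omega>"
proof (rule smooth_on_componentwise[OF \<Omega>])
  fix b :: 'e assume "b \<in> Basis"
  then obtain k where k: "b = bvec k" by (metis rangeE range_bvec)
  \<comment> \<open>The Gram matrix with column \<open>k\<close> replaced by the right-hand side, as
    in the numerator of Cramer's rule.\<close>
  define R where "R x i j = (if j = k then y x \<bullet> A x (bvec i) else A x (bvec i) \<bullet> A x (bvec j))" for x and i j :: "'e bidx"
  have num: "smooth_on (\<lambda>x. det (\<chi> i j. R x i j)) \<Omega>"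
  proof (rule smooth_on_det[OF \<Omega>])
    show "smooth_on (\<lambda>x. R x i j) \<Omega>" for i j
      unfolding R_def by (cases "j = k") (simp_all, intro smooth_intros \<Omega> A y, intro smooth_intros \<Omega> A)
  qed
  have den: "smooth_on (\<lambda>x. det (gram (A x))) \<Omega>"
    unfolding gram_def by (intro smooth_on_det smooth_intros \<Omega> A)
  have "smooth_on (\<lambda>x. det (\<chi> i j. R x i j) / det (gram (A x))) \<Omega>"
    using det_gram_pos[OF lin] by (intro smooth_intros \<Omega> num den) (metis less_irrefl)
  then show "smooth_on (\<lambda>x. pinv (A x) (y x) \<bullet> b) \<Omega>"
  proof (rule smooth_on_cong[OF \<Omega>, rotated])
    fix x assume x: "x \<in> \<Omega>"
    define r where "r = (\<chi> i. y x \<bullet> A x (bvec i))"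
    define u where "u = matrix_inv (gram (A x)) *v r"
    have "gram (A x) *v u = r"
      by (simp add: u_def matrix_vector_mul_assoc gram_matrix_inv lin x)
    then have "u = (\<chi> k. det (\<chi> i j. if j = k then r $ i else gram (A x) $ i $ j) / det (gram (A x)))"
      using cramer[of "gram (A x)" u r] det_gram_pos[OF lin[OF x]] by simp
    then have "u $ k = det (\<chi> i j. R x i j) / det (gram (A x))"
      by (simp add: R_def r_def gram_def cong: if_cong)
    moreover have "pinv (A x) (y x) \<bullet> b = u $ k" by (simp add: k pinv_def u_def r_def fromv_inner)
    ultimately show "det (\<chi> i j. R x i j) / det (gram (A x)) = pinv (A x) (y x) \<bullet> b" by simp
  qed
qed

lemma tr_add: "tr (\<lambda>w. f w + g w) = tr f + tr g"
  by (simp add: tr_def inner_add_left sum.distrib)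

lemma tr_diff: "tr (\<lambda>w. f w - g w) = tr f - tr g"
  by (simp add: tr_def inner_diff_left sum_subtractf)

lemma tr_sum: "tr (\<lambda>w. \<Sum>i\<in>I. f i w) = (\<Sum>i\<in>I. tr (f i))"
  unfolding tr_def by (simp add: inner_sum_left) (rule sum.swap)

lemma tr_scaleR: "tr (\<lambda>w. k *\<^sub>R f w) = k * tr f"
  by (simp add: tr_def sum_distrib_left)

lemma tr_rank_one: "tr (\<lambda>w. (w \<bullet> u) *\<^sub>R v) = u \<bullet> v"
  unfolding tr_def by (subst (3) euclidean_inner) (simp add: mult.commute inner_commute)

context imm
begin

section \<open>Rules for the divergence and the weighted divergence in a chart\<close>

lemma smooth_dloc_pos: "c \<in> atlas S \<Longrightarrow> smooth_on (\<lambda>x. dloc c X x b) (cdom c)"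
  unfolding dloc_def by (intro smooth_on_frechet_derivative smooth_pos_chart)

lemma smooth_pinv_chart:
  "c \<in> atlas S \<Longrightarrow> smooth_on f (cdom c) \<Longrightarrow> smooth_on (\<lambda>x. pinv (dloc c X x) (f x)) (cdom c)"
  by (rule smooth_on_pinv[OF open_cdom dloc_pos_linear' dloc_pos_inj' smooth_dloc_pos])

lemma smooth_tderiv:
  assumes f: "smooth_map_on S M f" and W: "smooth_map_on S M W"
  shows "smooth_map_on S M (\<lambda>p. tderiv f p (W p))"
proof (rule smooth_map_onI_global)
  fix c assume c: "c \<in> atlas S"
  have "smooth_on (\<lambda>x. frechet_derivative (local_rep c f) (at x) (pinv (dloc c X x) (local_rep c W x))) (cdom c)"
    by (intro smooth_on_frechet_derivative_field open_cdom c smooth_map_onD'[OF f] smooth_pinv_chart smooth_map_onD'[OF W])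
  then have "smooth_on (\<lambda>x. tderiv f (cinv c x) (W (cinv c x))) (cdom c)"
    by (rule smooth_on_cong[OF open_cdom[OF c], rotated])
      (simp add: tderiv_chart'[OF c _ f] dloc_def local_rep_apply)
  then show "smooth_on (\<lambda>x. tderiv f (cinv c x) (W (cinv c x))) (snd c ` (fst c \<inter> M))"
    using chart_subset[OF c] by (simp add: Int_absorb2)
qed

lemma divg_sum:
  assumes "p \<in> M" "\<And>i. i \<in> I \<Longrightarrow> smooth_map_on S M (f i)"
  shows "divg (\<lambda>q. \<Sum>i\<in>I. f i q) p = (\<Sum>i\<in>I. divg (f i) p)"
proof -
  have "tderiv (\<lambda>q. \<Sum>i\<in>I. f i q) p = (\<lambda>y. \<Sum>i\<in>I. tderiv (f i) p y)"
    by (rule ext, rule tderiv_sum[OF _ _ assms(2)]) (use assms(1) in auto)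
  then show ?thesis by (simp add: divg_def tr_sum)
qed

lemma divg_diff:
  assumes "p \<in> M" "smooth_map_on S M f" "smooth_map_on S M g"
  shows "divg (\<lambda>q. f q - g q) p = divg f p - divg g p"
proof -
  have "tderiv (\<lambda>q. f q - g q) p = (\<lambda>y. tderiv f p y - tderiv g p y)"
    by (rule ext, rule tderiv_diff[OF _ _ assms(2,3)]) (use assms(1) in auto)
  then show ?thesis by (simp add: divg_def tr_diff)
qed

lemma divg_scaleR:
  assumes "p \<in> M" "smooth_map_on S M f" "smooth_map_on S M W"
  shows "divg (\<lambda>q. f q *\<^sub>R W q) p = f p * divg W p + tderiv f p (W p)"
proof -
  have "tderiv (\<lambda>q. f q *\<^sub>R W q) p = (\<lambda>y. f p *\<^sub>R tderiv W p y + tderiv f p y *\<^sub>R W p)"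
    by (rule ext, rule tderiv_bilinear[OF bounded_bilinear_scaleR assms(1) assms(1) assms(2,3)])
  moreover have "tr (\<lambda>y. tderiv f p y *\<^sub>R W p) = tderiv f p (W p)"
  proof -
    have "tderiv f p (W p) = (\<Sum>b\<in>Basis. (W p \<bullet> b) *\<^sub>R tderiv f p b)"
      by (rule linear_basis_expansion[OF tderiv_linear[OF assms(1) assms(1) assms(2)]])
    then show ?thesis by (simp add: tr_def mult.commute)
  qed
  ultimately show ?thesis by (simp add: divg_def tr_add tr_scaleR)
qed

text \<open>The integrand of \<open>F\<close> at \<open>x = 0\<close>, \<open>t = 1\<close>, without
  the constant factor.\<close>

definition gauss :: "'a \<Rightarrow> real" where
  "gauss p = exp (- (norm (X p))\<^sup>2 / 4)"

text \<open>In coordinates the weighted divergence is the Euclidean divergence of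
  \<open>sqrt (det g) * gauss * \<tau>\<close>: the derivative of the density supplies the
  Christoffel part of \<open>div T\<close>, and the derivative of \<open>gauss\<close> supplies
  \<open>- X \<bullet> T / 2\<close>. The explicit formula for \<open>v'\<close> is returned as well
  because its continuity in \<open>x\<close> has to be checked before integrating.\<close>

lemma weighted_divergence_chart:
  assumes c: "c \<in> atlas S" and x: "x \<in> cdom c"
    and T: "smooth_map_on S M T" and tan: "\<And>q. q \<in> M \<Longrightarrow> T q \<in> tangent_space S q"
  defines "\<tau> \<equiv> \<lambda>x. pinv (dloc c X x) (T (cinv c x))"
  obtains v' where
    "((\<lambda>x. (adens c x * gauss (cinv c x)) *\<^sub>R \<tau> x) has_derivative v') (at x)"
    "(\<Sum>b\<in>Basis. v' b \<bullet> b) = (divg T (cinv c x) - X (cinv c x) \<bullet> T (cinv c x) / 2) * gauss (cinv c x) * adens c x"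
    "\<And>b. v' b = (adens c x * gauss (cinv c x)) *\<^sub>R frechet_derivative \<tau> (at x) b +
       (adens c x * tr (\<lambda>w. pinv (dloc c X x) (frechet_derivative (\<lambda>y. dloc c X y w) (at x) b)) * gauss (cinv c x)
        - adens c x * gauss (cinv c x) * (X (cinv c x) \<bullet> dloc c X x b) / 2) *\<^sub>R \<tau> x"
proof -
  define A where "A x = dloc c X x" for x
  define A' where "A' b w = frechet_derivative (\<lambda>y. dloc c X y w) (at x) b" for b w
  define p where "p = cinv c x"
  have p: "p \<in> fst c" "snd c p = x" "p \<in> M" using x chart_subset[OF c] by (auto simp: p_def)
  have lin: "linear (A x)" "inj (A x)" using dloc_pos_linear'[OF c x] dloc_pos_inj'[OF c x] by (simp_all add: A_def)
  have \<tau>s: "smooth_on \<tau> (cdom c)" unfolding \<tau>_def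
    using smooth_pinv_chart[OF c smooth_map_onD'[OF T c]] by (simp add: local_rep_def)
  define \<tau>' where "\<tau>' = frechet_derivative \<tau> (at x)"
  have \<tau>d: "(\<tau> has_derivative \<tau>') (at x)" unfolding \<tau>'_def by (rule smooth_on_has_derivative[OF \<tau>s x])
  have Ad: "((\<lambda>y. A y w) has_derivative (\<lambda>b. A' b w)) (at x)" for w
    unfolding A'_def A_def by (rule smooth_on_has_derivative[OF smooth_dloc_pos[OF c] x])
  have A'lin: "linear (\<lambda>b. A' b w)" for w using Ad has_derivative_linear by blast
  \<comment> \<open>Differentiating \<open>T = A \<tau>\<close> in the direction \<open>b\<close>
    gives \<open>A' b \<tau>\<close>, while the density gives \<open>A' \<tau> b\<close>; they match
    because mixed partial derivatives of the position commute.\<close>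
  have sym: "A' b w = A' w b" for b w
    unfolding A'_def dloc_def by (rule frechet_derivative_commute[OF open_cdom[OF c] x smooth_pos_chart[OF c]])
  have ad: "(adens c has_derivative (\<lambda>b. adens c x * tr (\<lambda>w. pinv (A x) (A' b w)))) (at x)"
    unfolding adens_def[abs_def] A_def[symmetric] by (rule has_derivative_sqrt_det_gram[OF lin Ad])
  have Xd: "(local_rep c X has_derivative A x) (at x)"
    using dloc_has_derivative[OF smooth_pos c p(1,3)] p by (simp add: A_def)
  have Xp: "local_rep c X x = X p" by (simp add: local_rep_def p_def)
  have gd: "((\<lambda>x. gauss (cinv c x)) has_derivative (\<lambda>b. - gauss p * (X p \<bullet> A x b) / 2)) (at x)"
  proof -
    have "((\<lambda>x. (- 1 / 4) * (local_rep c X x \<bullet> local_rep c X x)) has_derivative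
        (\<lambda>b. (- 1 / 4) * (local_rep c X x \<bullet> A x b + A x b \<bullet> local_rep c X x))) (at x)"
      by (intro has_derivative_mult_right has_derivative_inner Xd)
    then have e: "((\<lambda>x. - (local_rep c X x \<bullet> local_rep c X x) / 4) has_derivative (\<lambda>b. - (X p \<bullet> A x b) / 2)) (at x)"
      by (simp add: Xp inner_commute)
    have "((\<lambda>x. exp (- (local_rep c X x \<bullet> local_rep c X x) / 4)) has_derivative (\<lambda>b. exp (- (X p \<bullet> X p) / 4) * (- (X p \<bullet> A x b) / 2))) (at x)"
      using has_derivative_exp[OF e] by (simp add: Xp mult.commute)
    then show ?thesis by (simp add: gauss_def power2_norm_eq_inner local_rep_def)
  qed
  define v' where "v' b = (adens c x * gauss p) *\<^sub>R \<tau>' b + (adens c x * (- gauss p * (X p \<bullet> A x b) / 2) + adens c x * tr (\<lambda>w. pinv (A x) (A' b w)) * gauss p) *\<^sub>R \<tau> x" for b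
  have vd: "((\<lambda>x. (adens c x * gauss (cinv c x)) *\<^sub>R \<tau> x) has_derivative v') (at x)"
    unfolding v'_def using has_derivative_scaleR[OF has_derivative_mult[OF ad gd] \<tau>d] by (simp add: p_def)
  have Tp: "T p = A x (\<tau> x)"
  proof -
    have "T p \<in> range (A x)"
      using tan[OF p(3)] range_dloc_change[OF c chart_at(1)[OF p(3)] p(1) chart_at(2)[OF p(3)] openin_M p(3) smooth_pos]
      by (simp add: tangent_space_def differential_dloc A_def p)
    then show ?thesis using pinv_left[OF lin] by (auto simp: \<tau>_def A_def p_def)
  qed
  have Teq: "local_rep c T y = A y (\<tau> y)" if "y \<in> cdom c" for y
  proof -
    have py: "cinv c y \<in> fst c" "snd c (cinv c y) = y" "cinv c y \<in> M" using that chart_subset[OF c] by auto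
    have "T (cinv c y) \<in> range (A y)"
      using tan[OF py(3)] range_dloc_change[OF c chart_at(1)[OF py(3)] py(1) chart_at(2)[OF py(3)] openin_M py(3) smooth_pos]
      by (simp add: tangent_space_def differential_dloc A_def py)
    then show ?thesis using pinv_left[OF dloc_pos_linear'[OF c that] dloc_pos_inj'[OF c that]]
      by (auto simp: \<tau>_def A_def local_rep_def)
  qed
  have dT: "dloc c T x = (\<lambda>b. A' (\<tau> x) b + A x (\<tau>' b))"
  proof (rule dloc_eqI)
    have "((\<lambda>y. \<Sum>k\<in>Basis. (\<tau> y \<bullet> k) *\<^sub>R A y k) has_derivative
        (\<lambda>b. \<Sum>k\<in>Basis. (\<tau> x \<bullet> k) *\<^sub>R A' b k + (\<tau>' b \<bullet> k) *\<^sub>R A x k)) (at x)"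
      by (intro has_derivative_sum has_derivative_scaleR Ad has_derivative_inner_left \<tau>d)
    moreover have "(\<Sum>k\<in>Basis. (\<tau> x \<bullet> k) *\<^sub>R A' b k + (\<tau>' b \<bullet> k) *\<^sub>R A x k) = A' (\<tau> x) b + A x (\<tau>' b)" for b
      using linear_basis_expansion[OF A'lin[of b], of "\<tau> x"] linear_basis_expansion[OF lin(1), of "\<tau>' b"]
      by (simp add: sum.distrib sym[of b])
    ultimately have "((\<lambda>y. \<Sum>k\<in>Basis. (\<tau> y \<bullet> k) *\<^sub>R A y k) has_derivative (\<lambda>b. A' (\<tau> x) b + A x (\<tau>' b))) (at x)"
      by simp
    then show "(local_rep c T has_derivative (\<lambda>b. A' (\<tau> x) b + A x (\<tau>' b))) (at x)"
    proof (rule has_derivative_transform_within_open[OF _ open_cdom[OF c] x])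
      fix y assume y: "y \<in> cdom c"
      show "(\<Sum>k\<in>Basis. (\<tau> y \<bullet> k) *\<^sub>R A y k) = local_rep c T y"
        using linear_basis_expansion[of "A y" "\<tau> y"] dloc_pos_linear'[OF c y] Teq[OF y] by (simp add: A_def)
    qed
  qed
  have div: "divg T p = tr (\<lambda>w. pinv (A x) (A' (\<tau> x) w)) + tr \<tau>'"
    using divg_chart[OF c p(1) openin_M p(3) T] unfolding p(2) dT
    by (simp add: A_def[symmetric] linear_add[OF linear_pinv] lin tr_add)
  have trsum: "(\<Sum>b\<in>Basis. (\<tau> x \<bullet> b) * tr (\<lambda>w. pinv (A x) (A' b w))) = tr (\<lambda>w. pinv (A x) (A' (\<tau> x) w))"
  proof -
    have "linear (\<lambda>b. pinv (A x) (A' b w) \<bullet> w)" for w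
      using linear_compose[OF linear_compose[OF A'lin[of w] linear_pinv[of "A x"]] bounded_linear.linear[OF bounded_linear_inner_left[of w]]]
      by (simp add: o_def)
    then have "pinv (A x) (A' (\<tau> x) w) \<bullet> w = (\<Sum>b\<in>Basis. (\<tau> x \<bullet> b) * (pinv (A x) (A' b w) \<bullet> w))" for w
      using linear_basis_expansion[of "\<lambda>b. pinv (A x) (A' b w) \<bullet> w" "\<tau> x"] by simp
    then show ?thesis unfolding tr_def by (simp add: sum_distrib_left) (rule sum.swap)
  qed
  have Xsum: "(\<Sum>b\<in>Basis. (\<tau> x \<bullet> b) * (X p \<bullet> A x b)) = X p \<bullet> T p"
    unfolding Tp using linear_basis_expansion[OF lin(1), of "\<tau> x"] by (simp add: inner_sum_right)
  have "(\<Sum>b\<in>Basis. v' b \<bullet> b) = adens c x * gauss p * tr \<tau>'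
     - adens c x * gauss p / 2 * (\<Sum>b\<in>Basis. (\<tau> x \<bullet> b) * (X p \<bullet> A x b))
     + adens c x * gauss p * (\<Sum>b\<in>Basis. (\<tau> x \<bullet> b) * tr (\<lambda>w. pinv (A x) (A' b w)))"
    unfolding v'_def tr_def[of \<tau>'] sum_distrib_left sum.distrib[symmetric] sum_subtractf[symmetric]
    by (intro sum.cong refl) (simp add: inner_add_left algebra_simps)
  also have "\<dots> = (divg T p - X p \<bullet> T p / 2) * gauss p * adens c x"
    unfolding trsum Xsum div by (simp add: algebra_simps)
  finally have sumv: "(\<Sum>b\<in>Basis. v' b \<bullet> b) = (divg T p - X p \<bullet> T p / 2) * gauss p * adens c x" .
  show thesis
    by (rule that[OF vd]) (use sumv in \<open>simp_all add: v'_def p_def A_def A'_def \<tau>'_def algebra_simps\<close>)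
qed

lemma tangent_subspace_closed:
  "q \<in> M \<Longrightarrow> t \<in> tangent_space S q \<Longrightarrow> k *\<^sub>R t \<in> tangent_space S q"
  using subspace_tangent subspace_scale by blast

end

context cimm
begin

section \<open>The weighted divergence theorem for tangential fields\<close>

lemma smooth_gauss_continuous: "continuous_map (mtop S) euclidean gauss"
proof -
  have c: "continuous_map (mtop S) euclidean X" by (rule smooth_imp_continuous_map[OF smooth_pos])
  have "continuous_map (mtop S) euclidean ((\<lambda>v. exp (- (norm v)\<^sup>2 / 4)) \<circ> X)"
    by (rule continuous_map_compose[OF c]) (auto intro!: continuous_intros)
  then show ?thesis by (simp add: gauss_def[abs_def] o_def)
qed

lemma smooth_divg:
  assumes W: "smooth_map_on S M W"
  shows "smooth_map_on S M (divg W)"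
  unfolding divg_def[abs_def] tr_def
  by (intro smooth_map_on_sum openin_M smooth_map_on_bilinear[OF _ bounded_bilinear_inner] smooth_tderiv W smooth_map_on_const)

lemma continuous_mult:
  fixes f g :: "'a \<Rightarrow> real"
  shows "continuous_map (mtop S) euclidean f \<Longrightarrow> continuous_map (mtop S) euclidean g \<Longrightarrow>
    continuous_map (mtop S) euclidean (\<lambda>p. f p * g p)"
  using continuous_map_real_mult[of "mtop S" f g] by simp

lemma integrable_gauss:
  assumes "smooth_map_on S M (f :: 'a \<Rightarrow> real)"
  shows "integrable \<mu>S (\<lambda>p. f p * gauss p)"
  by (intro integrable_continuous continuous_mult smooth_imp_continuous_map assms smooth_gauss_continuous)

text \<open>Compact support inside one chart reduces this to the Euclidean divergence theorem for
  the coordinate field \<open>v\<close>.\<close>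

lemma integral_tangential_divergence_local:
  assumes c: "c \<in> atlas S" and K: "compactin (mtop S) K" "K \<subseteq> fst c"
    and T: "smooth_map_on S M T" and tan: "\<And>q. q \<in> M \<Longrightarrow> T q \<in> tangent_space S q"
    and z: "\<And>q. q \<notin> K \<Longrightarrow> T q = 0"
  shows "(LINT p|\<mu>S. (divg T p - X p \<bullet> T p / 2) * gauss p) = 0"
proof -
  define \<tau> where "\<tau> x = pinv (dloc c X x) (T (cinv c x))" for x
  define v where "v x = (adens c x * gauss (cinv c x)) *\<^sub>R \<tau> x" for x
  have ex: "\<exists>v'. (v has_derivative v') (at x) \<and>
    (\<Sum>b\<in>Basis. v' b \<bullet> b) = (divg T (cinv c x) - X (cinv c x) \<bullet> T (cinv c x) / 2) * gauss (cinv c x) * adens c x \<and>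
    (\<forall>b. v' b = (adens c x * gauss (cinv c x)) *\<^sub>R frechet_derivative \<tau> (at x) b +
       (adens c x * tr (\<lambda>w. pinv (dloc c X x) (frechet_derivative (\<lambda>y. dloc c X y w) (at x) b)) * gauss (cinv c x)
        - adens c x * gauss (cinv c x) * (X (cinv c x) \<bullet> dloc c X x b) / 2) *\<^sub>R \<tau> x)" if "x \<in> cdom c" for x
    by (rule weighted_divergence_chart[OF c that T tan]) (unfold v_def \<tau>_def, blast+)
  define v' where "v' x = (SOME v'. (v has_derivative v') (at x) \<and>
    (\<Sum>b\<in>Basis. v' b \<bullet> b) = (divg T (cinv c x) - X (cinv c x) \<bullet> T (cinv c x) / 2) * gauss (cinv c x) * adens c x \<and>
    (\<forall>b. v' b = (adens c x * gauss (cinv c x)) *\<^sub>R frechet_derivative \<tau> (at x) b +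
       (adens c x * tr (\<lambda>w. pinv (dloc c X x) (frechet_derivative (\<lambda>y. dloc c X y w) (at x) b)) * gauss (cinv c x)
        - adens c x * gauss (cinv c x) * (X (cinv c x) \<bullet> dloc c X x b) / 2) *\<^sub>R \<tau> x))" for x
  note v' = someI_ex[OF ex, folded v'_def]
  have \<tau>s: "smooth_on \<tau> (cdom c)"
    using smooth_pinv_chart[OF c smooth_map_onD'[OF T c]] by (simp add: local_rep_def \<tau>_def[abs_def])
  have gs: "continuous_on (cdom c) (\<lambda>x. gauss (cinv c x))" and Xs: "continuous_on (cdom c) (\<lambda>x. X (cinv c x))"
  proof -
    show Xs: "continuous_on (cdom c) (\<lambda>x. X (cinv c x))"
      using smooth_on_imp_continuous_on[OF smooth_pos_chart[OF c]] by (simp add: local_rep_def o_def)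
    show "continuous_on (cdom c) (\<lambda>x. gauss (cinv c x))" unfolding gauss_def by (intro continuous_intros Xs) simp
  qed
  have cont: "continuous_on (cdom c) (\<lambda>x. v' x b)" for b
  proof (rule continuous_on_cong[THEN iffD1, OF refl])
    show "(adens c x * gauss (cinv c x)) *\<^sub>R frechet_derivative \<tau> (at x) b +
       (adens c x * tr (\<lambda>w. pinv (dloc c X x) (frechet_derivative (\<lambda>y. dloc c X y w) (at x) b)) * gauss (cinv c x)
        - adens c x * gauss (cinv c x) * (X (cinv c x) \<bullet> dloc c X x b) / 2) *\<^sub>R \<tau> x = v' x b" if "x \<in> cdom c" for x
      using v'[OF that] by simp
    have 1: "continuous_on (cdom c) (\<lambda>x. frechet_derivative \<tau> (at x) b)"
      by (intro smooth_on_imp_continuous_on smooth_on_frechet_derivative \<tau>s)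
    have 2: "continuous_on (cdom c) (\<lambda>x. tr (\<lambda>w. pinv (dloc c X x) (frechet_derivative (\<lambda>y. dloc c X y w) (at x) b)))"
      unfolding tr_def
      by (intro smooth_on_imp_continuous_on smooth_intros smooth_pinv_chart c open_cdom smooth_dloc_pos)
    show "continuous_on (cdom c) (\<lambda>x. (adens c x * gauss (cinv c x)) *\<^sub>R frechet_derivative \<tau> (at x) b +
       (adens c x * tr (\<lambda>w. pinv (dloc c X x) (frechet_derivative (\<lambda>y. dloc c X y w) (at x) b)) * gauss (cinv c x)
        - adens c x * gauss (cinv c x) * (X (cinv c x) \<bullet> dloc c X x b) / 2) *\<^sub>R \<tau> x)"
      by (intro continuous_intros continuous_on_adens[OF c] gs Xs 1 2 continuous_on_dloc[OF c]
          smooth_on_imp_continuous_on[OF \<tau>s]) simp_all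
  qed
  have "(LINT x|lborel. indicator (cdom c) x * (\<Sum>b\<in>Basis. v' x b \<bullet> b)) = 0"
  proof (rule integral_divergence_eq_0[OF open_cdom[OF c] compact_chart_image[OF c K]])
    show "snd c ` K \<subseteq> cdom c" using K by auto
    show "(v has_derivative v' x) (at x)" if "x \<in> cdom c" for x using v'[OF that] by simp
    show "v x = 0" if "x \<in> cdom c - snd c ` K" for x
    proof -
      have "cinv c x \<notin> K" using that by (metis DiffD1 DiffD2 chart_cinv image_eqI)
      then show ?thesis using z linear_0[OF linear_pinv[of "dloc c X x"]] by (simp add: v_def \<tau>_def)
    qed
    show "continuous_on (cdom c) (\<lambda>x. v' x b)" for b by (rule cont)
  qed
  moreover have "(LINT p|\<mu>S. (divg T p - X p \<bullet> T p / 2) * gauss p) =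
     (LINT x|lborel. indicator (cdom c) x * ((divg T (cinv c x) - X (cinv c x) \<bullet> T (cinv c x) / 2) * gauss (cinv c x) * adens c x))"
  proof (rule integral_chart[OF c])
    have "smooth_map_on S M (\<lambda>p. divg T p - X p \<bullet> T p / 2)"
      using smooth_map_on_diff[OF openin_M smooth_divg[OF T] smooth_map_on_bounded_linear[OF openin_M bounded_linear_divide[of 2]
         smooth_map_on_bilinear[OF openin_M bounded_bilinear_inner smooth_pos T]]] .
    then show "(\<lambda>p. (divg T p - X p \<bullet> T p / 2) * gauss p) \<in> borel_measurable \<mu>S"
      using borel_measurable_integrable[OF integrable_gauss] by blast
    fix p assume p: "p \<in> M - fst c"
    \<comment> \<open>The field vanishes on this whole open set, so off the chart its derivatives
      vanish too.\<close>
    have o: "openin (mtop S) (M - K)" using compactin_closedin[OF K(1)] by (simp add: closedin_def)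
    have "tderiv T p y = 0" for y
    proof -
      have pK: "p \<in> M - K" using p K(2) by blast
      have "tderiv T p y = tderiv (\<lambda>_. 0) p y" by (rule tderiv_cong[OF o pK]) (use z in simp)
      then show ?thesis by (simp add: tderiv_const)
    qed
    then have "divg T p = 0" by (simp add: divg_def tr_def)
    moreover have "T p = 0" using z p K(2) by blast
    ultimately show "(divg T p - X p \<bullet> T p / 2) * gauss p = 0" by simp
  qed
  moreover have "indicator (cdom c) x * ((divg T (cinv c x) - X (cinv c x) \<bullet> T (cinv c x) / 2) * gauss (cinv c x) * adens c x)
    = indicator (cdom c) x * (\<Sum>b\<in>Basis. v' x b \<bullet> b)" for x
    using conjunct1[OF conjunct2[OF v'[of x]]] by (cases "x \<in> cdom c") simp_all
  ultimately show ?thesis by simp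
qed

text \<open>A partition of unity splits \<open>T\<close> into fields supported in charts. Since the
  identity is additive in the field, the derivatives of the partition functions never have to be
  computed.\<close>

lemma integral_tangential_divergence:
  assumes T: "smooth_map_on S M T" and tan: "\<And>q. q \<in> M \<Longrightarrow> T q \<in> tangent_space S q"
  shows "(LINT p|\<mu>S. (divg T p - X p \<bullet> T p / 2) * gauss p) = 0"
proof -
  obtain I c \<rho> K where pou: "is_partition I c \<rho> K" using is_partition_exists by blast
  note I = is_partitionD[OF pou]
  have sm: "smooth_map_on S M (\<lambda>q. \<rho> i q *\<^sub>R T q)" if "i \<in> I" for i
    by (intro smooth_map_on_bilinear[OF _ bounded_bilinear_scaleR] openin_M I(3) that T)
  have sd: "smooth_map_on S M (\<lambda>p. divg W p - X p \<bullet> W p / 2)" if "smooth_map_on S M W" for W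
    using smooth_map_on_diff[OF openin_M smooth_divg[OF that] smooth_map_on_bounded_linear[OF openin_M bounded_linear_divide[of 2]
         smooth_map_on_bilinear[OF openin_M bounded_bilinear_inner smooth_pos that]]] .
  have eq: "(divg T p - X p \<bullet> T p / 2) * gauss p =
     (\<Sum>i\<in>I. (divg (\<lambda>q. \<rho> i q *\<^sub>R T q) p - X p \<bullet> (\<rho> i p *\<^sub>R T p) / 2) * gauss p)" if p: "p \<in> M" for p
  proof -
    have "divg T p = divg (\<lambda>q. \<Sum>i\<in>I. \<rho> i q *\<^sub>R T q) p"
    proof -
      have "tderiv T p y = tderiv (\<lambda>q. \<Sum>i\<in>I. \<rho> i q *\<^sub>R T q) p y" for y
        by (rule tderiv_cong[OF openin_M p]) (simp add: scaleR_sum_left[symmetric] I(7))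
      then show ?thesis by (simp add: divg_def tr_def)
    qed
    also have "\<dots> = (\<Sum>i\<in>I. divg (\<lambda>q. \<rho> i q *\<^sub>R T q) p)" by (rule divg_sum[OF p sm])
    finally have 1: "divg T p = (\<Sum>i\<in>I. divg (\<lambda>q. \<rho> i q *\<^sub>R T q) p)" .
    have 2: "X p \<bullet> T p / 2 = (\<Sum>i\<in>I. X p \<bullet> (\<rho> i p *\<^sub>R T p) / 2)"
    proof -
      have "(\<Sum>i\<in>I. X p \<bullet> (\<rho> i p *\<^sub>R T p) / 2) = (\<Sum>i\<in>I. \<rho> i p) * (X p \<bullet> T p / 2)"
        by (simp add: sum_distrib_right)
      then show ?thesis by (simp add: I(7)[OF p])
    qed
    show ?thesis unfolding 1 2 by (simp add: sum_subtractf[symmetric] sum_distrib_right)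
  qed
  have "(LINT p|\<mu>S. (divg T p - X p \<bullet> T p / 2) * gauss p) =
    (LINT p|\<mu>S. (\<Sum>i\<in>I. (divg (\<lambda>q. \<rho> i q *\<^sub>R T q) p - X p \<bullet> (\<rho> i p *\<^sub>R T p) / 2) * gauss p))"
    by (rule Bochner_Integration.integral_cong) (use eq in auto)
  also have "\<dots> = (\<Sum>i\<in>I. LINT p|\<mu>S. (divg (\<lambda>q. \<rho> i q *\<^sub>R T q) p - X p \<bullet> (\<rho> i p *\<^sub>R T p) / 2) * gauss p)"
    by (rule Bochner_Integration.integral_sum) (intro integrable_gauss sd sm)
  also have "\<dots> = (\<Sum>i\<in>I. 0)"
  proof (intro sum.cong refl integral_tangential_divergence_local[OF I(2,4,5) sm])
    fix i q assume i: "i \<in> I"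
    show "q \<in> M \<Longrightarrow> \<rho> i q *\<^sub>R T q \<in> tangent_space S q" by (intro tangent_subspace_closed tan)
    show "q \<notin> K i \<Longrightarrow> \<rho> i q *\<^sub>R T q = 0" using I(6)[OF i] by simp
  qed
  finally show ?thesis by simp
qed

end

section \<open>Normal fields and mean curvature\<close>

context imm
begin

text \<open>A dimension count: \<open>u \<mapsto> pinv A (E u)\<close> is an injective endomorphism
  of \<open>'e\<close>, hence onto, so the \<open>DIM('e)\<close> orthonormal vectors span the
  tangent space.\<close>

lemma frame_expansion:
  assumes p: "p \<in> M" and tan: "\<And>i. i \<in> Basis \<Longrightarrow> e i \<in> tangent_space S p"
    and on: "\<And>i j. i \<in> (Basis :: 'e set) \<Longrightarrow> j \<in> Basis \<Longrightarrow> e i \<bullet> e j = (if i = j then 1 else 0)"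
  shows "tproj p y = (\<Sum>i\<in>Basis. (y \<bullet> e i) *\<^sub>R e i)"
proof -
  define E where "E u = (\<Sum>i\<in>Basis. (u \<bullet> i) *\<^sub>R e i)" for u :: 'e
  define A where "A = differential S X p"
  have A: "linear A" "inj A" using differential_pos_linear[OF p] inj_differential[OF p] by (simp_all add: A_def)
  have linE: "linear E" by (auto simp: linear_iff E_def inner_add_left scaleR_add_left sum.distrib scaleR_sum_right)
  have Ei: "E u \<bullet> e j = u \<bullet> j" if "j \<in> Basis" for u j
  proof -
    have "E u \<bullet> e j = (\<Sum>i\<in>Basis. (u \<bullet> i) * (if i = j then 1 else 0))"
      unfolding E_def inner_sum_left by (intro sum.cong refl) (simp add: on that)
    then show ?thesis using that by (simp add: if_distrib cong: if_cong)
  qed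
  have injE: "inj E" by (rule injI) (metis Ei euclidean_eqI)
  have Et: "E u \<in> range A" for u
    unfolding E_def using subspace_tangent[OF p] tan
    by (auto simp: A_def tangent_space_def[symmetric] intro!: subspace_sum subspace_scale)
  have AE: "A (pinv A (E u)) = E u" for u using Et[of u] A by auto
  have "linear (\<lambda>u. pinv A (E u))" using linear_compose[OF linE linear_pinv] by (simp add: o_def)
  moreover have "inj (\<lambda>u. pinv A (E u))" by (rule injI) (metis AE injE injD)
  ultimately have surj: "surj (\<lambda>u. pinv A (E u))" using linear_injective_imp_surjective by blast
  obtain u where "pinv A y = pinv A (E u)" using surj by (metis surjD)
  then have "tproj p y = E u" using AE by (simp add: tderiv_def A_def)
  moreover have "u \<bullet> j = y \<bullet> e j" if "j \<in> Basis" for j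
    using Ei[OF that, of u] \<open>tproj p y = E u\<close> tproj_orth[OF p tan[OF that], of y] by (simp add: inner_diff_left)
  ultimately show ?thesis unfolding E_def by simp
qed

text \<open>Differentiating \<open>N \<bullet> e i = 0\<close> along \<open>e i\<close> trades the
  derivative of \<open>N\<close> for that of the frame, whose normal parts add up to the mean
  curvature vector.\<close>

lemma divg_normal:
  assumes p: "p \<in> M" and h: "has_mean_curvature S p h" and N: "smooth_map_on S M N"
    and nor: "\<And>q t. q \<in> M \<Longrightarrow> t \<in> tangent_space S q \<Longrightarrow> N q \<bullet> t = 0"
  shows "divg N p = - (N p \<bullet> h)"
proof -
  obtain U e where U: "openin (mtop S) U" "p \<in> U" and fr: "orthonormal_frame S U e"
    and h_eq: "h = (\<Sum>i\<in>Basis. normal_proj S p (flat_deriv S (e i p) (e i) p))"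
    using h unfolding has_mean_curvature_def by blast
  have UM: "U \<subseteq> M" using U(1) openin_subset by blast
  have es: "\<And>i. i \<in> Basis \<Longrightarrow> smooth_map_on S U (e i)"
    and et: "\<And>i q. i \<in> Basis \<Longrightarrow> q \<in> U \<Longrightarrow> e i q \<in> tangent_space S q"
    and eo: "\<And>i j q. i \<in> Basis \<Longrightarrow> j \<in> Basis \<Longrightarrow> q \<in> U \<Longrightarrow> e i q \<bullet> e j q = (if i = j then 1 else 0)"
    using fr unfolding orthonormal_frame_def by blast+
  have NU: "smooth_map_on S U N" by (rule smooth_map_on_subset[OF N UM])
  have "tderiv N p y = (\<Sum>i\<in>Basis. (y \<bullet> e i p) *\<^sub>R tderiv N p (e i p))" for y
  proof -
    have "tderiv N p y = tderiv N p (\<Sum>i\<in>Basis. (y \<bullet> e i p) *\<^sub>R e i p)"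
      using tderiv_tproj[OF p, of N y] frame_expansion[OF p, of "\<lambda>i. e i p" y] et eo U(2) by simp
    then show ?thesis using tderiv_linear[OF U(2) p NU] by (simp add: linear_sum linear_scale)
  qed
  then have "tderiv N p = (\<lambda>y. \<Sum>i\<in>Basis. (y \<bullet> e i p) *\<^sub>R tderiv N p (e i p))" by (rule ext)
  then have "divg N p = tr (\<lambda>y. \<Sum>i\<in>Basis. (y \<bullet> e i p) *\<^sub>R tderiv N p (e i p))"
    unfolding divg_def by (rule arg_cong)
  also have "\<dots> = (\<Sum>i\<in>Basis. tr (\<lambda>y. (y \<bullet> e i p) *\<^sub>R tderiv N p (e i p)))" by (rule tr_sum)
  also have "(\<Sum>i\<in>Basis. tr (\<lambda>y. (y \<bullet> e i p) *\<^sub>R tderiv N p (e i p))) = (\<Sum>i\<in>Basis. - (N p \<bullet> normal_proj S p (flat_deriv S (e i p) (e i) p)))"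
  proof (intro sum.cong refl)
    fix i :: 'e assume i: "i \<in> Basis"
    have "tderiv (\<lambda>q. N q \<bullet> e i q) p (e i p) = tderiv (\<lambda>q. 0) p (e i p)"
      by (rule tderiv_cong[OF U]) (use nor et i UM in auto)
    then have "N p \<bullet> tderiv (e i) p (e i p) + tderiv N p (e i p) \<bullet> e i p = 0"
      using tderiv_bilinear[OF bounded_bilinear_inner U(2) p NU es[OF i]] tderiv_const[of "0::real" p] by simp
    moreover have "N p \<bullet> normal_proj S p (flat_deriv S (e i p) (e i) p) = N p \<bullet> tderiv (e i) p (e i p)"
      using nor[OF p tproj_in] flat_deriv_eq[OF p et[OF i U(2)]] by (simp add: normal_proj_eq[OF p] inner_diff_right)
    ultimately show "tr (\<lambda>y. (y \<bullet> e i p) *\<^sub>R tderiv N p (e i p)) = - (N p \<bullet> normal_proj S p (flat_deriv S (e i p) (e i) p))"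
      by (simp add: tr_rank_one inner_commute)
  qed
  also have "\<dots> = - (N p \<bullet> h)" unfolding h_eq by (simp add: inner_sum_right sum_negf)
  finally show ?thesis .
qed

end

locale shrinker = cimm S for S :: "('a, 'e::euclidean_space, 'v::euclidean_space) immersed" +
  assumes shrinker: "self_shrinker S"
begin

text \<open>For the normal part \<open>N\<close> of \<open>W\<close> the self-shrinker equation
  gives \<open>div N = X \<bullet> N / 2\<close>, so the integrand of \<open>W\<close> is that of
  its tangential part.\<close>

theorem integral_divergence:
  assumes W: "smooth_map_on S M W"
  shows "(LINT p|\<mu>S. (divg W p - X p \<bullet> W p / 2) * gauss p) = 0"
proof -
  define T where "T p = tproj p (W p)" for p
  define N where "N p = W p - T p" for p
  have Ts: "smooth_map_on S M T" unfolding T_def by (rule smooth_tderiv[OF smooth_pos W])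
  have Ns: "smooth_map_on S M N" unfolding N_def by (intro smooth_map_on_diff openin_M W Ts)
  have "divg W p - X p \<bullet> W p / 2 = divg T p - X p \<bullet> T p / 2" if p: "p \<in> M" for p
  proof -
    have nor: "N q \<bullet> t = 0" if "q \<in> M" "t \<in> tangent_space S q" for q t
      unfolding N_def T_def by (rule tproj_orth[OF that])
    have mc: "has_mean_curvature S p (- (1 / 2) *\<^sub>R normal_proj S p (X p))"
      using shrinker p by (simp add: self_shrinker_def)
    have "N p \<bullet> normal_proj S p (X p) = N p \<bullet> X p"
      using nor[OF p tproj_in] by (simp add: normal_proj_eq[OF p] inner_diff_right)
    then have "divg N p = X p \<bullet> N p / 2"
      using divg_normal[OF p mc Ns nor] by (simp add: inner_commute)
    moreover have "divg N p = divg W p - divg T p"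
      unfolding N_def by (rule divg_diff[OF p W Ts])
    ultimately show ?thesis by (simp add: N_def inner_diff_right diff_divide_distrib)
  qed
  then have "(LINT p|\<mu>S. (divg W p - X p \<bullet> W p / 2) * gauss p) = (LINT p|\<mu>S. (divg T p - X p \<bullet> T p / 2) * gauss p)"
    by (intro Bochner_Integration.integral_cong) auto
  also have "\<dots> = 0"
    by (rule integral_tangential_divergence[OF Ts]) (simp add: T_def tproj_in)
  finally show ?thesis .
qed

end

section \<open>Variations by reparametrization\<close>

lemma bounded_derivative_compact_support:
  fixes \<sigma> :: "'e::euclidean_space \<Rightarrow> 'e"
  assumes \<sigma>: "smooth_on \<sigma> UNIV" and K: "compact K" "\<And>x. x \<notin> K \<Longrightarrow> \<sigma> x = 0"
  obtains L where "L \<ge> 0" "\<And>x w. norm (frechet_derivative \<sigma> (at x) w) \<le> L * norm w"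
proof -
  define D where "D x = frechet_derivative \<sigma> (at x)" for x
  have lin: "linear (D x)" for x unfolding D_def by (rule smooth_on_linear_frechet[OF \<sigma>]) simp
  have D0: "D x w = 0" if "x \<notin> K" for x w
  proof -
    have "frechet_derivative \<sigma> (at x) = frechet_derivative (\<lambda>_. 0) (at x)"
      by (rule frechet_derivative_cong_open[of "- K"]) (use K that in \<open>auto simp: compact_imp_closed open_Compl\<close>)
    then show ?thesis by (simp add: D_def)
  qed
  have "\<exists>B\<ge>0. \<forall>x. norm (D x b) \<le> B" for b
  proof -
    have "continuous_on K (\<lambda>x. D x b)" unfolding D_def
      by (rule continuous_on_subset[OF smooth_on_imp_continuous_on[OF smooth_on_frechet_derivative[OF \<sigma>]]]) simp
    then have "bounded ((\<lambda>x. D x b) ` K)" using compact_continuous_image[OF _ K(1)] compact_imp_bounded by blast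
    then obtain B where "\<And>x. x \<in> K \<Longrightarrow> norm (D x b) \<le> B" by (auto simp: bounded_iff)
    then have "norm (D x b) \<le> max B 0" for x using D0[of x b] by (cases "x \<in> K") (auto simp: le_max_iff_disj)
    then show ?thesis by (intro exI[of _ "max B 0"]) simp
  qed
  then obtain B where B: "\<And>b. B b \<ge> 0" "\<And>b x. norm (D x b) \<le> B b" by metis
  show thesis
  proof (rule that)
    show "(\<Sum>b\<in>Basis. B b) \<ge> 0" by (intro sum_nonneg B)
    fix x w
    have "norm (D x w) = norm (\<Sum>b\<in>Basis. (w \<bullet> b) *\<^sub>R D x b)" using linear_basis_expansion[OF lin, of x w] by simp
    also have "\<dots> \<le> (\<Sum>b\<in>Basis. norm w * B b)"
      by (rule sum_norm_le) (use B Basis_le_norm in \<open>auto intro!: mult_mono\<close>)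
    finally show "norm (frechet_derivative \<sigma> (at x) w) \<le> (\<Sum>b\<in>Basis. B b) * norm w"
      by (simp add: D_def sum_distrib_left mult.commute)
  qed
qed

text \<open>For small \<open>s\<close> the map \<open>s \<sigma>\<close> contracts by 1/2.
  Injectivity of the perturbation and of its derivative follow at once, and Banach's fixed point
  theorem solves \<open>z = y + s \<sigma> z\<close> for surjectivity.\<close>

lemma perturbation_of_identity:
  fixes \<sigma> :: "'e::euclidean_space \<Rightarrow> 'e"
  assumes \<sigma>: "smooth_on \<sigma> UNIV" and K: "compact K" "\<And>x. x \<notin> K \<Longrightarrow> \<sigma> x = 0"
  obtains \<epsilon> where "\<epsilon> > 0" "\<And>s. \<bar>s\<bar> < \<epsilon> \<Longrightarrow> bij (\<lambda>x. x - s *\<^sub>R \<sigma> x)"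
    "\<And>s x. \<bar>s\<bar> < \<epsilon> \<Longrightarrow> inj (\<lambda>w. w - s *\<^sub>R frechet_derivative \<sigma> (at x) w)"
proof -
  obtain L where L: "L \<ge> 0" "\<And>x w. norm (frechet_derivative \<sigma> (at x) w) \<le> L * norm w"
    using bounded_derivative_compact_support[OF assms] by metis
  have lip: "norm (\<sigma> x - \<sigma> y) \<le> L * norm (x - y)" for x y
  proof (rule differentiable_bound[of UNIV \<sigma> "\<lambda>x. frechet_derivative \<sigma> (at x)"])
    show "(\<sigma> has_derivative frechet_derivative \<sigma> (at z)) (at z within UNIV)" for z
      using smooth_on_has_derivative[OF \<sigma>] by simp
    show "onorm (frechet_derivative \<sigma> (at z)) \<le> L" for z by (rule onorm_le) (rule L(2))
  qed auto
  \<comment> \<open>Chosen so that \<open>|s| * L \<le> 1/2\<close>; the summand 1 covers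
    \<open>L = 0\<close>.\<close>
  define \<epsilon> where "\<epsilon> = 1 / (2 * (L + 1))"
  have sL: "\<bar>s\<bar> * L \<le> 1 / 2" if "\<bar>s\<bar> < \<epsilon>" for s
  proof -
    have "\<bar>s\<bar> * L \<le> \<epsilon> * (L + 1)" using that L(1) by (intro mult_mono) auto
    also have "\<dots> = 1 / 2" using L(1) by (simp add: \<epsilon>_def field_simps)
    finally show ?thesis .
  qed
  have contr: "norm (s *\<^sub>R \<sigma> x - s *\<^sub>R \<sigma> y) \<le> 1 / 2 * norm (x - y)" if "\<bar>s\<bar> < \<epsilon>" for s x y
  proof -
    have "norm (s *\<^sub>R \<sigma> x - s *\<^sub>R \<sigma> y) = \<bar>s\<bar> * norm (\<sigma> x - \<sigma> y)" by (simp add: scaleR_diff_right[symmetric])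
    also have "\<dots> \<le> \<bar>s\<bar> * (L * norm (x - y))" by (intro mult_left_mono lip) simp
    also have "\<dots> \<le> 1 / 2 * norm (x - y)" using mult_right_mono[OF sL[OF that], of "norm (x - y)"] by (simp add: mult.assoc)
    finally show ?thesis .
  qed
  show thesis
  proof (rule that)
    show "\<epsilon> > 0" using L(1) by (simp add: \<epsilon>_def)
    fix s :: real assume s: "\<bar>s\<bar> < \<epsilon>"
    show "bij (\<lambda>x. x - s *\<^sub>R \<sigma> x)"
    proof (rule bijI)
      show "inj (\<lambda>x. x - s *\<^sub>R \<sigma> x)"
      proof (rule injI)
        fix x y assume "x - s *\<^sub>R \<sigma> x = y - s *\<^sub>R \<sigma> y"
        then have "x - y = s *\<^sub>R \<sigma> x - s *\<^sub>R \<sigma> y" by (simp add: algebra_simps)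
        then have "norm (x - y) \<le> 1 / 2 * norm (x - y)" using contr[OF s, of x y] by simp
        then show "x = y" by simp
      qed
      show "surj (\<lambda>x. x - s *\<^sub>R \<sigma> x)"
        unfolding surj_def
      proof
        fix y
        have "\<exists>!z\<in>UNIV. y + s *\<^sub>R \<sigma> z = z"
          by (rule Banach_fix[of UNIV "1/2"]) (use contr[OF s] in \<open>auto simp: dist_norm complete_UNIV\<close>)
        then obtain z where "y + s *\<^sub>R \<sigma> z = z" by blast
        then show "\<exists>z. y = z - s *\<^sub>R \<sigma> z" by (intro exI[of _ z]) (simp add: algebra_simps)
      qed
    qed
    fix x
    show "inj (\<lambda>w. w - s *\<^sub>R frechet_derivative \<sigma> (at x) w)"
    proof (rule injI)
      fix u w assume e: "u - s *\<^sub>R frechet_derivative \<sigma> (at x) u = w - s *\<^sub>R frechet_derivative \<sigma> (at x) w"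
      have "linear (frechet_derivative \<sigma> (at x))" by (rule smooth_on_linear_frechet[OF \<sigma>]) simp
      then have "frechet_derivative \<sigma> (at x) (u - w) = frechet_derivative \<sigma> (at x) u - frechet_derivative \<sigma> (at x) w"
        by (rule linear_diff)
      moreover have "u - w = s *\<^sub>R (frechet_derivative \<sigma> (at x) u - frechet_derivative \<sigma> (at x) w)"
        using e by (simp add: algebra_simps)
      ultimately have "u - w = s *\<^sub>R frechet_derivative \<sigma> (at x) (u - w)" by simp
      then have "norm (u - w) = \<bar>s\<bar> * norm (frechet_derivative \<sigma> (at x) (u - w))" by (metis norm_scaleR)
      also have "\<dots> \<le> \<bar>s\<bar> * (L * norm (u - w))" by (intro mult_left_mono L) simp
      also have "\<dots> \<le> 1 / 2 * norm (u - w)" using mult_right_mono[OF sL[OF s], of "norm (u - w)"] by (simp add: mult.assoc)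
      finally show "u = w" by simp
    qed
  qed
qed

text \<open>A point outside \<open>A\<close> is already the image of itself, so by injectivity
  nothing leaves \<open>A\<close>. Hence the perturbation maps the image of a chart onto itself and
  can be transplanted to the manifold.\<close>

lemma bij_betw_of_identity_outside:
  assumes "bij f" "\<And>x. x \<notin> A \<Longrightarrow> f x = x"
  shows "bij_betw f A A"
proof -
  have inj: "inj f" and surj: "surj f" using assms(1) by (simp_all add: bij_def)
  have "f x \<in> A" if "x \<in> A" for x
  proof (rule ccontr)
    assume "f x \<notin> A"
    then have "f x = x" using assms(2)[of "f x"] injD[OF inj, of "f x" x] by simp
    with \<open>f x \<notin> A\<close> that show False by simp
  qed
  moreover have "\<exists>x\<in>A. y = f x" if "y \<in> A" for y
    using surj assms(2) that by (metis surjD)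
  ultimately show ?thesis using inj by (auto simp: bij_betw_def inj_on_def inj_def)
qed

context mfd
begin

section \<open>Other position maps on the same manifold\<close>

lemma smooth_manifold_pos [simp]: "smooth_manifold (S\<lparr>pos := Z\<rparr>) \<longleftrightarrow> smooth_manifold S"
  and smooth_map_on_pos [simp]: "smooth_map_on (S\<lparr>pos := Z\<rparr>) N f \<longleftrightarrow> smooth_map_on S N f"
  and differential_pos [simp]: "differential (S\<lparr>pos := Z\<rparr>) g p = differential S g p"
  by (simp_all add: smooth_manifold_def smooth_map_on_def differential_def chart_at_def)

end

context imm
begin

lemma immersed_pos_iff:
  "immersed_submanifold (S\<lparr>pos := Z\<rparr>) \<longleftrightarrow>
    smooth_map_on S M Z \<and> (\<forall>p\<in>M. inj (differential S Z p))"
  by (simp add: immersed_submanifold_def smooth_mfd)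

lemma cimm_pos: "compact_space (mtop S) \<Longrightarrow> immersed_submanifold (S\<lparr>pos := Z\<rparr>) \<Longrightarrow> cimm (S\<lparr>pos := Z\<rparr>)"
  by unfold_locales (simp_all add: smooth_mfd)

end

context mfd
begin

lemma BorM_pos: "mfd.BorM (S\<lparr>pos := Z\<rparr>) = BorM"
proof -
  interpret Z: mfd "S\<lparr>pos := Z\<rparr>" by unfold_locales (simp add: smooth_mfd)
  show ?thesis by (simp add: BorM_def Z.BorM_def)
qed

text \<open>Joint smoothness in the parameter and the point, in the form that
  \<open>normal_variation\<close> demands.\<close>

definition jsmooth :: "real set \<Rightarrow> (real \<Rightarrow> 'a \<Rightarrow> 'b::real_normed_vector) \<Rightarrow> bool" where
  "jsmooth I g \<longleftrightarrow> (\<forall>c\<in>atlas S. smooth_on (\<lambda>(s, x). g s (cinv c x)) (I \<times> cdom c))"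

lemma jsmoothI:
  assumes "open I" "\<And>p. p \<in> M \<Longrightarrow> \<exists>c\<in>atlas S. \<exists>N. openin (mtop S) N \<and> p \<in> N \<and> N \<subseteq> fst c \<and>
     smooth_on (\<lambda>(s, x). g s (cinv c x)) (I \<times> snd c ` N)"
  shows "jsmooth I g"
  unfolding jsmooth_def
proof (intro ballI smooth_on_local)
  fix d sx assume d: "d \<in> atlas S" and sx: "sx \<in> I \<times> cdom d"
  then obtain p where p: "p \<in> fst d" "snd sx = snd d p" "fst sx \<in> I" by auto
  then have "p \<in> M" using chart_subset[OF d] by blast
  then obtain c N where c: "c \<in> atlas S" and N: "openin (mtop S) N" "p \<in> N" "N \<subseteq> fst c"
    "smooth_on (\<lambda>(s, x). g s (cinv c x)) (I \<times> snd c ` N)" using assms(2) by blast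
  have "open (I \<times> snd d ` (fst d \<inter> N))" by (intro open_Times assms(1) open_chart_Int d N)
  moreover have "sx \<in> I \<times> snd d ` (fst d \<inter> N)" using p N(2) by (cases sx) auto
  ultimately show "\<exists>T. open T \<and> sx \<in> T \<and> smooth_on (\<lambda>(s, x). g s (cinv d x)) T"
    using smooth_family_transfer[OF c d N(1,3) assms(1) N(4)] by blast
qed

lemma jsmoothD: "jsmooth I g \<Longrightarrow> c \<in> atlas S \<Longrightarrow> smooth_on (\<lambda>(s, x). g s (cinv c x)) (I \<times> cdom c)"
  by (simp add: jsmooth_def)

lemma jsmooth_slice:
  assumes "open I" "jsmooth I g" "s \<in> I"
  shows "smooth_map_on S M (g s)"
proof (rule smooth_map_onI_global)
  fix c assume c: "c \<in> atlas S"
  have img: "(\<lambda>x. (s, x)) ` cdom c \<subseteq> I \<times> cdom c" using assms(3) by auto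
  have "smooth_on (\<lambda>x. (\<lambda>(s, x). g s (cinv c x)) (s, x)) (cdom c)"
    by (rule smooth_on_compose[OF open_cdom[OF c] _ img _ jsmoothD[OF assms(2) c]])
      (auto intro!: open_Times assms(1) open_cdom c smooth_intros)
  then show "smooth_on (\<lambda>x. g s (cinv c x)) (snd c ` (fst c \<inter> M))"
    using chart_subset[OF c] by (simp add: Int_absorb2)
qed

text \<open>A coordinate map transplanted to the manifold and continued by the identity outside the
  chart.\<close>

definition chart_map :: "'a set \<times> ('a \<Rightarrow> 'e) \<Rightarrow> ('e \<Rightarrow> 'e) \<Rightarrow> 'a \<Rightarrow> 'a" where
  "chart_map c \<Psi> p = (if p \<in> fst c then cinv c (\<Psi> (snd c p)) else p)"

end

context cimm
begin

text \<open>The area density of an arbitrary immersion \<open>Z\<close> of the same manifold;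
  \<open>adens\<close> is the case of the given position.\<close>

definition dens :: "'a set \<times> ('a \<Rightarrow> 'e) \<Rightarrow> ('a \<Rightarrow> 'v) \<Rightarrow> 'e \<Rightarrow> real" where
  "dens c Z x = sqrt (det (gram (dloc c Z x)))"

context
  fixes Z :: "'a \<Rightarrow> 'v"
  assumes Z: "immersed_submanifold (S\<lparr>pos := Z\<rparr>)"
begin

interpretation Z: cimm "S\<lparr>pos := Z\<rparr>" by (rule cimm_pos[OF compact Z])

lemma dens_adens: "dens c Z x = Z.adens c x"
  by (simp add: dens_def Z.adens_def)

lemma dens_pos: "c \<in> atlas S \<Longrightarrow> x \<in> cdom c \<Longrightarrow> dens c Z x > 0"
  using Z.adens_pos[of c x] by (simp add: dens_adens)

lemma borel_dens:
  "c \<in> atlas S \<Longrightarrow> A \<in> sets borel \<Longrightarrow> A \<subseteq> cdom c \<Longrightarrow> (\<lambda>x. indicator A x * dens c Z x) \<in> borel_measurable borel"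
  using Z.borel_adens[of c A] by (simp add: dens_adens)

lemma space_pos: "space (area_measure (S\<lparr>pos := Z\<rparr>)) = M"
  and sets_pos: "sets (area_measure (S\<lparr>pos := Z\<rparr>)) = BorM"
  and emeasure_pos: "c \<in> atlas S \<Longrightarrow> B \<in> BorM \<Longrightarrow> B \<subseteq> fst c \<Longrightarrow>
    emeasure (area_measure (S\<lparr>pos := Z\<rparr>)) B = (\<integral>\<^sup>+x. ennreal (indicator (snd c ` B) x * dens c Z x) \<partial>lborel)"
  using Z.space_area Z.sets_area Z.emeasure_area[of c B] by (simp_all add: dens_adens BorM_pos)

lemma pos_smooth: "smooth_map_on S M Z"
  using Z by (simp add: immersed_pos_iff)

lemma pos_dloc: "c \<in> atlas S \<Longrightarrow> x \<in> cdom c \<Longrightarrow> linear (dloc c Z x)"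
  "c \<in> atlas S \<Longrightarrow> x \<in> cdom c \<Longrightarrow> inj (dloc c Z x)"
  using Z.dloc_pos_linear'[of c x] Z.dloc_pos_inj'[of c x] by simp_all

end

lemma immersed_posI:
  assumes Z: "smooth_map_on S M Z"
    and "\<And>p. p \<in> M \<Longrightarrow> \<exists>c\<in>atlas S. p \<in> fst c \<and> inj (dloc c Z (snd c p))"
  shows "immersed_submanifold (S\<lparr>pos := Z\<rparr>)"
  unfolding immersed_pos_iff
proof (intro conjI ballI Z)
  fix p assume p: "p \<in> M"
  then obtain c where "c \<in> atlas S" "p \<in> fst c" "inj (dloc c Z (snd c p))" using assms(2) by blast
  then show "inj (differential S Z p)"
    unfolding differential_dloc using inj_dloc_change[OF chart_at(1)[OF p] _ chart_at(2)[OF p] _ openin_M p Z] by blast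
qed

section \<open>Invariance of integrals under a diffeomorphism supported in one chart\<close>

context
  fixes c K and \<Psi> :: "'e \<Rightarrow> 'e"
  assumes c: "c \<in> atlas S" and K: "compactin (mtop S) K" "K \<subseteq> fst c"
    and \<Psi>: "smooth_on \<Psi> UNIV" "bij_betw \<Psi> (cdom c) (cdom c)"
      "\<And>x. inj (frechet_derivative \<Psi> (at x))" "\<And>p. p \<in> fst c - K \<Longrightarrow> \<Psi> (snd c p) = snd c p"
begin

abbreviation "\<psi> \<equiv> chart_map c \<Psi>"

lemma \<Psi>_cdom: "x \<in> cdom c \<Longrightarrow> \<Psi> x \<in> cdom c"
  using \<Psi>(2) bij_betw_apply by metis

lemma \<psi>_off: "p \<notin> K \<Longrightarrow> \<psi> p = p"
  using \<Psi>(4) c by (simp add: chart_map_def)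

lemma \<psi>_chart: "x \<in> cdom c \<Longrightarrow> \<psi> (cinv c x) = cinv c (\<Psi> x)"
  by (simp add: chart_map_def)

lemma \<psi>_M: "p \<in> M \<Longrightarrow> \<psi> p \<in> M"
  using \<Psi>_cdom chart_subset[OF c] by (auto simp: chart_map_def)

lemma open_off_K: "openin (mtop S) (M - K)"
  using compactin_closedin[OF K(1)] by (simp add: closedin_def)

lemma dloc_\<psi>:
  fixes Z :: "'a \<Rightarrow> 'v"
  assumes Z: "smooth_map_on S M Z" and x: "x \<in> cdom c"
  shows "dloc c (\<lambda>p. Z (\<psi> p)) x = (\<lambda>w. dloc c Z (\<Psi> x) (frechet_derivative \<Psi> (at x) w))"
proof (rule dloc_eqI)
  have "(local_rep c Z has_derivative dloc c Z (\<Psi> x)) (at (\<Psi> x))"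
    unfolding dloc_def by (rule smooth_on_has_derivative[OF smooth_map_onD'[OF Z c] \<Psi>_cdom[OF x]])
  from has_derivative_compose[OF smooth_on_has_derivative[OF \<Psi>(1) UNIV_I] this]
  have "((\<lambda>x. local_rep c Z (\<Psi> x)) has_derivative (\<lambda>w. dloc c Z (\<Psi> x) (frechet_derivative \<Psi> (at x) w))) (at x)" .
  then show "(local_rep c (\<lambda>p. Z (\<psi> p)) has_derivative (\<lambda>w. dloc c Z (\<Psi> x) (frechet_derivative \<Psi> (at x) w))) (at x)"
    by (rule has_derivative_transform_within_open[OF _ open_cdom[OF c] x]) (simp add: local_rep_def \<psi>_chart)
qed

lemma dloc_off:
  fixes Z :: "'a \<Rightarrow> 'v"
  assumes d: "d \<in> atlas S" and p: "p \<in> fst d" "p \<notin> K"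
  shows "dloc d (\<lambda>p. Z (\<psi> p)) (snd d p) = dloc d Z (snd d p)"
  unfolding dloc_def
proof (rule frechet_derivative_cong_open)
  show "open (snd d ` (fst d \<inter> (M - K)))" by (rule open_chart_Int[OF d open_off_K])
  show "snd d p \<in> snd d ` (fst d \<inter> (M - K))" using p subsetD[OF chart_subset[OF d]] by blast
  show "local_rep d (\<lambda>p. Z (\<psi> p)) y = local_rep d Z y" if "y \<in> snd d ` (fst d \<inter> (M - K))" for y
    using that d \<psi>_off by (auto simp: local_rep_def)
qed

lemma smooth_\<psi>:
  fixes Z :: "'a \<Rightarrow> 'v"
  assumes Z: "smooth_map_on S M Z"
  shows "smooth_map_on S M (\<lambda>p. Z (\<psi> p))"
proof (rule smooth_map_onI)
  fix p assume p: "p \<in> M"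
  show "\<exists>d\<in>atlas S. \<exists>N'. openin (mtop S) N' \<and> p \<in> N' \<and> N' \<subseteq> fst d \<and>
     smooth_on (\<lambda>x. Z (\<psi> (cinv d x))) (snd d ` N')"
  proof (cases "p \<in> fst c")
    case True
    have img: "\<Psi> ` cdom c \<subseteq> cdom c" using \<Psi>_cdom by blast
    have "smooth_on (\<lambda>x. local_rep c Z (\<Psi> x)) (cdom c)"
      by (rule smooth_on_compose[OF open_cdom[OF c] open_cdom[OF c] img smooth_on_subset[OF \<Psi>(1) subset_UNIV]
          smooth_map_onD'[OF Z c]])
    then have "smooth_on (\<lambda>x. Z (\<psi> (cinv c x))) (cdom c)"
      by (rule smooth_on_cong[OF open_cdom[OF c], rotated]) (simp add: local_rep_def \<psi>_chart)
    then show ?thesis using c True chart_openin[OF c] by blast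
  next
    case False
    obtain d where d: "d \<in> atlas S" "p \<in> fst d" using atlas_covers[OF p] by blast
    have o: "open (snd d ` (fst d \<inter> (M - K)))" by (rule open_chart_Int[OF d(1) open_off_K])
    have "smooth_on (\<lambda>x. Z (\<psi> (cinv d x))) (snd d ` (fst d \<inter> (M - K)))"
    proof (rule smooth_on_cong[OF o])
      show "smooth_on (\<lambda>x. Z (cinv d x)) (snd d ` (fst d \<inter> (M - K)))"
        by (rule smooth_on_subset[OF smooth_map_onD2[OF Z d(1)]]) auto
    qed (use d \<psi>_off in auto)
    moreover have "openin (mtop S) (fst d \<inter> (M - K))" by (intro openin_Int chart_openin d open_off_K)
    moreover have "p \<in> fst d \<inter> (M - K)" using d p False K(2) by blast
    ultimately show ?thesis using d(1) by blast
  qed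
qed

lemma immersed_\<psi>:
  fixes Z :: "'a \<Rightarrow> 'v"
  assumes Z: "immersed_submanifold (S\<lparr>pos := Z\<rparr>)"
  shows "immersed_submanifold (S\<lparr>pos := (\<lambda>p. Z (\<psi> p))\<rparr>)"
proof (rule immersed_posI[OF smooth_\<psi>[OF pos_smooth[OF Z]]])
  fix p assume p: "p \<in> M"
  show "\<exists>d\<in>atlas S. p \<in> fst d \<and> inj (dloc d (\<lambda>p. Z (\<psi> p)) (snd d p))"
  proof (cases "p \<in> fst c")
    case True
    have x: "snd c p \<in> cdom c" using True by blast
    have "inj (dloc c (\<lambda>p. Z (\<psi> p)) (snd c p))"
      unfolding dloc_\<psi>[OF pos_smooth[OF Z] x]
      using inj_compose[OF pos_dloc(2)[OF Z c \<Psi>_cdom[OF x]] \<Psi>(3)] by (simp add: o_def)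
    then show ?thesis using c True by blast
  next
    case False
    obtain d where d: "d \<in> atlas S" "p \<in> fst d" using atlas_covers[OF p] by blast
    have "p \<notin> K" using False K(2) by blast
    then have "inj (dloc d (\<lambda>p. Z (\<psi> p)) (snd d p))"
      using dloc_off[OF d, of Z] pos_dloc(2)[OF Z d(1), of "snd d p"] d by simp
    then show ?thesis using d by blast
  qed
qed

text \<open>In coordinates \<open>\<psi>\<close> is the continuous map \<open>\<Psi>\<close>, so
  preimages of Borel sets are Borel; off the chart \<open>\<psi>\<close> is the identity.
  Surjectivity of \<open>\<Psi>\<close> makes the image of the preimage the whole coordinate set, as
  the change of variables formula wants it.\<close>

lemma \<psi>_preimage:
  assumes B: "B \<in> BorM"
  shows "{p \<in> fst c. \<psi> p \<in> B} \<in> BorM" "snd c ` {p \<in> fst c. \<psi> p \<in> B} \<in> sets borel"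
    "\<Psi> ` snd c ` {p \<in> fst c. \<psi> p \<in> B} = snd c ` (B \<inter> fst c)" "{p \<in> M. \<psi> p \<in> B} = (B - fst c) \<union> {p \<in> fst c. \<psi> p \<in> B}"
proof -
  have m: "\<Psi> \<in> borel_measurable borel"
    by (rule borel_measurable_continuous_onI[OF smooth_on_imp_continuous_on[OF \<Psi>(1)]])
  have iff: "\<psi> p \<in> B \<longleftrightarrow> \<Psi> (snd c p) \<in> snd c ` (B \<inter> fst c)" if "p \<in> fst c" for p
  proof -
    have x: "\<Psi> (snd c p) \<in> cdom c" using that \<Psi>_cdom by blast
    have e: "\<psi> p = cinv c (\<Psi> (snd c p))" using that by (simp add: chart_map_def)
    show ?thesis
    proof
      assume "\<psi> p \<in> B"
      then show "\<Psi> (snd c p) \<in> snd c ` (B \<inter> fst c)"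
        using x by (intro image_eqI[of _ _ "\<psi> p"]) (simp_all add: e)
    next
      assume "\<Psi> (snd c p) \<in> snd c ` (B \<inter> fst c)"
      then show "\<psi> p \<in> B" using c by (auto simp: e)
    qed
  qed
  have set: "{p \<in> fst c. \<psi> p \<in> B} = {p \<in> fst c. snd c p \<in> \<Psi> -` (snd c ` (B \<inter> fst c))}" using iff by auto
  show 1: "{p \<in> fst c. \<psi> p \<in> B} \<in> BorM"
    unfolding set by (rule chart_preimage_BorM[OF c measurable_sets_borel[OF m chart_image_borel[OF c B]]])
  then show "snd c ` {p \<in> fst c. \<psi> p \<in> B} \<in> sets borel" by (rule chart_image_borel'[OF c]) auto
  show "\<Psi> ` snd c ` {p \<in> fst c. \<psi> p \<in> B} = snd c ` (B \<inter> fst c)"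
  proof (intro equalityI subsetI)
    fix y assume "y \<in> \<Psi> ` snd c ` {p \<in> fst c. \<psi> p \<in> B}"
    then show "y \<in> snd c ` (B \<inter> fst c)" using iff by auto
  next
    fix y assume y: "y \<in> snd c ` (B \<inter> fst c)"
    then have "y \<in> \<Psi> ` cdom c" using \<Psi>(2) by (auto simp: bij_betw_def)
    then obtain p where p: "p \<in> fst c" "y = \<Psi> (snd c p)" by auto
    then have "\<psi> p \<in> B" using iff y by simp
    then show "y \<in> \<Psi> ` snd c ` {p \<in> fst c. \<psi> p \<in> B}" using p by blast
  qed
  show "{p \<in> M. \<psi> p \<in> B} = (B - fst c) \<union> {p \<in> fst c. \<psi> p \<in> B}"
    using BorM_subset[OF B] chart_subset[OF c] by (auto simp: chart_map_def)
qed

text \<open>Off the chart neither the points nor the densities change. Inside the chart the Jacobian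
  of \<open>\<Psi>\<close> relates the two densities, and the change of variables formula
  applies.\<close>

lemma emeasure_\<psi>:
  fixes Z :: "'a \<Rightarrow> 'v"
  assumes Z: "immersed_submanifold (S\<lparr>pos := Z\<rparr>)" and d: "d \<in> atlas S" and B: "B \<in> BorM" "B \<subseteq> fst d"
  shows "emeasure (area_measure (S\<lparr>pos := (\<lambda>p. Z (\<psi> p))\<rparr>)) {p \<in> M. \<psi> p \<in> B} = emeasure (area_measure (S\<lparr>pos := Z\<rparr>)) B"
proof -
  define W where "W p = Z (\<psi> p)" for p
  have W: "immersed_submanifold (S\<lparr>pos := W\<rparr>)" unfolding W_def by (rule immersed_\<psi>[OF Z])
  have B1: "{p \<in> fst c. \<psi> p \<in> B} \<in> BorM" and B1b: "snd c ` {p \<in> fst c. \<psi> p \<in> B} \<in> sets borel"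
    and B1i: "\<Psi> ` snd c ` {p \<in> fst c. \<psi> p \<in> B} = snd c ` (B \<inter> fst c)"
    using \<psi>_preimage[OF B(1)] by blast+
  have Bc: "B \<inter> fst c \<in> BorM" and B2: "B - fst c \<in> BorM"
    by (intro BorM_Int BorM_Diff B chart_BorM c)+
  have e2: "emeasure (area_measure (S\<lparr>pos := W\<rparr>)) (B - fst c) = emeasure (area_measure (S\<lparr>pos := Z\<rparr>)) (B - fst c)"
  proof -
    have sub: "B - fst c \<subseteq> fst d" using B by blast
    have ieq: "indicator (snd d ` (B - fst c)) x * dens d W x = indicator (snd d ` (B - fst c)) x * dens d Z x" for x
    proof (cases "x \<in> snd d ` (B - fst c)")
      case True
      then obtain p where "p \<in> B - fst c" "x = snd d p" by blast
      then have "p \<in> fst d" "p \<notin> K" and x: "x = snd d p" using B(2) K(2) by auto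
      then show ?thesis unfolding x dens_def W_def using dloc_off[OF d, of p Z] by simp
    qed simp
    show ?thesis unfolding emeasure_pos[OF W d B2 sub] emeasure_pos[OF Z d B2 sub] ieq ..
  qed
  have e1: "emeasure (area_measure (S\<lparr>pos := W\<rparr>)) {p \<in> fst c. \<psi> p \<in> B} = emeasure (area_measure (S\<lparr>pos := Z\<rparr>)) (B \<inter> fst c)"
  proof -
    have dW: "dens c W x = \<bar>det (mat_of (frechet_derivative \<Psi> (at x)))\<bar> * dens c Z (\<Psi> x)" if x: "x \<in> cdom c" for x
    proof -
      have "dloc c W x = dloc c Z (\<Psi> x) \<circ> frechet_derivative \<Psi> (at x)"
        unfolding W_def by (subst dloc_\<psi>[OF pos_smooth[OF Z] x]) (simp add: o_def)
      then show ?thesis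
        using det_gram_compose[OF pos_dloc(1)[OF Z c \<Psi>_cdom[OF x]] smooth_on_linear_frechet[OF \<Psi>(1) UNIV_I]]
        by (simp add: dens_def real_sqrt_mult)
    qed
    have eq: "indicator (snd c ` {p \<in> fst c. \<psi> p \<in> B}) x * (\<bar>det (mat_of (frechet_derivative \<Psi> (at x)))\<bar> * dens c Z (\<Psi> x))
      = indicator (snd c ` {p \<in> fst c. \<psi> p \<in> B}) x * dens c W x" for x
      using dW[of x] by (cases "x \<in> snd c ` {p \<in> fst c. \<psi> p \<in> B}") auto
    have "(\<integral>\<^sup>+y. ennreal (indicator (\<Psi> ` snd c ` {p \<in> fst c. \<psi> p \<in> B}) y * dens c Z y) \<partial>lborel)
      = (\<integral>\<^sup>+x. ennreal (indicator (snd c ` {p \<in> fst c. \<psi> p \<in> B}) x * (\<bar>det (mat_of (frechet_derivative \<Psi> (at x)))\<bar> * dens c Z (\<Psi> x))) \<partial>lborel)"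
    proof (rule change_of_variables_euclidean[OF B1b])
      show "\<Psi> ` snd c ` {p \<in> fst c. \<psi> p \<in> B} \<in> sets borel" unfolding B1i by (rule chart_image_borel[OF c B(1)])
      show "(\<Psi> has_derivative frechet_derivative \<Psi> (at x)) (at x)" for x by (rule smooth_on_has_derivative[OF \<Psi>(1) UNIV_I])
      show "inj_on \<Psi> (snd c ` {p \<in> fst c. \<psi> p \<in> B})" by (rule inj_on_subset[OF bij_betw_imp_inj_on[OF \<Psi>(2)]]) auto
      show "dens c Z y \<ge> 0" if "y \<in> \<Psi> ` snd c ` {p \<in> fst c. \<psi> p \<in> B}" for y
        using dens_pos[OF Z c, of y] that unfolding B1i by auto
      show "(\<lambda>y. indicator (\<Psi> ` snd c ` {p \<in> fst c. \<psi> p \<in> B}) y * dens c Z y) \<in> borel_measurable borel"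
        unfolding B1i by (rule borel_dens[OF Z c chart_image_borel[OF c B(1)]]) auto
      show "(\<lambda>x. indicator (snd c ` {p \<in> fst c. \<psi> p \<in> B}) x * (\<bar>det (mat_of (frechet_derivative \<Psi> (at x)))\<bar> * dens c Z (\<Psi> x))) \<in> borel_measurable borel"
        unfolding eq by (rule borel_dens[OF W c B1b]) auto
    qed
    then show ?thesis
      unfolding eq unfolding B1i using emeasure_pos[OF W c B1] emeasure_pos[OF Z c Bc] by simp
  qed
  have "emeasure (area_measure (S\<lparr>pos := W\<rparr>)) {p \<in> M. \<psi> p \<in> B} =
     emeasure (area_measure (S\<lparr>pos := W\<rparr>)) (B - fst c) + emeasure (area_measure (S\<lparr>pos := W\<rparr>)) {p \<in> fst c. \<psi> p \<in> B}"
    unfolding \<psi>_preimage(4)[OF B(1)]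
    by (rule plus_emeasure[symmetric]) (use B1 B2 sets_pos[OF W] in auto)
  also have "\<dots> = emeasure (area_measure (S\<lparr>pos := Z\<rparr>)) (B - fst c) + emeasure (area_measure (S\<lparr>pos := Z\<rparr>)) (B \<inter> fst c)"
    unfolding e1 e2 ..
  also have "\<dots> = emeasure (area_measure (S\<lparr>pos := Z\<rparr>)) ((B - fst c) \<union> (B \<inter> fst c))"
    by (rule plus_emeasure) (use Bc B2 sets_pos[OF Z] in auto)
  also have "(B - fst c) \<union> (B \<inter> fst c) = B" by blast
  finally show ?thesis by (simp add: W_def)
qed

text \<open>The area measure of \<open>Z\<close> is the image under \<open>\<psi>\<close> of that of
  \<open>Z \<circ> \<psi>\<close>, so all integrals of functions of the position agree, in
  particular the values of \<open>F\<close>.\<close>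

lemma integral_\<psi>:
  fixes Z :: "'a \<Rightarrow> 'v" and h :: "'v \<Rightarrow> real"
  assumes Z: "immersed_submanifold (S\<lparr>pos := Z\<rparr>)" and h: "continuous_on UNIV h"
  shows "(LINT p|area_measure (S\<lparr>pos := (\<lambda>p. Z (\<psi> p))\<rparr>). h (Z (\<psi> p))) = (LINT p|area_measure (S\<lparr>pos := Z\<rparr>). h (Z p))"
proof -
  let ?\<mu>W = "area_measure (S\<lparr>pos := (\<lambda>p. Z (\<psi> p))\<rparr>)" and ?\<mu>Z = "area_measure (S\<lparr>pos := Z\<rparr>)"
  note W = immersed_\<psi>[OF Z]
  interpret Z: cimm "S\<lparr>pos := Z\<rparr>" by (rule cimm_pos[OF compact Z])
  have pre: "\<psi> -` B \<inter> space ?\<mu>W = {p \<in> M. \<psi> p \<in> B}" for B by (auto simp: space_pos[OF W])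
  have m: "\<psi> \<in> measurable ?\<mu>W ?\<mu>Z"
  proof (rule measurableI)
    show "\<psi> p \<in> space ?\<mu>Z" if "p \<in> space ?\<mu>W" for p using that \<psi>_M by (simp add: space_pos W Z)
    show "\<psi> -` B \<inter> space ?\<mu>W \<in> sets ?\<mu>W" if "B \<in> sets ?\<mu>Z" for B
    proof -
      have B: "B \<in> BorM" using that sets_pos[OF Z] by simp
      have "(B - fst c) \<union> {p \<in> fst c. \<psi> p \<in> B} \<in> BorM"
        by (intro BorM_Un BorM_Diff B chart_BorM c \<psi>_preimage(1))
      then show ?thesis unfolding pre \<psi>_preimage(4)[OF B] sets_pos[OF W] .
    qed
  qed
  have "distr ?\<mu>W ?\<mu>Z \<psi> = ?\<mu>Z"
  proof (rule emeasure_eq_on_charts[OF compact])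
    fix d B assume d: "d \<in> atlas S" and B: "B \<in> BorM" "B \<subseteq> fst d"
    show "emeasure (distr ?\<mu>W ?\<mu>Z \<psi>) B = emeasure ?\<mu>Z B"
      using emeasure_\<psi>[OF Z d B] B sets_pos[OF Z] by (subst emeasure_distr[OF m]) (simp_all add: pre)
  qed (simp_all add: BorM_pos)
  then have "(LINT p|?\<mu>Z. h (Z p)) = (LINT p|distr ?\<mu>W ?\<mu>Z \<psi>. h (Z p))" by simp
  also have "\<dots> = (LINT p|?\<mu>W. h (Z (\<psi> p)))"
  proof (rule integral_distr[OF m])
    have "continuous_map (mtop S) euclidean (h \<circ> Z)"
      by (rule continuous_map_compose[OF smooth_imp_continuous_map[OF pos_smooth[OF Z]]]) (use h in simp)
    then show "(\<lambda>p. h (Z p)) \<in> borel_measurable ?\<mu>Z"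
      using Z.borel_continuous[of "h \<circ> Z"] by (simp add: o_def)
  qed
  finally show ?thesis by simp
qed

end

text \<open>Only what the diffeomorphisms \<open>\<phi> s\<close>, with velocity \<open>- T\<close> at \<open>s = 0\<close>, do to smooth families and to
  integrals is recorded. These properties pass to compositions, so a flow is assembled from one
  diffeomorphism \<open>x \<mapsto> x - s \<sigma> x\<close> per chart and no ordinary differential equation has to be solved.\<close>

definition flow :: "real \<Rightarrow> (real \<Rightarrow> 'a \<Rightarrow> 'a) \<Rightarrow> ('a \<Rightarrow> 'v) \<Rightarrow> bool" where
  "flow \<epsilon> \<phi> T \<longleftrightarrow> \<epsilon> > 0 \<and> (\<forall>p\<in>M. \<phi> 0 p = p) \<and>
     (\<forall>\<delta> (g :: real \<Rightarrow> 'a \<Rightarrow> 'v). 0 < \<delta> \<and> \<delta> \<le> \<epsilon> \<and> jsmooth {-\<delta><..<\<delta>} g \<longrightarrow>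
        jsmooth {-\<delta><..<\<delta>} (\<lambda>s p. g s (\<phi> s p)) \<and>
        (\<forall>p\<in>M. ((\<lambda>s. g s (\<phi> s p)) has_vector_derivative
           (vector_derivative (\<lambda>s. g s p) (at 0) - tderiv (g 0) p (T p))) (at 0))) \<and>
     (\<forall>s Z. \<bar>s\<bar> < \<epsilon> \<and> immersed_submanifold (S\<lparr>pos := Z\<rparr>) \<longrightarrow>
        immersed_submanifold (S\<lparr>pos := (\<lambda>p. Z (\<phi> s p))\<rparr>) \<and>
        (\<forall>h :: 'v \<Rightarrow> real. continuous_on UNIV h \<longrightarrow>
           (LINT p|area_measure (S\<lparr>pos := (\<lambda>p. Z (\<phi> s p))\<rparr>). h (Z (\<phi> s p))) =
           (LINT p|area_measure (S\<lparr>pos := Z\<rparr>). h (Z p))))"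

lemma jsmooth_has_vector_derivative:
  fixes g :: "real \<Rightarrow> 'a \<Rightarrow> 'v"
  assumes "\<delta> > 0" "jsmooth {-\<delta><..<\<delta>} g" "p \<in> M"
  shows "((\<lambda>s. g s p) has_vector_derivative vector_derivative (\<lambda>s. g s p) (at 0)) (at 0)"
proof -
  obtain c where c: "c \<in> atlas S" "p \<in> fst c" using atlas_covers[OF assms(3)] by blast
  have mem: "(0, snd c p) \<in> {-\<delta><..<\<delta>} \<times> cdom c" using assms(1) c by auto
  have "(\<lambda>(s, x). g s (cinv c x)) differentiable at (0, snd c p)"
    by (rule smooth_on_differentiable[OF jsmoothD[OF assms(2) c(1)] mem])
  moreover have "(\<lambda>s::real. (s, snd c p)) differentiable at 0"
    unfolding differentiable_def by (rule exI[where x="\<lambda>s. (s, 0)"]) (auto intro!: derivative_eq_intros)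
  ultimately have "((\<lambda>(s, x). g s (cinv c x)) \<circ> (\<lambda>s. (s, snd c p))) differentiable at 0"
    by (intro differentiable_chain_at) auto
  then have "(\<lambda>s. g s p) differentiable at 0" using c by (simp add: o_def)
  then show ?thesis by (simp add: vector_derivative_works)
qed

text \<open>Base case for adding up velocities over a partition of unity.\<close>

lemma flow_zero: "flow 1 (\<lambda>s p. p) (\<lambda>p. 0)"
proof -
  have "((\<lambda>s. g s p) has_vector_derivative (vector_derivative (\<lambda>s. g s p) (at 0) - tderiv (g 0) p 0)) (at 0)"
    if "0 < \<delta>" "jsmooth {- \<delta><..<\<delta>} g" "p \<in> M" for \<delta> p and g :: "real \<Rightarrow> 'a \<Rightarrow> 'v"
  proof -
    have "smooth_map_on S M (g 0)" by (rule jsmooth_slice[OF _ that(2)]) (use that(1) in auto)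
    then have "tderiv (g 0) p 0 = 0" by (rule linear_0[OF tderiv_linear[OF that(3,3)]])
    then show ?thesis using jsmooth_has_vector_derivative[OF that] by simp
  qed
  then show ?thesis unfolding flow_def by auto
qed

text \<open>Both diffeomorphisms are the identity at \<open>s = 0\<close>, so their velocities add
  there. The smaller parameter range keeps the properties of both.\<close>

lemma flow_comp:
  assumes 1: "flow \<epsilon>1 \<phi>1 T1" and 2: "flow \<epsilon>2 \<phi>2 T2"
  shows "flow (min \<epsilon>1 \<epsilon>2) (\<lambda>s p. \<phi>1 s (\<phi>2 s p)) (\<lambda>p. T1 p + T2 p)"
  unfolding flow_def
proof (intro conjI allI ballI impI)
  show "min \<epsilon>1 \<epsilon>2 > 0" using 1 2 by (simp add: flow_def)
  show "\<phi>1 0 (\<phi>2 0 p) = p" if "p \<in> M" for p using 1 2 that by (simp add: flow_def)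
next
  fix \<delta> and g :: "real \<Rightarrow> 'a \<Rightarrow> 'v"
  assume a: "0 < \<delta> \<and> \<delta> \<le> min \<epsilon>1 \<epsilon>2 \<and> jsmooth {-\<delta><..<\<delta>} g"
  \<comment> \<open>The family composed with the first diffeomorphism is admissible for the second
    one and has the same map at \<open>s = 0\<close>.\<close>
  define G where "G s p = g s (\<phi>1 s p)" for s p
  have G: "jsmooth {-\<delta><..<\<delta>} G"
    and dG: "\<And>p. p \<in> M \<Longrightarrow> ((\<lambda>s. G s p) has_vector_derivative
       (vector_derivative (\<lambda>s. g s p) (at 0) - tderiv (g 0) p (T1 p))) (at 0)"
    using 1 a unfolding flow_def G_def by auto
  show "jsmooth {-\<delta><..<\<delta>} (\<lambda>s p. g s (\<phi>1 s (\<phi>2 s p)))"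
    using 2 a G unfolding flow_def G_def[symmetric] by auto
  fix p assume p: "p \<in> M"
  have "((\<lambda>s. G s (\<phi>2 s p)) has_vector_derivative
     (vector_derivative (\<lambda>s. G s p) (at 0) - tderiv (G 0) p (T2 p))) (at 0)"
    using 2 a G p unfolding flow_def by auto
  moreover have "vector_derivative (\<lambda>s. G s p) (at 0) = vector_derivative (\<lambda>s. g s p) (at 0) - tderiv (g 0) p (T1 p)"
    by (rule vector_derivative_at[OF dG[OF p]])
  moreover have "tderiv (G 0) p (T2 p) = tderiv (g 0) p (T2 p)"
    by (rule tderiv_cong[OF openin_M p]) (use 1 in \<open>simp add: flow_def G_def\<close>)
  moreover have "tderiv (g 0) p (T1 p + T2 p) = tderiv (g 0) p (T1 p) + tderiv (g 0) p (T2 p)"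
    using jsmooth_slice[of "{-\<delta><..<\<delta>}" g 0] a by (intro linear_add tderiv_linear[OF p p]) simp
  ultimately show "((\<lambda>s. g s (\<phi>1 s (\<phi>2 s p))) has_vector_derivative
     (vector_derivative (\<lambda>s. g s p) (at 0) - tderiv (g 0) p (T1 p + T2 p))) (at 0)"
    by (simp add: G_def diff_diff_eq)
next
  fix s Z assume a: "\<bar>s\<bar> < min \<epsilon>1 \<epsilon>2 \<and> immersed_submanifold (S\<lparr>pos := Z\<rparr>)"
  define Z1 where "Z1 p = Z (\<phi>1 s p)" for p
  have Z1: "immersed_submanifold (S\<lparr>pos := Z1\<rparr>)"
    and h1: "\<And>h :: 'v \<Rightarrow> real. continuous_on UNIV h \<Longrightarrow>
       (LINT p|area_measure (S\<lparr>pos := Z1\<rparr>). h (Z1 p)) = (LINT p|area_measure (S\<lparr>pos := Z\<rparr>). h (Z p))"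
    using 1 a unfolding flow_def Z1_def by auto
  show "immersed_submanifold (S\<lparr>pos := (\<lambda>p. Z (\<phi>1 s (\<phi>2 s p)))\<rparr>)"
    using 2 a Z1 unfolding flow_def Z1_def[symmetric] by auto
  fix h :: "'v \<Rightarrow> real" assume h: "continuous_on UNIV h"
  have "(LINT p|area_measure (S\<lparr>pos := (\<lambda>p. Z1 (\<phi>2 s p))\<rparr>). h (Z1 (\<phi>2 s p))) = (LINT p|area_measure (S\<lparr>pos := Z1\<rparr>). h (Z1 p))"
    using 2 a Z1 h unfolding flow_def by auto
  then show "(LINT p|area_measure (S\<lparr>pos := (\<lambda>p. Z (\<phi>1 s (\<phi>2 s p)))\<rparr>). h (Z (\<phi>1 s (\<phi>2 s p)))) =
     (LINT p|area_measure (S\<lparr>pos := Z\<rparr>). h (Z p))"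
    using h1[OF h] by (simp add: Z1_def)
qed

text \<open>\<open>\<sigma>\<close> is the field \<open>T\<close> in coordinates, extended by zero.
  The maps \<open>x - s \<sigma> x\<close> form no one-parameter group, but only their velocity at
  \<open>s = 0\<close> is asked for.\<close>

lemma flow_local:
  assumes c: "c \<in> atlas S" and K: "compactin (mtop S) K" "K \<subseteq> fst c"
    and T: "smooth_map_on S M T" and tan: "\<And>q. q \<in> M \<Longrightarrow> T q \<in> tangent_space S q"
    and z: "\<And>q. q \<notin> K \<Longrightarrow> T q = 0"
  shows "\<exists>\<epsilon> \<phi>. flow \<epsilon> \<phi> T"
proof -
  define \<tau> where "\<tau> x = pinv (dloc c X x) (T (cinv c x))" for x
  define \<sigma> where "\<sigma> x = (if x \<in> cdom c then \<tau> x else 0)" for x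
  have \<tau>s: "smooth_on \<tau> (cdom c)"
    using smooth_pinv_chart[OF c smooth_map_onD'[OF T c]] by (simp add: local_rep_def \<tau>_def[abs_def])
  have cK: "compact (snd c ` K)" and KD: "snd c ` K \<subseteq> cdom c" using compact_chart_image[OF c K] K by auto
  have \<tau>0: "\<tau> (snd c p) = 0" if "p \<in> fst c - K" for p
    using that z[of p] c linear_0[OF linear_pinv[of "dloc c X (snd c p)"]] by (simp add: \<tau>_def)
  have \<tau>0': "\<tau> x = 0" if x: "x \<in> cdom c - snd c ` K" for x
  proof -
    have "cinv c x \<in> fst c - K" using x by (metis Diff_iff chart_cinv cinv_in image_eqI)
    then show ?thesis using \<tau>0[of "cinv c x"] x by simp
  qed
  have \<sigma>s: "smooth_on \<sigma> UNIV" unfolding \<sigma>_def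
    by (rule extend_by_zero_smooth[OF open_cdom[OF c] cK KD \<tau>s \<tau>0'])
  have \<sigma>0: "\<sigma> x = 0" if "x \<notin> snd c ` K" for x using that \<tau>0' by (simp add: \<sigma>_def)
  obtain \<epsilon> where \<epsilon>: "\<epsilon> > 0" "\<And>s. \<bar>s\<bar> < \<epsilon> \<Longrightarrow> bij (\<lambda>x. x - s *\<^sub>R \<sigma> x)"
    "\<And>s x. \<bar>s\<bar> < \<epsilon> \<Longrightarrow> inj (\<lambda>w. w - s *\<^sub>R frechet_derivative \<sigma> (at x) w)"
    using perturbation_of_identity[OF \<sigma>s cK \<sigma>0] by metis
  define \<Psi> where "\<Psi> s x = x - s *\<^sub>R \<sigma> x" for s x
  define \<phi> where "\<phi> s = chart_map c (\<Psi> s)" for s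
  have \<Psi>1: "smooth_on (\<Psi> s) UNIV" for s unfolding \<Psi>_def by (intro smooth_intros \<sigma>s open_UNIV)
  have \<Psi>2: "bij_betw (\<Psi> s) (cdom c) (cdom c)" if "\<bar>s\<bar> < \<epsilon>" for s
  proof -
    have "bij (\<Psi> s)" unfolding \<Psi>_def by (rule \<epsilon>(2)[OF that])
    moreover have "\<Psi> s x = x" if "x \<notin> cdom c" for x using that by (simp add: \<Psi>_def \<sigma>_def)
    ultimately show ?thesis by (rule bij_betw_of_identity_outside)
  qed
  have \<Psi>3: "inj (frechet_derivative (\<Psi> s) (at x))" if "\<bar>s\<bar> < \<epsilon>" for s x
  proof -
    have "(\<Psi> s has_derivative (\<lambda>w. w - s *\<^sub>R frechet_derivative \<sigma> (at x) w)) (at x)"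
      unfolding \<Psi>_def by (intro derivative_intros smooth_on_has_derivative[OF \<sigma>s UNIV_I])
    then have "frechet_derivative (\<Psi> s) (at x) = (\<lambda>w. w - s *\<^sub>R frechet_derivative \<sigma> (at x) w)"
      using frechet_derivative_at by metis
    then show ?thesis using \<epsilon>(3)[OF that] by simp
  qed
  have \<Psi>4: "\<Psi> s (snd c p) = snd c p" if "p \<in> fst c - K" for s p
    using \<tau>0[OF that] by (simp add: \<Psi>_def \<sigma>_def)
  have \<phi>off: "\<phi> s p = p" if "p \<notin> K" for s p
    using \<Psi>4 c that by (simp add: \<phi>_def chart_map_def)
  have \<phi>c: "\<phi> s (cinv c x) = cinv c (\<Psi> s x)" if "x \<in> cdom c" for s x
    using that by (simp add: \<phi>_def chart_map_def)
  have oK: "openin (mtop S) (M - K)" using compactin_closedin[OF K(1)] by (simp add: closedin_def)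
  have "flow \<epsilon> \<phi> T"
    unfolding flow_def
  proof (intro conjI allI ballI impI)
    show "\<epsilon> > 0" by fact
    show "\<phi> 0 p = p" if "p \<in> M" for p using c by (simp add: \<phi>_def chart_map_def \<Psi>_def)
  next
    fix s and Z :: "'a \<Rightarrow> 'v" assume a: "\<bar>s\<bar> < \<epsilon> \<and> immersed_submanifold (S\<lparr>pos := Z\<rparr>)"
    then have s: "\<bar>s\<bar> < \<epsilon>" and Z: "immersed_submanifold (S\<lparr>pos := Z\<rparr>)" by auto
    show "immersed_submanifold (S\<lparr>pos := (\<lambda>p. Z (\<phi> s p))\<rparr>)"
      unfolding \<phi>_def by (rule immersed_\<psi>[OF c K \<Psi>1 \<Psi>2[OF s] \<Psi>3[OF s] \<Psi>4 Z])
    fix h :: "'v \<Rightarrow> real" assume h: "continuous_on UNIV h"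
    show "(LINT p|area_measure (S\<lparr>pos := (\<lambda>p. Z (\<phi> s p))\<rparr>). h (Z (\<phi> s p))) = (LINT p|area_measure (S\<lparr>pos := Z\<rparr>). h (Z p))"
      unfolding \<phi>_def by (rule integral_\<psi>[OF c K \<Psi>1 \<Psi>2[OF s] \<Psi>3[OF s] \<Psi>4 Z h])
  next
    fix \<delta> and g :: "real \<Rightarrow> 'a \<Rightarrow> 'v"
    assume a: "0 < \<delta> \<and> \<delta> \<le> \<epsilon> \<and> jsmooth {-\<delta><..<\<delta>} g"
    then have \<delta>: "0 < \<delta>" "\<delta> \<le> \<epsilon>" and g: "jsmooth {-\<delta><..<\<delta>} g" by auto
    let ?I = "{-\<delta><..<\<delta>}"
    have oI: "open (?I \<times> cdom c)" by (intro open_Times open_cdom c) simp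
    have img: "(\<lambda>sx. (fst sx, \<Psi> (fst sx) (snd sx))) ` (?I \<times> cdom c) \<subseteq> ?I \<times> cdom c"
    proof (rule image_subsetI)
      fix sx assume "sx \<in> ?I \<times> cdom c"
      then have sx: "fst sx \<in> ?I" "snd sx \<in> cdom c" by auto
      then have "\<bar>fst sx\<bar> < \<epsilon>" using \<delta> by (auto simp: abs_less_iff)
      then show "(fst sx, \<Psi> (fst sx) (snd sx)) \<in> ?I \<times> cdom c"
        using bij_betw_apply[OF \<Psi>2, of "fst sx" "snd sx"] sx by auto
    qed
    have "smooth_on (\<lambda>sx. \<sigma> (snd sx)) (?I \<times> cdom c)"
      by (rule smooth_on_compose[OF oI open_UNIV subset_UNIV _ \<sigma>s]) (intro smooth_intros oI)
    then have sm: "smooth_on (\<lambda>sx. (fst sx, \<Psi> (fst sx) (snd sx))) (?I \<times> cdom c)"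
      unfolding \<Psi>_def by (intro smooth_intros oI)
    have comp: "smooth_on (\<lambda>sx. (\<lambda>(s, x). g s (cinv c x)) (fst sx, \<Psi> (fst sx) (snd sx))) (?I \<times> cdom c)"
      by (rule smooth_on_compose[OF oI oI img sm jsmoothD[OF g c]])
    show "jsmooth ?I (\<lambda>s p. g s (\<phi> s p))"
    proof (rule jsmoothI)
      fix p assume p: "p \<in> M"
      show "\<exists>d\<in>atlas S. \<exists>N. openin (mtop S) N \<and> p \<in> N \<and> N \<subseteq> fst d \<and>
        smooth_on (\<lambda>(s, x). g s (\<phi> s (cinv d x))) (?I \<times> snd d ` N)"
      proof (cases "p \<in> fst c")
        case True
        have "smooth_on (\<lambda>(s, x). g s (\<phi> s (cinv c x))) (?I \<times> cdom c)"
          by (rule smooth_on_cong[OF oI _ comp]) (auto simp: \<phi>c)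
        then show ?thesis using True c chart_openin[OF c] by blast
      next
        case False
        obtain d where d: "d \<in> atlas S" "p \<in> fst d" using atlas_covers[OF p] by blast
        let ?N = "fst d \<inter> (M - K)"
        have o: "open (?I \<times> snd d ` ?N)" by (intro open_Times open_chart_Int d oK) simp
        have "smooth_on (\<lambda>(s, x). g s (cinv d x)) (?I \<times> snd d ` ?N)"
          by (rule smooth_on_subset[OF jsmoothD[OF g d(1)]]) auto
        then have "smooth_on (\<lambda>(s, x). g s (\<phi> s (cinv d x))) (?I \<times> snd d ` ?N)"
          by (rule smooth_on_cong[OF o, rotated]) (use d \<phi>off in auto)
        moreover have "openin (mtop S) ?N" by (intro openin_Int chart_openin d oK)
        moreover have "p \<in> ?N" using d p False K(2) by blast
        ultimately show ?thesis using d(1) by blast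
      qed
    qed simp
    fix p assume p: "p \<in> M"
    show "((\<lambda>s. g s (\<phi> s p)) has_vector_derivative
       (vector_derivative (\<lambda>s. g s p) (at 0) - tderiv (g 0) p (T p))) (at 0)"
    proof (cases "p \<in> fst c")
      case False
      then have "p \<notin> K" using K(2) by blast
      moreover have "tderiv (g 0) p 0 = 0"
        using \<delta> by (intro linear_0 tderiv_linear[OF p p] jsmooth_slice[OF _ g]) auto
      ultimately show ?thesis
        using jsmooth_has_vector_derivative[OF \<delta>(1) g p] z[of p] by (simp add: \<phi>off)
    next
      case True
      define x where "x = snd c p"
      have x: "x \<in> cdom c" "cinv c x = p" using True c by (auto simp: x_def)
      define \<Gamma> where "\<Gamma> = (\<lambda>(s, x). g s (cinv c x))"
      define D where "D = frechet_derivative \<Gamma> (at (0, x))"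
      have mem: "(0, x) \<in> ?I \<times> cdom c" using \<delta> x by auto
      have \<Gamma>d: "(\<Gamma> has_derivative D) (at (0, x))"
        unfolding D_def \<Gamma>_def by (rule smooth_on_has_derivative[OF jsmoothD[OF g c] mem])
      have linD: "linear D" using \<Gamma>d has_derivative_linear by blast
      have g0: "smooth_map_on S M (g 0)" by (rule jsmooth_slice[OF _ g]) (use \<delta> in auto)
      have d1: "((\<lambda>s. g s p) has_derivative (\<lambda>s. D (s, 0))) (at 0)"
      proof -
        have "((\<lambda>s. (s, x)) has_derivative (\<lambda>s. (s, 0))) (at 0)" by (auto intro!: derivative_eq_intros)
        from has_derivative_compose[OF this \<Gamma>d] show ?thesis by (simp add: \<Gamma>_def x)
      qed
      have vd: "vector_derivative (\<lambda>s. g s p) (at 0) = D (1, 0)"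
      proof (rule vector_derivative_at)
        have "(\<lambda>s. D (s, 0)) = (\<lambda>s. s *\<^sub>R D (1, 0))"
        proof
          fix s
          have "D (s *\<^sub>R (1, 0)) = s *\<^sub>R D (1, 0)" by (rule linear_scale[OF linD])
          moreover have "s *\<^sub>R (1 :: real, 0 :: 'e) = (s, 0)" by simp
          ultimately show "D (s, 0) = s *\<^sub>R D (1, 0)" by (simp only:)
        qed
        then show "((\<lambda>s. g s p) has_vector_derivative D (1, 0)) (at 0)"
          using d1 unfolding has_vector_derivative_def by (simp only:)
      qed
      have dl: "dloc c (g 0) x w = D (0, w)" for w
      proof -
        have "((\<lambda>y. (0, y)) has_derivative (\<lambda>w. (0, w))) (at x)" by (auto intro!: derivative_eq_intros)
        from has_derivative_compose[OF this, of \<Gamma> D] \<Gamma>d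
        have "((\<lambda>y. \<Gamma> (0, y)) has_derivative (\<lambda>w. D (0, w))) (at x)" by simp
        then have "dloc c (g 0) x = (\<lambda>w. D (0, w))"
          by (intro dloc_eqI) (simp add: \<Gamma>_def local_rep_def o_def)
        then show ?thesis by simp
      qed
      have Tx: "T p = dloc c X x (\<sigma> x)"
      proof -
        have "T p \<in> range (dloc c X x)"
          using tan[OF p] range_dloc_change[OF c chart_at(1)[OF p] True chart_at(2)[OF p] openin_M p smooth_pos]
          by (simp add: tangent_space_def differential_dloc x_def)
        then show ?thesis using pinv_left[OF dloc_pos_linear'[OF c x(1)] dloc_pos_inj'[OF c x(1)]] x
          by (auto simp: \<sigma>_def \<tau>_def)
      qed
      have td: "tderiv (g 0) p (T p) = D (0, \<sigma> x)"
        unfolding Tx using tderiv_dloc[OF c True openin_M p g0, of "\<sigma> x"] dl by (simp add: x_def)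
      \<comment> \<open>The velocity of this curve splits into the parameter direction, which gives
        the derivative of the family, and \<open>- \<sigma> x\<close>, which is \<open>- T\<close>
        in coordinates.\<close>
      have "((\<lambda>s. (s, \<Psi> s x)) has_derivative (\<lambda>s. (s, - s *\<^sub>R \<sigma> x))) (at 0)"
        unfolding \<Psi>_def by (auto intro!: derivative_eq_intros)
      from has_derivative_compose[OF this, of \<Gamma> D] \<Gamma>d
      have "((\<lambda>s. \<Gamma> (s, \<Psi> s x)) has_derivative (\<lambda>s. D (s, - s *\<^sub>R \<sigma> x))) (at 0)" by (simp add: \<Psi>_def)
      moreover have "D (s, - s *\<^sub>R \<sigma> x) = s *\<^sub>R (D (1, 0) - D (0, \<sigma> x))" for s
      proof -
        have "(s, - s *\<^sub>R \<sigma> x) = s *\<^sub>R ((1, 0) - (0, \<sigma> x))" by simp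
        then show ?thesis using linear_scale[OF linD] linear_diff[OF linD] by metis
      qed
      moreover have "\<Gamma> (s, \<Psi> s x) = g s (\<phi> s p)" for s
        using \<phi>c[OF x(1)] x(2) by (simp add: \<Gamma>_def)
      ultimately show ?thesis unfolding vd td has_vector_derivative_def by simp
    qed
  qed
  then show ?thesis by blast
qed

lemma flow_cong:
  assumes "flow \<epsilon> \<phi> T" "\<And>p. p \<in> M \<Longrightarrow> T p = T' p"
  shows "flow \<epsilon> \<phi> T'"
  using assms unfolding flow_def by simp

lemma flow_exists:
  assumes T: "smooth_map_on S M T" and tan: "\<And>q. q \<in> M \<Longrightarrow> T q \<in> tangent_space S q"
  shows "\<exists>\<epsilon> \<phi>. flow \<epsilon> \<phi> T"
proof -
  obtain I c \<rho> K where pou: "is_partition I c \<rho> K" using is_partition_exists by blast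
  note I = is_partitionD[OF pou]
  have "J \<subseteq> I \<Longrightarrow> \<exists>\<epsilon> \<phi>. flow \<epsilon> \<phi> (\<lambda>p. \<Sum>i\<in>J. \<rho> i p *\<^sub>R T p)" if "finite J" for J
    using that
  proof (induction J rule: finite_induct)
    case empty
    show ?case using flow_zero by auto
  next
    case (insert i J)
    then have i: "i \<in> I" by simp
    obtain \<epsilon>2 \<phi>2 where 2: "flow \<epsilon>2 \<phi>2 (\<lambda>p. \<Sum>i\<in>J. \<rho> i p *\<^sub>R T p)" using insert by blast
    have "\<exists>\<epsilon> \<phi>. flow \<epsilon> \<phi> (\<lambda>p. \<rho> i p *\<^sub>R T p)"
    proof (rule flow_local[OF I(2,4,5)[OF i]])
      show "smooth_map_on S M (\<lambda>p. \<rho> i p *\<^sub>R T p)"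
        by (intro smooth_map_on_bilinear[OF _ bounded_bilinear_scaleR] openin_M I(3) i T)
      show "q \<in> M \<Longrightarrow> \<rho> i q *\<^sub>R T q \<in> tangent_space S q" for q by (intro tangent_subspace_closed tan)
      show "q \<notin> K i \<Longrightarrow> \<rho> i q *\<^sub>R T q = 0" for q using I(6)[OF i] by simp
    qed
    then obtain \<epsilon>1 \<phi>1 where "flow \<epsilon>1 \<phi>1 (\<lambda>p. \<rho> i p *\<^sub>R T p)" by blast
    from flow_comp[OF this 2] show ?case using insert by auto
  qed
  from this[OF I(1)] obtain \<epsilon> \<phi> where "flow \<epsilon> \<phi> (\<lambda>p. \<Sum>i\<in>I. \<rho> i p *\<^sub>R T p)" by blast
  then have "flow \<epsilon> \<phi> T"
    by (rule flow_cong) (simp add: scaleR_sum_left[symmetric] I(7))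
  then show ?thesis by blast
qed

end

section \<open>Products of self-shrinkers\<close>

lemma second_countable_prod_topology:
  assumes "second_countable X" "second_countable Y"
  shows "second_countable (prod_topology X Y)"
proof -
  obtain A where A: "countable A" "\<forall>V\<in>A. openin X V" "\<forall>U x. openin X U \<and> x \<in> U \<longrightarrow> (\<exists>V\<in>A. x \<in> V \<and> V \<subseteq> U)"
    using assms(1) unfolding second_countable_def by blast
  obtain B where B: "countable B" "\<forall>V\<in>B. openin Y V" "\<forall>U x. openin Y U \<and> x \<in> U \<longrightarrow> (\<exists>V\<in>B. x \<in> V \<and> V \<subseteq> U)"
    using assms(2) unfolding second_countable_def by blast
  show ?thesis
    unfolding second_countable_def
  proof (intro exI[of _ "(\<lambda>(U, V). U \<times> V) ` (A \<times> B)"] conjI)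
    show "countable ((\<lambda>(U, V). U \<times> V) ` (A \<times> B))" using A B by simp
    show "\<forall>V\<in>(\<lambda>(U, V). U \<times> V) ` (A \<times> B). openin (prod_topology X Y) V"
      using A B by (auto simp: openin_prod_Times_iff)
    show "\<forall>U x. openin (prod_topology X Y) U \<and> x \<in> U \<longrightarrow> (\<exists>V\<in>(\<lambda>(U, V). U \<times> V) ` (A \<times> B). x \<in> V \<and> V \<subseteq> U)"
    proof (intro allI impI)
      fix U and x :: "'a \<times> 'b" assume "openin (prod_topology X Y) U \<and> x \<in> U"
      then obtain V W where "openin X V" "fst x \<in> V" "openin Y W" "snd x \<in> W" "V \<times> W \<subseteq> U"
        unfolding openin_prod_topology_alt by (metis prod.collapse)
      moreover from this obtain V' W' where "V' \<in> A" "fst x \<in> V'" "V' \<subseteq> V" "W' \<in> B" "snd x \<in> W'" "W' \<subseteq> W"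
        using A(3) B(3) by meson
      ultimately show "\<exists>V\<in>(\<lambda>(U, V). U \<times> V) ` (A \<times> B). x \<in> V \<and> V \<subseteq> U"
        by (intro bexI[of _ "V' \<times> W'"]) (auto simp: mem_Times_iff)
    qed
  qed
qed

lemma sum_Basis_prod:
  fixes f :: "'p::euclidean_space \<times> 'q::euclidean_space \<Rightarrow> 'r::comm_monoid_add"
  shows "(\<Sum>i\<in>Basis. f i) = (\<Sum>b\<in>Basis. f (b, 0)) + (\<Sum>b\<in>Basis. f (0, b))"
proof -
  have "inj_on (\<lambda>u :: 'p. (u, 0 :: 'q)) Basis" "inj_on (\<lambda>u :: 'q. (0 :: 'p, u)) Basis" by (auto simp: inj_on_def)
  moreover have "(\<lambda>u :: 'p. (u, 0 :: 'q)) ` Basis \<inter> (\<lambda>v. (0, v)) ` Basis = {}" using nonzero_Basis by auto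
  ultimately show ?thesis
    unfolding Basis_prod_def by (subst sum.union_disjoint) (simp_all add: sum.reindex)
qed

lemma tr_prod:
  assumes "linear f" "linear g"
  shows "tr (\<lambda>z. (f (fst z), g (snd z))) = tr f + tr g"
  unfolding tr_def sum_Basis_prod using linear_0[OF assms(1)] linear_0[OF assms(2)] by simp

section \<open>Product charts and the product immersion\<close>

locale prod_shrinker = A: shrinker S1 + B: shrinker S2
  for S1 :: "('a, 'e1::euclidean_space, 'v1::euclidean_space) immersed"
  and S2 :: "('b, 'e2::euclidean_space, 'v2::euclidean_space) immersed"
begin

abbreviation "PS \<equiv> prod_immersed S1 S2"

definition pc :: "'a set \<times> ('a \<Rightarrow> 'e1) \<Rightarrow> 'b set \<times> ('b \<Rightarrow> 'e2) \<Rightarrow> ('a \<times> 'b) set \<times> ('a \<times> 'b \<Rightarrow> 'e1 \<times> 'e2)" where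
  "pc c d = (fst c \<times> fst d, map_prod (snd c) (snd d))"

lemma mtop_PS [simp]: "mtop PS = prod_topology (mtop S1) (mtop S2)"
  and pos_PS: "pos PS = map_prod (pos S1) (pos S2)"
  by (simp_all add: prod_immersed_def)

lemma atlas_PS_iff: "C \<in> atlas PS \<longleftrightarrow> (\<exists>c\<in>atlas S1. \<exists>d\<in>atlas S2. C = pc c d)"
  by (force simp: prod_immersed_def pc_def)

lemma fst_pc [simp]: "fst (pc c d) = fst c \<times> fst d"
  and snd_pc: "snd (pc c d) = map_prod (snd c) (snd d)"
  by (simp_all add: pc_def)

lemma cdom_pc: "cdom (pc c d) = cdom c \<times> cdom d"
  by (force simp: pc_def)

lemma image_pc: "snd (pc c d) ` (U \<times> V) = (snd c ` U) \<times> (snd d ` V)"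
  by (force simp: pc_def)

lemma inj_pc: "c \<in> atlas S1 \<Longrightarrow> d \<in> atlas S2 \<Longrightarrow> inj_on (snd (pc c d)) (fst (pc c d))"
  using A.chart_inj[of c] B.chart_inj[of d] by (simp add: snd_pc map_prod_inj_on)

lemma cinv_pc:
  assumes "c \<in> atlas S1" "d \<in> atlas S2" "z \<in> cdom c \<times> cdom d"
  shows "cinv (pc c d) z = (cinv c (fst z), cinv d (snd z))"
  by (rule inv_into_f_eq[OF inj_pc[OF assms(1,2)]]) (use assms in \<open>auto simp: snd_pc\<close>)

end

lemma smooth_on_fst_part:
  fixes f :: "'p::euclidean_space \<Rightarrow> 'r::real_normed_vector" and V :: "'q::euclidean_space set"
  assumes "open U" "open V" "smooth_on f U"
  shows "smooth_on (\<lambda>z. f (fst z)) (U \<times> V)"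
proof -
  have o: "open (U \<times> V)" by (intro open_Times assms)
  show ?thesis
    by (rule smooth_on_compose[OF o assms(1) _ _ assms(3)]) (auto intro!: smooth_intros o)
qed

lemma smooth_on_snd_part:
  fixes f :: "'q::euclidean_space \<Rightarrow> 'r::real_normed_vector" and U :: "'p::euclidean_space set"
  assumes "open U" "open V" "smooth_on f V"
  shows "smooth_on (\<lambda>z. f (snd z)) (U \<times> V)"
proof -
  have o: "open (U \<times> V)" by (intro open_Times assms)
  show ?thesis
    by (rule smooth_on_compose[OF o assms(2) _ _ assms(3)]) (auto intro!: smooth_intros o)
qed

context prod_shrinker
begin

lemma smooth_manifold_PS: "smooth_manifold PS"
proof -
  have 1: "topspace (mtop PS) \<noteq> {}" using A.M_nonempty B.M_nonempty by simp
  have 2: "Hausdorff_space (mtop PS)" using A.Hausdorff B.Hausdorff by (simp add: Hausdorff_space_prod_topology)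
  have 3: "second_countable (mtop PS)"
    using second_countable_prod_topology[OF A.second_countable_mtop B.second_countable_mtop] by simp
  have 4: "(\<Union>C\<in>atlas PS. fst C) = topspace (mtop PS)"
  proof (intro equalityI subsetI)
    fix z assume "z \<in> (\<Union>C\<in>atlas PS. fst C)"
    then obtain C where "C \<in> atlas PS" "z \<in> fst C" by blast
    then obtain c d where "c \<in> atlas S1" "d \<in> atlas S2" "z \<in> fst c \<times> fst d" using atlas_PS_iff fst_pc by metis
    then show "z \<in> topspace (mtop PS)" using A.chart_subset[of c] B.chart_subset[of d] by auto
  next
    fix z assume "z \<in> topspace (mtop PS)"
    then have "fst z \<in> A.M" "snd z \<in> B.M" by auto
    then obtain c d where "c \<in> atlas S1" "fst z \<in> fst c" "d \<in> atlas S2" "snd z \<in> fst d"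
      using A.atlas_covers B.atlas_covers by metis
    then show "z \<in> (\<Union>C\<in>atlas PS. fst C)"
      by (intro UN_I[of "pc c d"]) (auto simp: atlas_PS_iff mem_Times_iff)
  qed
  have 5: "openin (mtop PS) (fst C) \<and> open (cdom C) \<and>
      homeomorphic_map (subtopology (mtop PS) (fst C)) (top_of_set (cdom C)) (snd C)" if C: "C \<in> atlas PS" for C
  proof -
    obtain c d where cd: "c \<in> atlas S1" "d \<in> atlas S2" "C = pc c d" using C atlas_PS_iff by blast
    obtain g where g: "homeomorphic_maps (subtopology (mtop S1) (fst c)) (top_of_set (cdom c)) (snd c) g"
      using A.chart_homeo[OF cd(1)] homeomorphic_map_maps by blast
    obtain h where h: "homeomorphic_maps (subtopology (mtop S2) (fst d)) (top_of_set (cdom d)) (snd d) h"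
      using B.chart_homeo[OF cd(2)] homeomorphic_map_maps by blast
    have "homeomorphic_maps (prod_topology (subtopology (mtop S1) (fst c)) (subtopology (mtop S2) (fst d)))
      (prod_topology (top_of_set (cdom c)) (top_of_set (cdom d))) (\<lambda>(x, y). (snd c x, snd d y)) (\<lambda>(x, y). (g x, h y))"
      using g h homeomorphic_maps_prod by blast
    then have "homeomorphic_map (subtopology (mtop PS) (fst C)) (top_of_set (cdom C)) (snd C)"
      unfolding cd cdom_pc homeomorphic_map_maps
      by (intro exI[of _ "\<lambda>(x, y). (g x, h y)"]) (simp add: subtopology_Times snd_pc map_prod_def)
    then show ?thesis
      using A.chart_openin[OF cd(1)] B.chart_openin[OF cd(2)] A.open_cdom[OF cd(1)] B.open_cdom[OF cd(2)]
      unfolding cd cdom_pc by (simp add: openin_prod_Times_iff open_Times)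
  qed
  have 6: "smooth_on (local_rep C (snd D)) (snd C ` (fst C \<inter> fst D))" if C: "C \<in> atlas PS" and D: "D \<in> atlas PS" for C D
  proof -
    obtain c d where cd: "c \<in> atlas S1" "d \<in> atlas S2" "C = pc c d" using C atlas_PS_iff by blast
    obtain c' d' where cd': "c' \<in> atlas S1" "d' \<in> atlas S2" "D = pc c' d'" using D atlas_PS_iff by blast
    let ?U = "snd c ` (fst c \<inter> fst c')" and ?V = "snd d ` (fst d \<inter> fst d')"
    have U: "open ?U" and V: "open ?V"
      using A.open_chart_Int[OF cd(1) A.chart_openin[OF cd'(1)]] B.open_chart_Int[OF cd(2) B.chart_openin[OF cd'(2)]] by auto
    have im: "snd C ` (fst C \<inter> fst D) = ?U \<times> ?V"
      unfolding cd cd' fst_pc Times_Int_Times image_pc ..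
    have o: "open (?U \<times> ?V)" using U V by (rule open_Times)
    have "smooth_on (\<lambda>z. (snd c' (cinv c (fst z)), snd d' (cinv d (snd z)))) (?U \<times> ?V)"
      by (intro smooth_on_Pair o smooth_on_fst_part[OF U V A.transition_smooth[OF cd(1) cd'(1)]]
          smooth_on_snd_part[OF U V B.transition_smooth[OF cd(2) cd'(2)]])
    then show ?thesis unfolding im
    proof (rule smooth_on_cong[OF o, rotated])
      fix z assume z: "z \<in> ?U \<times> ?V"
      then have "z \<in> cdom c \<times> cdom d" by auto
      then show "(snd c' (cinv c (fst z)), snd d' (cinv d (snd z))) = local_rep C (snd D) z"
        using cinv_pc[OF cd(1,2)] unfolding cd(3) cd'(3) by (simp add: local_rep_def snd_pc)
    qed
  qed
  show ?thesis
    unfolding smooth_manifold_def case_prod_beta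
    using 1 2 3 4 5 6 by (simp add: local_rep_def)
qed

sublocale P: mfd PS
  by unfold_locales (rule smooth_manifold_PS)

lemma MP: "P.M = A.M \<times> B.M"
  by simp

lemma smooth_map_fst:
  assumes f: "smooth_map_on S1 N f" and N: "openin (mtop S1) N" "openin (mtop S2) N'"
  shows "smooth_map_on PS (N \<times> N') (\<lambda>z. f (fst z))"
proof (rule P.smooth_map_onI_global)
  fix C assume "C \<in> atlas PS"
  then obtain c d where cd: "c \<in> atlas S1" "d \<in> atlas S2" "C = pc c d" using atlas_PS_iff by blast
  let ?U = "snd c ` (fst c \<inter> N)" and ?V = "snd d ` (fst d \<inter> N')"
  have U: "open ?U" and V: "open ?V" using A.open_chart_Int[OF cd(1) N(1)] B.open_chart_Int[OF cd(2) N(2)] by auto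
  have im: "snd C ` (fst C \<inter> N \<times> N') = ?U \<times> ?V" unfolding cd fst_pc Times_Int_Times image_pc ..
  have "smooth_on (\<lambda>z. f (cinv c (fst z))) (?U \<times> ?V)"
    by (rule smooth_on_fst_part[OF U V A.smooth_map_onD2[OF f cd(1)]])
  then show "smooth_on (\<lambda>z. f (fst (cinv C z))) (snd C ` (fst C \<inter> N \<times> N'))"
    unfolding im
  proof (rule smooth_on_cong[OF open_Times[OF U V], rotated])
    fix z assume "z \<in> ?U \<times> ?V"
    then have "z \<in> cdom c \<times> cdom d" by auto
    then show "f (cinv c (fst z)) = f (fst (cinv C z))" using cinv_pc[OF cd(1,2)] unfolding cd(3) by simp
  qed
qed

lemma smooth_map_snd:
  assumes f: "smooth_map_on S2 N' f" and N: "openin (mtop S1) N" "openin (mtop S2) N'"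
  shows "smooth_map_on PS (N \<times> N') (\<lambda>z. f (snd z))"
proof (rule P.smooth_map_onI_global)
  fix C assume "C \<in> atlas PS"
  then obtain c d where cd: "c \<in> atlas S1" "d \<in> atlas S2" "C = pc c d" using atlas_PS_iff by blast
  let ?U = "snd c ` (fst c \<inter> N)" and ?V = "snd d ` (fst d \<inter> N')"
  have U: "open ?U" and V: "open ?V" using A.open_chart_Int[OF cd(1) N(1)] B.open_chart_Int[OF cd(2) N(2)] by auto
  have im: "snd C ` (fst C \<inter> N \<times> N') = ?U \<times> ?V" unfolding cd fst_pc Times_Int_Times image_pc ..
  have "smooth_on (\<lambda>z. f (cinv d (snd z))) (?U \<times> ?V)"
    by (rule smooth_on_snd_part[OF U V B.smooth_map_onD2[OF f cd(2)]])
  then show "smooth_on (\<lambda>z. f (snd (cinv C z))) (snd C ` (fst C \<inter> N \<times> N'))"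
    unfolding im
  proof (rule smooth_on_cong[OF open_Times[OF U V], rotated])
    fix z assume "z \<in> ?U \<times> ?V"
    then have "z \<in> cdom c \<times> cdom d" by auto
    then show "f (cinv d (snd z)) = f (snd (cinv C z))" using cinv_pc[OF cd(1,2)] unfolding cd(3) by simp
  qed
qed

lemma smooth_pos_PS: "smooth_map_on PS P.M (pos PS)"
proof -
  have bl: "bounded_linear (\<lambda>x :: 'v1. (x, 0 :: 'v2))" "bounded_linear (\<lambda>x :: 'v2. (0 :: 'v1, x))"
    by (simp_all add: bounded_linear_Pair)
  have "smooth_map_on PS P.M (\<lambda>z. (pos S1 (fst z), 0) + (0, pos S2 (snd z)))"
    unfolding MP
    by (intro P.smooth_map_on_add P.smooth_map_on_bounded_linear[OF _ bl(1)] P.smooth_map_on_bounded_linear[OF _ bl(2)]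
        smooth_map_fst smooth_map_snd A.smooth_pos B.smooth_pos) (simp_all add: openin_prod_Times_iff)
  moreover have "(\<lambda>z. (pos S1 (fst z), 0) + (0, pos S2 (snd z))) = pos PS" by (auto simp: pos_PS)
  ultimately show ?thesis by simp
qed

section \<open>Derivatives, projections and mean curvature of the product\<close>

lemma dloc_pc_fst:
  assumes cd: "c \<in> atlas S1" "d \<in> atlas S2" and p: "p \<in> fst c" "q \<in> fst d" "p \<in> N" and f: "smooth_map_on S1 N f"
  shows "(local_rep (pc c d) (\<lambda>z. f (fst z)) has_derivative (\<lambda>w. dloc c f (snd c p) (fst w))) (at (snd c p, snd d q))"
proof -
  have "(local_rep c f has_derivative dloc c f (snd c p)) (at (fst (snd c p, snd d q)))"
    using A.dloc_has_derivative[OF f cd(1) p(1,3)] by simp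
  from has_derivative_compose[OF has_derivative_fst[OF has_derivative_ident] this]
  have "((\<lambda>z. local_rep c f (fst z)) has_derivative (\<lambda>w. dloc c f (snd c p) (fst w))) (at (snd c p, snd d q))" .
  then show ?thesis
  proof (rule has_derivative_transform_within_open)
    show "open (cdom c \<times> cdom d)" by (intro open_Times A.open_cdom B.open_cdom cd)
    show "(snd c p, snd d q) \<in> cdom c \<times> cdom d" using p by auto
    show "local_rep c f (fst z) = local_rep (pc c d) (\<lambda>z. f (fst z)) z" if "z \<in> cdom c \<times> cdom d" for z
      using cinv_pc[OF cd that] by (simp add: local_rep_def)
  qed
qed

lemma dloc_pc_snd:
  assumes cd: "c \<in> atlas S1" "d \<in> atlas S2" and p: "p \<in> fst c" "q \<in> fst d" "q \<in> N" and f: "smooth_map_on S2 N f"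
  shows "(local_rep (pc c d) (\<lambda>z. f (snd z)) has_derivative (\<lambda>w. dloc d f (snd d q) (snd w))) (at (snd c p, snd d q))"
proof -
  have "(local_rep d f has_derivative dloc d f (snd d q)) (at (snd (snd c p, snd d q)))"
    using B.dloc_has_derivative[OF f cd(2) p(2,3)] by simp
  from has_derivative_compose[OF has_derivative_snd[OF has_derivative_ident] this]
  have "((\<lambda>z. local_rep d f (snd z)) has_derivative (\<lambda>w. dloc d f (snd d q) (snd w))) (at (snd c p, snd d q))" .
  then show ?thesis
  proof (rule has_derivative_transform_within_open)
    show "open (cdom c \<times> cdom d)" by (intro open_Times A.open_cdom B.open_cdom cd)
    show "(snd c p, snd d q) \<in> cdom c \<times> cdom d" using p by auto
    show "local_rep d f (snd z) = local_rep (pc c d) (\<lambda>z. f (snd z)) z" if "z \<in> cdom c \<times> cdom d" for z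
      using cinv_pc[OF cd that] by (simp add: local_rep_def)
  qed
qed

lemma dloc_pc_pos:
  assumes cd: "c \<in> atlas S1" "d \<in> atlas S2" and p: "p \<in> fst c" "q \<in> fst d"
  shows "dloc (pc c d) (pos PS) (snd c p, snd d q) =
    (\<lambda>w. (dloc c (pos S1) (snd c p) (fst w), dloc d (pos S2) (snd d q) (snd w)))"
proof (rule P.dloc_eqI)
  have "p \<in> A.M" "q \<in> B.M" using A.chart_subset[OF cd(1)] B.chart_subset[OF cd(2)] p by auto
  then have "((\<lambda>z. (local_rep (pc c d) (\<lambda>z. pos S1 (fst z)) z, local_rep (pc c d) (\<lambda>z. pos S2 (snd z)) z)) has_derivative
    (\<lambda>w. (dloc c (pos S1) (snd c p) (fst w), dloc d (pos S2) (snd d q) (snd w)))) (at (snd c p, snd d q))"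
    by (intro has_derivative_Pair dloc_pc_fst[OF cd p _ A.smooth_pos] dloc_pc_snd[OF cd p _ B.smooth_pos])
  moreover have "(\<lambda>z. (local_rep (pc c d) (\<lambda>z. pos S1 (fst z)) z, local_rep (pc c d) (\<lambda>z. pos S2 (snd z)) z)) = local_rep (pc c d) (pos PS)"
    by (auto simp: local_rep_def pos_PS fun_eq_iff map_prod_def case_prod_beta)
  ultimately show "(local_rep (pc c d) (pos PS) has_derivative
    (\<lambda>w. (dloc c (pos S1) (snd c p) (fst w), dloc d (pos S2) (snd d q) (snd w)))) (at (snd c p, snd d q))" by simp
qed

lemma obtain_chart:
  assumes "z \<in> P.M"
  obtains c d where "c \<in> atlas S1" "d \<in> atlas S2" "chart_at PS z = pc c d" "fst z \<in> fst c" "snd z \<in> fst d"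
    "snd (chart_at PS z) z = (snd c (fst z), snd d (snd z))"
proof -
  obtain c d where "c \<in> atlas S1" "d \<in> atlas S2" "chart_at PS z = pc c d"
    using P.chart_at(1)[OF assms] atlas_PS_iff by blast
  moreover have "z \<in> fst (pc c d)" using P.chart_at(2)[OF assms] calculation by simp
  ultimately show thesis by (intro that[of c d]) (auto simp: snd_pc map_prod_def case_prod_beta)
qed

lemma immersed_PS: "immersed_submanifold PS"
  unfolding immersed_submanifold_def
proof (intro conjI ballI smooth_manifold_PS smooth_pos_PS)
  fix z assume z: "z \<in> P.M"
  obtain c d where cd: "c \<in> atlas S1" "d \<in> atlas S2" "chart_at PS z = pc c d" "fst z \<in> fst c" "snd z \<in> fst d"
    "snd (chart_at PS z) z = (snd c (fst z), snd d (snd z))" by (rule obtain_chart[OF z])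
  show "inj (differential PS (pos PS) z)"
    unfolding P.differential_dloc cd(6) unfolding cd(3) dloc_pc_pos[OF cd(1,2,4,5)]
    using A.dloc_pos_inj[OF cd(1,4)] B.dloc_pos_inj[OF cd(2,5)] by (auto simp: inj_def prod_eq_iff)
qed

sublocale P: cimm PS
proof unfold_locales
  show "immersed_submanifold PS" by (rule immersed_PS)
  show "compact_space (mtop PS)" using A.compact B.compact by (simp add: compact_space_prod_topology)
qed

text \<open>The images of the two differentials are orthogonal, so the normal equations
  decouple.\<close>

lemma pinv_pc:
  assumes cd: "c \<in> atlas S1" "d \<in> atlas S2" and p: "p \<in> fst c" "q \<in> fst d"
  shows "pinv (dloc (pc c d) (pos PS) (snd c p, snd d q)) y =
    (pinv (dloc c (pos S1) (snd c p)) (fst y), pinv (dloc d (pos S2) (snd d q)) (snd y))"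
proof (rule pinv_uniqueI)
  have P: "pc c d \<in> atlas PS" "(p, q) \<in> fst (pc c d)" "snd (pc c d) (p, q) = (snd c p, snd d q)"
    using cd p by (auto simp: atlas_PS_iff snd_pc)
  show "linear (dloc (pc c d) (pos PS) (snd c p, snd d q))" "inj (dloc (pc c d) (pos PS) (snd c p, snd d q))"
    using P.dloc_pos_linear[OF P(1,2)] P.dloc_pos_inj[OF P(1,2)] unfolding P(3) by blast+
  fix w
  show "(y - dloc (pc c d) (pos PS) (snd c p, snd d q)
      (pinv (dloc c (pos S1) (snd c p)) (fst y), pinv (dloc d (pos S2) (snd d q)) (snd y))) \<bullet>
      dloc (pc c d) (pos PS) (snd c p, snd d q) w = 0"
    unfolding dloc_pc_pos[OF cd p]
    using pinv_orth[OF A.dloc_pos_linear[OF cd(1) p(1)] A.dloc_pos_inj[OF cd(1) p(1)], of "fst y" "fst w"]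
      pinv_orth[OF B.dloc_pos_linear[OF cd(2) p(2)] B.dloc_pos_inj[OF cd(2) p(2)], of "snd y" "snd w"]
    by (simp add: inner_prod_def)
qed

lemma tderiv_fst:
  assumes z: "z \<in> N \<times> N'" and N: "openin (mtop S1) N" "openin (mtop S2) N'" and f: "smooth_map_on S1 N f"
  shows "P.tderiv (\<lambda>z. f (fst z)) z y = A.tderiv f (fst z) (fst y)"
proof -
  have M: "fst z \<in> A.M" "snd z \<in> B.M" using z N openin_subset by (metis mem_Times_iff subsetD)+
  then have "z \<in> P.M" unfolding MP by (auto simp: mem_Times_iff)
  then obtain c d where cd: "c \<in> atlas S1" "d \<in> atlas S2" "chart_at PS z = pc c d" "fst z \<in> fst c" "snd z \<in> fst d"
    "snd (chart_at PS z) z = (snd c (fst z), snd d (snd z))" by (rule obtain_chart)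
  have "P.tderiv (\<lambda>z. f (fst z)) z y = dloc c f (snd c (fst z)) (pinv (dloc c (pos S1) (snd c (fst z))) (fst y))"
    unfolding P.tderiv_def P.differential_dloc cd(6) unfolding cd(3) pinv_pc[OF cd(1,2,4,5)]
    by (subst P.dloc_eqI[OF dloc_pc_fst[OF cd(1,2,4,5) _ f]]) (use z in auto)
  then show ?thesis using A.tderiv_chart[OF cd(1,4) N(1) _ f] z by (simp add: mem_Times_iff)
qed

lemma tderiv_snd:
  assumes z: "z \<in> N \<times> N'" and N: "openin (mtop S1) N" "openin (mtop S2) N'" and f: "smooth_map_on S2 N' f"
  shows "P.tderiv (\<lambda>z. f (snd z)) z y = B.tderiv f (snd z) (snd y)"
proof -
  have M: "fst z \<in> A.M" "snd z \<in> B.M" using z N openin_subset by (metis mem_Times_iff subsetD)+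
  then have "z \<in> P.M" unfolding MP by (auto simp: mem_Times_iff)
  then obtain c d where cd: "c \<in> atlas S1" "d \<in> atlas S2" "chart_at PS z = pc c d" "fst z \<in> fst c" "snd z \<in> fst d"
    "snd (chart_at PS z) z = (snd c (fst z), snd d (snd z))" by (rule obtain_chart)
  have "P.tderiv (\<lambda>z. f (snd z)) z y = dloc d f (snd d (snd z)) (pinv (dloc d (pos S2) (snd d (snd z))) (snd y))"
    unfolding P.tderiv_def P.differential_dloc cd(6) unfolding cd(3) pinv_pc[OF cd(1,2,4,5)]
    by (subst P.dloc_eqI[OF dloc_pc_snd[OF cd(1,2,4,5) _ f]]) (use z in auto)
  then show ?thesis using B.tderiv_chart[OF cd(2,5) N(2) _ f] z by (simp add: mem_Times_iff)
qed

lemma tproj_PS: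
  assumes "z \<in> P.M"
  shows "P.tproj z y = (A.tproj (fst z) (fst y), B.tproj (snd z) (snd y))"
proof -
  obtain c d where cd: "c \<in> atlas S1" "d \<in> atlas S2" "chart_at PS z = pc c d" "fst z \<in> fst c" "snd z \<in> fst d"
    "snd (chart_at PS z) z = (snd c (fst z), snd d (snd z))" by (rule obtain_chart[OF assms])
  have M: "fst z \<in> A.M" "snd z \<in> B.M" using assms by auto
  show ?thesis
    unfolding P.tderiv_def P.differential_dloc cd(6) unfolding cd(3) pinv_pc[OF cd(1,2,4,5)]
    unfolding dloc_pc_pos[OF cd(1,2,4,5)]
    using A.tderiv_chart[OF cd(1,4) A.openin_M M(1) A.smooth_pos] B.tderiv_chart[OF cd(2,5) B.openin_M M(2) B.smooth_pos] by simp
qed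

text \<open>A vector is tangent exactly when the projection fixes it, and the projection acts
  factorwise.\<close>

lemma tangent_PS_iff:
  assumes "z \<in> P.M"
  shows "v \<in> tangent_space PS z \<longleftrightarrow> fst v \<in> tangent_space S1 (fst z) \<and> snd v \<in> tangent_space S2 (snd z)"
proof -
  have M: "fst z \<in> A.M" "snd z \<in> B.M" using assms by auto
  have "v \<in> tangent_space PS z \<longleftrightarrow> P.tproj z v = v" using P.tproj_tangent[OF assms] P.tproj_in by metis
  also have "\<dots> \<longleftrightarrow> A.tproj (fst z) (fst v) = fst v \<and> B.tproj (snd z) (snd v) = snd v"
    unfolding tproj_PS[OF assms] by (auto simp: prod_eq_iff)
  also have "\<dots> \<longleftrightarrow> fst v \<in> tangent_space S1 (fst z) \<and> snd v \<in> tangent_space S2 (snd z)"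
    using A.tproj_tangent[OF M(1)] A.tproj_in B.tproj_tangent[OF M(2)] B.tproj_in by metis
  finally show ?thesis .
qed

text \<open>The frames of the factors, padded with zeros, form a frame of the product. Each frame
  field depends on the point of its own factor only, so its derivative stays in that factor and the
  two curvature sums sit side by side.\<close>

lemma has_mean_curvature_PS:
  assumes h1: "has_mean_curvature S1 p h1" and h2: "has_mean_curvature S2 q h2"
  shows "has_mean_curvature PS (p, q) (h1, h2)"
proof -
  obtain N1 e1 where N1: "openin (mtop S1) N1" "p \<in> N1" and f1: "orthonormal_frame S1 N1 e1"
    and e1: "h1 = (\<Sum>i\<in>Basis. normal_proj S1 p (flat_deriv S1 (e1 i p) (e1 i) p))"
    using h1 unfolding has_mean_curvature_def by blast
  obtain N2 e2 where N2: "openin (mtop S2) N2" "q \<in> N2" and f2: "orthonormal_frame S2 N2 e2"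
    and e2: "h2 = (\<Sum>i\<in>Basis. normal_proj S2 q (flat_deriv S2 (e2 i q) (e2 i) q))"
    using h2 unfolding has_mean_curvature_def by blast
  have N1M: "N1 \<subseteq> A.M" and N2M: "N2 \<subseteq> B.M" using N1 N2 openin_subset by blast+
  have s1: "\<And>i. i \<in> Basis \<Longrightarrow> smooth_map_on S1 N1 (e1 i)" and s2: "\<And>i. i \<in> Basis \<Longrightarrow> smooth_map_on S2 N2 (e2 i)"
    and t1: "\<And>i p. i \<in> Basis \<Longrightarrow> p \<in> N1 \<Longrightarrow> e1 i p \<in> tangent_space S1 p"
    and t2: "\<And>i p. i \<in> Basis \<Longrightarrow> p \<in> N2 \<Longrightarrow> e2 i p \<in> tangent_space S2 p"
    and o1: "\<And>i j p. i \<in> Basis \<Longrightarrow> j \<in> Basis \<Longrightarrow> p \<in> N1 \<Longrightarrow> e1 i p \<bullet> e1 j p = (if i = j then 1 else 0)"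
    and o2: "\<And>i j p. i \<in> Basis \<Longrightarrow> j \<in> Basis \<Longrightarrow> p \<in> N2 \<Longrightarrow> e2 i p \<bullet> e2 j p = (if i = j then 1 else 0)"
    using f1 f2 unfolding orthonormal_frame_def by blast+
  \<comment> \<open>A basis vector of the product is \<open>(b, 0)\<close> or \<open>(0, b)\<close>
    with \<open>b \<noteq> 0\<close>, so a vanishing second component selects the frame of the first
    factor.\<close>
  define e :: "'e1 \<times> 'e2 \<Rightarrow> 'a \<times> 'b \<Rightarrow> 'v1 \<times> 'v2" where
    "e i = (if snd i = 0 then (\<lambda>z. (e1 (fst i) (fst z), 0)) else (\<lambda>z. (0, e2 (snd i) (snd z))))" for i
  have el: "e (b, 0) = (\<lambda>z. (e1 b (fst z), 0))" for b by (simp add: e_def)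
  have er: "e (0, b) = (\<lambda>z. (0, e2 b (snd z)))" if "b \<in> Basis" for b using that nonzero_Basis by (auto simp: e_def)
  have N: "openin (mtop PS) (N1 \<times> N2)" using N1 N2 by (simp add: openin_prod_Times_iff)
  have bl: "bounded_linear (\<lambda>x :: 'v1. (x, 0 :: 'v2))" "bounded_linear (\<lambda>x :: 'v2. (0 :: 'v1, x))"
    by (simp_all add: bounded_linear_Pair)
  have Basis_cases: "(\<exists>b\<in>Basis. i = (b, 0)) \<or> (\<exists>b\<in>Basis. i = (0, b))" if "i \<in> Basis" for i :: "'e1 \<times> 'e2"
    using that by (auto simp: Basis_prod_def)
  have zero_in: "0 \<in> tangent_space S1 x" if "x \<in> A.M" for x using A.subspace_tangent[OF that] subspace_0 by blast
  have zero_in2: "0 \<in> tangent_space S2 x" if "x \<in> B.M" for x using B.subspace_tangent[OF that] subspace_0 by blast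
  have sl: "smooth_map_on PS (N1 \<times> N2) (\<lambda>z. (e1 b (fst z), 0 :: 'v2))" if "b \<in> Basis" for b
    by (intro P.smooth_map_on_bounded_linear[OF N bl(1)] smooth_map_fst s1 that N1(1) N2(1))
  have sr: "smooth_map_on PS (N1 \<times> N2) (\<lambda>z. (0 :: 'v1, e2 b (snd z)))" if "b \<in> Basis" for b
    by (intro P.smooth_map_on_bounded_linear[OF N bl(2)] smooth_map_snd s2 that N1(1) N2(1))
  have frame: "orthonormal_frame PS (N1 \<times> N2) e"
    unfolding orthonormal_frame_def
  proof (intro conjI ballI)
    fix i :: "'e1 \<times> 'e2" assume "i \<in> Basis"
    then show "smooth_map_on PS (N1 \<times> N2) (e i)" using Basis_cases[of i] sl sr el er by auto
  next
    fix z and i :: "'e1 \<times> 'e2" assume z: "z \<in> N1 \<times> N2" and i: "i \<in> Basis"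
    have zM: "z \<in> P.M" using z N1M N2M by auto
    show "e i z \<in> tangent_space PS z"
      unfolding tangent_PS_iff[OF zM] using Basis_cases[OF i] t1 t2 z zero_in zero_in2 N1M N2M
      by (auto simp: el er)
    fix j :: "'e1 \<times> 'e2" assume j: "j \<in> Basis"
    show "e i z \<bullet> e j z = (if i = j then 1 else 0)"
      using Basis_cases[OF i] Basis_cases[OF j] o1 o2 z by (auto simp: el er inner_prod_def split: if_splits)
  qed
  have z: "(p, q) \<in> N1 \<times> N2" and zM: "(p, q) \<in> P.M" and pM: "p \<in> A.M" and qM: "q \<in> B.M"
    using N1 N2 N1M N2M by auto
  have L: "normal_proj PS (p, q) (flat_deriv PS (e (b, 0) (p, q)) (e (b, 0)) (p, q)) =
     (normal_proj S1 p (flat_deriv S1 (e1 b p) (e1 b) p), 0)" if b: "b \<in> Basis" for b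
  proof -
    have t: "e (b, 0) (p, q) \<in> tangent_space PS (p, q)"
      unfolding tangent_PS_iff[OF zM] el using t1[OF b N1(2)] zero_in2[OF qM] by simp
    have "P.tderiv (e (b, 0)) (p, q) y = (A.tderiv (e1 b) p (fst y), 0)" for y
      unfolding el
      using P.tderiv_bounded_linear[OF bl(1) z zM smooth_map_fst[OF s1[OF b] N1(1) N2(1)]]
        tderiv_fst[OF z N1(1) N2(1) s1[OF b]] by simp
    then have "flat_deriv PS (e (b, 0) (p, q)) (e (b, 0)) (p, q) = (A.tderiv (e1 b) p (e1 b p), 0)"
      using P.flat_deriv_eq[OF zM t] by (simp add: el)
    then show ?thesis
      using linear_0[OF B.tproj_linear[OF qM]]
      by (simp add: P.normal_proj_eq[OF zM] A.normal_proj_eq[OF pM] tproj_PS[OF zM] A.flat_deriv_eq[OF pM t1[OF b N1(2)]])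
  qed
  have R: "normal_proj PS (p, q) (flat_deriv PS (e (0, b) (p, q)) (e (0, b)) (p, q)) =
     (0, normal_proj S2 q (flat_deriv S2 (e2 b q) (e2 b) q))" if b: "b \<in> Basis" for b
  proof -
    have t: "e (0, b) (p, q) \<in> tangent_space PS (p, q)"
      unfolding tangent_PS_iff[OF zM] er[OF b] using t2[OF b N2(2)] zero_in[OF pM] by simp
    have "P.tderiv (e (0, b)) (p, q) y = (0, B.tderiv (e2 b) q (snd y))" for y
      unfolding er[OF b]
      using P.tderiv_bounded_linear[OF bl(2) z zM smooth_map_snd[OF s2[OF b] N1(1) N2(1)]]
        tderiv_snd[OF z N1(1) N2(1) s2[OF b]] by simp
    then have "flat_deriv PS (e (0, b) (p, q)) (e (0, b)) (p, q) = (0, B.tderiv (e2 b) q (e2 b q))"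
      using P.flat_deriv_eq[OF zM t] by (simp add: er[OF b])
    then show ?thesis
      using linear_0[OF A.tproj_linear[OF pM]]
      by (simp add: P.normal_proj_eq[OF zM] B.normal_proj_eq[OF qM] tproj_PS[OF zM] B.flat_deriv_eq[OF qM t2[OF b N2(2)]])
  qed
  have "(\<Sum>i\<in>Basis. normal_proj PS (p, q) (flat_deriv PS (e i (p, q)) (e i) (p, q))) =
    (\<Sum>b\<in>Basis. (normal_proj S1 p (flat_deriv S1 (e1 b p) (e1 b) p), 0)) +
    (\<Sum>b\<in>Basis. (0, normal_proj S2 q (flat_deriv S2 (e2 b q) (e2 b) q)))"
    unfolding sum_Basis_prod by (simp add: L R)
  also have "\<dots> = (h1, h2)"
    unfolding e1 e2 by (simp add: prod_eq_iff fst_sum snd_sum)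
  finally have "(h1, h2) = (\<Sum>i\<in>Basis. normal_proj PS (p, q) (flat_deriv PS (e i (p, q)) (e i) (p, q)))" by simp
  then show ?thesis unfolding has_mean_curvature_def using N z frame by blast
qed

lemma self_shrinker_PS: "self_shrinker PS"
  unfolding self_shrinker_def
proof (intro conjI ballI immersed_PS)
  fix z assume z: "z \<in> P.M"
  then have M: "fst z \<in> A.M" "snd z \<in> B.M" by auto
  have calculation: "has_mean_curvature PS (fst z, snd z)
     (- (1 / 2) *\<^sub>R normal_proj S1 (fst z) (pos S1 (fst z)), - (1 / 2) *\<^sub>R normal_proj S2 (snd z) (pos S2 (snd z)))"
    using A.shrinker B.shrinker M by (intro has_mean_curvature_PS) (auto simp: self_shrinker_def)
  have pz: "pos PS z = (pos S1 (fst z), pos S2 (snd z))" by (simp add: pos_PS map_prod_def case_prod_beta)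
  have "(- (1 / 2) *\<^sub>R normal_proj S1 (fst z) (pos S1 (fst z)), - (1 / 2) *\<^sub>R normal_proj S2 (snd z) (pos S2 (snd z)))
    = - (1 / 2) *\<^sub>R normal_proj PS z (pos PS z)"
    by (simp add: P.normal_proj_eq[OF z] A.normal_proj_eq[OF M(1)] B.normal_proj_eq[OF M(2)] tproj_PS[OF z] pz)
  with calculation show "has_mean_curvature PS z (- (1 / 2) *\<^sub>R normal_proj PS z (pos PS z))" by simp
qed

sublocale P: shrinker PS
  by unfold_locales (rule self_shrinker_PS)

end

section \<open>The second variation\<close>

lemma smooth_on_ln:
  fixes f :: "'p::real_normed_vector \<Rightarrow> real"
  assumes "open S" "smooth_on f S" "\<And>x. x \<in> S \<Longrightarrow> f x > 0"
  shows "smooth_on (\<lambda>x. ln (f x)) S"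
  unfolding smooth_on_def
proof
  have nz: "f x \<noteq> 0" if "x \<in> S" for x using assms(3)[OF that] by simp
  fix k show "Ck_on k (\<lambda>x. ln (f x)) S"
  proof (cases k)
    case 0
    then show ?thesis using smooth_on_imp_continuous_on[OF assms(2)] nz assms(3)
      by (auto intro!: continuous_on_ln)
  next
    case (Suc m)
    show ?thesis unfolding Suc
    proof (rule Ck_on_SucI[OF assms(1)])
      show "((\<lambda>x. ln (f x)) has_derivative (\<lambda>v. inverse (f x) * frechet_derivative f (at x) v)) (at x)" if "x \<in> S" for x
        using has_derivative_ln[OF assms(3)[OF that] smooth_on_has_derivative[OF assms(2) that]]
        by (simp add: divide_inverse mult.commute)
      show "Ck_on m (\<lambda>x. inverse (f x) * frechet_derivative f (at x) v) S" for v
        using smooth_on_mult[OF assms(1) smooth_on_inverse[OF assms(1,2) nz] smooth_on_frechet_derivative[OF assms(2)]]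
        by (simp add: smooth_on_def)
    qed
  qed
qed

section \<open>Differentiation under the integral\<close>

lemma has_real_derivative_integral:
  fixes g :: "real \<Rightarrow> 'a \<Rightarrow> real"
  assumes \<mu>: "finite_measure \<mu>" and \<delta>: "\<delta> > 0"
    and der: "\<And>s p. p \<in> space \<mu> \<Longrightarrow> s \<in> ball s0 \<delta> \<Longrightarrow> ((\<lambda>s. g s p) has_real_derivative g' s p) (at s)"
    and bd: "\<And>s p. p \<in> space \<mu> \<Longrightarrow> s \<in> ball s0 \<delta> \<Longrightarrow> \<bar>g' s p\<bar> \<le> B"
    and int: "\<And>s. s \<in> ball s0 \<delta> \<Longrightarrow> integrable \<mu> (g s)"
    and meas: "g' s0 \<in> borel_measurable \<mu>"
  shows "((\<lambda>s. LINT p|\<mu>. g s p) has_real_derivative (LINT p|\<mu>. g' s0 p)) (at s0)"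
  unfolding has_field_derivative_iff tendsto_at_iff_sequentially
proof (intro allI impI)
  interpret finite_measure \<mu> by fact
  fix Y :: "nat \<Rightarrow> real" assume Y0: "\<forall>i. Y i \<in> UNIV - {s0}" and Y: "Y \<longlonglongrightarrow> s0"
  have s0: "s0 \<in> ball s0 \<delta>" using \<delta> by simp
  obtain N where N: "\<And>n. n \<ge> N \<Longrightarrow> Y n \<in> ball s0 \<delta>"
    using Y \<delta> unfolding lim_sequentially by (metis dist_commute mem_ball)
  \<comment> \<open>Dropping finitely many terms keeps the sequence inside the ball where the bounds
    hold.\<close>
  define Z where "Z n = Y (n + N)" for n
  have Z: "Z n \<in> ball s0 \<delta>" "Z n \<noteq> s0" for n using N[of "n + N"] Y0 by (auto simp: Z_def)
  have Zlim: "Z \<longlonglongrightarrow> s0" unfolding Z_def by (rule LIMSEQ_ignore_initial_segment[OF Y])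
  have "(\<lambda>n. LINT p|\<mu>. (g (Z n) p - g s0 p) / (Z n - s0)) \<longlonglongrightarrow> (LINT p|\<mu>. g' s0 p)"
  proof (rule integral_dominated_convergence[where w="\<lambda>_. B"])
    show "(\<lambda>p. (g (Z n) p - g s0 p) / (Z n - s0)) \<in> borel_measurable \<mu>" for n
      using int[OF Z(1)] int[OF s0] by (intro borel_measurable_divide borel_measurable_diff) auto
    show "AE p in \<mu>. (\<lambda>n. (g (Z n) p - g s0 p) / (Z n - s0)) \<longlonglongrightarrow> g' s0 p"
    proof (rule AE_I2)
      fix p assume p: "p \<in> space \<mu>"
      have "((\<lambda>s. (g s p - g s0 p) / (s - s0)) \<longlongrightarrow> g' s0 p) (at s0)"
        using der[OF p s0] by (simp add: has_field_derivative_iff)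
      then show "(\<lambda>n. (g (Z n) p - g s0 p) / (Z n - s0)) \<longlonglongrightarrow> g' s0 p"
        by (rule filterlim_compose) (use Z Zlim in \<open>auto simp: filterlim_at\<close>)
    qed
    show "AE p in \<mu>. norm ((g (Z n) p - g s0 p) / (Z n - s0)) \<le> B" for n
    proof (rule AE_I2)
      fix p assume p: "p \<in> space \<mu>"
      \<comment> \<open>The mean value inequality turns the bound on the derivative into one on the
        difference quotients.\<close>
      have "norm (g (Z n) p - g s0 p) \<le> B * norm (Z n - s0)"
        by (rule field_differentiable_bound[where f="\<lambda>s. g s p" and f'="\<lambda>s. g' s p" and S="ball s0 \<delta>"])
          (use der[OF p] bd[OF p] Z s0 in \<open>auto intro: has_field_derivative_at_within\<close>)
      then show "norm ((g (Z n) p - g s0 p) / (Z n - s0)) \<le> B"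
        using Z(2)[of n] by (simp add: divide_le_eq)
    qed
  qed (use meas in auto)
  moreover have "(LINT p|\<mu>. (g (Z n) p - g s0 p) / (Z n - s0)) = ((LINT p|\<mu>. g (Z n) p) - (LINT p|\<mu>. g s0 p)) / (Z n - s0)" for n
    using int[OF Z(1)] int[OF s0] by simp
  ultimately have "(\<lambda>n. ((LINT p|\<mu>. g (Z n) p) - (LINT p|\<mu>. g s0 p)) / (Z n - s0)) \<longlonglongrightarrow> (LINT p|\<mu>. g' s0 p)" by (simp only:)
  then have "(\<lambda>n. ((\<lambda>y. ((LINT p|\<mu>. g y p) - (LINT p|\<mu>. g s0 p)) / (y - s0)) \<circ> Y) (n + N)) \<longlonglongrightarrow> (LINT p|\<mu>. g' s0 p)"
    by (simp add: Z_def o_def)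
  then show "((\<lambda>y. ((LINT p|\<mu>. g y p) - (LINT p|\<mu>. g s0 p)) / (y - s0)) \<circ> Y) \<longlonglongrightarrow> (LINT p|\<mu>. g' s0 p)"
    by (rule LIMSEQ_offset)
qed

text \<open>The velocity of a curve as a function of the parameter; in this form it can be iterated
  and inherits smoothness.\<close>

definition vderiv :: "(real \<Rightarrow> 'q::real_normed_vector) \<Rightarrow> real \<Rightarrow> 'q" where
  "vderiv \<theta> s = frechet_derivative \<theta> (at s) 1"

lemma smooth_on_vderiv: "smooth_on \<theta> I \<Longrightarrow> smooth_on (vderiv \<theta>) I"
  unfolding vderiv_def[abs_def] by (rule smooth_on_frechet_derivative)

lemma vderiv_has_vector_derivative:
  assumes "smooth_on \<theta> I" "s \<in> I"
  shows "(\<theta> has_vector_derivative vderiv \<theta> s) (at s)"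
proof -
  have d: "(\<theta> has_derivative frechet_derivative \<theta> (at s)) (at s)" by (rule smooth_on_has_derivative[OF assms])
  have "frechet_derivative \<theta> (at s) = (\<lambda>h. h *\<^sub>R vderiv \<theta> s)"
  proof
    fix h :: real
    have "frechet_derivative \<theta> (at s) (h *\<^sub>R 1) = h *\<^sub>R frechet_derivative \<theta> (at s) 1"
      by (rule linear_scale[OF has_derivative_linear[OF d]])
    then show "frechet_derivative \<theta> (at s) h = h *\<^sub>R vderiv \<theta> s" by (simp add: vderiv_def)
  qed
  then show ?thesis using d unfolding has_vector_derivative_def by (simp only:)
qed

lemma vderiv_eqI:
  assumes "(\<theta> has_vector_derivative d) (at s)"
  shows "vderiv \<theta> s = d"
proof -
  have "frechet_derivative \<theta> (at s) = (\<lambda>h. h *\<^sub>R d)"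
    using frechet_derivative_at[OF assms[unfolded has_vector_derivative_def]] by simp
  then show ?thesis by (simp add: vderiv_def)
qed

text \<open>\<open>Q\<close> is bounded, and \<open>\<theta>\<close> with its first two derivatives
  is bounded on a compact interval around \<open>s0\<close>; these bounds dominate the integrands.
  As the exponent is linear in \<open>\<theta>\<close>, differentiation concerns only a curve in a
  finite-dimensional space.\<close>

lemma exponential_integral_derivatives:
  fixes \<theta> :: "real \<Rightarrow> 'q::euclidean_space" and Q :: "'a \<Rightarrow> 'q"
  assumes \<mu>: "finite_measure \<mu>" and Q: "Q \<in> borel_measurable \<mu>" "\<And>p. p \<in> space \<mu> \<Longrightarrow> norm (Q p) \<le> C"
    and \<theta>: "smooth_on \<theta> I" and I: "open I" "s0 \<in> I"
  shows "((\<lambda>s. LINT p|\<mu>. exp (\<theta> s \<bullet> Q p)) has_real_derivative (LINT p|\<mu>. (vderiv \<theta> s0 \<bullet> Q p) * exp (\<theta> s0 \<bullet> Q p))) (at s0)"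
    "((\<lambda>s. LINT p|\<mu>. (vderiv \<theta> s \<bullet> Q p) * exp (\<theta> s \<bullet> Q p)) has_real_derivative
      (LINT p|\<mu>. (vderiv (vderiv \<theta>) s0 \<bullet> Q p + (vderiv \<theta> s0 \<bullet> Q p)\<^sup>2) * exp (\<theta> s0 \<bullet> Q p))) (at s0)"
proof -
  interpret finite_measure \<mu> by fact
  obtain \<delta> where \<delta>: "\<delta> > 0" "cball s0 \<delta> \<subseteq> I" using I open_contains_cball by blast
  note \<theta>1 = smooth_on_vderiv[OF \<theta>]
  note \<theta>2 = smooth_on_vderiv[OF \<theta>1]
  have bound: "\<exists>R. \<forall>s\<in>cball s0 \<delta>. norm (f s) \<le> R" if "smooth_on f I" for f :: "real \<Rightarrow> 'q"
  proof -
    have "compact (f ` cball s0 \<delta>)"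
      by (intro compact_continuous_image continuous_on_subset[OF smooth_on_imp_continuous_on[OF that]] \<delta>(2) compact_cball)
    then show ?thesis using compact_imp_bounded[of "f ` cball s0 \<delta>"] by (simp add: bounded_iff)
  qed
  obtain R0 where R0: "\<And>s. s \<in> cball s0 \<delta> \<Longrightarrow> norm (\<theta> s) \<le> R0" using bound[OF \<theta>] by blast
  obtain R1 where R1: "\<And>s. s \<in> cball s0 \<delta> \<Longrightarrow> norm (vderiv \<theta> s) \<le> R1" using bound[OF \<theta>1] by blast
  obtain R2 where R2: "\<And>s. s \<in> cball s0 \<delta> \<Longrightarrow> norm (vderiv (vderiv \<theta>) s) \<le> R2" using bound[OF \<theta>2] by blast
  define C' where "C' = max C 0"
  have ip: "\<bar>v \<bullet> Q p\<bar> \<le> R * C'" if "norm v \<le> R" "p \<in> space \<mu>" for v R p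
  proof -
    have "\<bar>v \<bullet> Q p\<bar> \<le> norm v * norm (Q p)" by (rule Cauchy_Schwarz_ineq2)
    also have "\<dots> \<le> R * C'" using that Q(2)[OF that(2)] by (intro mult_mono) (auto simp: C'_def order_trans[OF norm_ge_zero])
    finally show ?thesis .
  qed
  have eb: "exp (\<theta> s \<bullet> Q p) \<le> exp (R0 * C')" if "s \<in> ball s0 \<delta>" "p \<in> space \<mu>" for s p
    using ip[OF R0 that(2), of s] that by auto
  have sub': "s \<in> cball s0 \<delta>" if "s \<in> ball s0 \<delta>" for s using \<delta>(2) that by auto
  have dI: "s \<in> I" if "s \<in> ball s0 \<delta>" for s using \<delta>(2) that by auto
  have ms: "(\<lambda>p. v \<bullet> Q p) \<in> borel_measurable \<mu>" for v using Q(1) by simp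
  have int0: "integrable \<mu> (\<lambda>p. exp (\<theta> s \<bullet> Q p))" if "s \<in> ball s0 \<delta>" for s
    by (rule integrable_const_bound[of _ "exp (R0 * C')"]) (use eb[OF that] ms in auto)
  have b1: "\<bar>(vderiv \<theta> s \<bullet> Q p) * exp (\<theta> s \<bullet> Q p)\<bar> \<le> (R1 * C') * exp (R0 * C')" if "p \<in> space \<mu>" "s \<in> ball s0 \<delta>" for s p
  proof -
    have a: "\<bar>vderiv \<theta> s \<bullet> Q p\<bar> \<le> R1 * C'" by (rule ip[OF R1[OF sub'[OF that(2)]] that(1)])
    show ?thesis unfolding abs_mult using a eb[OF that(2,1)] by (intro mult_mono) auto
  qed
  have int1: "integrable \<mu> (\<lambda>p. (vderiv \<theta> s \<bullet> Q p) * exp (\<theta> s \<bullet> Q p))" if "s \<in> ball s0 \<delta>" for s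
    by (rule integrable_const_bound[of _ "(R1 * C') * exp (R0 * C')"]) (use b1[OF _ that] ms in auto)
  have d0: "((\<lambda>s. f s \<bullet> Q p) has_real_derivative vderiv f s \<bullet> Q p) (at s)"
    if "smooth_on f I" "s \<in> ball s0 \<delta>" for f s p
    using bounded_linear.has_vector_derivative[OF bounded_linear_inner_left vderiv_has_vector_derivative[OF that(1) dI[OF that(2)]]]
    by (simp add: has_real_derivative_iff_has_vector_derivative)
  show "((\<lambda>s. LINT p|\<mu>. exp (\<theta> s \<bullet> Q p)) has_real_derivative (LINT p|\<mu>. (vderiv \<theta> s0 \<bullet> Q p) * exp (\<theta> s0 \<bullet> Q p))) (at s0)"
  proof (rule has_real_derivative_integral[OF \<mu> \<delta>(1) _ b1 int0])
    show "((\<lambda>s. exp (\<theta> s \<bullet> Q p)) has_real_derivative (vderiv \<theta> s \<bullet> Q p) * exp (\<theta> s \<bullet> Q p)) (at s)"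
      if "s \<in> ball s0 \<delta>" for s p
      using DERIV_fun_exp[OF d0[OF \<theta> that]] by (simp add: mult.commute)
  qed (use ms in auto)
  have b2: "\<bar>(vderiv (vderiv \<theta>) s \<bullet> Q p + (vderiv \<theta> s \<bullet> Q p)\<^sup>2) * exp (\<theta> s \<bullet> Q p)\<bar> \<le> (R2 * C' + (R1 * C')\<^sup>2) * exp (R0 * C')"
    if "p \<in> space \<mu>" "s \<in> ball s0 \<delta>" for s p
  proof -
    have a: "\<bar>vderiv \<theta> s \<bullet> Q p\<bar> \<le> R1 * C'" by (rule ip[OF R1[OF sub'[OF that(2)]] that(1)])
    have b: "\<bar>vderiv (vderiv \<theta>) s \<bullet> Q p\<bar> \<le> R2 * C'" by (rule ip[OF R2[OF sub'[OF that(2)]] that(1)])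
    have "(vderiv \<theta> s \<bullet> Q p)\<^sup>2 \<le> (R1 * C')\<^sup>2" using a by (rule power2_le_iff_abs_le[THEN iffD2, rotated]) (use a in linarith)
    then have "\<bar>vderiv (vderiv \<theta>) s \<bullet> Q p + (vderiv \<theta> s \<bullet> Q p)\<^sup>2\<bar> \<le> R2 * C' + (R1 * C')\<^sup>2"
      using b by (smt (verit) zero_le_power2)
    then show ?thesis unfolding abs_mult using eb[OF that(2,1)] by (intro mult_mono) auto
  qed
  show "((\<lambda>s. LINT p|\<mu>. (vderiv \<theta> s \<bullet> Q p) * exp (\<theta> s \<bullet> Q p)) has_real_derivative
      (LINT p|\<mu>. (vderiv (vderiv \<theta>) s0 \<bullet> Q p + (vderiv \<theta> s0 \<bullet> Q p)\<^sup>2) * exp (\<theta> s0 \<bullet> Q p))) (at s0)"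
  proof (rule has_real_derivative_integral[OF \<mu> \<delta>(1) _ b2 int1])
    show "((\<lambda>s. (vderiv \<theta> s \<bullet> Q p) * exp (\<theta> s \<bullet> Q p)) has_real_derivative
       (vderiv (vderiv \<theta>) s \<bullet> Q p + (vderiv \<theta> s \<bullet> Q p)\<^sup>2) * exp (\<theta> s \<bullet> Q p)) (at s)"
      if "s \<in> ball s0 \<delta>" for s p
      using DERIV_mult[OF d0[OF \<theta>1 that] DERIV_fun_exp[OF d0[OF \<theta> that]]]
      by (simp add: algebra_simps power2_eq_square)
  qed (use ms in auto)
qed

section \<open>Gaussian integrals on a closed submanifold\<close>

context cimm
begin

text \<open>At a maximum of \<open>|X|^2\<close> its differential vanishes, which says that
  \<open>X\<close> is orthogonal to the tangent space. If \<open>X\<close> were 0 there it would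
  vanish everywhere, and an immersion of positive dimension is not constant.\<close>

lemma exists_normal_position: "\<exists>p\<in>M. X p \<noteq> 0 \<and> tproj p (X p) = 0"
proof -
  define f where "f p = X p \<bullet> X p" for p
  have fs: "smooth_map_on S M f" unfolding f_def
    by (intro smooth_map_on_bilinear[OF openin_M bounded_bilinear_inner] smooth_pos)
  have cf: "continuous_map (mtop S) euclidean f" by (rule smooth_imp_continuous_map[OF fs])
  have "compactin euclidean (f ` M)" by (rule image_compactin[OF compact[unfolded compact_space_def] cf])
  then have "compact (f ` M)" by simp
  then obtain m where "m \<in> f ` M" "\<forall>y\<in>f ` M. y \<le> m" using compact_attains_sup[of "f ` M"] M_nonempty by auto
  then obtain p where p: "p \<in> M" and max: "\<And>q. q \<in> M \<Longrightarrow> f q \<le> f p" by auto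
  obtain c where c: "c \<in> atlas S" "p \<in> fst c" using atlas_covers[OF p] by blast
  define A where "A = dloc c X (snd c p)"
  have Xd: "(local_rep c X has_derivative A) (at (snd c p))" unfolding A_def by (rule dloc_has_derivative[OF smooth_pos c p])
  have lp: "local_rep c X (snd c p) = X p" using c by (simp add: local_rep_def)
  have fd: "((\<lambda>x. local_rep c X x \<bullet> local_rep c X x) has_derivative (\<lambda>v. X p \<bullet> A v + A v \<bullet> X p)) (at (snd c p))"
    using has_derivative_inner[OF Xd Xd] by (simp add: lp)
  have "(\<lambda>v. X p \<bullet> A v + A v \<bullet> X p) = (\<lambda>v. 0)"
  proof (rule differential_zero_maxmin[OF _ open_cdom[OF c(1)] fd])
    show "snd c p \<in> cdom c" using c by auto
    have "local_rep c X y \<bullet> local_rep c X y \<le> local_rep c X (snd c p) \<bullet> local_rep c X (snd c p)" if "y \<in> cdom c" for y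
      using max[of "cinv c y"] subsetD[OF chart_subset[OF c(1)] cinv_in[OF that]] unfolding lp by (simp add: f_def local_rep_def)
    then show "(\<forall>y\<in>cdom c. local_rep c X y \<bullet> local_rep c X y \<le> local_rep c X (snd c p) \<bullet> local_rep c X (snd c p)) \<or>
      (\<forall>y\<in>cdom c. local_rep c X (snd c p) \<bullet> local_rep c X (snd c p) \<le> local_rep c X y \<bullet> local_rep c X y)" by blast
  qed
  then have z: "X p \<bullet> A v = 0" for v by (auto dest: fun_cong[of _ _ v] simp: inner_commute)
  have "tproj p (X p) = A (pinv A (X p))" unfolding A_def by (rule tderiv_chart[OF c openin_M p smooth_pos])
  then have "X p \<bullet> tproj p (X p) = 0" using z by simp
  then have "tproj p (X p) \<bullet> tproj p (X p) = 0" using tproj_inner[OF p, of "X p" "X p"] by (simp add: inner_commute)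
  then have t0: "tproj p (X p) = 0" by simp
  have "X p \<noteq> 0"
  proof
    assume "X p = 0"
    then have "f q \<le> 0" if "q \<in> M" for q using max[OF that] by (simp add: f_def)
    then have X0: "X q = 0" if "q \<in> M" for q using that unfolding f_def by (metis inner_ge_zero inner_eq_zero_iff order_antisym)
    have "(local_rep c X has_derivative (\<lambda>_. 0)) (at (snd c p))"
    proof (rule has_derivative_transform_within_open[OF has_derivative_const open_cdom[OF c(1)]])
      show "snd c p \<in> cdom c" using c by auto
      show "0 = local_rep c X y" if "y \<in> cdom c" for y
        using X0[OF subsetD[OF chart_subset[OF c(1)] cinv_in[OF that]]] by (simp add: local_rep_def)
    qed
    then have "A = (\<lambda>_. 0)" using has_derivative_unique[OF Xd] by blast
    moreover have "inj A" unfolding A_def by (rule dloc_pos_inj[OF c])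
    moreover obtain b :: 'e where "b \<in> Basis" using nonempty_Basis by blast
    ultimately show False using nonzero_Basis[of b] by (metis injD)
  qed
  then show ?thesis using p t0 by blast
qed

text \<open>The projection is the derivative of the position, so its trace is the divergence of
  \<open>X\<close>, which a chart computes as the trace of the identity.\<close>

lemma tr_tproj:
  assumes p: "p \<in> M"
  shows "tr (tproj p) = DIM('e)"
proof -
  obtain c where c: "c \<in> atlas S" "p \<in> fst c" using atlas_covers[OF p] by blast
  have "tr (tproj p) = divg X p" by (simp add: divg_def)
  also have "\<dots> = tr (\<lambda>w :: 'e. w)"
    unfolding divg_chart[OF c openin_M p smooth_pos] by (simp add: pinv_left[OF dloc_pos_linear[OF c] dloc_pos_inj[OF c]])
  also have "\<dots> = DIM('e)" by (simp add: tr_def)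
  finally show ?thesis .
qed

text \<open>Not normalized: \<open>gint (\<lambda>p. 1)\<close> is the total weighted area and
  appears as a factor in the identities below.\<close>

definition gint :: "('a \<Rightarrow> real) \<Rightarrow> real" where
  "gint f = (LINT p|\<mu>S. f p * gauss p)"

lemma gint_cong: "(\<And>p. p \<in> M \<Longrightarrow> f p = g p) \<Longrightarrow> gint f = gint g"
  unfolding gint_def by (rule Bochner_Integration.integral_cong) auto

lemma gint_add: "smooth_map_on S M f \<Longrightarrow> smooth_map_on S M g \<Longrightarrow> gint (\<lambda>p. f p + g p) = gint f + gint g"
  using Bochner_Integration.integral_add[OF integrable_gauss integrable_gauss] by (simp add: gint_def distrib_right)

lemma gint_diff: "smooth_map_on S M f \<Longrightarrow> smooth_map_on S M g \<Longrightarrow> gint (\<lambda>p. f p - g p) = gint f - gint g"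
  using Bochner_Integration.integral_diff[OF integrable_gauss integrable_gauss] by (simp add: gint_def left_diff_distrib)

lemma gint_cmult: "gint (\<lambda>p. k * f p) = k * gint f"
  by (simp add: gint_def mult.assoc)

lemma gint_const: "gint (\<lambda>p. k) = k * gint (\<lambda>p. 1)"
  using gint_cmult[of k "\<lambda>p. 1"] by simp

lemma gint_pos:
  assumes f: "smooth_map_on S M f" and nn: "\<And>q. q \<in> M \<Longrightarrow> f q \<ge> 0" and p: "p \<in> M" "f p > 0"
  shows "gint f > 0"
  unfolding gint_def
  by (rule integral_pos[OF continuous_mult[OF smooth_imp_continuous_map[OF f] smooth_gauss_continuous] _ p(1)])
    (use nn p in \<open>auto simp: gauss_def\<close>)

lemma gint_nonneg: "(\<And>q. q \<in> M \<Longrightarrow> f q \<ge> 0) \<Longrightarrow> gint f \<ge> 0"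
  unfolding gint_def by (rule Bochner_Integration.integral_nonneg_AE) (auto simp: gauss_def)

end

context shrinker
begin

lemma gint_divg:
  assumes W: "smooth_map_on S M W"
  shows "gint (divg W) = gint (\<lambda>p. X p \<bullet> W p / 2)"
proof -
  have "smooth_map_on S M (\<lambda>p. X p \<bullet> W p / 2)"
    by (rule smooth_map_on_bounded_linear[OF openin_M bounded_linear_divide smooth_map_on_bilinear[OF openin_M bounded_bilinear_inner smooth_pos W]])
  from gint_diff[OF smooth_divg[OF W] this] integral_divergence[OF W]
  show ?thesis by (simp add: gint_def)
qed

section \<open>Identities for a self-adjoint map that commutes with the tangential
  projections\<close>

context
  fixes L :: "'v \<Rightarrow> 'v" and y :: 'v and \<kappa> :: real
  assumes L: "linear L" and Lsa: "\<And>u v. L u \<bullet> v = u \<bullet> L v"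
    and Lt: "\<And>p v. p \<in> M \<Longrightarrow> tproj p (L v) = L (tproj p v)"
    and trL: "\<And>p. p \<in> M \<Longrightarrow> tr (\<lambda>v. L (tproj p v)) = \<kappa>"
begin

text \<open>For a suitable \<open>L\<close>, the first derivative of the exponent of
  \<open>F\<close> at \<open>s = 0\<close> will be \<open>w + l / 2 - \<kappa>\<close>.\<close>

abbreviation "w \<equiv> \<lambda>p. X p \<bullet> L (X p) / 2"
abbreviation "l \<equiv> \<lambda>p. X p \<bullet> y"

lemma L_bounded: "bounded_linear L"
  using L linear_conv_bounded_linear by blast

lemma smooth_LX: "smooth_map_on S M (\<lambda>p. L (X p))"
  by (rule smooth_map_on_bounded_linear[OF openin_M L_bounded smooth_pos])

lemma smooth_w: "smooth_map_on S M w"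
  by (rule smooth_map_on_bounded_linear[OF openin_M bounded_linear_divide smooth_map_on_bilinear[OF openin_M bounded_bilinear_inner smooth_pos smooth_LX]])

lemma smooth_l: "smooth_map_on S M l"
  by (rule smooth_map_on_bilinear[OF openin_M bounded_bilinear_inner smooth_pos smooth_map_on_const[OF openin_M]])

lemma tderiv_LX: "p \<in> M \<Longrightarrow> tderiv (\<lambda>p. L (X p)) p v = L (tproj p v)"
  by (rule tderiv_bounded_linear[OF L_bounded _ _ smooth_pos])

lemma tderiv_w:
  assumes p: "p \<in> M"
  shows "tderiv w p v = L (X p) \<bullet> tproj p v"
proof -
  have "tderiv w p v = tderiv (\<lambda>p. X p \<bullet> L (X p)) p v / 2"
    by (rule tderiv_bounded_linear[OF bounded_linear_divide p p smooth_map_on_bilinear[OF openin_M bounded_bilinear_inner smooth_pos smooth_LX]])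
  also have "tderiv (\<lambda>p. X p \<bullet> L (X p)) p v = X p \<bullet> L (tproj p v) + tproj p v \<bullet> L (X p)"
    using tderiv_bilinear[OF bounded_bilinear_inner p p smooth_pos smooth_LX] by (simp add: tderiv_LX[OF p])
  also have "X p \<bullet> L (tproj p v) = L (X p) \<bullet> tproj p v" by (rule Lsa[symmetric])
  also have "tproj p v \<bullet> L (X p) = L (X p) \<bullet> tproj p v" by (rule inner_commute)
  finally show ?thesis by simp
qed

lemma tderiv_l: "p \<in> M \<Longrightarrow> tderiv l p v = y \<bullet> tproj p v"
  using tderiv_bilinear[OF bounded_bilinear_inner _ _ smooth_pos smooth_map_on_const[OF openin_M], of p y v]
  by (simp add: tderiv_const inner_commute)

lemma divg_LX:
  assumes "p \<in> M"
  shows "divg (\<lambda>p. L (X p)) p = \<kappa>"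
proof -
  have "tderiv (\<lambda>p. L (X p)) p = (\<lambda>v. L (tproj p v))" by (rule ext, rule tderiv_LX[OF assms])
  then show ?thesis using trL[OF assms] by (simp add: divg_def)
qed

lemma divg_const: "divg (\<lambda>p. y) p = 0"
  by (simp add: divg_def tr_def tderiv_const)

text \<open>The test field is the constant \<open>y\<close>, whose divergence is 0.\<close>

lemma gint_l: "gint l = 0"
proof -
  have "gint (divg (\<lambda>p. y)) = gint (\<lambda>p. X p \<bullet> y / 2)" by (rule gint_divg[OF smooth_map_on_const[OF openin_M]])
  moreover have "gint (divg (\<lambda>p. y)) = 0" by (simp add: gint_def divg_const)
  moreover have "gint (\<lambda>p. X p \<bullet> y / 2) = 1 / 2 * gint l" using gint_cmult[of "1/2" l] by simp
  ultimately show ?thesis by simp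
qed

text \<open>The test field is \<open>L X\<close>, whose divergence is the constant trace
  \<open>\<kappa>\<close>.\<close>

lemma gint_w: "gint w = \<kappa> * gint (\<lambda>p. 1)"
proof -
  have "gint (divg (\<lambda>p. L (X p))) = gint w" by (rule gint_divg[OF smooth_LX])
  moreover have "gint (divg (\<lambda>p. L (X p))) = gint (\<lambda>p. \<kappa>)" by (rule gint_cong) (rule divg_LX)
  ultimately show ?thesis using gint_const[of \<kappa>] by simp
qed

text \<open>Two test fields evaluate the same term: \<open>w y\<close> gives half the integral of
  \<open>w l\<close>, while \<open>l L X\<close> gives all of it, the integral of \<open>l\<close>
  being 0. Both can hold only if the term vanishes.\<close>

lemma gint_cross: "gint (\<lambda>p. tproj p (L (X p)) \<bullet> y) = 0"
proof -
  let ?c = "\<lambda>p. tproj p (L (X p)) \<bullet> y"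
  have sc: "smooth_map_on S M ?c"
    by (intro smooth_map_on_bilinear[OF openin_M bounded_bilinear_inner] smooth_map_on_const openin_M smooth_tderiv smooth_pos smooth_LX)
  have 1: "gint ?c = 1 / 2 * gint (\<lambda>p. w p * l p)"
  proof -
    have sW: "smooth_map_on S M (\<lambda>p. w p *\<^sub>R y)"
      by (intro smooth_map_on_bilinear[OF openin_M bounded_bilinear_scaleR] smooth_w smooth_map_on_const openin_M)
    have "gint ?c = gint (divg (\<lambda>p. w p *\<^sub>R y))"
    proof (rule gint_cong)
      fix p assume p: "p \<in> M"
      show "?c p = divg (\<lambda>p. w p *\<^sub>R y) p"
        using divg_scaleR[OF p smooth_w smooth_map_on_const[OF openin_M], of y] tproj_selfadjoint[OF p, of "L (X p)" y]
        by (simp add: divg_const tderiv_w[OF p])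
    qed
    also have "\<dots> = gint (\<lambda>p. X p \<bullet> (w p *\<^sub>R y) / 2)" by (rule gint_divg[OF sW])
    also have "\<dots> = gint (\<lambda>p. 1 / 2 * (w p * l p))" by (rule gint_cong) simp
    finally show ?thesis by (simp only: gint_cmult)
  qed
  have 2: "gint ?c = gint (\<lambda>p. w p * l p)"
  proof -
    have sW: "smooth_map_on S M (\<lambda>p. l p *\<^sub>R L (X p))"
      by (intro smooth_map_on_bilinear[OF openin_M bounded_bilinear_scaleR] smooth_l smooth_LX)
    have "gint (divg (\<lambda>p. l p *\<^sub>R L (X p))) = gint (\<lambda>p. X p \<bullet> (l p *\<^sub>R L (X p)) / 2)" by (rule gint_divg[OF sW])
    also have "\<dots> = gint (\<lambda>p. w p * l p)" by (rule gint_cong) simp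
    finally have "gint (divg (\<lambda>p. l p *\<^sub>R L (X p))) = gint (\<lambda>p. w p * l p)" .
    moreover have "gint (divg (\<lambda>p. l p *\<^sub>R L (X p))) = gint (\<lambda>p. \<kappa> * l p + ?c p)"
    proof (rule gint_cong)
      fix p assume p: "p \<in> M"
      show "divg (\<lambda>p. l p *\<^sub>R L (X p)) p = \<kappa> * l p + ?c p"
        using divg_scaleR[OF p smooth_l smooth_LX] divg_LX[OF p] tderiv_l[OF p, of "L (X p)"]
        by (simp add: inner_commute mult.commute)
    qed
    moreover have "gint (\<lambda>p. \<kappa> * l p + ?c p) = \<kappa> * gint l + gint ?c"
      using gint_add[OF smooth_map_on_bounded_linear[OF openin_M bounded_linear_mult_right smooth_l] sc] gint_cmult[of \<kappa> l] by simp
    ultimately show ?thesis using gint_l by simp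
  qed
  show ?thesis using 1 2 by simp
qed

text \<open>The test field is \<open>u Z\<close> with \<open>u = w + l / 2 - \<kappa>\<close> and
  \<open>Z = L X + y\<close>, chosen so that \<open>X \<bullet> Z / 2 = u + \<kappa>\<close> and
  \<open>div Z = \<kappa>\<close>. The terms \<open>\<kappa> u\<close> cancel and leave the integral
  of \<open>u^2\<close> against that of the derivative of \<open>u\<close> along \<open>Z\<close>.
  Since the gradient of \<open>u\<close> is the tangential part of \<open>L X + y / 2\<close>, the
  cross term appears with the factor 3/2 and drops out by \<open>gint_cross\<close>.\<close>

lemma gint_square:
  "gint (\<lambda>p. (w p + l p / 2 - \<kappa>)\<^sup>2) =
   gint (\<lambda>p. (norm (tproj p (L (X p))))\<^sup>2) + 1 / 2 * gint (\<lambda>p. (norm (tproj p y))\<^sup>2)"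
proof -
  define u where "u p = w p + l p / 2 - \<kappa>" for p
  define Z where "Z p = L (X p) + y" for p
  have sl2: "smooth_map_on S M (\<lambda>p. l p / 2)"
    by (rule smooth_map_on_bounded_linear[OF openin_M bounded_linear_divide smooth_l])
  have su: "smooth_map_on S M u" unfolding u_def
    by (intro smooth_map_on_diff smooth_map_on_add smooth_map_on_const openin_M smooth_w sl2)
  have sZ: "smooth_map_on S M Z" unfolding Z_def
    by (intro smooth_map_on_add smooth_map_on_const openin_M smooth_LX)
  have suZ: "smooth_map_on S M (\<lambda>p. u p *\<^sub>R Z p)"
    by (rule smooth_map_on_bilinear[OF openin_M bounded_bilinear_scaleR su sZ])
  have tu: "tderiv u p v = (L (X p) + y /\<^sub>R 2) \<bullet> tproj p v" if p: "p \<in> M" for p v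
  proof -
    have "tderiv u p v = tderiv (\<lambda>q. w q + l q / 2) p v - tderiv (\<lambda>q. \<kappa>) p v"
      unfolding u_def by (rule tderiv_diff[OF p p smooth_map_on_add[OF openin_M smooth_w sl2] smooth_map_on_const[OF openin_M]])
    also have "tderiv (\<lambda>q. w q + l q / 2) p v = tderiv (\<lambda>q. w q - (- 1 / 2) * l q) p v" by simp
    also have "\<dots> = tderiv w p v - tderiv (\<lambda>q. (- 1 / 2) * l q) p v"
      by (rule tderiv_diff[OF p p smooth_w smooth_map_on_bounded_linear[OF openin_M bounded_linear_mult_right smooth_l]])
    also have "tderiv (\<lambda>q. (- 1 / 2) * l q) p v = (- 1 / 2) * tderiv l p v"
      by (rule tderiv_bounded_linear[OF bounded_linear_mult_right p p smooth_l])
    finally show ?thesis by (simp add: tderiv_const tderiv_w[OF p] tderiv_l[OF p] inner_add_left)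
  qed
  have dZ: "divg Z p = \<kappa>" if p: "p \<in> M" for p
  proof -
    have "divg (\<lambda>q. Z q - y) p = divg Z p - divg (\<lambda>q. y) p" by (rule divg_diff[OF p sZ smooth_map_on_const[OF openin_M]])
    then show ?thesis using divg_LX[OF p] divg_const by (simp add: Z_def)
  qed
  let ?g = "\<lambda>p. tderiv u p (Z p)"
  have sg: "smooth_map_on S M ?g" by (rule smooth_tderiv[OF su sZ])
  have ssq: "smooth_map_on S M (\<lambda>p. u p * u p)" by (rule smooth_map_on_bilinear[OF openin_M bounded_bilinear_mult su su])
  have sku: "smooth_map_on S M (\<lambda>p. \<kappa> * u p)" by (rule smooth_map_on_bounded_linear[OF openin_M bounded_linear_mult_right su])
  have "gint (divg (\<lambda>p. u p *\<^sub>R Z p)) = gint (\<lambda>p. X p \<bullet> (u p *\<^sub>R Z p) / 2)" by (rule gint_divg[OF suZ])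
  moreover have "gint (divg (\<lambda>p. u p *\<^sub>R Z p)) = gint (\<lambda>p. \<kappa> * u p + ?g p)"
    by (rule gint_cong) (simp add: divg_scaleR su sZ dZ mult.commute)
  moreover have "gint (\<lambda>p. X p \<bullet> (u p *\<^sub>R Z p) / 2) = gint (\<lambda>p. u p * u p + \<kappa> * u p)"
  proof (rule gint_cong)
    fix p
    have "X p \<bullet> (u p *\<^sub>R Z p) / 2 = u p * (w p + l p / 2)"
      by (simp add: Z_def inner_add_right add_divide_distrib distrib_left)
    also have "\<dots> = u p * (u p + \<kappa>)" by (simp add: u_def)
    finally show "X p \<bullet> (u p *\<^sub>R Z p) / 2 = u p * u p + \<kappa> * u p" by (simp add: algebra_simps)
  qed
  ultimately have e1: "gint (\<lambda>p. u p * u p) = gint ?g"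
    using gint_add[OF sku sg] gint_add[OF ssq sku] by simp
  let ?a = "\<lambda>p. (norm (tproj p (L (X p))))\<^sup>2" and ?b = "\<lambda>p. (norm (tproj p y))\<^sup>2" and ?c = "\<lambda>p. tproj p (L (X p)) \<bullet> y"
  have st: "smooth_map_on S M (\<lambda>p. tproj p (L (X p)))" "smooth_map_on S M (\<lambda>p. tproj p y)"
    by (intro smooth_tderiv smooth_pos smooth_LX smooth_map_on_const openin_M)+
  have sa: "smooth_map_on S M ?a" and sb: "smooth_map_on S M ?b" and sc: "smooth_map_on S M ?c"
    unfolding power2_norm_eq_inner
    by (intro smooth_map_on_bilinear[OF openin_M bounded_bilinear_inner] st smooth_map_on_const openin_M)+
  have "gint ?g = gint (\<lambda>p. ?a p + (3 / 2 * ?c p + 1 / 2 * ?b p))"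
  proof (rule gint_cong)
    fix p assume p: "p \<in> M"
    have lin: "tproj p (Z p) = tproj p (L (X p)) + tproj p y"
      unfolding Z_def by (rule linear_add[OF tproj_linear[OF p]])
    have 1: "L (X p) \<bullet> tproj p (L (X p)) = ?a p"
      using tproj_inner[OF p, of "L (X p)" "L (X p)"] by (simp add: power2_norm_eq_inner inner_commute)
    have 2: "y \<bullet> tproj p y = ?b p"
      using tproj_inner[OF p, of y y] by (simp add: power2_norm_eq_inner inner_commute)
    have 3: "L (X p) \<bullet> tproj p y = ?c p" using tproj_selfadjoint[OF p, of "L (X p)" y] by simp
    have 4: "y \<bullet> tproj p (L (X p)) = ?c p" by (simp add: inner_commute)
    show "?g p = ?a p + (3 / 2 * ?c p + 1 / 2 * ?b p)"
      unfolding tu[OF p] lin by (simp add: inner_add_left inner_add_right 1 2 3 4)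
  qed
  also have "\<dots> = gint ?a + (gint (\<lambda>p. 3 / 2 * ?c p) + gint (\<lambda>p. 1 / 2 * ?b p))"
  proof -
    have s1: "smooth_map_on S M (\<lambda>p. 3 / 2 * ?c p)" and s2: "smooth_map_on S M (\<lambda>p. 1 / 2 * ?b p)"
      by (rule smooth_map_on_bounded_linear[OF openin_M bounded_linear_mult_right], rule sc sb)+
    show ?thesis using gint_add[OF sa smooth_map_on_add[OF openin_M s1 s2]] gint_add[OF s1 s2] by (simp only:)
  qed
  also have "\<dots> = gint ?a + 1 / 2 * gint ?b" unfolding gint_cmult gint_cross by simp
  finally show ?thesis using e1 by (simp add: u_def power2_eq_square[of "_ - \<kappa>"])
qed

text \<open>By Pythagoras the gap between the two sides is the integral of the squared normal part
  of \<open>L X\<close> plus half that of \<open>y\<close>. The first is strictly positive because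
  its integrand is positive at \<open>p\<close>.\<close>

lemma second_variation_negative:
  assumes p: "p \<in> M" "L (X p) \<noteq> tproj p (L (X p))"
  shows "gint (\<lambda>p. (w p + l p / 2 - \<kappa>)\<^sup>2) < gint (\<lambda>p. (norm (L (X p)))\<^sup>2) + 1 / 2 * (norm y)\<^sup>2 * gint (\<lambda>p. 1)"
proof -
  let ?a = "\<lambda>p. (norm (tproj p (L (X p))))\<^sup>2" and ?b = "\<lambda>p. (norm (tproj p y))\<^sup>2"
  have st: "smooth_map_on S M (\<lambda>p. tproj p (L (X p)))" "smooth_map_on S M (\<lambda>p. tproj p y)"
    by (intro smooth_tderiv smooth_pos smooth_LX smooth_map_on_const openin_M)+
  have sa: "smooth_map_on S M ?a" and sb: "smooth_map_on S M ?b" and sL: "smooth_map_on S M (\<lambda>p. (norm (L (X p)))\<^sup>2)"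
    unfolding power2_norm_eq_inner
    by (intro smooth_map_on_bilinear[OF openin_M bounded_bilinear_inner] st smooth_LX)+
  have pyth: "(norm v)\<^sup>2 - (norm (tproj q v))\<^sup>2 = (norm (v - tproj q v))\<^sup>2" if "q \<in> M" for q v
    using tproj_inner[OF that, of v v] by (simp add: power2_norm_eq_inner inner_diff_left inner_diff_right inner_commute)
  have "gint (\<lambda>q. (norm (L (X q)))\<^sup>2 - ?a q) > 0"
  proof (rule gint_pos[OF smooth_map_on_diff[OF openin_M sL sa] _ p(1)])
    show "(norm (L (X q)))\<^sup>2 - ?a q \<ge> 0" if "q \<in> M" for q unfolding pyth[OF that] by simp
    show "(norm (L (X p)))\<^sup>2 - ?a p > 0" unfolding pyth[OF p(1)] using p(2) by simp
  qed
  then have 1: "gint ?a < gint (\<lambda>q. (norm (L (X q)))\<^sup>2)" using gint_diff[OF sL sa] by simp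
  have "gint (\<lambda>q. (norm y)\<^sup>2 - ?b q) \<ge> 0"
    by (rule gint_nonneg) (simp add: pyth)
  then have 2: "gint ?b \<le> (norm y)\<^sup>2 * gint (\<lambda>p. 1)"
    using gint_diff[OF smooth_map_on_const[OF openin_M] sb, of "(norm y)\<^sup>2"] gint_const[of "(norm y)\<^sup>2"] by simp
  show ?thesis unfolding gint_square using 1 2 by simp
qed

end

end

section \<open>Scaled determinants and derivatives of the coefficient functions\<close>

lemma prod_Basis_prod:
  fixes f :: "'p::euclidean_space \<times> 'q::euclidean_space \<Rightarrow> 'r::comm_monoid_mult"
  shows "(\<Prod>i\<in>Basis. f i) = (\<Prod>b\<in>Basis. f (b, 0)) * (\<Prod>b\<in>Basis. f (0, b))"
proof -
  have "inj_on (\<lambda>u :: 'p. (u, 0 :: 'q)) Basis" "inj_on (\<lambda>u :: 'q. (0 :: 'p, u)) Basis" by (auto simp: inj_on_def)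
  moreover have "(\<lambda>u :: 'p. (u, 0 :: 'q)) ` Basis \<inter> (\<lambda>v. (0, v)) ` Basis = {}" using nonzero_Basis by auto
  ultimately show ?thesis
    unfolding Basis_prod_def by (subst prod.union_disjoint) (simp_all add: prod.reindex)
qed

text \<open>Every term of the expansion contains each \<open>k i\<close> once through its row and
  once through its column.\<close>

lemma det_diagonal_scaling:
  fixes G :: "real ^ 'n ^ 'n"
  shows "det (\<chi> i j. k i * k j * G $ i $ j) = (\<Prod>i\<in>UNIV. k i)\<^sup>2 * det G"
proof -
  have "(\<Prod>i\<in>UNIV. k i * k (p i) * G $ i $ p i) = (\<Prod>i\<in>UNIV. k i)\<^sup>2 * (\<Prod>i\<in>UNIV. G $ i $ p i)"
    if "p permutes UNIV" for p
    using prod.permute[OF that, of k] by (simp add: prod.distrib power2_eq_square o_def)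
  then show ?thesis
    unfolding det_def sum_distrib_left by (intro sum.cong refl) (simp add: mult_ac)
qed

lemma (in mfd) smooth_map_on_Pair:
  "openin (mtop S) N \<Longrightarrow> smooth_map_on S N f \<Longrightarrow> smooth_map_on S N g \<Longrightarrow> smooth_map_on S N (\<lambda>p. (f p, g p))"
  by (rule smooth_map_onI_global, rule smooth_on_Pair) (simp_all add: open_chart_Int smooth_map_onD2)

text \<open>The function is the first component of \<open>coeffs\<close> below: \<open>n\<close> and
  \<open>m\<close> will be the dimensions of the product and of the first factor, and
  \<open>xx\<close> will be \<open>|x|^2\<close>.\<close>

lemma log_coefficient_derivative:
  assumes t: "(t has_real_derivative t') (at s)" and x: "(xx has_real_derivative xx') (at s)"
    and pos: "t s > 0" "1 + s > (0::real)"
  shows "((\<lambda>s. - (n / 2) * ln (4 * pi * t s) + m * ln (1 + s) - xx s / (4 * t s)) has_real_derivative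
    - (n / 2) * (t' / t s) + m / (1 + s) - (xx' * t s - xx s * t') / (4 * (t s)\<^sup>2)) (at s)"
proof (rule DERIV_add[THEN DERIV_diff])
  have "((\<lambda>s. ln (4 * pi * t s)) has_real_derivative inverse (4 * pi * t s) * (4 * pi * t')) (at s)"
    by (rule DERIV_chain2[OF DERIV_ln DERIV_cmult[OF t]]) (use pos in simp)
  from DERIV_cmult[OF this, of "- (n / 2)"]
  show "((\<lambda>s. - (n / 2) * ln (4 * pi * t s)) has_real_derivative - (n / 2) * (t' / t s)) (at s)"
    by (rule DERIV_cong) (use pos in \<open>simp add: field_simps\<close>)
  have "((\<lambda>s. ln (1 + s)) has_real_derivative inverse (1 + s) * (0 + 1)) (at s)"
    by (rule DERIV_chain2[OF DERIV_ln DERIV_add[OF DERIV_const DERIV_ident]]) (use pos in simp)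
  from DERIV_cmult[OF this, of m]
  show "((\<lambda>s. m * ln (1 + s)) has_real_derivative m / (1 + s)) (at s)"
    by (rule DERIV_cong) (simp add: field_simps)
  have "((\<lambda>s. xx s / (4 * t s)) has_real_derivative (xx' * (4 * t s) - xx s * (4 * t')) / ((4 * t s) * (4 * t s))) (at s)"
    by (rule DERIV_divide[OF x DERIV_cmult[OF t]]) (use pos in simp)
  then show "((\<lambda>s. xx s / (4 * t s)) has_real_derivative (xx' * t s - xx s * t') / (4 * (t s)\<^sup>2)) (at s)"
    by (rule DERIV_cong) (use pos in \<open>simp add: field_simps power2_eq_square\<close>)
qed

lemma DERIV_power2:
  fixes f :: "real \<Rightarrow> real"
  assumes "(f has_real_derivative f') (at s)"
  shows "((\<lambda>s. (f s)\<^sup>2) has_real_derivative 2 * f s * f') (at s)"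
  using DERIV_mult[OF assms assms] by (simp add: power2_eq_square mult_ac)

text \<open>The vanishing of \<open>xx\<close> and \<open>xx'\<close> at 0 reflects
  \<open>x 0 = 0\<close>; only \<open>xx''\<close> survives from the translation.\<close>

lemma log_coefficient_second_derivative:
  assumes t: "(t has_real_derivative h) (at 0)" "(t' has_real_derivative t'') (at 0)" "t 0 = 1" "t' 0 = h"
    and x: "(xx has_real_derivative xx' 0) (at 0)" "(xx' has_real_derivative xx'') (at 0)" "xx 0 = 0" "xx' 0 = 0"
  shows "((\<lambda>s. - (n / 2) * (t' s / t s) + m / (1 + s) - (xx' s * t s - xx s * t' s) / (4 * (t s)\<^sup>2)) has_real_derivative
    - (n / 2) * (t'' - h\<^sup>2) - m - xx'' / 4) (at (0::real))"
proof -
  have 1: "((\<lambda>s. t' s / t s) has_real_derivative (t'' * t 0 - t' 0 * h) / (t 0 * t 0)) (at 0)"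
    by (rule DERIV_divide[OF t(2) t(1)]) (simp add: t)
  have 2: "((\<lambda>s. m / (1 + s)) has_real_derivative (0 * (1 + 0) - m * (0 + 1)) / ((1 + 0) * (1 + 0))) (at 0)"
    by (rule DERIV_divide[OF DERIV_const DERIV_add[OF DERIV_const DERIV_ident]]) simp
  have 3: "((\<lambda>s. (xx' s * t s - xx s * t' s) / (4 * (t s)\<^sup>2)) has_real_derivative
      ((xx'' * t 0 + h * xx' 0 - (xx' 0 * t' 0 + t'' * xx 0)) * (4 * (t 0)\<^sup>2) - (xx' 0 * t 0 - xx 0 * t' 0) * (4 * (2 * t 0 * h)))
      / ((4 * (t 0)\<^sup>2) * (4 * (t 0)\<^sup>2))) (at 0)"
    by (rule DERIV_divide[OF DERIV_diff[OF DERIV_mult[OF x(2) t(1)] DERIV_mult[OF x(1) t(2)]] DERIV_cmult[OF DERIV_power2[OF t(1)]]])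
      (simp add: t)
  show ?thesis
    by (rule DERIV_cong[OF DERIV_diff[OF DERIV_add[OF DERIV_cmult[OF 1] 2] 3]]) (simp add: t x power2_eq_square)
qed

text \<open>The functions are the coefficients of \<open>|X1|^2\<close> and \<open>|X2|^2\<close> in
  the exponent, the second and third components of \<open>coeffs\<close>.\<close>

lemma square_coefficient_derivative:
  assumes t: "(t has_real_derivative t') (at s)" and pos: "t s > (0::real)"
  shows "((\<lambda>s. - ((1 + s)\<^sup>2 / (4 * t s))) has_real_derivative - ((2 * (1 + s) * t s - (1 + s)\<^sup>2 * t') / (4 * (t s)\<^sup>2))) (at s)"
    "((\<lambda>s. - (1 / (4 * t s))) has_real_derivative t' / (4 * (t s)\<^sup>2)) (at s)"
proof -
  have "((\<lambda>s. (1 + s)\<^sup>2 / (4 * t s)) has_real_derivative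
    (2 * (1 + s) * (0 + 1) * (4 * t s) - (1 + s)\<^sup>2 * (4 * t')) / ((4 * t s) * (4 * t s))) (at s)"
    by (rule DERIV_divide[OF DERIV_power2[OF DERIV_add[OF DERIV_const DERIV_ident]] DERIV_cmult[OF t]]) (use pos in simp)
  from DERIV_minus[OF this]
  show "((\<lambda>s. - ((1 + s)\<^sup>2 / (4 * t s))) has_real_derivative - ((2 * (1 + s) * t s - (1 + s)\<^sup>2 * t') / (4 * (t s)\<^sup>2))) (at s)"
    by (rule DERIV_cong) (use pos in \<open>simp add: divide_simps power2_eq_square; simp add: algebra_simps\<close>)
  have "((\<lambda>s. 1 / (4 * t s)) has_real_derivative (0 * (4 * t s) - 1 * (4 * t')) / ((4 * t s) * (4 * t s))) (at s)"
    by (rule DERIV_divide[OF DERIV_const DERIV_cmult[OF t]]) (use pos in simp)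
  from DERIV_minus[OF this]
  show "((\<lambda>s. - (1 / (4 * t s))) has_real_derivative t' / (4 * (t s)\<^sup>2)) (at s)"
    by (rule DERIV_cong) (use pos in \<open>simp add: divide_simps power2_eq_square\<close>)
qed

lemma square_coefficient_second_derivative:
  assumes t: "(t has_real_derivative h) (at 0)" "(t' has_real_derivative t'') (at 0)" "t 0 = 1" "t' 0 = h"
  shows "((\<lambda>s. - ((2 * (1 + s) * t s - (1 + s)\<^sup>2 * t' s) / (4 * (t s)\<^sup>2))) has_real_derivative
      - (1 / 2) + h - (2 * h\<^sup>2 - t'') / 4) (at (0::real))"
    "((\<lambda>s. t' s / (4 * (t s)\<^sup>2)) has_real_derivative (t'' - 2 * h\<^sup>2) / 4) (at 0)"
proof -
  have q: "((\<lambda>s. 4 * (t s)\<^sup>2) has_real_derivative 4 * (2 * t 0 * h)) (at 0)"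
    by (rule DERIV_cmult[OF DERIV_power2[OF t(1)]])
  have l: "((\<lambda>s. 1 + s) has_real_derivative 0 + 1) (at (0::real))" by (rule DERIV_add[OF DERIV_const DERIV_ident])
  have nz: "4 * (t 0)\<^sup>2 \<noteq> 0" by (simp add: t)
  show "((\<lambda>s. - ((2 * (1 + s) * t s - (1 + s)\<^sup>2 * t' s) / (4 * (t s)\<^sup>2))) has_real_derivative
      - (1 / 2) + h - (2 * h\<^sup>2 - t'') / 4) (at (0::real))"
    by (rule DERIV_cong[OF DERIV_minus[OF DERIV_divide[OF DERIV_diff[OF
      DERIV_mult[OF DERIV_cmult[OF l, of 2] t(1)] DERIV_mult[OF DERIV_power2[OF l] t(2)]] q nz]]])
      (simp add: t power2_eq_square field_simps)
  show "((\<lambda>s. t' s / (4 * (t s)\<^sup>2)) has_real_derivative (t'' - 2 * h\<^sup>2) / 4) (at 0)"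
    by (rule DERIV_cong[OF DERIV_divide[OF t(2) q nz]]) (simp add: t power2_eq_square field_simps)
qed

section \<open>The dilation of the first factor\<close>

context prod_shrinker
begin

abbreviation "\<mu>P \<equiv> area_measure PS"

lemma pos_PS_apply: "pos PS z = (pos S1 (fst z), pos S2 (snd z))"
  by (simp add: pos_PS map_prod_def case_prod_beta)

definition proj1 :: "'v1 \<times> 'v2 \<Rightarrow> 'v1 \<times> 'v2" where
  "proj1 v = (fst v, 0)"

definition dilate :: "real \<Rightarrow> 'v1 \<times> 'v2 \<Rightarrow> 'v1 \<times> 'v2" where
  "dilate s v = v + s *\<^sub>R proj1 v"

definition dilated_pos :: "real \<Rightarrow> 'a \<times> 'b \<Rightarrow> 'v1 \<times> 'v2" where
  "dilated_pos s z = dilate s (pos PS z)"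

lemma proj1_bounded: "bounded_linear proj1"
  unfolding proj1_def[abs_def] by (rule bounded_linear_Pair[OF bounded_linear_fst bounded_linear_zero])

lemma dilate_bounded: "bounded_linear (dilate s)"
  unfolding dilate_def[abs_def]
  by (rule bounded_linear_add[OF bounded_linear_ident bounded_linear_compose[OF bounded_linear_scaleR_right proj1_bounded]])

lemma dilate_Pair: "dilate s (a, b) = ((1 + s) *\<^sub>R a, b)"
  by (simp add: dilate_def proj1_def algebra_simps)

lemma inj_dilate: "s > -1 \<Longrightarrow> inj (dilate s)"
  by (auto simp: inj_def dilate_Pair split_paired_all)

lemma smooth_dilated_pos: "smooth_map_on PS P.M (dilated_pos s)"
  unfolding dilated_pos_def by (rule P.smooth_map_on_bounded_linear[OF P.openin_M dilate_bounded smooth_pos_PS])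

lemma dloc_dilated_pos:
  assumes "C \<in> atlas PS" "x \<in> cdom C"
  shows "dloc C (dilated_pos s) x = (\<lambda>w. dilate s (dloc C (pos PS) x w))"
proof (rule P.dloc_eqI)
  have "(local_rep C (pos PS) has_derivative dloc C (pos PS) x) (at x)"
    unfolding dloc_def by (rule smooth_on_has_derivative[OF P.smooth_pos_chart[OF assms(1)] assms(2)])
  from bounded_linear.has_derivative[OF dilate_bounded this]
  show "(local_rep C (dilated_pos s) has_derivative (\<lambda>w. dilate s (dloc C (pos PS) x w))) (at x)"
    by (simp add: local_rep_def o_def dilated_pos_def)
qed

lemma immersed_dilated_pos:
  assumes "s > -1"
  shows "immersed_submanifold (PS\<lparr>pos := dilated_pos s\<rparr>)"
proof (rule P.immersed_posI[OF smooth_dilated_pos])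
  fix z assume "z \<in> P.M"
  then obtain C where C: "C \<in> atlas PS" "z \<in> fst C" using P.atlas_covers by blast
  have "inj (dloc C (dilated_pos s) (snd C z))"
    using inj_compose[OF inj_dilate[OF assms] P.dloc_pos_inj[OF C]] dloc_dilated_pos[OF C(1), of "snd C z"] C(2)
    by (simp add: o_def)
  then show "\<exists>C\<in>atlas PS. z \<in> fst C \<and> inj (dloc C (dilated_pos s) (snd C z))" using C by blast
qed

text \<open>Each basis vector of the product coordinates is mapped into one of the two factors, so
  the dilation multiplies its image by \<open>1 + s\<close> or by 1. Rows and columns of the Gram
  matrix scale accordingly, and the density gains one factor \<open>1 + s\<close> for each dimension
  of the first factor.\<close>

lemma dens_dilated_pos:
  assumes C: "C \<in> atlas PS" "x \<in> cdom C" and s: "s > -1"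
  shows "P.dens C (dilated_pos s) x = (1 + s) ^ DIM('e1) * P.adens C x"
proof -
  obtain c d where cd: "c \<in> atlas S1" "d \<in> atlas S2" "C = pc c d" using C(1) atlas_PS_iff by blast
  obtain p q where pq: "p \<in> fst c" "q \<in> fst d" "x = (snd c p, snd d q)" using C(2) unfolding cd(3) cdom_pc by auto
  define D where "D = dloc C (pos PS) x"
  have D: "D = (\<lambda>w. (dloc c (pos S1) (snd c p) (fst w), dloc d (pos S2) (snd d q) (snd w)))"
    unfolding D_def cd(3) pq(3) by (rule dloc_pc_pos[OF cd(1,2) pq(1,2)])
  define k where "k b = (if snd b = 0 then 1 + s else 1)" for b :: "'e1 \<times> 'e2"
  have kb: "dilate s (D b) = k b *\<^sub>R D b" if "b \<in> Basis" for b
  proof -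
    have "(\<exists>u\<in>Basis. b = (u, 0)) \<or> (\<exists>u\<in>Basis. b = (0, u))" using that by (auto simp: Basis_prod_def)
    then show ?thesis
      using linear_0[OF A.dloc_pos_linear[OF cd(1) pq(1)]] linear_0[OF B.dloc_pos_linear[OF cd(2) pq(2)]] nonzero_Basis
      by (auto simp: D k_def dilate_Pair)
  qed
  have "gram (\<lambda>w. dilate s (D w)) = (\<chi> i j. k (bvec i) * k (bvec j) * gram D $ i $ j)"
    unfolding gram_def by (simp add: vec_eq_iff kb mult.assoc)
  then have "det (gram (\<lambda>w. dilate s (D w))) = (\<Prod>i\<in>UNIV. k (bvec i))\<^sup>2 * det (gram D)"
    using det_diagonal_scaling[of "\<lambda>i. k (bvec i)" "gram D"] by simp
  also have "(\<Prod>i\<in>UNIV. k (bvec i)) = (\<Prod>b\<in>Basis. k b)" by (rule prod.reindex_bij_betw[OF bij_bvec])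
  also have "\<dots> = (1 + s) ^ DIM('e1)"
    unfolding prod_Basis_prod by (simp add: k_def nonzero_Basis)
  finally have "det (gram (\<lambda>w. dilate s (D w))) = ((1 + s) ^ DIM('e1))\<^sup>2 * det (gram D)" .
  then show ?thesis
    unfolding P.dens_def P.adens_def dloc_dilated_pos[OF C] D_def[symmetric]
    using s by (simp add: real_sqrt_mult)
qed

lemma area_dilated_pos:
  assumes s: "s > -1"
  shows "area_measure (PS\<lparr>pos := dilated_pos s\<rparr>) = density \<mu>P (\<lambda>_. ennreal ((1 + s) ^ DIM('e1)))"
proof (rule P.emeasure_eq_on_charts[OF P.compact])
  note imm = immersed_dilated_pos[OF s]
  show "sets (area_measure (PS\<lparr>pos := dilated_pos s\<rparr>)) = P.BorM" by (rule P.sets_pos[OF imm])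
  show "sets (density \<mu>P (\<lambda>_. ennreal ((1 + s) ^ DIM('e1)))) = P.BorM" by (simp only: sets_density P.sets_area)
  fix C B assume C: "C \<in> atlas PS" and B: "B \<in> P.BorM" "B \<subseteq> fst C"
  have m: "(\<lambda>x. indicator (snd C ` B) x * P.adens C x) \<in> borel_measurable borel"
    by (rule P.borel_adens[OF C P.chart_image_borel'[OF C B]]) (use B in auto)
  have "emeasure (area_measure (PS\<lparr>pos := dilated_pos s\<rparr>)) B = (\<integral>\<^sup>+x. ennreal (indicator (snd C ` B) x * P.dens C (dilated_pos s) x) \<partial>lborel)"
    by (rule P.emeasure_pos[OF imm C B])
  also have "\<dots> = (\<integral>\<^sup>+x. ennreal ((1 + s) ^ DIM('e1)) * ennreal (indicator (snd C ` B) x * P.adens C x) \<partial>lborel)"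
  proof (rule nn_integral_cong)
    fix x
    show "ennreal (indicator (snd C ` B) x * P.dens C (dilated_pos s) x) = ennreal ((1 + s) ^ DIM('e1)) * ennreal (indicator (snd C ` B) x * P.adens C x)"
    proof (cases "x \<in> snd C ` B")
      case True
      then have x: "x \<in> cdom C" using B by auto
      show ?thesis using True dens_dilated_pos[OF C x s] P.adens_pos[OF C x] s by (simp add: ennreal_mult')
    qed simp
  qed
  also have "\<dots> = ennreal ((1 + s) ^ DIM('e1)) * (\<integral>\<^sup>+x. ennreal (indicator (snd C ` B) x * P.adens C x) \<partial>lborel)"
    by (rule nn_integral_cmult) (use m in simp)
  also have "\<dots> = ennreal ((1 + s) ^ DIM('e1)) * emeasure \<mu>P B"
    unfolding P.emeasure_area[OF C B] ..
  also have "\<dots> = emeasure (density \<mu>P (\<lambda>_. ennreal ((1 + s) ^ DIM('e1)))) B"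
    by (rule emeasure_density_const[symmetric]) (simp only: P.sets_area B)
  finally show "emeasure (area_measure (PS\<lparr>pos := dilated_pos s\<rparr>)) B = emeasure (density \<mu>P (\<lambda>_. ennreal ((1 + s) ^ DIM('e1)))) B" .
qed

text \<open>The tangential part of the velocity of the dilation, which the flow has to cancel.\<close>

definition dirT :: "'a \<times> 'b \<Rightarrow> 'v1 \<times> 'v2" where
  "dirT z = P.tproj z (proj1 (pos PS z))"

lemma flow_dirT: "\<exists>\<epsilon> \<phi>. P.flow \<epsilon> \<phi> dirT"
proof (rule P.flow_exists)
  show "smooth_map_on PS P.M dirT" unfolding dirT_def
    by (intro P.smooth_tderiv smooth_pos_PS P.smooth_map_on_bounded_linear[OF P.openin_M proj1_bounded])
  show "dirT q \<in> tangent_space PS q" for q unfolding dirT_def by (rule P.tproj_in)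
qed

lemma jsmooth_dilated_pos: "open I \<Longrightarrow> P.jsmooth I dilated_pos"
  unfolding P.jsmooth_def
proof
  fix C assume I: "open I" and C: "C \<in> atlas PS"
  have o: "open (I \<times> cdom C)" by (intro open_Times I P.open_cdom C)
  have Xs: "smooth_on (\<lambda>sx. local_rep C (pos PS) (snd sx)) (I \<times> cdom C)"
    by (rule smooth_on_snd_part[OF I P.open_cdom[OF C] P.smooth_pos_chart[OF C]])
  have "smooth_on (\<lambda>sx. local_rep C (pos PS) (snd sx) + fst sx *\<^sub>R proj1 (local_rep C (pos PS) (snd sx))) (I \<times> cdom C)"
    by (intro smooth_intros o Xs smooth_on_bounded_linear[OF o proj1_bounded])
  then show "smooth_on (\<lambda>(s, x). dilated_pos s (cinv C x)) (I \<times> cdom C)"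
    by (simp add: dilated_pos_def dilate_def local_rep_def case_prod_unfold)
qed

section \<open>The normal variation and the value of \<open>F\<close> along it\<close>

context
  fixes \<epsilon>0 \<phi> assumes flow: "P.flow \<epsilon>0 \<phi> dirT"
begin

definition variation :: "real \<Rightarrow> 'a \<times> 'b \<Rightarrow> 'v1 \<times> 'v2" where
  "variation s z = dilated_pos s (\<phi> s z)"

text \<open>The bound 1/2 keeps \<open>1 + s\<close> positive.\<close>

abbreviation "\<epsilon> \<equiv> min \<epsilon>0 (1 / 2)"

lemma \<epsilon>_pos: "\<epsilon> > 0"
  using flow by (simp add: P.flow_def)

lemma flow_jsmooth: "P.jsmooth {-\<epsilon><..<\<epsilon>} variation"
  and flow_derivative: "z \<in> P.M \<Longrightarrow> ((\<lambda>s. variation s z) has_vector_derivative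
     (vector_derivative (\<lambda>s. dilated_pos s z) (at 0) - P.tderiv (dilated_pos 0) z (dirT z))) (at 0)"
proof -
  have "0 < \<epsilon> \<and> \<epsilon> \<le> \<epsilon>0 \<and> P.jsmooth {-\<epsilon><..<\<epsilon>} dilated_pos" using \<epsilon>_pos jsmooth_dilated_pos by simp
  then show "P.jsmooth {-\<epsilon><..<\<epsilon>} variation"
    "z \<in> P.M \<Longrightarrow> ((\<lambda>s. variation s z) has_vector_derivative
     (vector_derivative (\<lambda>s. dilated_pos s z) (at 0) - P.tderiv (dilated_pos 0) z (dirT z))) (at 0)"
    using flow unfolding P.flow_def variation_def[abs_def] by blast+
qed

lemma flow_invariance:
  assumes "s \<in> {-\<epsilon><..<\<epsilon>}"
  shows "immersed_submanifold (PS\<lparr>pos := variation s\<rparr>)"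
    "continuous_on UNIV (h :: 'v1 \<times> 'v2 \<Rightarrow> real) \<Longrightarrow>
      (LINT z|area_measure (PS\<lparr>pos := variation s\<rparr>). h (variation s z)) =
      (LINT z|area_measure (PS\<lparr>pos := dilated_pos s\<rparr>). h (dilated_pos s z))"
proof -
  have s: "\<bar>s\<bar> < \<epsilon>0" "s > -1" using assms by auto
  have *: "immersed_submanifold (PS\<lparr>pos := (\<lambda>z. dilated_pos s (\<phi> s z))\<rparr>) \<and>
      (\<forall>h :: 'v1 \<times> 'v2 \<Rightarrow> real. continuous_on UNIV h \<longrightarrow>
       (LINT z|area_measure (PS\<lparr>pos := (\<lambda>z. dilated_pos s (\<phi> s z))\<rparr>). h (dilated_pos s (\<phi> s z))) =
       (LINT z|area_measure (PS\<lparr>pos := dilated_pos s\<rparr>). h (dilated_pos s z)))"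
    using flow s(1) immersed_dilated_pos[OF s(2)] unfolding P.flow_def by blast
  show "immersed_submanifold (PS\<lparr>pos := variation s\<rparr>)" using * unfolding variation_def[abs_def] by blast
  show "continuous_on UNIV (h :: 'v1 \<times> 'v2 \<Rightarrow> real) \<Longrightarrow>
      (LINT z|area_measure (PS\<lparr>pos := variation s\<rparr>). h (variation s z)) =
      (LINT z|area_measure (PS\<lparr>pos := dilated_pos s\<rparr>). h (dilated_pos s z))"
    using * unfolding variation_def[abs_def] by blast
qed

text \<open>The velocity at \<open>s = 0\<close> is \<open>proj1 X\<close> from the dilation minus
  its tangential part from the diffeomorphisms, hence normal.\<close>

lemma normal_variation_variation: "normal_variation PS \<epsilon> variation"
  unfolding normal_variation_def
proof (intro conjI ballI)
  fix z assume z: "z \<in> P.M"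
  have d0: "dilated_pos 0 = pos PS" by (simp add: dilated_pos_def dilate_def fun_eq_iff)
  show "variation 0 z = pos PS z"
  proof -
    have "\<phi> 0 z = z" using flow z unfolding P.flow_def by blast
    then show ?thesis unfolding variation_def d0 by simp
  qed
  have "((\<lambda>s. dilated_pos s z) has_vector_derivative proj1 (pos PS z)) (at 0)"
    unfolding dilated_pos_def dilate_def by (auto intro!: derivative_eq_intros)
  then have "vector_derivative (\<lambda>s. dilated_pos s z) (at 0) = proj1 (pos PS z)" by (rule vector_derivative_at)
  moreover have "P.tderiv (dilated_pos 0) z (dirT z) = dirT z"
    unfolding d0 by (rule P.tproj_tangent[OF z]) (simp add: dirT_def P.tproj_in)
  ultimately have "vector_derivative (\<lambda>s. variation s z) (at 0) = proj1 (pos PS z) - P.tproj z (proj1 (pos PS z))"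
    using vector_derivative_at[OF flow_derivative[OF z]] by (simp add: dirT_def)
  then show "vector_derivative (\<lambda>s. variation s z) (at 0) \<in> (tangent_space PS z)\<^sup>\<bottom>"
    using P.tproj_orth[OF z] by (auto simp: orthogonal_comp_def orthogonal_def inner_commute)
next
  fix C assume C: "C \<in> atlas PS"
  show "case C of (U, \<phi>) \<Rightarrow> smooth_on (\<lambda>(s, x). local_rep (U, \<phi>) (variation s) x) ({-\<epsilon><..<\<epsilon>} \<times> \<phi> ` U)"
    using P.jsmoothD[OF flow_jsmooth C] by (cases C) (simp add: local_rep_apply)
next
  fix s assume "s \<in> {-\<epsilon><..<\<epsilon>}"
  then show "immersed_submanifold (PS\<lparr>pos := variation s\<rparr>)" by (rule flow_invariance)
next
  \<comment> \<open>On a closed manifold every variation is compactly supported, with the whole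
    manifold as \<open>K\<close>.\<close>
  show "\<exists>K. compactin (mtop PS) K \<and> (\<forall>s\<in>{-\<epsilon><..<\<epsilon>}. \<forall>p\<in>P.M - K. variation s p = pos PS p)"
    by (intro exI[of _ P.M]) (use P.compact in \<open>simp add: compact_space_def\<close>)
qed

text \<open>The logarithm of the integrand of \<open>F\<close> is an inner product of a vector depending only on \<open>(s, x, t)\<close>
  and one depending only on the point.\<close>

definition moments :: "'a \<times> 'b \<Rightarrow> real \<times> real \<times> real \<times> ('v1 \<times> 'v2)" where
  "moments z = (1, (norm (pos S1 (fst z)))\<^sup>2, (norm (pos S2 (snd z)))\<^sup>2, pos PS z)"

definition coeffs :: "real \<Rightarrow> 'v1 \<times> 'v2 \<Rightarrow> real \<Rightarrow> real \<times> real \<times> real \<times> ('v1 \<times> 'v2)" where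
  "coeffs s x t = (- ((real DIM('e1) + real DIM('e2)) / 2) * ln (4 * pi * t) + real DIM('e1) * ln (1 + s) - (x \<bullet> x) / (4 * t),
     - ((1 + s)\<^sup>2 / (4 * t)), - (1 / (4 * t)), (1 / (2 * t)) *\<^sub>R dilate s x)"

text \<open>Reparametrization invariance passes from the variation to the dilation, and the constant
  density \<open>(1 + s) ^ DIM('e1)\<close> from the dilated measure to the fixed one. All
  dependence on \<open>s\<close>, \<open>x\<close> and \<open>t\<close> is then in the
  exponent.\<close>

lemma F_functional_variation:
  assumes s: "s \<in> {-\<epsilon><..<\<epsilon>}" and t: "t > 0"
  shows "F_functional (PS\<lparr>pos := variation s\<rparr>) x t = (LINT z|\<mu>P. exp (coeffs s x t \<bullet> moments z))"
proof -
  have s1: "s > -1" using s by auto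
  define h where "h v = exp (- (norm (v - x))\<^sup>2 / (4 * t))" for v :: "'v1 \<times> 'v2"
  have hc: "continuous_on UNIV h" unfolding h_def using t by (intro continuous_intros) auto
  have hm: "(\<lambda>z. h (dilated_pos s z)) \<in> borel_measurable \<mu>P"
  proof (rule P.borel_continuous)
    have "continuous_map (mtop PS) euclidean (h \<circ> dilated_pos s)"
      by (rule continuous_map_compose[OF P.smooth_imp_continuous_map[OF smooth_dilated_pos]]) (use hc in simp)
    then show "continuous_map (mtop PS) euclidean (\<lambda>z. h (dilated_pos s z))" by (simp only: o_def)
  qed
  have "F_functional (PS\<lparr>pos := variation s\<rparr>) x t =
     (4 * pi * t) powr (- real DIM('e1 \<times> 'e2) / 2) * (LINT z|area_measure (PS\<lparr>pos := variation s\<rparr>). h (variation s z))"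
    by (simp add: F_functional_def h_def)
  also have "(LINT z|area_measure (PS\<lparr>pos := variation s\<rparr>). h (variation s z)) =
     (LINT z|area_measure (PS\<lparr>pos := dilated_pos s\<rparr>). h (dilated_pos s z))"
    by (rule flow_invariance(2)[OF s hc])
  also have "\<dots> = (LINT z|\<mu>P. (1 + s) ^ DIM('e1) *\<^sub>R h (dilated_pos s z))"
    unfolding area_dilated_pos[OF s1] by (rule integral_density[OF hm]) (use s1 in auto)
  also have "(4 * pi * t) powr (- real DIM('e1 \<times> 'e2) / 2) * \<dots> =
     (LINT z|\<mu>P. (4 * pi * t) powr (- real DIM('e1 \<times> 'e2) / 2) * ((1 + s) ^ DIM('e1) *\<^sub>R h (dilated_pos s z)))"
    by (rule integral_mult_right_zero[symmetric])
  also have "\<dots> = (LINT z|\<mu>P. exp (coeffs s x t \<bullet> moments z))"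
  proof (rule Bochner_Integration.integral_cong[OF refl])
    fix z :: "'a \<times> 'b"
    define a where "a = pos S1 (fst z)"
    define b where "b = pos S2 (snd z)"
    obtain c d where x: "x = (c, d)" by (cases x)
    have 1: "(4 * pi * t) powr (- real DIM('e1 \<times> 'e2) / 2) = exp (- ((real DIM('e1) + real DIM('e2)) / 2) * ln (4 * pi * t))"
      using t by (simp add: powr_def algebra_simps)
    have 2: "(1 + s) ^ DIM('e1) = exp (real DIM('e1) * ln (1 + s))"
      using s1 by (simp add: exp_of_nat_mult)
    \<comment> \<open>Expanding the square separates the parameters from the point, which enters
      only through \<open>|a|^2\<close>, \<open>|b|^2\<close> and the position
      \<open>(a, b)\<close>.\<close>
    have nrm: "(norm (dilated_pos s z - x))\<^sup>2 = (1 + s)\<^sup>2 * (norm a)\<^sup>2 + (norm b)\<^sup>2 - 2 * ((1 + s) * (c \<bullet> a) + d \<bullet> b) + x \<bullet> x"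
      unfolding dilated_pos_def pos_PS_apply a_def[symmetric] b_def[symmetric] dilate_Pair x
      unfolding power2_norm_eq_inner
      by (simp add: inner_prod_def inner_diff_left inner_diff_right inner_add_left inner_add_right inner_commute power2_eq_square algebra_simps)
    have 3: "coeffs s x t \<bullet> moments z = - ((real DIM('e1) + real DIM('e2)) / 2) * ln (4 * pi * t) + real DIM('e1) * ln (1 + s) + - (norm (dilated_pos s z - x))\<^sup>2 / (4 * t)"
      unfolding nrm unfolding coeffs_def moments_def pos_PS_apply a_def[symmetric] b_def[symmetric] x dilate_Pair
      using t by (simp add: inner_prod_def inner_add_left) (simp add: field_simps)
    show "(4 * pi * t) powr (- real DIM('e1 \<times> 'e2) / 2) * ((1 + s) ^ DIM('e1) *\<^sub>R h (dilated_pos s z)) = exp (coeffs s x t \<bullet> moments z)"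
      unfolding 1 2 3 h_def exp_add by simp
  qed
  finally show ?thesis .
qed

lemma smooth_sq1: "smooth_map_on PS P.M (\<lambda>z. (norm (pos S1 (fst z)))\<^sup>2)"
  and smooth_sq2: "smooth_map_on PS P.M (\<lambda>z. (norm (pos S2 (snd z)))\<^sup>2)"
proof -
  have "smooth_map_on PS P.M (\<lambda>z. fst (pos PS z))" "smooth_map_on PS P.M (\<lambda>z. snd (pos PS z))"
    by (rule P.smooth_map_on_bounded_linear[OF P.openin_M _ smooth_pos_PS], rule bounded_linear_fst bounded_linear_snd)+
  then have X: "smooth_map_on PS P.M (\<lambda>z. pos S1 (fst z))" "smooth_map_on PS P.M (\<lambda>z. pos S2 (snd z))"
    by (simp_all add: pos_PS_apply)
  show "smooth_map_on PS P.M (\<lambda>z. (norm (pos S1 (fst z)))\<^sup>2)" "smooth_map_on PS P.M (\<lambda>z. (norm (pos S2 (snd z)))\<^sup>2)"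
    unfolding power2_norm_eq_inner
    by (rule P.smooth_map_on_bilinear[OF P.openin_M bounded_bilinear_inner X(1) X(1)],
        rule P.smooth_map_on_bilinear[OF P.openin_M bounded_bilinear_inner X(2) X(2)])
qed

lemma smooth_moments: "smooth_map_on PS P.M moments"
  unfolding moments_def
  by (intro P.smooth_map_on_Pair P.openin_M P.smooth_map_on_const smooth_sq1 smooth_sq2 smooth_pos_PS)

text \<open>The map \<open>L\<close> of the preceding identities:
  \<open>X \<bullet> blockL a b X / 2\<close> is the quadratic part of the first derivative of the
  exponent.\<close>

definition blockL :: "real \<Rightarrow> real \<Rightarrow> 'v1 \<times> 'v2 \<Rightarrow> 'v1 \<times> 'v2" where
  "blockL a b v = (a *\<^sub>R fst v, b *\<^sub>R snd v)"

lemma blockL: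
  "linear (blockL a b)" "blockL a b u \<bullet> v = u \<bullet> blockL a b v"
  "z \<in> P.M \<Longrightarrow> P.tproj z (blockL a b v) = blockL a b (P.tproj z v)"
  "z \<in> P.M \<Longrightarrow> tr (\<lambda>v. blockL a b (P.tproj z v)) = a * real DIM('e1) + b * real DIM('e2)"
proof -
  show "linear (blockL a b)" by (auto simp: linear_iff blockL_def algebra_simps)
  show "blockL a b u \<bullet> v = u \<bullet> blockL a b v" by (simp add: blockL_def inner_prod_def)
next
  assume z: "z \<in> P.M"
  then have M: "fst z \<in> A.M" "snd z \<in> B.M" by auto
  note lin = A.tproj_linear[OF M(1)] B.tproj_linear[OF M(2)]
  show "P.tproj z (blockL a b v) = blockL a b (P.tproj z v)"
    unfolding tproj_PS[OF z] by (simp add: blockL_def linear_scale[OF lin(1)] linear_scale[OF lin(2)])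
  have "tr (\<lambda>v. blockL a b (P.tproj z v)) = tr (\<lambda>v. ((\<lambda>u. a *\<^sub>R A.tproj (fst z) u) (fst v), (\<lambda>u. b *\<^sub>R B.tproj (snd z) u) (snd v)))"
    unfolding tproj_PS[OF z] by (simp add: blockL_def)
  also have "\<dots> = tr (\<lambda>u. a *\<^sub>R A.tproj (fst z) u) + tr (\<lambda>u. b *\<^sub>R B.tproj (snd z) u)"
    by (rule tr_prod) (intro linear_compose_scale_right lin)+
  also have "\<dots> = a * real DIM('e1) + b * real DIM('e2)"
    unfolding tr_scaleR using A.tr_tproj[OF M(1)] B.tr_tproj[OF M(2)] by simp
  finally show "tr (\<lambda>v. blockL a b (P.tproj z v)) = a * real DIM('e1) + b * real DIM('e2)" .
qed

text \<open>The block maps \<open>blockL 1 0\<close> and \<open>blockL 0 1\<close> isolate one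
  factor each in \<open>gint_w\<close>.\<close>

lemma gint_moments:
  "P.gint (\<lambda>z. (norm (pos S1 (fst z)))\<^sup>2) = 2 * real DIM('e1) * P.gint (\<lambda>z. 1)"
  "P.gint (\<lambda>z. (norm (pos S2 (snd z)))\<^sup>2) = 2 * real DIM('e2) * P.gint (\<lambda>z. 1)"
  "P.gint (\<lambda>z. pos PS z \<bullet> v) = 0"
proof -
  have e1: "pos PS z \<bullet> blockL 1 0 (pos PS z) / 2 = 1 / 2 * (norm (pos S1 (fst z)))\<^sup>2"
    and e2: "pos PS z \<bullet> blockL 0 1 (pos PS z) / 2 = 1 / 2 * (norm (pos S2 (snd z)))\<^sup>2" for z
    by (simp_all add: pos_PS_apply blockL_def inner_prod_def power2_norm_eq_inner)
  have "P.gint (\<lambda>z. pos PS z \<bullet> blockL a b (pos PS z) / 2) = (a * real DIM('e1) + b * real DIM('e2)) * P.gint (\<lambda>z. 1)" for a b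
    using P.gint_w[OF blockL] .
  from this[of 1 0] this[of 0 1]
  show "P.gint (\<lambda>z. (norm (pos S1 (fst z)))\<^sup>2) = 2 * real DIM('e1) * P.gint (\<lambda>z. 1)"
    "P.gint (\<lambda>z. (norm (pos S2 (snd z)))\<^sup>2) = 2 * real DIM('e2) * P.gint (\<lambda>z. 1)"
    unfolding e1 e2 P.gint_cmult by simp_all
  show "P.gint (\<lambda>z. pos PS z \<bullet> v) = 0" by (rule P.gint_l[OF blockL])
qed

text \<open>Take a pair of points at which both positions are normal and nonzero: the projection
  kills the whole vector, while the block map keeps at least one component nonzero.\<close>

lemma exists_non_tangential:
  assumes "a \<noteq> 0 \<or> b \<noteq> 0"
  shows "\<exists>z\<in>P.M. blockL a b (pos PS z) \<noteq> P.tproj z (blockL a b (pos PS z))"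
proof -
  obtain p where p: "p \<in> A.M" "pos S1 p \<noteq> 0" "A.tproj p (pos S1 p) = 0" using A.exists_normal_position by blast
  obtain q where q: "q \<in> B.M" "pos S2 q \<noteq> 0" "B.tproj q (pos S2 q) = 0" using B.exists_normal_position by blast
  have z: "(p, q) \<in> P.M" using p q by simp
  have "P.tproj (p, q) (blockL a b (pos PS (p, q))) = 0"
    unfolding blockL(3)[OF z] tproj_PS[OF z] 
    by (simp add: pos_PS_apply p(3) q(3) blockL_def zero_prod_def linear_scale[OF A.tproj_linear[OF p(1)]] linear_scale[OF B.tproj_linear[OF q(1)]])
  moreover have "blockL a b (pos PS (p, q)) \<noteq> 0"
    using assms p q by (auto simp: pos_PS_apply blockL_def zero_prod_def)
  ultimately show ?thesis using z by metis
qed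

text \<open>All admissible \<open>x\<close> and \<open>t\<close> are treated at once. The second
  derivative of \<open>F\<close> integrates the second derivative of the exponent plus the square of
  its first derivative; the former is linear in the moments and evaluated by
  \<open>gint_moments\<close>, the latter is bounded by
  \<open>second_variation_negative\<close>.\<close>

lemma second_derivative_negative:
  fixes x :: "real \<Rightarrow> 'v1 \<times> 'v2" and t :: "real \<Rightarrow> real"
  assumes x: "smooth_on x {-\<epsilon><..<\<epsilon>}" "x 0 = 0" and t: "smooth_on t {-\<epsilon><..<\<epsilon>}" "t 0 = 1" "\<forall>s\<in>{-\<epsilon><..<\<epsilon>}. t s > 0"
    and D: "has_second_derivative_at (\<lambda>s. F_functional (PS\<lparr>pos := variation s\<rparr>) (x s) (t s)) D 0"
  shows "D < 0"
proof -
  let ?I = "{-\<epsilon><..<\<epsilon>}"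
  have I: "open ?I" "0 \<in> ?I" using \<epsilon>_pos by auto
  have pos1: "1 + s > 0" if "s \<in> ?I" for s using that by auto
  have tp: "t s > 0" if "s \<in> ?I" for s using t(3) that by blast
  define \<theta> where "\<theta> s = coeffs s (x s) (t s)" for s
  \<comment> \<open>The last component of \<open>coeffs\<close>, the coefficient of the position
    vector.\<close>
  define v where "v s = (1 / (2 * t s)) *\<^sub>R dilate s (x s)" for s
  have nz: "t s \<noteq> 0" "1 + s \<noteq> 0" "4 * t s \<noteq> 0" "2 * t s \<noteq> 0" if "s \<in> ?I" for s using tp[OF that] pos1[OF that] by auto
  have vs: "smooth_on v ?I" unfolding v_def dilate_def
    by (intro smooth_intros I x t nz smooth_on_bounded_linear[OF I(1) proj1_bounded])
  have \<theta>s: "smooth_on \<theta> ?I" unfolding \<theta>_def coeffs_def v_def[symmetric]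
    by (intro smooth_intros smooth_on_ln vs I x t nz) (use tp pos1 in \<open>auto simp: power2_eq_square intro!: smooth_intros\<close>)
  define y where "y = vderiv x 0"
  define h where "h = vderiv t 0"
  define t'' where "t'' = vderiv (vderiv t) 0"
  define v2 where "v2 = vderiv (vderiv v) 0"
  have dx: "(x has_vector_derivative vderiv x s) (at s)" "(vderiv x has_vector_derivative vderiv (vderiv x) s) (at s)" if "s \<in> ?I" for s
    by (rule vderiv_has_vector_derivative[OF _ that], intro smooth_on_vderiv x)+
  have dt: "(t has_real_derivative vderiv t s) (at s)" "(vderiv t has_real_derivative vderiv (vderiv t) s) (at s)" if "s \<in> ?I" for s
    unfolding has_real_derivative_iff_has_vector_derivative
    by (rule vderiv_has_vector_derivative[OF _ that], intro smooth_on_vderiv t)+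
  have dv: "(v has_vector_derivative vderiv v s) (at s)" "(vderiv v has_vector_derivative vderiv (vderiv v) s) (at s)" if "s \<in> ?I" for s
    by (rule vderiv_has_vector_derivative[OF _ that], intro smooth_on_vderiv vs)+
  define xx where "xx s = x s \<bullet> x s" for s
  define xx' where "xx' s = 2 * (x s \<bullet> vderiv x s)" for s
  have dxx: "(xx has_real_derivative xx' s) (at s)" if "s \<in> ?I" for s
    using bounded_bilinear.has_vector_derivative[OF bounded_bilinear_inner dx(1)[OF that] dx(1)[OF that]]
    by (simp add: xx_def[abs_def] xx'_def has_real_derivative_iff_has_vector_derivative inner_commute)
  have dxx': "(xx' has_real_derivative 2 * (y \<bullet> y)) (at 0)"
  proof -
    have "((\<lambda>s. x s \<bullet> vderiv x s) has_real_derivative (x 0 \<bullet> vderiv (vderiv x) 0 + vderiv x 0 \<bullet> vderiv x 0)) (at 0)"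
      using bounded_bilinear.has_vector_derivative[OF bounded_bilinear_inner dx(1)[OF I(2)] dx(2)[OF I(2)]]
      by (simp add: has_real_derivative_iff_has_vector_derivative)
    from DERIV_cmult[OF this, of 2] show ?thesis by (simp add: xx'_def[abs_def] x(2) y_def)
  qed
  \<comment> \<open>Since \<open>x 0 = 0\<close>, neither the change of \<open>t\<close> nor the
    dilation of \<open>x\<close> contributes to first order.\<close>
  have v0: "vderiv v 0 = (1 / 2) *\<^sub>R y"
  proof (rule vderiv_eqI)
    have dz: "((\<lambda>s. x s + s *\<^sub>R proj1 (x s)) has_vector_derivative (y + (0 *\<^sub>R proj1 y + 1 *\<^sub>R proj1 (x 0)))) (at 0)"
      unfolding y_def
      by (intro has_vector_derivative_add dx(1)[OF I(2)] has_vector_derivative_scaleR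
          bounded_linear.has_vector_derivative[OF proj1_bounded dx(1)[OF I(2)]]) simp
    have "((\<lambda>s. 1 / (2 * t s)) has_real_derivative - (2 * h) / ((2 * t 0) * (2 * t 0))) (at 0)"
      unfolding h_def by (rule derivative_eq_intros dt(1)[OF I(2)] refl | simp add: t(2))+
    from has_vector_derivative_scaleR[OF this dz]
    show "(v has_vector_derivative (1 / 2) *\<^sub>R y) (at 0)"
      using bounded_linear.linear[OF proj1_bounded, THEN linear_0]
      by (simp add: v_def[abs_def] dilate_def t(2) x(2))
  qed
  have \<theta>Q: "\<theta> s \<bullet> moments z = (- ((real DIM('e1) + real DIM('e2)) / 2) * ln (4 * pi * t s) + real DIM('e1) * ln (1 + s) - xx s / (4 * t s))
     + (- ((1 + s)\<^sup>2 / (4 * t s))) * (norm (pos S1 (fst z)))\<^sup>2 + (- (1 / (4 * t s))) * (norm (pos S2 (snd z)))\<^sup>2 + v s \<bullet> pos PS z" for s z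
    by (simp add: \<theta>_def coeffs_def moments_def v_def xx_def inner_prod_def)
  \<comment> \<open>\<open>c0\<close>, \<open>c1\<close>, \<open>c2\<close> and
    \<open>vderiv v\<close> are the components of the velocity of \<open>\<theta>\<close>; the
    comparison with \<open>vderiv \<theta>\<close> is made after pairing with
    \<open>moments z\<close>.\<close>
  define c0 where "c0 s = - ((real DIM('e1) + real DIM('e2)) / 2) * (vderiv t s / t s) + real DIM('e1) / (1 + s) - (xx' s * t s - xx s * vderiv t s) / (4 * (t s)\<^sup>2)" for s
  define c1 where "c1 s = - ((2 * (1 + s) * t s - (1 + s)\<^sup>2 * vderiv t s) / (4 * (t s)\<^sup>2))" for s
  define c2 where "c2 s = vderiv t s / (4 * (t s)\<^sup>2)" for s
  have \<theta>1: "vderiv \<theta> s \<bullet> moments z = c0 s + c1 s * (norm (pos S1 (fst z)))\<^sup>2 + c2 s * (norm (pos S2 (snd z)))\<^sup>2 + vderiv v s \<bullet> pos PS z"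
    if s: "s \<in> ?I" for s z
  proof (rule DERIV_unique)
    show "((\<lambda>s. \<theta> s \<bullet> moments z) has_real_derivative vderiv \<theta> s \<bullet> moments z) (at s)"
      using bounded_linear.has_vector_derivative[OF bounded_linear_inner_left vderiv_has_vector_derivative[OF \<theta>s s]]
      by (simp add: has_real_derivative_iff_has_vector_derivative)
    have "((\<lambda>s. v s \<bullet> pos PS z) has_real_derivative vderiv v s \<bullet> pos PS z) (at s)"
      using bounded_linear.has_vector_derivative[OF bounded_linear_inner_left dv(1)[OF s]]
      by (simp add: has_real_derivative_iff_has_vector_derivative)
    then show "((\<lambda>s. \<theta> s \<bullet> moments z) has_real_derivative c0 s + c1 s * (norm (pos S1 (fst z)))\<^sup>2 + c2 s * (norm (pos S2 (snd z)))\<^sup>2 + vderiv v s \<bullet> pos PS z) (at s)"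
      unfolding \<theta>Q c0_def c1_def c2_def
      by (intro DERIV_add DERIV_cmult_right log_coefficient_derivative square_coefficient_derivative dt(1)[OF s] dxx[OF s] tp[OF s] pos1[OF s])
  qed
  \<comment> \<open>The components of the acceleration of \<open>\<theta>\<close> at 0. Together
    with \<open>v2\<close> they still contain the second derivatives of \<open>t\<close> and
    \<open>x\<close>, which disappear only after integration.\<close>
  define C0 where "C0 = - ((real DIM('e1) + real DIM('e2)) / 2) * (t'' - h\<^sup>2) - real DIM('e1) - 2 * (y \<bullet> y) / 4"
  define C1 where "C1 = - (1 / 2) + h - (2 * h\<^sup>2 - t'') / 4"
  define C2 where "C2 = (t'' - 2 * h\<^sup>2) / 4"
  have \<theta>2: "vderiv (vderiv \<theta>) 0 \<bullet> moments z = C0 + C1 * (norm (pos S1 (fst z)))\<^sup>2 + C2 * (norm (pos S2 (snd z)))\<^sup>2 + v2 \<bullet> pos PS z" for z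
  proof (rule DERIV_unique)
    show "((\<lambda>s. vderiv \<theta> s \<bullet> moments z) has_real_derivative vderiv (vderiv \<theta>) 0 \<bullet> moments z) (at 0)"
      using bounded_linear.has_vector_derivative[OF bounded_linear_inner_left vderiv_has_vector_derivative[OF smooth_on_vderiv[OF \<theta>s] I(2)]]
      by (simp add: has_real_derivative_iff_has_vector_derivative)
    have dvv: "((\<lambda>s. vderiv v s \<bullet> pos PS z) has_real_derivative v2 \<bullet> pos PS z) (at 0)"
      using bounded_linear.has_vector_derivative[OF bounded_linear_inner_left dv(2)[OF I(2)]]
      by (simp add: has_real_derivative_iff_has_vector_derivative v2_def)
    have t1: "(t has_real_derivative h) (at 0)" "(vderiv t has_real_derivative t'') (at 0)"
      using dt[OF I(2)] by (simp_all add: h_def t''_def)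
    have "(c0 has_real_derivative C0) (at 0)" unfolding c0_def[abs_def] C0_def
      by (rule log_coefficient_second_derivative[OF t1 t(2) h_def[symmetric] dxx[OF I(2)] dxx'])
        (simp_all add: xx_def xx'_def x(2))
    moreover have "(c1 has_real_derivative C1) (at 0)" "(c2 has_real_derivative C2) (at 0)"
      unfolding c1_def[abs_def] c2_def[abs_def] C1_def C2_def
      by (rule square_coefficient_second_derivative[OF t1 t(2) h_def[symmetric]])+
    ultimately have "((\<lambda>s. c0 s + c1 s * (norm (pos S1 (fst z)))\<^sup>2 + c2 s * (norm (pos S2 (snd z)))\<^sup>2 + vderiv v s \<bullet> pos PS z)
      has_real_derivative C0 + C1 * (norm (pos S1 (fst z)))\<^sup>2 + C2 * (norm (pos S2 (snd z)))\<^sup>2 + v2 \<bullet> pos PS z) (at 0)"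
      by (intro DERIV_add DERIV_cmult_right dvv)
    then show "((\<lambda>s. vderiv \<theta> s \<bullet> moments z) has_real_derivative C0 + C1 * (norm (pos S1 (fst z)))\<^sup>2 + C2 * (norm (pos S2 (snd z)))\<^sup>2 + v2 \<bullet> pos PS z) (at 0)"
      by (rule has_field_derivative_transform_within_open[OF _ I]) (simp add: \<theta>1)
  qed
  obtain R where R: "\<And>z. z \<in> P.M \<Longrightarrow> norm (moments z) \<le> R"
    using P.continuous_bounded[OF P.smooth_imp_continuous_map[OF smooth_moments]] by blast
  have mm: "moments \<in> borel_measurable \<mu>P" by (rule P.borel_continuous[OF P.smooth_imp_continuous_map[OF smooth_moments]])
  have R': "\<And>z. z \<in> space \<mu>P \<Longrightarrow> norm (moments z) \<le> R" using R by (simp only: P.space_area)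
  define D0 where "D0 = (LINT z|\<mu>P. (vderiv (vderiv \<theta>) 0 \<bullet> moments z + (vderiv \<theta> 0 \<bullet> moments z)\<^sup>2) * exp (\<theta> 0 \<bullet> moments z))"
  define \<Phi>' where "\<Phi>' s = (LINT z|\<mu>P. (vderiv \<theta> s \<bullet> moments z) * exp (\<theta> s \<bullet> moments z))" for s
  have \<Phi>1: "((\<lambda>s. LINT z|\<mu>P. exp (\<theta> s \<bullet> moments z)) has_real_derivative \<Phi>' s) (at s)" if "s \<in> ?I" for s
    unfolding \<Phi>'_def by (rule exponential_integral_derivatives(1)[OF P.finite_measure_area mm R' \<theta>s I(1) that])
  have \<Phi>2: "(\<Phi>' has_real_derivative D0) (at 0)"
    unfolding \<Phi>'_def[abs_def] D0_def by (rule exponential_integral_derivatives(2)[OF P.finite_measure_area mm R' \<theta>s I])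
  \<comment> \<open>The definition of the second derivative admits any \<open>f'\<close> that is a
    derivative near 0; by uniqueness it agrees near 0 with the explicit
    \<open>\<Phi>'\<close>.\<close>
  have "D = D0"
  proof -
    obtain f' where f': "\<forall>\<^sub>F s in nhds 0. ((\<lambda>s. F_functional (PS\<lparr>pos := variation s\<rparr>) (x s) (t s)) has_real_derivative f' s) (at s)"
      "(f' has_real_derivative D) (at 0)" using D unfolding has_second_derivative_at_def by blast
    have "\<forall>\<^sub>F s in nhds 0. s \<in> ?I" using I by (rule eventually_nhds_in_open)
    with f'(1) have "\<forall>\<^sub>F s in nhds 0. f' s = \<Phi>' s"
    proof eventually_elim
      case (elim s)
      have "((\<lambda>s. F_functional (PS\<lparr>pos := variation s\<rparr>) (x s) (t s)) has_real_derivative \<Phi>' s) (at s)"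
        by (rule has_field_derivative_transform_within_open[OF \<Phi>1[OF elim(2)] I(1) elim(2)])
          (simp add: F_functional_variation tp \<theta>_def)
      then show ?case using elim(1) DERIV_unique by blast
    qed
    then have "(\<Phi>' has_real_derivative D) (at 0)" using f'(2) DERIV_cong_ev[OF refl _ refl, of f' \<Phi>' 0 D] by simp
    then show ?thesis using \<Phi>2 DERIV_unique by blast
  qed
  moreover have "D0 < 0"
  proof -
    \<comment> \<open>\<open>a / 2\<close> and \<open>b / 2\<close> are the values of
      \<open>c1\<close> and \<open>c2\<close> at 0, and \<open>c0 0 = - \<kappa>\<close>; the
      summand \<open>- 1\<close> comes from the dilation. So the first derivative of the exponent is
      the \<open>u\<close> below.\<close>
    define a where "a = h / 2 - 1"
    define b where "b = h / 2"
    define \<kappa> where "\<kappa> = a * real DIM('e1) + b * real DIM('e2)"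
    \<comment> \<open>The constant factor of \<open>F\<close> at \<open>t = 1\<close>, the power
      \<open>(4 pi)^(-n/2)\<close> for the dimension \<open>n\<close> of the product, in exponential
      form.\<close>
    define K where "K = exp (- ((real DIM('e1) + real DIM('e2)) / 2) * ln (4 * pi))"
    define u where "u z = pos PS z \<bullet> blockL a b (pos PS z) / 2 + pos PS z \<bullet> y / 2 - \<kappa>" for z
    let ?A = "\<lambda>z. (norm (pos S1 (fst z)))\<^sup>2" and ?B = "\<lambda>z. (norm (pos S2 (snd z)))\<^sup>2" and ?V = "\<lambda>z. pos PS z \<bullet> v2"
    define G where "G = P.gint (\<lambda>z. 1)"
    have e0: "exp (\<theta> 0 \<bullet> moments z) = K * P.gauss z" for z
      unfolding \<theta>Q K_def P.gauss_def
      by (simp add: t(2) x(2) xx_def v_def dilate_def proj1_def pos_PS_apply power2_norm_eq_inner inner_prod_def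
          exp_add[symmetric] zero_prod_def[symmetric] add_divide_distrib)
    have e1: "vderiv \<theta> 0 \<bullet> moments z = u z" for z
      unfolding \<theta>1[OF I(2)] c0_def c1_def c2_def v0 u_def \<kappa>_def a_def b_def
      by (simp add: t(2) x(2) xx_def xx'_def h_def[symmetric] blockL_def pos_PS_apply inner_prod_def power2_norm_eq_inner
          inner_commute field_simps)
    have "D0 = (LINT z|\<mu>P. K * (((C0 + C1 * ?A z + C2 * ?B z + ?V z) + (u z)\<^sup>2) * P.gauss z))"
      unfolding D0_def e0 e1 \<theta>2 by (rule Bochner_Integration.integral_cong) (simp_all add: mult_ac inner_commute)
    also have "\<dots> = K * P.gint (\<lambda>z. (C0 + C1 * ?A z + C2 * ?B z + ?V z) + (u z)\<^sup>2)"
      by (simp add: P.gint_def)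
    finally have D0K: "D0 = K * P.gint (\<lambda>z. (C0 + C1 * ?A z + C2 * ?B z + ?V z) + (u z)\<^sup>2)" .
    have sV: "smooth_map_on PS P.M (\<lambda>z. pos PS z \<bullet> w)" for w
      by (intro P.smooth_map_on_bilinear[OF P.openin_M bounded_bilinear_inner] smooth_pos_PS P.smooth_map_on_const P.openin_M)
    have sk: "smooth_map_on PS P.M (\<lambda>z. k * f z)" if "smooth_map_on PS P.M f" for f :: "'a \<times> 'b \<Rightarrow> real" and k
      by (rule P.smooth_map_on_bounded_linear[OF P.openin_M bounded_linear_mult_right that])
    have sc: "smooth_map_on PS P.M (\<lambda>z. k)" for k :: real by (rule P.smooth_map_on_const[OF P.openin_M])
    have su: "smooth_map_on PS P.M u"
    proof -
      have "smooth_map_on PS P.M (\<lambda>z. pos PS z \<bullet> blockL a b (pos PS z) / 2 + pos PS z \<bullet> y / 2 - \<kappa>)"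
        using P.smooth_w[OF blockL] sk[OF sV, of "1/2" y] by (intro P.smooth_map_on_diff P.smooth_map_on_add P.openin_M sc) simp_all
      then show ?thesis by (simp add: u_def[abs_def])
    qed
    have su2: "smooth_map_on PS P.M (\<lambda>z. (u z)\<^sup>2)"
      unfolding power2_eq_square by (rule P.smooth_map_on_bilinear[OF P.openin_M bounded_bilinear_mult su su])
    have split: "P.gint (\<lambda>z. (C0 + C1 * ?A z + C2 * ?B z + ?V z) + (u z)\<^sup>2)
      = C0 * G + C1 * (2 * real DIM('e1) * G) + C2 * (2 * real DIM('e2) * G) + P.gint (\<lambda>z. (u z)\<^sup>2)"
    proof -
      note s1 = sk[OF smooth_sq1, of C1] and s2 = sk[OF smooth_sq2, of C2] and s0 = sc[of C0]
      note s01 = P.smooth_map_on_add[OF P.openin_M s0 s1]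
      note s012 = P.smooth_map_on_add[OF P.openin_M s01 s2]
      note s0123 = P.smooth_map_on_add[OF P.openin_M s012 sV[of v2]]
      show ?thesis
        unfolding P.gint_add[OF s0123 su2] P.gint_add[OF s012 sV] P.gint_add[OF s01 s2] P.gint_add[OF s0 s1]
          P.gint_cmult gint_moments G_def[symmetric]
        using P.gint_const[of C0] by (simp add: G_def)
    qed
    have normL: "P.gint (\<lambda>z. (norm (blockL a b (pos PS z)))\<^sup>2) = a\<^sup>2 * (2 * real DIM('e1) * G) + b\<^sup>2 * (2 * real DIM('e2) * G)"
    proof -
      have "P.gint (\<lambda>z. (norm (blockL a b (pos PS z)))\<^sup>2) = P.gint (\<lambda>z. a\<^sup>2 * ?A z + b\<^sup>2 * ?B z)"
        by (rule P.gint_cong) (simp add: blockL_def pos_PS_apply norm_Pair power_mult_distrib)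
      then show ?thesis
        unfolding P.gint_add[OF sk[OF smooth_sq1] sk[OF smooth_sq2]] P.gint_cmult gint_moments G_def .
    qed
    \<comment> \<open>\<open>a = b - 1\<close>, because only one factor is dilated.\<close>
    have ab: "a \<noteq> 0 \<or> b \<noteq> 0" by (auto simp: a_def b_def)
    obtain z where z: "z \<in> P.M" "blockL a b (pos PS z) \<noteq> P.tproj z (blockL a b (pos PS z))"
      using exists_non_tangential[OF ab] by blast
    have "P.gint (\<lambda>z. (u z)\<^sup>2) < P.gint (\<lambda>z. (norm (blockL a b (pos PS z)))\<^sup>2) + 1 / 2 * (norm y)\<^sup>2 * P.gint (\<lambda>z. 1)"
      unfolding u_def \<kappa>_def by (rule P.second_variation_negative[OF blockL z])
    then have "P.gint (\<lambda>z. (C0 + C1 * ?A z + C2 * ?B z + ?V z) + (u z)\<^sup>2)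
      < C0 * G + C1 * (2 * real DIM('e1) * G) + C2 * (2 * real DIM('e2) * G) + (a\<^sup>2 * (2 * real DIM('e1) * G) + b\<^sup>2 * (2 * real DIM('e2) * G) + 1 / 2 * (y \<bullet> y) * G)"
      unfolding split normL G_def[symmetric] power2_norm_eq_inner[of y] by simp
    \<comment> \<open>The coefficients of \<open>t''\<close> cancel because the mean of
      \<open>|Xi|^2\<close> is twice the dimension of its factor, which is criticality of
      \<open>t = 1\<close>. The terms in \<open>h\<close> and \<open>y\<close> cancel against those
      of \<open>a^2\<close>, \<open>b^2\<close> and \<open>|y|^2 / 2\<close>, so the strict gap in
      the preceding inequality is all that remains.\<close>
    also have "\<dots> = 0"
      by (simp add: C0_def C1_def C2_def a_def b_def power2_eq_square field_simps)
    finally have "P.gint (\<lambda>z. (C0 + C1 * ?A z + C2 * ?B z + ?V z) + (u z)\<^sup>2) < 0" .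
    then show ?thesis unfolding D0K by (simp add: K_def mult_less_0_iff)
  qed
  ultimately show ?thesis by simp
qed

end

lemma F_unstable_PS: "F_unstable PS"
  unfolding F_unstable_def
proof
  assume st: "F_stable PS"
  obtain \<epsilon>0 \<phi> where flow: "P.flow \<epsilon>0 \<phi> dirT" using flow_dirT by blast
  have "min \<epsilon>0 (1 / 2) > 0" by (rule \<epsilon>_pos[OF flow])
  with st normal_variation_variation[OF flow] obtain x t D where
    "smooth_on x {- min \<epsilon>0 (1 / 2)<..<min \<epsilon>0 (1 / 2)}" "x 0 = 0"
    "smooth_on t {- min \<epsilon>0 (1 / 2)<..<min \<epsilon>0 (1 / 2)}" "t 0 = 1"
    "\<forall>s\<in>{- min \<epsilon>0 (1 / 2)<..<min \<epsilon>0 (1 / 2)}. t s > 0"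
    "has_second_derivative_at (\<lambda>s. F_functional (PS\<lparr>pos := variation \<phi> s\<rparr>) (x s) (t s)) D 0" "D \<ge> 0"
    unfolding F_stable_def by blast
  then show False using second_derivative_negative[OF flow, of x t D] by simp
qed

end

theorem corollary1:
  fixes \<Sigma>1 :: "('a, 'e1::euclidean_space, 'v1::euclidean_space) immersed"
    and \<Sigma>2 :: "('b, 'e2::euclidean_space, 'v2::euclidean_space) immersed"
  assumes "closed_submanifold \<Sigma>1" and "self_shrinker \<Sigma>1"
    and "closed_submanifold \<Sigma>2" and "self_shrinker \<Sigma>2"
  shows "self_shrinker (prod_immersed \<Sigma>1 \<Sigma>2) \<and> F_unstable (prod_immersed \<Sigma>1 \<Sigma>2)"
proof -
  interpret prod_shrinker \<Sigma>1 \<Sigma>2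
    by unfold_locales (use assms in \<open>simp_all add: closed_submanifold_def immersed_submanifold_def\<close>)
  show ?thesis using self_shrinker_PS F_unstable_PS by blast
qed

end
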